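(* Let $G$ be a dynamic graph and $\mathcal{P}$ a connected graph on four vertices. One can maintain $\mathbf{c}(G,\mathcal{P})$ in (i) amortized $O(\sqrt{m})$ update time with $O(\min(m^{1.5},n^2))$ space, and query $\mathbf{c}(G,\mathcal{P},e)$ for an arbitrary edge $e\in E$ in worst-case $O(\sqrt m)$ time, if $\mathcal{P}$ is the length-3 path; (ii) amortized $O(m^{2/3})$ update time with $O(n^2)$ space, and query $\mathbf{c}(G,\mathcal{P},e)$ for an arbitrary edge $e\in E$ in worst-case $O(m^{2/3})$ time, if $\mathcal{P}$ is the paw or the 4-cycle; (iii) amortized $O(m^{2/3})$ update time with $O(\min(nm,m^{5/3}))$ space, and query $\mathbf{c}(G,\mathcal{P},e)$ for an arbitrary edge $e\in E$ in worst-case $O(m^{2/3})$ time, if $\mathcal{P}$ is the diamond.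
   Context: A dynamic graph $G=(V,E)$ is a simple undirected graph on a fixed vertex set $V$ with $n=|V|$ vertices undergoing edge insertions and deletions; $m$ is the current number of edges. Degrees and adjacency can be accessed in constant time. For a pattern $\mathcal{P}$, $\mathbf{c}(G,\mathcal{P})$ is the number of (not necessarily induced) subgraphs of $G$ isomorphic to $\mathcal{P}$, and $\mathbf{c}(G,\mathcal{P},e)$ the number of such subgraphs containing edge $e$. Maintaining a count means it can be retrieved in constant time after each update. Patterns: the length-3 path is the path with three edges on four vertices; the paw is a triangle plus one additional edge attached to one triangle vertex; the 4-cycle is the cycle on four vertices; the diamond is $K_4$ minus one edge. *)

theory Defs
  imports Complex_Main
begin

section \<open>Graphs and subgraph counts\<close>

type_synonym 'a graph = "'a set \<times> 'a set set"

definition simple_graph :: "'a graph \<Rightarrow> bool" where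
  "simple_graph G \<longleftrightarrow> finite (fst G) \<and> (\<forall>e \<in> snd G. e \<subseteq> fst G \<and> card e = 2)"

definition connected_graph :: "'a graph \<Rightarrow> bool" where
  "connected_graph G \<longleftrightarrow> fst G \<noteq> {} \<and>
     (\<forall>u \<in> fst G. \<forall>v \<in> fst G. (u, v) \<in> {(x, y). {x, y} \<in> snd G}\<^sup>*)"

definition subgraph :: "'a graph \<Rightarrow> 'a graph \<Rightarrow> bool" where
  "subgraph H G \<longleftrightarrow> simple_graph H \<and> fst H \<subseteq> fst G \<and> snd H \<subseteq> snd G"

definition isomorphic :: "'a graph \<Rightarrow> 'b graph \<Rightarrow> bool" where
  "isomorphic G H \<longleftrightarrow> (\<exists>f. bij_betw f (fst G) (fst H) \<and> (\<lambda>e. f ` e) ` snd G = snd H)"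

definition subgraph_count :: "'a graph \<Rightarrow> 'p graph \<Rightarrow> nat" where
  "subgraph_count G P = card {H. subgraph H G \<and> isomorphic H P}"

definition subgraph_count_edge :: "'a graph \<Rightarrow> 'p graph \<Rightarrow> 'a set \<Rightarrow> nat" where
  "subgraph_count_edge G P e = card {H. subgraph H G \<and> isomorphic H P \<and> e \<in> snd H}"

definition path3 :: "nat graph" where
  "path3 = ({0, 1, 2, 3}, {{0, 1}, {1, 2}, {2, 3}})"

definition paw :: "nat graph" where
  "paw = ({0, 1, 2, 3}, {{0, 1}, {1, 2}, {0, 2}, {2, 3}})"

definition cycle4 :: "nat graph" where
  "cycle4 = ({0, 1, 2, 3}, {{0, 1}, {1, 2}, {2, 3}, {0, 3}})"

definition diamond :: "nat graph" where
  "diamond = ({0, 1, 2, 3}, {{0, 1}, {1, 2}, {2, 3}, {0, 3}, {0, 2}})"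


section \<open>A word RAM with access to the dynamic graph\<close>

text \<open>
  Programs are structured; they use finitely many registers and a random access memory.
  Every value is a word, i.e. a number below a modulus \<open>W\<close>. For a graph on \<open>n\<close> vertices
  \<open>W\<close> is \<open>(n + 2) ^ c\<close> with \<open>c\<close> constant, so words have \<open>O(log n)\<close> bits.
  Degrees and adjacency of the current graph are available as unit-cost operations.
\<close>

datatype binop = Plus | Minus | Times | Divide | Modulo | Less | Equal

datatype expr =
    Const nat
  | Reg nat
  | Mem expr
  | Deg expr
  | Adj expr expr
  | Bin binop expr expr

datatype com =
    Skip
  | Assign nat expr
  | Store expr expr
  | Seq com com
  | Cond expr com com
  | While expr com

type_synonym memory = "nat \<Rightarrow> nat"
type_synonym state = "(nat \<Rightarrow> nat) \<times> memory"

fun binop_val :: "binop \<Rightarrow> nat \<Rightarrow> nat \<Rightarrow> nat" where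
  "binop_val Plus x y = x + y"
| "binop_val Minus x y = x - y"
| "binop_val Times x y = x * y"
| "binop_val Divide x y = x div y"
| "binop_val Modulo x y = x mod y"
| "binop_val Less x y = of_bool (x < y)"
| "binop_val Equal x y = of_bool (x = y)"

fun eval :: "nat set set \<Rightarrow> nat \<Rightarrow> state \<Rightarrow> expr \<Rightarrow> nat" where
  "eval E W s (Const k) = k mod W"
| "eval E W s (Reg i) = fst s i mod W"
| "eval E W s (Mem a) = snd s (eval E W s a) mod W"
| "eval E W s (Deg a) = card {e \<in> E. eval E W s a \<in> e} mod W"
| "eval E W s (Adj a b) = of_bool ({eval E W s a, eval E W s b} \<in> E) mod W"
| "eval E W s (Bin f a b) = binop_val f (eval E W s a) (eval E W s b) mod W"

fun expr_cost :: "expr \<Rightarrow> nat" where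
  "expr_cost (Const k) = 1"
| "expr_cost (Reg i) = 1"
| "expr_cost (Mem a) = 1 + expr_cost a"
| "expr_cost (Deg a) = 1 + expr_cost a"
| "expr_cost (Adj a b) = 1 + expr_cost a + expr_cost b"
| "expr_cost (Bin f a b) = 1 + expr_cost a + expr_cost b"

text \<open>
  Memory is initially zero and only cells with a non-zero content occupy space, i.e. the memory
  is a dictionary with constant access time whose space is its number of entries. A space bound
  such as \<open>O(m^(3/2))\<close>, in which \<open>n\<close> does not occur, presupposes such storage. Along every
  execution from the zero memory the set below is finite.
\<close>

definition mem_space :: "memory \<Rightarrow> nat" where
  "mem_space \<mu> = card {a. \<mu> a \<noteq> 0}"

text \<open>
  \<open>exec E W p s t k s'\<close>: started in \<open>s\<close>, program \<open>p\<close> halts in \<open>s'\<close> after \<open>t\<close> steps, and \<open>k\<close> is the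
  largest space occupied at any moment.
\<close>

inductive exec :: "nat set set \<Rightarrow> nat \<Rightarrow> com \<Rightarrow> state \<Rightarrow> nat \<Rightarrow> nat \<Rightarrow> state \<Rightarrow> bool"
  for E :: "nat set set" and W :: nat where
  Skip: "exec E W Skip s 1 (mem_space (snd s)) s"
| Assign: "exec E W (Assign i a) s (1 + expr_cost a) (mem_space (snd s))
     ((fst s)(i := eval E W s a), snd s)"
| Store: "\<mu> = (snd s)(eval E W s a := eval E W s b) \<Longrightarrow>
     exec E W (Store a b) s (1 + expr_cost a + expr_cost b)
       (max (mem_space (snd s)) (mem_space \<mu>)) (fst s, \<mu>)"
| Seq: "exec E W p s t k s' \<Longrightarrow> exec E W q s' t' k' s'' \<Longrightarrow>
     exec E W (Seq p q) s (t + t') (max k k') s''"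
| CondTrue: "eval E W s b \<noteq> 0 \<Longrightarrow> exec E W p s t k s' \<Longrightarrow>
     exec E W (Cond b p q) s (1 + expr_cost b + t) k s'"
| CondFalse: "eval E W s b = 0 \<Longrightarrow> exec E W q s t k s' \<Longrightarrow>
     exec E W (Cond b p q) s (1 + expr_cost b + t) k s'"
| WhileFalse: "eval E W s b = 0 \<Longrightarrow>
     exec E W (While b p) s (1 + expr_cost b) (mem_space (snd s)) s"
| WhileTrue: "eval E W s b \<noteq> 0 \<Longrightarrow> exec E W p s t k s' \<Longrightarrow>
     exec E W (While b p) s' t' k' s'' \<Longrightarrow>
     exec E W (While b p) s (1 + expr_cost b + t + t') (max k k') s''"

inductive_cases exec_SkipE: "exec E W Skip s t k s'"
inductive_cases exec_AssignE: "exec E W (Assign i a) s t k s'"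
inductive_cases exec_StoreE: "exec E W (Store a b) s t k s'"
inductive_cases exec_SeqE: "exec E W (Seq p q) s t k s'"
inductive_cases exec_CondE: "exec E W (Cond b p q) s t k s'"
inductive_cases exec_WhileE: "exec E W (While b p) s t k s'"

lemma exec_determ:
  "exec E W p s t k s' \<Longrightarrow> exec E W p s t2 k2 s2 \<Longrightarrow> t2 = t \<and> k2 = k \<and> s2 = s'"
proof (induction arbitrary: t2 k2 s2 rule: exec.induct)
  case (Skip s)
  from Skip.prems show ?case by (rule exec_SkipE) simp
next
  case (Assign i a s)
  from Assign.prems show ?case by (rule exec_AssignE) simp
next
  case (Store \<mu> s a b)
  from Store.prems show ?case by (rule exec_StoreE) (simp add: Store.hyps)
next
  case (Seq p s t k s' q t' k' s'')
  from Seq.prems obtain t3 k3 s3 t4 k4 where *: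
    "t2 = t3 + t4" "k2 = max k3 k4" "exec E W p s t3 k3 s3" "exec E W q s3 t4 k4 s2"
    by (rule exec_SeqE)
  from Seq.IH(1)[OF *(3)] have **: "t3 = t" "k3 = k" "s3 = s'" by simp_all
  from Seq.IH(2)[OF *(4)[unfolded **]] show ?case by (simp add: * **)
next
  case (CondTrue s b p t k s' q)
  from CondTrue.prems show ?case
    by (rule exec_CondE) (drule CondTrue.IH, simp, simp add: CondTrue.hyps)
next
  case (CondFalse s b q t k s' p)
  from CondFalse.prems show ?case
    by (rule exec_CondE) (simp add: CondFalse.hyps, drule CondFalse.IH, simp)
next
  case (WhileFalse s b p)
  from WhileFalse.prems show ?case
    by (rule exec_WhileE) (simp_all add: WhileFalse.hyps)
next
  case (WhileTrue s b p t k s' t' k' s'')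
  from WhileTrue.prems obtain t3 k3 s3 t4 k4 where *:
    "t2 = 1 + expr_cost b + t3 + t4" "k2 = max k3 k4"
    "exec E W p s t3 k3 s3" "exec E W (While b p) s3 t4 k4 s2"
    by (rule exec_WhileE) (simp_all add: WhileTrue.hyps)
  from WhileTrue.IH(1)[OF *(3)] have **: "t3 = t" "k3 = k" "s3 = s'" by simp_all
  from WhileTrue.IH(2)[OF *(4)[unfolded **]] show ?case by (simp add: * **)
qed


section \<open>Dynamic data structures\<close>

datatype operation = Insert nat nat | Delete nat nat | Query nat nat | Count

fun is_update :: "operation \<Rightarrow> bool" where
  "is_update (Insert u v) = True"
| "is_update (Delete u v) = True"
| "is_update (Query u v) = False"
| "is_update Count = False"

fun apply_op :: "operation \<Rightarrow> nat set set \<Rightarrow> nat set set" where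
  "apply_op (Insert u v) E = insert {u, v} E"
| "apply_op (Delete u v) E = E - {{u, v}}"
| "apply_op (Query u v) E = E"
| "apply_op Count E = E"

fun legal_op :: "nat \<Rightarrow> nat set set \<Rightarrow> operation \<Rightarrow> bool" where
  "legal_op n E (Insert u v) \<longleftrightarrow> u < n \<and> v < n \<and> u \<noteq> v \<and> {u, v} \<notin> E"
| "legal_op n E (Delete u v) \<longleftrightarrow> {u, v} \<in> E"
| "legal_op n E (Query u v) \<longleftrightarrow> {u, v} \<in> E"
| "legal_op n E Count \<longleftrightarrow> True"

fun legal_seq :: "nat \<Rightarrow> nat set set \<Rightarrow> operation list \<Rightarrow> bool" where
  "legal_seq n E [] \<longleftrightarrow> True"
| "legal_seq n E (x # xs) \<longleftrightarrow> legal_op n E x \<and> legal_seq n (apply_op x E) xs"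

datatype data_structure =
  Data_Structure (insert_prog: com) (delete_prog: com) (query_prog: com) (count_prog: com)

fun prog :: "data_structure \<Rightarrow> operation \<Rightarrow> com" where
  "prog D (Insert u v) = insert_prog D"
| "prog D (Delete u v) = delete_prog D"
| "prog D (Query u v) = query_prog D"
| "prog D Count = count_prog D"

text \<open>Each call finds \<open>n\<close> and its arguments in the first three registers.\<close>

fun init_regs :: "nat \<Rightarrow> operation \<Rightarrow> nat \<Rightarrow> nat" where
  "init_regs n (Insert u v) = (\<lambda>_. 0)(0 := n, 1 := u, 2 := v)"
| "init_regs n (Delete u v) = (\<lambda>_. 0)(0 := n, 1 := u, 2 := v)"
| "init_regs n (Query u v) = (\<lambda>_. 0)(0 := n, 1 := u, 2 := v)"
| "init_regs n Count = (\<lambda>_. 0)(0 := n)"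

datatype event = Event
  (op_of: operation) (edges_of: "nat set set") (cost_of: nat) (space_of: nat) (answer_of: nat)

text \<open>
  A run processes the operations one after the other. Memory persists between calls; the graph
  seen by a call is the one after the update it reports. The answer of a call is what it leaves in
  register \<open>0\<close>.
\<close>

inductive run ::
  "data_structure \<Rightarrow> nat \<Rightarrow> nat \<Rightarrow> nat set set \<Rightarrow> memory \<Rightarrow> operation list \<Rightarrow> event list \<Rightarrow> bool"
  for D :: data_structure and n W :: nat where
  Nil: "run D n W E \<mu> [] []"
| Cons: "E' = apply_op x E \<Longrightarrow>
     exec E' W (prog D x) (init_regs n x, \<mu>) t k (\<rho>, \<mu>') \<Longrightarrow>
     run D n W E' \<mu>' xs es \<Longrightarrow>
     run D n W E \<mu> (x # xs) (Event x E' t k (\<rho> 0) # es)"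

text \<open>
  The number of edges in the asymptotic bounds. It is never taken to be \<open>0\<close>, because no call has
  cost \<open>0\<close>.
\<close>

definition edges_at :: "event \<Rightarrow> nat" where
  "edges_at x = max 1 (card (edges_of x))"

definition amortized_update_time :: "event list \<Rightarrow> real \<Rightarrow> (nat \<Rightarrow> real) \<Rightarrow> bool" where
  "amortized_update_time es C T \<longleftrightarrow>
     (\<Sum>x \<leftarrow> filter (is_update \<circ> op_of) es. real (cost_of x))
       \<le> C * (\<Sum>x \<leftarrow> filter (is_update \<circ> op_of) es. T (edges_at x))"

fun correct_answer :: "nat \<Rightarrow> 'p graph \<Rightarrow> event \<Rightarrow> bool" where
  "correct_answer n P (Event (Query u v) E t k r) \<longleftrightarrow>
     r = subgraph_count_edge ({..<n}, E) P {u, v}"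
| "correct_answer n P (Event Count E t k r) \<longleftrightarrow> r = subgraph_count ({..<n}, E) P"
| "correct_answer n P (Event (Insert u v) E t k r) \<longleftrightarrow> True"
| "correct_answer n P (Event (Delete u v) E t k r) \<longleftrightarrow> True"

fun query_time :: "real \<Rightarrow> (nat \<Rightarrow> real) \<Rightarrow> event \<Rightarrow> bool" where
  "query_time C Q (Event (Query u v) E t k r) \<longleftrightarrow>
     real t \<le> C * Q (edges_at (Event (Query u v) E t k r))"
| "query_time C Q (Event Count E t k r) \<longleftrightarrow> real t \<le> C"
| "query_time C Q (Event (Insert u v) E t k r) \<longleftrightarrow> True"
| "query_time C Q (Event (Delete u v) E t k r) \<longleftrightarrow> True"

text \<open>
  \<open>maintainable P T S Q\<close>: the count of \<open>P\<close> can be maintained in amortized update time \<open>O(T m)\<close>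
  and space \<open>O(S n m)\<close>, with edge queries in worst-case time \<open>O(Q m)\<close> and the count itself
  available in constant time. The data structure and the constants \<open>c\<close> (word length) and \<open>C\<close> are
  uniform in \<open>n\<close> and in the sequence of operations, which starts with the empty graph on
  \<open>{..<n}\<close>. Since \<open>exec\<close> is deterministic, at most one run exists.
\<close>

definition maintainable ::
  "'p graph \<Rightarrow> (nat \<Rightarrow> real) \<Rightarrow> (nat \<Rightarrow> nat \<Rightarrow> real) \<Rightarrow> (nat \<Rightarrow> real) \<Rightarrow> bool" where
  "maintainable P T S Q \<longleftrightarrow>
     (\<exists>D c C. c \<ge> 1 \<and>
       (\<forall>n xs. legal_seq n {} xs \<longrightarrow>
         (\<exists>es. run D n ((n + 2) ^ c) {} (\<lambda>_. 0) xs es \<and>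
            amortized_update_time es C T \<and>
            (\<forall>x \<in> set es.
               correct_answer n P x \<and>
               query_time C Q x \<and>
               real (space_of x) \<le> C * S n (edges_at x)))))"

end

theory Submission
  imports Defs
begin

text \<open>
  A threshold \<open>\<theta>\<close> of order \<open>m^(1/p)\<close>, with \<open>p = 2\<close> for the path and \<open>p = 3\<close> for the other patterns, divides
  the vertices: light vertices have degree \<open>O(\<theta>)\<close>, and there are only \<open>O(\<theta>^(p-1))\<close> heavy vertices.
  The number of embeddings that use a new edge \<open>uv\<close> is a sum of contributions of three kinds: a loop over
  the heavy vertices, a double loop over neighbourhoods of light vertices, and entries of tables that
  count configurations whose inner vertices are light. An edge update changes these tables in
  \<open>O(\<theta>^(p-1))\<close> places, by loops of the same kind. A vertex whose degree has drifted too far from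
  its side is moved by deleting all its edges and inserting them again; the degree excess of the light
  vertices over \<open>\<theta>\<close> is the potential that pays for this, and \<open>\<theta>\<close> is recomputed after every \<open>m/2\<close>
  updates. An edge query deletes the edge, reads off the change of the count, and inserts it again.
  The number of copies is the number of embeddings divided by the number of automorphisms.
\<close>

section \<open>Structured memory\<close>

text \<open>Loops must enumerate neighbours, which degree and adjacency operations do not offer, and
  during a move or a query the stored graph differs from the current one; so the memory carries its
  own neighbourhoods. Space counts non-zero cells at every moment, and two of the space bounds have
  a term free of \<open>n\<close>. Hence nothing of size \<open>n\<close> may be kept: empty sets
  leave no trace, and isolated vertices are on no list. As for the peak within an update, table
  nests only add ones, so every cell they write holds an entry that is positive in the larger of the
  two graphs. Words form a ring modulo \<open>W\<close>, and a removal adds multiples of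
  \<open>W - 1\<close>; the tables are known modulo \<open>W\<close> only, and the count is exact
  because it is below \<open>W\<close>. Tables need not be transformed when a vertex changes sides,
  as they do not depend on the side of an isolated vertex. The scales fit: a move takes about
  \<theta> edge updates of cost \<open>\<theta> ^ (p - 1)\<close> and releases more than \<theta>
  units of excess, while a recomputation of \<theta> moves \<open>O(\<theta> ^ (p - 1))\<close>
  vertices and is spread over about \<open>\<theta> ^ p\<close> updates.\<close>

text \<open>
  The first component of a key is a tag. Tag 0 holds the number of embeddings; tags 1, 2, 3 hold the
  sizes, the elements and the positions (plus one) of indexed sets; tag 4 holds \<open>\<theta> - 1\<close>, the number of
  updates left before \<open>\<theta>\<close> is recomputed, and the number of edges; tags from 5 on hold tables. Set \<open>j < n\<close> is the
  neighbourhood of \<open>j\<close>, set \<open>n\<close> consists of the heavy vertices, set \<open>n + 1\<close> of the vertices that are not isolated, and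
  set \<open>n + 2\<close> is scratch space.
\<close>

type_synonym key = "nat \<times> nat \<times> nat \<times> nat"

fun adr :: "nat \<Rightarrow> key \<Rightarrow> nat" where
  "adr N (t, a, b, c) = ((c * N + b) * N + a) * 16 + t"

definition key_of :: "nat \<Rightarrow> nat \<Rightarrow> key" where
  "key_of N x = (x mod 16, x div 16 mod N, x div 16 div N mod N, x div 16 div N div N)"

definition box :: "nat \<Rightarrow> key set" where
  "box N = {..<16} \<times> {..<N} \<times> {..<N} \<times> {..<N}"

definition mem_of :: "nat \<Rightarrow> (key \<Rightarrow> nat) \<Rightarrow> memory" where
  "mem_of N M x = (if x < 16 * N ^ 3 then M (key_of N x) else 0)"

lemma adr_less:
  assumes "k \<in> box N" shows "adr N k < 16 * N ^ 3"
proof -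
  obtain t a b c where k: "k = (t, a, b, c)" by (cases k)
  have l: "t < 16" "a < N" "b < N" "c < N" using assms by (auto simp: k box_def)
  have 1: "c * N + b < N * N"
  proof -
    have "c * N + b < (c + 1) * N" using l by simp
    also have "\<dots> \<le> N * N" using l by (intro mult_right_mono) auto
    finally show ?thesis .
  qed
  have "(c * N + b) * N + a < N * N * N"
  proof -
    have "(c * N + b) * N + a < (c * N + b + 1) * N" using l by simp
    also have "\<dots> \<le> N * N * N" using 1 by (intro mult_right_mono) auto
    finally show ?thesis .
  qed
  then have "((c * N + b) * N + a + 1) * 16 \<le> N * N * N * 16" by (intro mult_right_mono) auto
  then show ?thesis using l by (simp add: k power3_eq_cube)
qed

lemma key_of_adr: "k \<in> box N \<Longrightarrow> key_of N (adr N k) = k"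
proof -
  assume "k \<in> box N"
  then obtain t a b c where k: "k = (t, a, b, c)" and l: "t < 16" "a < N" "b < N" "c < N"
    by (cases k) (auto simp: box_def)
  define y where "y = c * N + b"
  define x where "x = y * N + a"
  have "(x * 16 + t) mod 16 = t" "(x * 16 + t) div 16 = x" using l by auto
  moreover have "x mod N = a" "x div N = y" using l by (auto simp: x_def)
  moreover have "y mod N = b" "y div N = c" using l by (auto simp: y_def)
  ultimately show ?thesis by (simp add: k key_of_def x_def[symmetric] y_def[symmetric])
qed

text \<open>The last component of a key is a quotient that is not reduced, so no address is lost.
  Distinct addresses therefore have distinct keys, on which updates and the space bound
  rest.\<close>

lemma adr_key_of: "adr N (key_of N x) = x"
proof -
  have "x div 16 div N div N * N + x div 16 div N mod N = x div 16 div N"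
    "x div 16 div N * N + x div 16 mod N = x div 16" "x div 16 * 16 + x mod 16 = x"
    by simp_all
  then show ?thesis by (simp add: key_of_def)
qed

lemma mem_of_adr: "k \<in> box N \<Longrightarrow> mem_of N M (adr N k) = M k"
  by (simp add: mem_of_def adr_less key_of_adr)

lemma mem_of_upd: "k \<in> box N \<Longrightarrow> (mem_of N M)(adr N k := x) = mem_of N (M(k := x))"
  by (rule ext) (auto simp: mem_of_def adr_less key_of_adr dest: arg_cong[of _ _ "adr N"] simp: adr_key_of)

lemma mem_of_zero: "mem_of N (\<lambda>_. 0) = (\<lambda>_. 0)"
  by (rule ext) (simp add: mem_of_def)

definition supp :: "(key \<Rightarrow> nat) \<Rightarrow> key set" where
  "supp M = {k. M k \<noteq> 0}"

text \<open>Every occupied address is the address of a key in \<open>supp M\<close>. All later space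
  bounds count keys.\<close>

lemma mem_space_mem_of:
  assumes "supp M \<subseteq> Z" "finite Z" shows "mem_space (mem_of N M) \<le> card Z"
proof -
  have "{x. mem_of N M x \<noteq> 0} \<subseteq> adr N ` Z"
    using assms(1) adr_key_of unfolding mem_of_def supp_def
    by (auto split: if_splits intro!: image_eqI[of _ _ "key_of N _"])
  then show ?thesis unfolding mem_space_def
    by (meson assms(2) card_image_le card_mono finite_imageI order_trans)
qed

section \<open>Expressions and straight-line code on structured memory\<close>

datatype nexp = V nat | K nat | R nat nexp nexp nexp | Op binop nexp nexp

text \<open>The reductions modulo 16 and \<open>n + 3\<close> keep every access inside
  \<open>box (n + 3)\<close>, so that its address does not wrap round modulo \<open>W\<close>. For
  the indices that occur they are identities.\<close>

fun nev :: "nat \<Rightarrow> nat \<Rightarrow> (nat \<Rightarrow> nat) \<Rightarrow> (key \<Rightarrow> nat) \<Rightarrow> nexp \<Rightarrow> nat" where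
  "nev n W \<rho> M (V r) = \<rho> r mod W"
| "nev n W \<rho> M (K k) = k mod W"
| "nev n W \<rho> M (R t a b c) =
     M (t mod 16, nev n W \<rho> M a mod (n + 3), nev n W \<rho> M b mod (n + 3), nev n W \<rho> M c mod (n + 3)) mod W"
| "nev n W \<rho> M (Op f a b) = binop_val f (nev n W \<rho> M a) (nev n W \<rho> M b) mod W"

definition dim_expr :: expr where
  "dim_expr = Bin Plus (Reg 0) (Const 3)"

definition adr_expr :: "nat \<Rightarrow> expr \<Rightarrow> expr \<Rightarrow> expr \<Rightarrow> expr" where
  "adr_expr t a b c =
     Bin Plus (Bin Times (Bin Plus (Bin Times (Bin Plus (Bin Times (Bin Modulo c dim_expr) dim_expr)
       (Bin Modulo b dim_expr)) dim_expr) (Bin Modulo a dim_expr)) (Const 16)) (Const (t mod 16))"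

fun cexp :: "nexp \<Rightarrow> expr" where
  "cexp (V r) = Reg r"
| "cexp (K k) = Const k"
| "cexp (R t a b c) = Mem (adr_expr t (cexp a) (cexp b) (cexp c))"
| "cexp (Op f a b) = Bin f (cexp a) (cexp b)"

definition ecost :: "nexp \<Rightarrow> nat" where "ecost e = expr_cost (cexp e)"

lemma ecost_simps [simp]:
  "ecost (V r) = 1" "ecost (K k) = 1" "ecost (R t a b c) = 27 + ecost a + ecost b + ecost c"
  "ecost (Op f a b) = 1 + ecost a + ecost b"
  by (simp_all add: ecost_def adr_expr_def dim_expr_def)

definition asg :: "nat \<Rightarrow> nexp \<Rightarrow> com" where "asg r e = Assign r (cexp e)"
definition put :: "nat \<Rightarrow> nexp \<Rightarrow> nexp \<Rightarrow> nexp \<Rightarrow> nexp \<Rightarrow> com" where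
  "put t a b c e = Store (adr_expr t (cexp a) (cexp b) (cexp c)) (cexp e)"
definition cond :: "nexp \<Rightarrow> com \<Rightarrow> com \<Rightarrow> com" where "cond e p q = Cond (cexp e) p q"
definition loop :: "nexp \<Rightarrow> com \<Rightarrow> com" where "loop e p = While (cexp e) p"

text \<open>With fewer than two vertices no edge can be inserted; that case is settled separately in
  \<open>maintainable_pattern\<close>. The exponent 12 leaves room for the addresses, below
  \<open>16 * N ^ 3\<close>, and for numbers of embeddings up to \<open>8 * n ^ 4\<close>.\<close>

locale ram =
  fixes E :: "nat set set" and n W :: nat
  assumes n2: "n \<ge> 2" and W_eq: "W = (n + 2) ^ 12"
begin

abbreviation N where "N \<equiv> n + 3"

lemma W_ge: "4096 * n ^ 4 \<le> W" "16 * N ^ 3 \<le> W" "N < W" "16 < W" "4 ^ 12 \<le> W"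
proof -
  have a: "4 \<le> n + 2" using n2 by simp
  \<comment> \<open>Since \<open>4 \<le> n + 2\<close>, six of the twelve factors already supply
    \<open>4 ^ 6 = 4096\<close>.\<close>
  have *: "4 ^ 6 * (n + 2) ^ 6 \<le> W"
    proof -
    have "(n + 2) ^ 12 = (n + 2) ^ 6 * (n + 2) ^ 6" by (simp only: power_add[symmetric]) simp
    moreover have "4 ^ 6 * (n + 2) ^ 6 \<le> (n + 2) ^ 6 * (n + 2) ^ 6"
      using power_mono[OF a, of 6] by (intro mult_right_mono) auto
    ultimately show ?thesis by (simp only: W_eq)
  qed
  have "(n + 2) ^ 4 \<le> (n + 2) ^ 6" by (rule power_increasing) auto
  moreover have "n ^ 4 \<le> (n + 2) ^ 4" by (rule power_mono) auto
  ultimately have "n ^ 4 \<le> (n + 2) ^ 6" by linarith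
  then have "4 ^ 6 * n ^ 4 \<le> 4 ^ 6 * (n + 2) ^ 6" by (intro mult_left_mono) simp_all
  from le_trans[OF this *] show "4096 * n ^ 4 \<le> W" by simp
  have "N \<le> 2 * (n + 2)" by simp
  then have "N ^ 3 \<le> (2 * (n + 2)) ^ 3" by (rule power_mono) simp
  also have "\<dots> = 8 * (n + 2) ^ 3" by (simp only: power_mult_distrib) simp
  also have "(n + 2) ^ 3 \<le> (n + 2) ^ 6" by (rule power_increasing) auto
  finally have "N ^ 3 \<le> 8 * (n + 2) ^ 6" by simp
  then show 1: "16 * N ^ 3 \<le> W" using * by simp
  have "N \<le> N ^ 3" by (simp add: power3_eq_cube)
  then show "N < W" using 1 n2 by linarith
  then show "4 ^ 12 \<le> W" unfolding W_eq using power_mono[OF a, of 12] by simp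
  then show "16 < W" by simp
qed

lemma W_pos [simp]: "W > 0" using W_ge by simp

abbreviation ev where "ev \<equiv> nev n W"

lemma eval_adr:
  assumes "\<rho> 0 = n"
  shows "eval E W (\<rho>, \<mu>) (adr_expr t a b c) =
    adr N (t mod 16, eval E W (\<rho>, \<mu>) a mod N, eval E W (\<rho>, \<mu>) b mod N, eval E W (\<rho>, \<mu>) c mod N)"
proof -
  let ?a = "eval E W (\<rho>, \<mu>) a mod N" and ?b = "eval E W (\<rho>, \<mu>) b mod N" and ?c = "eval E W (\<rho>, \<mu>) c mod N"
  have d: "eval E W (\<rho>, \<mu>) dim_expr = N" using W_ge(3) assms by (simp add: dim_expr_def)
  have c16: "16 mod W = 16" using W_ge(4) by simp
  have t16: "t mod 16 mod W = t mod 16" using W_ge(4) by (simp add: less_trans[OF mod_less_divisor])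
  have k: "(t mod 16, ?a, ?b, ?c) \<in> box N" by (auto simp: box_def)
  have l: "((?c * N + ?b) * N + ?a) * 16 + t mod 16 < W" using adr_less[OF k] W_ge(2) by simp
  have l1: "(?c * N + ?b) * N + ?a < W" using l by simp
  have l1': "((?c * N + ?b) * N + ?a) * 16 < W" using l by simp
  have l2: "(?c * N + ?b) * N < W" using l1 by simp
  have "?c * N + ?b \<le> (?c * N + ?b) * N" by simp
  then have l3: "?c * N + ?b < W" using l2 by linarith
  then have l4: "?c * N < W" by simp
  have m: "?a mod W = ?a" "?b mod W = ?b" "?c mod W = ?c"
    using W_ge(3) by (meson mod_less less_trans mod_less_divisor zero_less_numeral add_pos_nonneg pos_add_strict add_nonneg_pos zero_le)+
  show ?thesis
    unfolding adr_expr_def eval.simps binop_val.simps d m c16 t16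
    using l l1 l1' l2 l3 l4 by (simp only: mod_less adr.simps)
qed

lemma in_box [simp]: "(t mod 16, a mod N, b mod N, c mod N) \<in> box N"
  by (auto simp: box_def)

lemma eval_cexp: "\<rho> 0 = n \<Longrightarrow> eval E W (\<rho>, mem_of N M) (cexp e) = ev \<rho> M e"
  by (induction e) (simp_all add: eval_adr mem_of_adr del: adr.simps)

definition sp where "sp M = mem_space (mem_of N M)"

text \<open>Upper bounds instead of exact values: \<open>t\<close> for the steps and
  \<open>B\<close> for the peak space. Both can be weakened, and all programs of one update share a
  single budget \<open>B\<close>.\<close>

definition runs :: "nat \<Rightarrow> com \<Rightarrow> (nat \<Rightarrow> nat) \<Rightarrow> (key \<Rightarrow> nat) \<Rightarrow> nat \<Rightarrow> (nat \<Rightarrow> nat) \<Rightarrow> (key \<Rightarrow> nat) \<Rightarrow> bool" where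
  "runs B p \<rho> M t \<rho>' M' \<longleftrightarrow> (\<exists>t' k. exec E W p (\<rho>, mem_of N M) t' k (\<rho>', mem_of N M') \<and> t' \<le> t \<and> k \<le> B)"

lemma runs_mono: "runs B p \<rho> M t \<rho>' M' \<Longrightarrow> t \<le> t' \<Longrightarrow> B \<le> B' \<Longrightarrow> runs B' p \<rho> M t' \<rho>' M'"
  unfolding runs_def by (meson le_trans)

lemma runs_skip: "sp M \<le> B \<Longrightarrow> runs B Skip \<rho> M 1 \<rho> M"
  unfolding runs_def sp_def using exec.Skip[of E W "(\<rho>, mem_of N M)"] by fastforce

lemma runs_asg:
  assumes "\<rho> 0 = n" "sp M \<le> B"
  shows "runs B (asg r e) \<rho> M (1 + ecost e) (\<rho>(r := ev \<rho> M e)) M"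
  unfolding runs_def asg_def ecost_def
  using exec.Assign[of E W r "cexp e" "(\<rho>, mem_of N M)"] assms
  by (auto simp: eval_cexp sp_def intro!: exI)

lemma runs_put:
  assumes "\<rho> 0 = n" "sp M \<le> B"
    and "sp (M((t mod 16, ev \<rho> M a mod N, ev \<rho> M b mod N, ev \<rho> M c mod N) := ev \<rho> M e)) \<le> B"
  shows "runs B (put t a b c e) \<rho> M (30 + ecost a + ecost b + ecost c + ecost e) \<rho>
    (M((t mod 16, ev \<rho> M a mod N, ev \<rho> M b mod N, ev \<rho> M c mod N) := ev \<rho> M e))"
proof -
  let ?k = "(t mod 16, ev \<rho> M a mod N, ev \<rho> M b mod N, ev \<rho> M c mod N)"
  let ?s = "(\<rho>, mem_of N M)"
  have "mem_of N (M(?k := ev \<rho> M e)) = (snd ?s)(eval E W ?s (adr_expr t (cexp a) (cexp b) (cexp c)) := eval E W ?s (cexp e))"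
    using assms(1) by (simp add: eval_adr eval_cexp mem_of_upd del: adr.simps)
  from exec.Store[OF this] have ex: "exec E W (put t a b c e) ?s
      (1 + expr_cost (adr_expr t (cexp a) (cexp b) (cexp c)) + expr_cost (cexp e))
      (max (sp M) (sp (M(?k := ev \<rho> M e)))) (\<rho>, mem_of N (M(?k := ev \<rho> M e)))"
    by (simp add: put_def sp_def)
  show ?thesis
    unfolding runs_def
    by (intro exI conjI, rule ex) (use assms(2,3) in \<open>auto simp: ecost_def adr_expr_def dim_expr_def\<close>)
qed

lemma runs_seq: "runs B p \<rho> M t \<rho>1 M1 \<Longrightarrow> runs B q \<rho>1 M1 t' \<rho>2 M2 \<Longrightarrow> runs B (Seq p q) \<rho> M (t + t') \<rho>2 M2"
  unfolding runs_def by (meson exec.Seq add_mono max.bounded_iff)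

lemma runs_cond:
  assumes "\<rho> 0 = n"
    and "ev \<rho> M e \<noteq> 0 \<Longrightarrow> runs B p \<rho> M t \<rho>' M'" and "ev \<rho> M e = 0 \<Longrightarrow> runs B q \<rho> M t \<rho>' M'"
  shows "runs B (cond e p q) \<rho> M (1 + ecost e + t) \<rho>' M'"
proof (cases "ev \<rho> M e = 0")
  case True
  then have z: "eval E W (\<rho>, mem_of N M) (cexp e) = 0" using eval_cexp[of \<rho>] assms(1) by simp
  from assms(3)[OF True] obtain t' k where "exec E W q (\<rho>, mem_of N M) t' k (\<rho>', mem_of N M')" "t' \<le> t" "k \<le> B"
    unfolding runs_def by blast
  then show ?thesis unfolding runs_def cond_def ecost_def
    using exec.CondFalse[OF z] by fastforce
next
  case False
  then have z: "eval E W (\<rho>, mem_of N M) (cexp e) \<noteq> 0" using eval_cexp[of \<rho>] assms(1) by simp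
  from assms(2)[OF False] obtain t' k where "exec E W p (\<rho>, mem_of N M) t' k (\<rho>', mem_of N M')" "t' \<le> t" "k \<le> B"
    unfolding runs_def by blast
  then show ?thesis unfolding runs_def cond_def ecost_def
    using exec.CondTrue[OF z] by fastforce
qed

lemma runs_loop_end:
  assumes "\<rho> 0 = n" "ev \<rho> M e = 0" "sp M \<le> B"
  shows "runs B (loop e p) \<rho> M (1 + ecost e) \<rho> M"
proof -
  have z: "eval E W (\<rho>, mem_of N M) (cexp e) = 0" using eval_cexp[of \<rho>] assms(1,2) by simp
  show ?thesis unfolding runs_def loop_def ecost_def
    by (intro exI conjI, rule exec.WhileFalse[OF z]) (use assms(3) in \<open>auto simp: sp_def\<close>)
qed

lemma runs_loop_step:
  assumes "\<rho> 0 = n" "ev \<rho> M e \<noteq> 0" "runs B p \<rho> M t \<rho>1 M1" "runs B (loop e p) \<rho>1 M1 t' \<rho>2 M2"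
  shows "runs B (loop e p) \<rho> M (1 + ecost e + t + t') \<rho>2 M2"
proof -
  have z: "eval E W (\<rho>, mem_of N M) (cexp e) \<noteq> 0" using eval_cexp[of \<rho>] assms(1,2) by simp
  from assms(3) obtain t1 k1 where 1: "exec E W p (\<rho>, mem_of N M) t1 k1 (\<rho>1, mem_of N M1)" "t1 \<le> t" "k1 \<le> B"
    unfolding runs_def by blast
  from assms(4) obtain t2 k2 where 2: "exec E W (While (cexp e) p) (\<rho>1, mem_of N M1) t2 k2 (\<rho>2, mem_of N M2)" "t2 \<le> t'" "k2 \<le> B"
    unfolding runs_def loop_def by blast
  show ?thesis unfolding runs_def loop_def ecost_def
    by (intro exI conjI, rule exec.WhileTrue[OF z 1(1) 2(1)]) (use 1 2 in auto)
qed

end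

section \<open>Nested counting loops\<close>

text \<open>
  \<open>Add r t a b c e\<close> adds \<open>e\<close> times register \<open>r\<close> to cell \<open>(t, a, b, c)\<close>, and \<open>Each j p\<close> runs \<open>p\<close> for all
  elements of set \<open>j\<close>. Nests only add to cells, so exchanging the signs in registers 3 and 4 turns
  the nest of an insertion into that of the deletion.
\<close>

datatype nest =
    Nop
  | Add nat nat nexp nexp nexp nexp
  | Guard nexp nest
  | Both nest nest
  | Each nexp nest

text \<open>At depth \<open>d\<close>, register \<open>10 + 2 * d\<close> is the counter and
  \<open>11 + 2 * d\<close> the current element. A nest may read the elements of the enclosing loops
  but not their counters, see \<open>visible\<close>.\<close>

fun comp :: "nat \<Rightarrow> nest \<Rightarrow> com" where
  "comp d Nop = Skip"
| "comp d (Add r t a b c e) = put t a b c (Op Plus (R t a b c) (Op Times (V r) e))"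
| "comp d (Guard e p) = cond e (comp d p) Skip"
| "comp d (Both p q) = Seq (comp d p) (comp d q)"
| "comp d (Each j p) = Seq (asg (10 + 2 * d) (K 0))
     (loop (Op Less (V (10 + 2 * d)) (R 1 j (K 0) (K 0)))
       (Seq (asg (11 + 2 * d) (R 2 j (V (10 + 2 * d)) (K 0)))
         (Seq (comp (d + 1) p) (asg (10 + 2 * d) (Op Plus (V (10 + 2 * d)) (K 1))))))"

fun vars :: "nexp \<Rightarrow> nat set" where
  "vars (V r) = {r}"
| "vars (K k) = {}"
| "vars (R t a b c) = vars a \<union> vars b \<union> vars c"
| "vars (Op f a b) = vars a \<union> vars b"

fun reads :: "nexp \<Rightarrow> nat set" where
  "reads (V r) = {}"
| "reads (K k) = {}"
| "reads (R t a b c) = {t mod 16} \<union> reads a \<union> reads b \<union> reads c"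
| "reads (Op f a b) = reads a \<union> reads b"

definition visible :: "nat \<Rightarrow> nat set" where
  "visible d = {r. r < 10 \<or> (odd r \<and> r < 10 + 2 * d)}"

definition exp_ok :: "nat \<Rightarrow> nat set \<Rightarrow> nexp \<Rightarrow> bool" where
  "exp_ok d X e \<longleftrightarrow> vars e \<subseteq> visible d \<and> reads e \<subseteq> X"

fun nest_ok :: "nat \<Rightarrow> nat set \<Rightarrow> nat set \<Rightarrow> nest \<Rightarrow> bool" where
  "nest_ok d X Y Nop \<longleftrightarrow> True"
| "nest_ok d X Y (Add r t a b c e) \<longleftrightarrow> r \<in> {3, 4} \<and> t mod 16 \<in> Y \<and>
     exp_ok d X a \<and> exp_ok d X b \<and> exp_ok d X c \<and> exp_ok d X e"
| "nest_ok d X Y (Guard e p) \<longleftrightarrow> exp_ok d X e \<and> nest_ok d X Y p"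
| "nest_ok d X Y (Both p q) \<longleftrightarrow> nest_ok d X Y p \<and> nest_ok d X Y q"
| "nest_ok d X Y (Each j p) \<longleftrightarrow> exp_ok d X j \<and> 1 \<in> X \<and> 2 \<in> X \<and> nest_ok (d + 1) X Y p"

text \<open>A generous price per executed node, address computations included, such that
  \<open>nsize p\<close> times the number of iterations bounds the running time.\<close>

fun nsize :: "nest \<Rightarrow> nat" where
  "nsize Nop = 1"
| "nsize (Add r t a b c e) = 60 + 2 * ecost a + 2 * ecost b + 2 * ecost c + ecost e"
| "nsize (Guard e p) = 2 + ecost e + nsize p"
| "nsize (Both p q) = nsize p + nsize q"
| "nsize (Each j p) = 200 + 2 * ecost j + nsize p"

definition upd :: "nat \<Rightarrow> (key \<Rightarrow> nat) \<Rightarrow> (key \<Rightarrow> int) \<Rightarrow> (key \<Rightarrow> nat)" where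
  "upd W M f = (\<lambda>k. nat ((int (M k) + f k) mod int W))"

context
  fixes n W :: nat
begin

text \<open>The amount added to cell \<open>k\<close>, computed from the initial memory alone. This
  is adequate when the tags that are read are disjoint from those that are written.\<close>

fun den :: "(nat \<Rightarrow> int) \<Rightarrow> (key \<Rightarrow> nat) \<Rightarrow> (nat \<Rightarrow> nat) \<Rightarrow> nat \<Rightarrow> nest \<Rightarrow> key \<Rightarrow> int" where
  "den sg M \<rho> d Nop k = 0"
| "den sg M \<rho> d (Add r t a b c e) k =
     (if k = (t mod 16, nev n W \<rho> M a mod (n + 3), nev n W \<rho> M b mod (n + 3), nev n W \<rho> M c mod (n + 3))
      then sg r * int (nev n W \<rho> M e) else 0)"
| "den sg M \<rho> d (Guard e p) k = (if nev n W \<rho> M e \<noteq> 0 then den sg M \<rho> d p k else 0)"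
| "den sg M \<rho> d (Both p q) k = den sg M \<rho> d p k + den sg M \<rho> d q k"
| "den sg M \<rho> d (Each j p) k =
     (\<Sum>i < M (1, nev n W \<rho> M j mod (n + 3), 0, 0).
        den sg M (\<rho>(11 + 2 * d := M (2, nev n W \<rho> M j mod (n + 3), i mod (n + 3), 0))) (d + 1) p k)"

fun iters :: "(key \<Rightarrow> nat) \<Rightarrow> (nat \<Rightarrow> nat) \<Rightarrow> nat \<Rightarrow> nest \<Rightarrow> nat" where
  "iters M \<rho> d Nop = 1"
| "iters M \<rho> d (Add r t a b c e) = 1"
| "iters M \<rho> d (Guard e p) = 1 + (if nev n W \<rho> M e \<noteq> 0 then iters M \<rho> d p else 0)"
| "iters M \<rho> d (Both p q) = iters M \<rho> d p + iters M \<rho> d q"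
| "iters M \<rho> d (Each j p) =
     1 + (\<Sum>i < M (1, nev n W \<rho> M j mod (n + 3), 0, 0).
        1 + iters M (\<rho>(11 + 2 * d := M (2, nev n W \<rho> M j mod (n + 3), i mod (n + 3), 0))) (d + 1) p)"

text \<open>Contributions to a cell may cancel in \<open>den\<close> although the cell is occupied
  in between. The peak space is therefore bounded through the set of written cells.\<close>

fun touched :: "(key \<Rightarrow> nat) \<Rightarrow> (nat \<Rightarrow> nat) \<Rightarrow> nat \<Rightarrow> nest \<Rightarrow> key set" where
  "touched M \<rho> d Nop = {}"
| "touched M \<rho> d (Add r t a b c e) =
     {(t mod 16, nev n W \<rho> M a mod (n + 3), nev n W \<rho> M b mod (n + 3), nev n W \<rho> M c mod (n + 3))}"
| "touched M \<rho> d (Guard e p) = (if nev n W \<rho> M e \<noteq> 0 then touched M \<rho> d p else {})"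
| "touched M \<rho> d (Both p q) = touched M \<rho> d p \<union> touched M \<rho> d q"
| "touched M \<rho> d (Each j p) =
     (\<Union>i < M (1, nev n W \<rho> M j mod (n + 3), 0, 0).
        touched M (\<rho>(11 + 2 * d := M (2, nev n W \<rho> M j mod (n + 3), i mod (n + 3), 0))) (d + 1) p)"

end

fun positive_nest :: "nest \<Rightarrow> bool" where
  "positive_nest Nop \<longleftrightarrow> True"
| "positive_nest (Add r t a b c e) \<longleftrightarrow> r = 3 \<and> e = K 1"
| "positive_nest (Guard e p) \<longleftrightarrow> positive_nest p"
| "positive_nest (Both p q) \<longleftrightarrow> positive_nest p \<and> positive_nest q"
| "positive_nest (Each j p) \<longleftrightarrow> positive_nest p"

fun scalar_nest :: "nest \<Rightarrow> bool" where
  "scalar_nest Nop \<longleftrightarrow> True"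
| "scalar_nest (Add r t a b c e) \<longleftrightarrow> t = 0 \<and> a = K 0 \<and> b = K 0 \<and> c = K 0"
| "scalar_nest (Guard e p) \<longleftrightarrow> scalar_nest p"
| "scalar_nest (Both p q) \<longleftrightarrow> scalar_nest p \<and> scalar_nest q"
| "scalar_nest (Each j p) \<longleftrightarrow> scalar_nest p"

lemma den_uminus: "den n W (\<lambda>r. - sg r) M \<rho> d p k = - den n W sg M \<rho> d p k"
  by (induction p arbitrary: \<rho> d) (auto simp: sum_negf)

text \<open>Nothing cancels, as each write adds exactly 1. In this way the cells written by a table
  update turn out to be cells that are non-zero for the larger graph.\<close>

lemma den_positive:
  assumes "positive_nest p" "sg 3 = 1" "W > 1"
  shows "den n W sg M \<rho> d p k \<ge> 0 \<and> (k \<in> touched n W M \<rho> d p \<longrightarrow> den n W sg M \<rho> d p k \<ge> 1)"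
  using assms(1)
proof (induction p arbitrary: \<rho> d)
  case (Both p q)
  then show ?case by (fastforce simp: add_increasing add_increasing2)
next
  case (Each j p)
  let ?f = "\<lambda>i. den n W sg M (\<rho>(11 + 2 * d := M (2, nev n W \<rho> M j mod (n + 3), i mod (n + 3), 0))) (d + 1) p k"
  have nn: "?f i \<ge> 0" for i using Each by simp
  show ?case
  proof (intro conjI impI)
    show "den n W sg M \<rho> d (Each j p) k \<ge> 0" by (simp add: sum_nonneg nn[simplified])
    assume "k \<in> touched n W M \<rho> d (Each j p)"
    then obtain i where i: "i < M (1, nev n W \<rho> M j mod (n + 3), 0, 0)"
      "k \<in> touched n W M (\<rho>(11 + 2 * d := M (2, nev n W \<rho> M j mod (n + 3), i mod (n + 3), 0))) (d + 1) p"
      by auto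
    have "1 \<le> ?f i" using Each i(2) by simp
    also have "\<dots> \<le> sum ?f {..<M (1, nev n W \<rho> M j mod (n + 3), 0, 0)}"
      using i(1) nn by (intro member_le_sum) auto
    finally show "1 \<le> den n W sg M \<rho> d (Each j p) k" by simp
  qed
qed (use assms in auto)

lemma den_scalar:
  assumes "scalar_nest p"
  shows "touched n W M \<rho> d p \<subseteq> {(0, 0, 0, 0)} \<and> (k \<noteq> (0, 0, 0, 0) \<longrightarrow> den n W sg M \<rho> d p k = 0)"
  using assms by (induction p arbitrary: \<rho> d) (auto, (fastforce+)?)

lemma nev_cong:
  "(\<And>r. r \<in> vars e \<Longrightarrow> \<rho> r = \<rho>' r) \<Longrightarrow> (\<And>t x. t \<in> reads e \<Longrightarrow> M (t, x) = M' (t, x)) \<Longrightarrow>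
     nev n W \<rho> M e = nev n W \<rho>' M' e"
proof (induction e)
  case (R t a b c)
  then have "nev n W \<rho> M a = nev n W \<rho>' M' a" "nev n W \<rho> M b = nev n W \<rho>' M' b" "nev n W \<rho> M c = nev n W \<rho>' M' c"
    by simp_all
  then show ?case using R.prems by simp
qed auto

text \<open>Code executed earlier changes only tags outside \<open>X\<close> and registers that are
  invisible at depth \<open>d\<close>. Hence every subnest may be evaluated as if it ran
  first.\<close>

lemma nest_cong:
  assumes "nest_ok d X Y p" and "\<And>r. r \<in> visible d \<Longrightarrow> \<rho> r = \<rho>' r" and "\<And>t x. t \<in> X \<Longrightarrow> M (t, x) = M' (t, x)"
  shows "den n W sg M \<rho> d p = den n W sg M' \<rho>' d p \<and> iters n W M \<rho> d p = iters n W M' \<rho>' d p \<and>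
    touched n W M \<rho> d p = touched n W M' \<rho>' d p"
  using assms(1,2)
proof (induction p arbitrary: d \<rho> \<rho>')
  case (Add r t a b c e)
  have "nev n W \<rho> M x = nev n W \<rho>' M' x" if "x \<in> {a, b, c, e}" for x
    by (rule nev_cong) (use Add that assms(3) in \<open>auto simp: exp_ok_def\<close>)
  then show ?case by (auto simp: fun_eq_iff)
next
  case (Guard e p)
  have "nev n W \<rho> M e = nev n W \<rho>' M' e"
    by (rule nev_cong) (use Guard assms(3) in \<open>auto simp: exp_ok_def\<close>)
  moreover have "den n W sg M \<rho> d p = den n W sg M' \<rho>' d p \<and> iters n W M \<rho> d p = iters n W M' \<rho>' d p \<and>
    touched n W M \<rho> d p = touched n W M' \<rho>' d p" by (rule Guard.IH) (use Guard.prems in auto)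
  ultimately show ?case by (auto simp: fun_eq_iff)
next
  case (Both p q)
  have "den n W sg M \<rho> d p = den n W sg M' \<rho>' d p \<and> iters n W M \<rho> d p = iters n W M' \<rho>' d p \<and>
    touched n W M \<rho> d p = touched n W M' \<rho>' d p" by (rule Both.IH) (use Both.prems in auto)
  moreover have "den n W sg M \<rho> d q = den n W sg M' \<rho>' d q \<and> iters n W M \<rho> d q = iters n W M' \<rho>' d q \<and>
    touched n W M \<rho> d q = touched n W M' \<rho>' d q" by (rule Both.IH) (use Both.prems in auto)
  ultimately show ?case by (auto simp: fun_eq_iff)
next
  case (Each j p)
  have j: "nev n W \<rho> M j = nev n W \<rho>' M' j"
    by (rule nev_cong) (use Each assms(3) in \<open>auto simp: exp_ok_def\<close>)
  let ?J = "nev n W \<rho>' M' j mod (n + 3)"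
  have 12: "M (1, x) = M' (1, x)" "M (2, x) = M' (2, x)" for x using Each.prems assms(3) by auto
  have "den n W sg M (\<rho>(11 + 2 * d := M (2, ?J, i mod (n + 3), 0))) (d + 1) p =
      den n W sg M' (\<rho>'(11 + 2 * d := M' (2, ?J, i mod (n + 3), 0))) (d + 1) p \<and>
     iters n W M (\<rho>(11 + 2 * d := M (2, ?J, i mod (n + 3), 0))) (d + 1) p =
      iters n W M' (\<rho>'(11 + 2 * d := M' (2, ?J, i mod (n + 3), 0))) (d + 1) p \<and>
     touched n W M (\<rho>(11 + 2 * d := M (2, ?J, i mod (n + 3), 0))) (d + 1) p =
      touched n W M' (\<rho>'(11 + 2 * d := M' (2, ?J, i mod (n + 3), 0))) (d + 1) p" for i
  proof (rule Each.IH)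
    fix r assume r: "r \<in> visible (d + 1)"
    then have "r = 11 + 2 * d \<or> r \<in> visible d" by (auto simp: visible_def) presburger
    then show "(\<rho>(11 + 2 * d := M (2, ?J, i mod (n + 3), 0))) r = (\<rho>'(11 + 2 * d := M' (2, ?J, i mod (n + 3), 0))) r"
      using Each.prems(2) 12 by auto
  qed (use Each.prems in auto)
  then show ?case unfolding den.simps iters.simps touched.simps j 12 by (auto simp: fun_eq_iff)
qed auto

lemma den_zero: "nest_ok d X Y p \<Longrightarrow> t \<notin> Y \<Longrightarrow> den n W sg M \<rho> d p (t, x) = 0"
  by (induction p arbitrary: d \<rho>) auto

lemma upd_upd: "W > 0 \<Longrightarrow> upd W (upd W M f) g = upd W M (\<lambda>k. f k + g k)"
  by (auto simp: upd_def fun_eq_iff mod_simps algebra_simps)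

lemma upd_less: "W > 0 \<Longrightarrow> upd W M f k < W"
  by (simp add: upd_def nat_less_iff)

lemma upd_id: "M k < W \<Longrightarrow> f k = 0 \<Longrightarrow> upd W M f k = M k"
  by (simp add: upd_def flip: of_nat_mod)

section \<open>Time, space and effect of compiled nests\<close>

context ram
begin

lemma sp_le: "supp M \<subseteq> Z \<Longrightarrow> finite Z \<Longrightarrow> card Z \<le> B \<Longrightarrow> sp M \<le> B"
  unfolding sp_def using mem_space_mem_of le_trans by blast

lemma supp_upd: "supp M \<subseteq> Z \<Longrightarrow> (\<And>k. k \<notin> Z \<Longrightarrow> f k = 0) \<Longrightarrow> supp (upd W M f) \<subseteq> Z"
proof
  fix k assume *: "supp M \<subseteq> Z" "\<And>k. k \<notin> Z \<Longrightarrow> f k = 0" "k \<in> supp (upd W M f)"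
  show "k \<in> Z"
  proof (rule ccontr)
    assume "k \<notin> Z"
    then have "M k = 0" "f k = 0" using * by (auto simp: supp_def)
    then show False using *(3) by (simp add: supp_def upd_def)
  qed
qed

lemma touched_den: "k \<notin> touched n W M \<rho> d p \<Longrightarrow> den n W sg M \<rho> d p k = 0"
  by (induction p arbitrary: d \<rho>) (auto intro!: sum.neutral)

text \<open>Reads use the tags \<open>X\<close> and writes the tags \<open>Y\<close>, so by
  \<open>nest_cong\<close> no part of the nest influences another, and the effects add up modulo
  \<open>W\<close>. The sign registers are fixed only modulo \<open>W\<close>, which lets
  \<open>W - 1\<close> act as minus one.\<close>

lemma runs_nest:
  assumes "nest_ok d X Y p" "X \<inter> Y = {}"
    and "\<rho> 0 = n" "\<And>r. r \<in> {3, 4} \<Longrightarrow> int (\<rho> r) mod int W = sg r mod int W"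
    and "\<And>k. M k < W" "finite Z" "card Z \<le> B" "supp M \<subseteq> Z" "touched n W M \<rho> d p \<subseteq> Z"
  shows "\<exists>\<rho>'. runs B (comp d p) \<rho> M (nsize p * iters n W M \<rho> d p) \<rho>' (upd W M (den n W sg M \<rho> d p)) \<and>
     (\<forall>r < 10 + 2 * d. \<rho>' r = \<rho> r)"
  using assms(1,3,4,5,8,9)
proof (induction p arbitrary: d \<rho> M)
  case Nop
  have eq: "upd W M (den n W sg M \<rho> d Nop) = M" using Nop by (auto simp: upd_id)
  have "sp M \<le> B" using Nop sp_le assms(6,7) by blast
  then show ?case unfolding eq using runs_skip by (intro exI[of _ \<rho>]) simp
next
  case (Add r t a b c e)
  let ?k = "(t mod 16, ev \<rho> M a mod N, ev \<rho> M b mod N, ev \<rho> M c mod N)"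
  let ?e = "Op Plus (R t a b c) (Op Times (V r) e)"
  have k: "?k \<in> Z" using Add by simp
  have r: "int (\<rho> r) mod int W = sg r mod int W" using Add by simp
  have v: "int (ev \<rho> M ?e) = (int (M ?k) + sg r * int (ev \<rho> M e)) mod int W"
  proof -
    have "int (ev \<rho> M ?e) = (int (M ?k) + (int (\<rho> r) mod int W) * int (ev \<rho> M e)) mod int W"
      by (simp add: zmod_int mod_simps) (metis mod_add_right_eq mod_mult_left_eq)
    then show ?thesis unfolding r by (metis mod_add_right_eq mod_mult_left_eq)
  qed
  have M': "M(?k := ev \<rho> M ?e) = upd W M (den n W sg M \<rho> d (Add r t a b c e))"
  proof
    fix k
    show "(M(?k := ev \<rho> M ?e)) k = upd W M (den n W sg M \<rho> d (Add r t a b c e)) k"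
    proof (cases "k = ?k")
      case True
      then have "(M(?k := ev \<rho> M ?e)) k = nat (int (ev \<rho> M ?e))" by simp
      also have "\<dots> = upd W M (den n W sg M \<rho> d (Add r t a b c e)) k"
        unfolding v using True by (simp add: upd_def)
      finally show ?thesis .
    next
      case False
      then show ?thesis using Add by (auto simp: upd_id)
    qed
  qed
  have s: "supp (M(?k := ev \<rho> M ?e)) \<subseteq> Z" using k Add.prems by (auto simp: supp_def)
  have "runs B (put t a b c ?e) \<rho> M (30 + ecost a + ecost b + ecost c + ecost ?e) \<rho> (M(?k := ev \<rho> M ?e))"
    by (rule runs_put) (use Add.prems s sp_le assms(6,7) in auto)
  then have "runs B (put t a b c ?e) \<rho> M (nsize (Add r t a b c e) * iters n W M \<rho> d (Add r t a b c e)) \<rho> (M(?k := ev \<rho> M ?e))"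
    by (rule runs_mono) auto
  then show ?case unfolding M'[symmetric] comp.simps by blast
next
  case (Guard e p)
  show ?case
  proof (cases "ev \<rho> M e = 0")
    case True
    have "upd W M (den n W sg M \<rho> d (Guard e p)) = M" using Guard True by (auto simp: upd_id)
    moreover have "runs B (comp d (Guard e p)) \<rho> M (1 + ecost e + 1) \<rho> M"
      unfolding comp.simps
      by (rule runs_cond, rule Guard.prems(2), simp add: True, rule runs_skip, rule sp_le[OF Guard.prems(5) assms(6,7)])
    moreover have "1 + ecost e + 1 \<le> nsize (Guard e p) * iters n W M \<rho> d (Guard e p)" using True by simp
    ultimately show ?thesis by (metis runs_mono order_refl)
  next
    case False
    have "\<exists>\<rho>'. runs B (comp d p) \<rho> M (nsize p * iters n W M \<rho> d p) \<rho>' (upd W M (den n W sg M \<rho> d p)) \<and>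
     (\<forall>r < 10 + 2 * d. \<rho>' r = \<rho> r)"
      by (rule Guard.IH) (use Guard.prems False in auto)
    then obtain \<rho>' where 1: "runs B (comp d p) \<rho> M (nsize p * iters n W M \<rho> d p) \<rho>' (upd W M (den n W sg M \<rho> d p))"
      and 2: "\<forall>r < 10 + 2 * d. \<rho>' r = \<rho> r" by blast
    have "runs B (comp d (Guard e p)) \<rho> M (1 + ecost e + nsize p * iters n W M \<rho> d p) \<rho>' (upd W M (den n W sg M \<rho> d p))"
      unfolding comp.simps
      by (rule runs_cond, rule Guard.prems(2), rule 1, simp add: False)
    moreover have "upd W M (den n W sg M \<rho> d p) = upd W M (den n W sg M \<rho> d (Guard e p))"
      using False by (auto simp: upd_def)
    moreover have "1 + ecost e + nsize p * iters n W M \<rho> d p \<le> nsize (Guard e p) * iters n W M \<rho> d (Guard e p)"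
      using False by (simp add: algebra_simps)
    ultimately show ?thesis using 2 by (metis runs_mono order_refl)
  qed
next
  case (Both p q)
  have "\<exists>\<rho>'. runs B (comp d p) \<rho> M (nsize p * iters n W M \<rho> d p) \<rho>' (upd W M (den n W sg M \<rho> d p)) \<and>
     (\<forall>r < 10 + 2 * d. \<rho>' r = \<rho> r)"
    by (rule Both.IH) (use Both.prems in auto)
  then obtain \<rho>1 where 1: "runs B (comp d p) \<rho> M (nsize p * iters n W M \<rho> d p) \<rho>1 (upd W M (den n W sg M \<rho> d p))"
      and 2: "\<forall>r < 10 + 2 * d. \<rho>1 r = \<rho> r" by blast
  let ?M = "upd W M (den n W sg M \<rho> d p)"
  have agree: "?M (t, x) = M (t, x)" if "t \<in> X" for t x
  proof (rule upd_id)
    show "M (t, x) < W" using Both.prems by simp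
    have "t \<notin> Y" using that assms(2) by auto
    moreover have "nest_ok d X Y p" using Both.prems by simp
    ultimately show "den n W sg M \<rho> d p (t, x) = 0" using den_zero by simp
  qed
  have vis: "\<rho>1 r = \<rho> r" if "r \<in> visible d" for r using that 2 by (auto simp: visible_def)
  have eq: "den n W sg ?M \<rho>1 d q = den n W sg M \<rho> d q \<and> iters n W ?M \<rho>1 d q = iters n W M \<rho> d q \<and>
    touched n W ?M \<rho>1 d q = touched n W M \<rho> d q"
    by (rule nest_cong) (use Both.prems vis agree in auto)
  have sZ: "supp ?M \<subseteq> Z"
  proof (rule supp_upd[OF Both.prems(5)])
    fix k assume "k \<notin> Z"
    then have "k \<notin> touched n W M \<rho> d p" using Both.prems(6) by auto
    then show "den n W sg M \<rho> d p k = 0" by (rule touched_den)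
  qed
  have "\<exists>\<rho>'. runs B (comp d q) \<rho>1 ?M (nsize q * iters n W ?M \<rho>1 d q) \<rho>' (upd W ?M (den n W sg ?M \<rho>1 d q)) \<and>
     (\<forall>r < 10 + 2 * d. \<rho>' r = \<rho>1 r)"
    by (rule Both.IH) (use Both.prems eq sZ 2 in \<open>auto simp: upd_less\<close>)
  then obtain \<rho>2 where 3: "runs B (comp d q) \<rho>1 ?M (nsize q * iters n W M \<rho> d q) \<rho>2 (upd W ?M (den n W sg M \<rho> d q))"
      and 4: "\<forall>r < 10 + 2 * d. \<rho>2 r = \<rho>1 r" using eq by auto
  have "runs B (comp d (Both p q)) \<rho> M (nsize p * iters n W M \<rho> d p + nsize q * iters n W M \<rho> d q) \<rho>2
      (upd W M (den n W sg M \<rho> d (Both p q)))"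
    using runs_seq[OF 1 3] unfolding upd_upd[OF W_pos] comp.simps den.simps[abs_def] .
  moreover have "nsize p * iters n W M \<rho> d p + nsize q * iters n W M \<rho> d q \<le> nsize (Both p q) * iters n W M \<rho> d (Both p q)"
    by (simp add: algebra_simps)
  ultimately show ?case using 2 4 by (metis runs_mono order_refl)
next
  case (Each j p)
  define c where "c = M (1, ev \<rho> M j mod N, 0, 0)"
  define el where "el i = M (2, ev \<rho> M j mod N, i mod N, 0)" for i
  define f where "f i = den n W sg M (\<rho>(11 + 2 * d := el i)) (d + 1) p" for i
  define w where "w i = iters n W M (\<rho>(11 + 2 * d := el i)) (d + 1) p" for i
  \<comment> \<open>The memory after \<open>i\<close> rounds. On the tags in \<open>X\<close> all
    these memories agree with \<open>M\<close>, so the bound and the elements of the loop do not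
    change while it runs.\<close>
  define Mi where "Mi i = upd W M (\<lambda>k. \<Sum>i<i. f i k)" for i
  define ce where "ce = Op Less (V (10 + 2 * d)) (R 1 j (K 0) (K 0))"
  define body where "body = Seq (asg (11 + 2 * d) (R 2 j (V (10 + 2 * d)) (K 0)))
         (Seq (comp (d + 1) p) (asg (10 + 2 * d) (Op Plus (V (10 + 2 * d)) (K 1))))"
  have cW: "c < W" using Each.prems by (simp add: c_def)
  have ok: "nest_ok (d + 1) X Y p" "exp_ok d X j" "1 \<in> X" "2 \<in> X" using Each.prems by auto
  have agree: "Mi i (t, x) = M (t, x)" if "t \<in> X" for t x i
    unfolding Mi_def
  proof (rule upd_id)
    show "M (t, x) < W" using Each.prems by simp
    have "t \<notin> Y" using that assms(2) by auto
    then have "f i (t, x) = 0" for i unfolding f_def by (rule den_zero[OF ok(1)])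
    then show "(\<Sum>i<i. f i (t, x)) = 0" by simp
  qed
  have tch: "touched n W M (\<rho>(11 + 2 * d := el i)) (d + 1) p \<subseteq> Z" if "i < c" for i
    using Each.prems(6)[unfolded touched.simps, folded c_def el_def] that by blast
  have f0: "f i k = 0" if "i < c" "k \<notin> Z" for i k
    unfolding f_def using touched_den tch that by blast
  have sZ: "supp (Mi i) \<subseteq> Z" if "i \<le> c" for i
    unfolding Mi_def by (rule supp_upd) (use Each.prems f0 that in \<open>auto intro!: sum.neutral\<close>)
  have spM: "sp (Mi i) \<le> B" if "i \<le> c" for i using sp_le[OF sZ[OF that]] assms(6,7) by simp
  have Mi_less: "Mi i k < W" for i k by (simp add: Mi_def upd_less)
  have jj: "ev \<rho>' (Mi i) j = ev \<rho> M j" if "\<forall>r < 10 + 2 * d. \<rho>' r = \<rho> r" for i \<rho>'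
    by (rule nev_cong) (use that ok(2) agree in \<open>auto simp: exp_ok_def visible_def\<close>)
  have L: "\<exists>\<rho>''. runs B (loop ce body) \<rho>' (Mi i) ((\<Sum>i=i..<c. 150 + ecost j + ecost j + nsize p * w i) + (50 + ecost j)) \<rho>'' (Mi c) \<and>
     (\<forall>r < 10 + 2 * d. \<rho>'' r = \<rho> r)"
    if "i \<le> c" "\<forall>r < 10 + 2 * d. \<rho>' r = \<rho> r" "\<rho>' (10 + 2 * d) = i" for i \<rho>'
    using that
  proof (induction "c - i" arbitrary: i \<rho>')
    case 0
    have "runs B (loop ce body) \<rho>' (Mi i) (1 + ecost ce) \<rho>' (Mi i)"
    proof (rule runs_loop_end)
      show "\<rho>' 0 = n" using 0 Each.prems by simp
      have "M (1, ev \<rho> M j mod N, 0, 0) = i" using 0 by (simp add: c_def)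
      then show "ev \<rho>' (Mi i) ce = 0"
        using jj[OF 0(3)] agree[OF ok(3)] 0(4) by (simp add: ce_def)
    qed (use spM 0 in auto)
    then show ?case using 0 by (auto intro!: exI[of _ \<rho>'] elim!: runs_mono simp: ce_def)
  next
    case (Suc m)
    have i: "i < c" using Suc by simp
    have n0: "\<rho>' 0 = n" using Suc.prems Each.prems by simp
    have iW: "i mod W = i" using i cW by simp
    have cond: "ev \<rho>' (Mi i) ce \<noteq> 0"
    proof -
      have "M (Suc 0, ev \<rho> M j mod N, 0, 0) = c" by (simp add: c_def)
      then show ?thesis using i iW cW Suc.prems jj[OF Suc.prems(2)] agree[OF ok(3)] W_ge(4)
        by (simp add: ce_def)
    qed
    define \<rho>1 where "\<rho>1 = \<rho>'(11 + 2 * d := el i)"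
    have e1: "ev \<rho>' (Mi i) (R 2 j (V (10 + 2 * d)) (K 0)) = el i"
      using iW Suc.prems jj[OF Suc.prems(2)] agree[OF ok(4)] Each.prems(4)
      by (simp add: el_def)
    have r1: "runs B (asg (11 + 2 * d) (R 2 j (V (10 + 2 * d)) (K 0))) \<rho>' (Mi i)
        (1 + ecost (R 2 j (V (10 + 2 * d)) (K 0))) \<rho>1 (Mi i)"
      unfolding \<rho>1_def e1[symmetric]
      by (rule runs_asg, rule n0, rule spM) (use i in simp)
    have vis: "\<rho>1 r = (\<rho>(11 + 2 * d := el i)) r" if "r \<in> visible (d + 1)" for r
    proof -
      have "r \<noteq> 10 + 2 * d" using that by (auto simp: visible_def)
      moreover have "r < 12 + 2 * d" using that by (auto simp: visible_def)
      ultimately have "r < 10 + 2 * d \<or> r = 11 + 2 * d" by linarith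
      then show ?thesis using Suc.prems(2) by (auto simp: \<rho>1_def)
    qed
    have eq: "den n W sg (Mi i) \<rho>1 (d + 1) p = f i \<and> iters n W (Mi i) \<rho>1 (d + 1) p = w i \<and>
      touched n W (Mi i) \<rho>1 (d + 1) p = touched n W M (\<rho>(11 + 2 * d := el i)) (d + 1) p"
      unfolding f_def w_def by (rule nest_cong) (use ok vis agree in auto)
    have "\<exists>\<rho>'. runs B (comp (d + 1) p) \<rho>1 (Mi i) (nsize p * iters n W (Mi i) \<rho>1 (d + 1) p) \<rho>'
        (upd W (Mi i) (den n W sg (Mi i) \<rho>1 (d + 1) p)) \<and> (\<forall>r < 10 + 2 * (d + 1). \<rho>' r = \<rho>1 r)"
    proof (rule Each.IH)
      show "int (\<rho>1 r) mod int W = sg r mod int W" if "r \<in> {3, 4}" for r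
        using that Each.prems(3) Suc.prems(2) by (auto simp: \<rho>1_def)
      show "nest_ok (d + 1) X Y p" by (rule ok)
      show "\<rho>1 0 = n" using n0 by (simp add: \<rho>1_def)
      show "supp (Mi i) \<subseteq> Z" using sZ i by simp
      show "touched n W (Mi i) \<rho>1 (d + 1) p \<subseteq> Z" using eq tch[OF i] by simp
    qed (rule Mi_less)
    moreover have "upd W (Mi i) (f i) = Mi (Suc i)" unfolding Mi_def upd_upd[OF W_pos] by simp
    ultimately obtain \<rho>2 where r2: "runs B (comp (d + 1) p) \<rho>1 (Mi i) (nsize p * w i) \<rho>2 (Mi (Suc i))"
      and a2: "\<forall>r < 12 + 2 * d. \<rho>2 r = \<rho>1 r" using eq by auto
    define \<rho>3 where "\<rho>3 = \<rho>2(10 + 2 * d := i + 1)"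
    have ri: "\<rho>2 (10 + 2 * d) = i" using a2 Suc.prems by (simp add: \<rho>1_def)
    have e3: "ev \<rho>2 (Mi (Suc i)) (Op Plus (V (10 + 2 * d)) (K 1)) = i + 1"
      using ri i cW W_ge(4) by simp
    have r3: "runs B (asg (10 + 2 * d) (Op Plus (V (10 + 2 * d)) (K 1))) \<rho>2 (Mi (Suc i)) (1 + 3) \<rho>3 (Mi (Suc i))"
      unfolding \<rho>3_def e3[symmetric]
      by (rule runs_mono[OF runs_asg]) (use a2 n0 spM[of "Suc i"] i in \<open>auto simp: \<rho>1_def\<close>)
    have b: "runs B body \<rho>' (Mi i) ((1 + ecost (R 2 j (V (10 + 2 * d)) (K 0))) + (nsize p * w i + (1 + 3))) \<rho>3 (Mi (Suc i))"
      unfolding body_def by (rule runs_seq[OF r1 runs_seq[OF r2 r3]])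
    have "\<exists>\<rho>''. runs B (loop ce body) \<rho>3 (Mi (Suc i)) ((\<Sum>i=Suc i..<c. 150 + ecost j + ecost j + nsize p * w i) + (50 + ecost j)) \<rho>'' (Mi c) \<and>
     (\<forall>r < 10 + 2 * d. \<rho>'' r = \<rho> r)"
      by (rule Suc.hyps(1)) (use Suc.hyps(2) i Suc.prems(2) a2 in \<open>auto simp: \<rho>3_def \<rho>1_def\<close>)
    then obtain \<rho>'' where r4: "runs B (loop ce body) \<rho>3 (Mi (Suc i)) ((\<Sum>i=Suc i..<c. 150 + ecost j + ecost j + nsize p * w i) + (50 + ecost j)) \<rho>'' (Mi c)"
      and a4: "\<forall>r < 10 + 2 * d. \<rho>'' r = \<rho> r" by blast
    have "runs B (loop ce body) \<rho>' (Mi i) ((\<Sum>i=i..<c. 150 + ecost j + ecost j + nsize p * w i) + (50 + ecost j)) \<rho>'' (Mi c)"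
      by (rule runs_mono[OF runs_loop_step[OF n0 cond b r4]])
        (use i in \<open>auto simp: ce_def sum.atLeast_Suc_lessThan\<close>)
    then show ?case using a4 by blast
  qed
  define \<rho>0 where "\<rho>0 = \<rho>(10 + 2 * d := 0)"
  have M0: "Mi 0 = M" using Each.prems by (auto simp: Mi_def upd_id)
  have "sp M \<le> B" using sp_le[OF sZ[of 0]] M0 assms(6,7) by simp
  then have r0: "runs B (asg (10 + 2 * d) (K 0)) \<rho> M (1 + 1) \<rho>0 M"
    using runs_asg[of \<rho> M B "10 + 2 * d" "K 0"] Each.prems(2) by (simp add: \<rho>0_def)
  have "\<exists>\<rho>''. runs B (loop ce body) \<rho>0 (Mi 0) ((\<Sum>i=0..<c. 150 + ecost j + ecost j + nsize p * w i) + (50 + ecost j)) \<rho>'' (Mi c) \<and>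
     (\<forall>r < 10 + 2 * d. \<rho>'' r = \<rho> r)"
    by (rule L) (auto simp: \<rho>0_def)
  then obtain \<rho>'' where r1: "runs B (loop ce body) \<rho>0 M ((\<Sum>i=0..<c. 150 + ecost j + ecost j + nsize p * w i) + (50 + ecost j)) \<rho>'' (Mi c)"
    and a: "\<forall>r < 10 + 2 * d. \<rho>'' r = \<rho> r" by (auto simp: M0)
  have d: "Mi c = upd W M (den n W sg M \<rho> d (Each j p))"
    unfolding Mi_def by (rule arg_cong[of _ _ "upd W M"]) (simp add: fun_eq_iff f_def c_def el_def)
  have it: "iters n W M \<rho> d (Each j p) = 1 + (\<Sum>i<c. 1 + w i)"
    by (simp add: w_def c_def el_def)
  have "(\<Sum>i=0..<c. 150 + ecost j + ecost j + nsize p * w i) \<le> (\<Sum>i<c. nsize (Each j p) * (1 + w i))"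
    unfolding atLeast0LessThan by (intro sum_mono) (auto simp: algebra_simps)
  also have "\<dots> = nsize (Each j p) * (\<Sum>i<c. 1 + w i)" by (simp only: sum_distrib_left)
  finally have t: "(1 + 1) + ((\<Sum>i=0..<c. 150 + ecost j + ecost j + nsize p * w i) + (50 + ecost j))
     \<le> nsize (Each j p) * iters n W M \<rho> d (Each j p)"
    unfolding it by (simp add: algebra_simps)
  have "comp d (Each j p) = Seq (asg (10 + 2 * d) (K 0)) (loop ce body)" by (simp add: ce_def body_def)
  then have "runs B (comp d (Each j p)) \<rho> M (nsize (Each j p) * iters n W M \<rho> d (Each j p)) \<rho>''
      (upd W M (den n W sg M \<rho> d (Each j p)))"
    using runs_mono[OF runs_seq[OF r0 r1] t order_refl] unfolding d by (simp only:)
  with a show ?case by blast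
qed

end

section \<open>Indexed sets in memory\<close>

text \<open>The last conjunct forbids stale elements beyond the end of the list, because they would
  count as occupied space.\<close>

definition lrep :: "(key \<Rightarrow> nat) \<Rightarrow> nat \<Rightarrow> nat set \<Rightarrow> bool" where
  "lrep M j S \<longleftrightarrow> finite S \<and> M (1, j, 0, 0) = card S \<and>
     (\<forall>x. M (3, j, x, 0) \<noteq> 0 \<longleftrightarrow> x \<in> S) \<and>
     (\<forall>x\<in>S. M (3, j, x, 0) \<le> card S \<and> M (2, j, M (3, j, x, 0) - 1, 0) = x) \<and>
     (\<forall>i<card S. M (2, j, i, 0) \<in> S \<and> M (3, j, M (2, j, i, 0), 0) = Suc i) \<and>
     (\<forall>i\<ge>card S. M (2, j, i, 0) = 0)"

definition add_mem :: "(key \<Rightarrow> nat) \<Rightarrow> nat \<Rightarrow> nat \<Rightarrow> (key \<Rightarrow> nat)" where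
  "add_mem M j x = M((2, j, M (1, j, 0, 0), 0) := x,
     (1, j, 0, 0) := M (1, j, 0, 0) + 1, (3, j, x, 0) := M (1, j, 0, 0) + 1)"

text \<open>The last element \<open>y\<close> fills the gap at position \<open>i\<close>. The order
  of the writes matters when \<open>y = x\<close>: the zeros come later and override the entries
  written for \<open>y\<close>.\<close>

definition del_mem :: "(key \<Rightarrow> nat) \<Rightarrow> nat \<Rightarrow> nat \<Rightarrow> (key \<Rightarrow> nat)" where
  "del_mem M j x = (let i = M (3, j, x, 0) - 1; l = M (1, j, 0, 0) - 1; y = M (2, j, l, 0) in
     M((2, j, i, 0) := y, (3, j, y, 0) := i + 1, (2, j, l, 0) := 0, (3, j, x, 0) := 0,
       (1, j, 0, 0) := l))"

text \<open>The size cell of an empty set holds 0 and occupies no space. Counting it would cost one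
  cell for each of the \<open>n\<close> neighbourhoods, which the bounds free of \<open>n\<close> do
  not allow.\<close>

definition list_keys :: "nat \<Rightarrow> nat set \<Rightarrow> key set" where
  "list_keys j S = (if S = {} then {} else {(1, j, 0, 0)}) \<union> (\<lambda>i. (2, j, i, 0)) ` {..<card S} \<union> (\<lambda>x. (3, j, x, 0)) ` S"

lemma finite_list_keys [simp]: "finite S \<Longrightarrow> finite (list_keys j S)"
  by (simp add: list_keys_def)

lemma list_keys_mono:
  assumes "S \<subseteq> T" "finite T" shows "list_keys j S \<subseteq> list_keys j T"
proof -
  have "card S \<le> card T" using assms card_mono by blast
  then have "{..<card S} \<subseteq> {..<card T}" by auto
  then have "(\<lambda>i. (2::nat, j, i, 0::nat)) ` {..<card S} \<subseteq> (\<lambda>i. (2, j, i, 0)) ` {..<card T}" by (rule image_mono)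
  moreover have "(\<lambda>x. (3::nat, j, x, 0::nat)) ` S \<subseteq> (\<lambda>x. (3, j, x, 0)) ` T" using assms(1) by (rule image_mono)
  ultimately show ?thesis using assms(1) unfolding list_keys_def by (intro Un_mono) auto
qed

lemma card_list_keys:
  assumes f: "finite S" shows "card (list_keys j S) \<le> 3 * card S"
proof -
  let ?A = "if S = {} then {} else {(1::nat, j, 0::nat, 0::nat)}"
  let ?B = "(\<lambda>i. (2::nat, j, i, 0::nat)) ` {..<card S}" and ?C = "(\<lambda>x. (3::nat, j, x, 0::nat)) ` S"
  have "card (list_keys j S) \<le> card (?A \<union> ?B) + card ?C"
    unfolding list_keys_def by (rule card_Un_le)
  moreover have "card (?A \<union> ?B) \<le> card ?A + card ?B" by (rule card_Un_le)
  moreover have "card ?A \<le> card S" using f by (auto simp: Suc_le_eq card_gt_0_iff)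
  moreover have "card ?B \<le> card S" using card_image_le[of "{..<card S}" "\<lambda>i. (2::nat, j, i, 0::nat)"] by simp
  moreover have "card ?C \<le> card S" using card_image_le[OF f] by blast
  ultimately show ?thesis by linarith
qed

lemma lrep_finite: "lrep M j S \<Longrightarrow> finite S"
  by (simp add: lrep_def)

lemma lrep_card: "lrep M j S \<Longrightarrow> M (1, j, 0, 0) = card S" "lrep M j S \<Longrightarrow> M (Suc 0, j, 0, 0) = card S"
  by (simp_all add: lrep_def)

lemma lrep_mem: "lrep M j S \<Longrightarrow> M (3, j, x, 0) = 0 \<longleftrightarrow> x \<notin> S" "lrep M j S \<Longrightarrow> 0 < M (3, j, x, 0) \<longleftrightarrow> x \<in> S"
  unfolding lrep_def by (metis neq0_conv)+

lemma lrep_cong: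
  assumes "\<And>t b. t \<in> {1, 2, 3} \<Longrightarrow> M' (t, j, b, 0) = M (t, j, b, 0)"
  shows "lrep M' j S = lrep M j S"
  using assms by (simp add: lrep_def)

lemma lrep_empty: "lrep (\<lambda>_. 0) j {}"
  by (simp add: lrep_def)

lemma lrep_add:
  assumes "lrep M j S" "x \<notin> S"
  shows "lrep (add_mem M j x) j (insert x S)"
proof -
  have "M (3, j, z, 0) - Suc 0 \<noteq> card S" if "z \<in> S" for z
  proof -
    have "M (3, j, z, 0) \<le> card S" "M (3, j, z, 0) \<noteq> 0" using assms(1) that by (auto simp: lrep_def)
    then show ?thesis by linarith
  qed
  then show ?thesis using assms unfolding lrep_def add_mem_def by (auto simp: less_Suc_eq)
qed

lemma lrep_del:
  assumes "lrep M j S" "x \<in> S"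
  shows "lrep (del_mem M j x) j (S - {x})"
proof -
  define e where "e i = M (2, j, i, 0)" for i
  define p where "p z = M (3, j, z, 0)" for z
  define c where "c = card S"
  define i where "i = p x - 1"
  define l where "l = c - 1"
  define y where "y = e l"
  have f: "finite S" and A: "M (1, j, 0, 0) = c" "M (Suc 0, j, 0, 0) = c" and B: "\<And>z. p z \<noteq> 0 \<longleftrightarrow> z \<in> S"
    and C: "\<And>z. z \<in> S \<Longrightarrow> p z \<le> c \<and> e (p z - 1) = z"
    and D: "\<And>k. k < c \<Longrightarrow> e k \<in> S \<and> p (e k) = Suc k" and F: "\<And>k. k \<ge> c \<Longrightarrow> e k = 0"
    using assms(1) unfolding lrep_def e_def p_def c_def by auto
  have c0: "c > 0" using assms(2) f by (auto simp: c_def card_gt_0_iff)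
  have ix: "p x = Suc i" "i < c" "e i = x" using B[of x] C[of x] assms(2) by (auto simp: i_def)
  have ly: "l < c" "y \<in> S" "p y = Suc l" using c0 D[of l] by (auto simp: l_def y_def)
  define M' where "M' = del_mem M j x"
  have e': "M' (2, j, k, 0) = (if k = l then 0 else if k = i then y else e k)" for k
    by (simp add: M'_def del_mem_def Let_def A e_def[symmetric] p_def[symmetric] i_def l_def y_def)
  have p': "M' (3, j, z, 0) = (if z = x then 0 else if z = y then Suc i else p z)" for z
    by (simp add: M'_def del_mem_def Let_def A e_def[symmetric] p_def[symmetric] i_def l_def y_def)
  have n': "M' (1, j, 0, 0) = l"
    by (simp add: M'_def del_mem_def Let_def A l_def)
  have c': "card (S - {x}) = l" using f assms(2) by (simp add: c_def l_def)
  have "lrep M' j (S - {x})"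
    unfolding lrep_def c' n' e' p'
  proof (intro conjI allI ballI impI)
    fix z assume z: "z \<in> S - {x}"
    show "(if z = x then 0 else if z = y then Suc i else p z) \<le> l"
    proof (cases "z = y")
      case True
      then have "i \<noteq> l" using z ix by (auto simp: y_def)
      then show ?thesis using True z ix ly by (auto simp: l_def)
    next
      case False
      have "p z \<noteq> Suc l" using False C[of z] z by (auto simp: y_def)
      then show ?thesis using False z C[of z] by (auto simp: l_def)
    qed
    show "(if (if z = x then 0 else if z = y then Suc i else p z) - 1 = l then 0 else
      if (if z = x then 0 else if z = y then Suc i else p z) - 1 = i then y
      else e ((if z = x then 0 else if z = y then Suc i else p z) - 1)) = z"
    proof (cases "z = y")
      case True
      then have "i \<noteq> l" using z ix by (auto simp: y_def)
      then show ?thesis using True z by auto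
    next
      case False
      have "p z - 1 \<noteq> l" "p z - 1 \<noteq> i" using False C[of z] z ix by (auto simp: y_def)
      then show ?thesis using False z C[of z] by auto
    qed
  next
    fix k assume k: "k < l"
    then have kc: "k < c" using ly by simp
    have *: "i < l \<Longrightarrow> y \<noteq> x" using ix ly by auto
    show "(if k = l then 0 else if k = i then y else e k) \<in> S - {x}"
      using k kc D[OF kc] ly ix * by auto
    show "(if (if k = l then 0 else if k = i then y else e k) = x then 0
       else if (if k = l then 0 else if k = i then y else e k) = y then Suc i
       else p (if k = l then 0 else if k = i then y else e k)) = Suc k"
      using k kc D[OF kc] ly ix * by auto
  next
    fix k assume "l \<le> k"
    then show "(if k = l then 0 else if k = i then y else e k) = 0"
      using F[of k] ix by (auto simp: l_def)
  qed (use B f ly in auto)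
  then show ?thesis by (simp add: M'_def)
qed

lemma add_mem_other: "t \<notin> {1, 2, 3} \<or> j' \<noteq> j \<Longrightarrow> add_mem M j x (t, j', b, c) = M (t, j', b, c)"
  by (auto simp: add_mem_def)

lemma del_mem_other: "t \<notin> {1, 2, 3} \<or> j' \<noteq> j \<Longrightarrow> del_mem M j x (t, j', b, c) = M (t, j', b, c)"
  by (auto simp: del_mem_def Let_def)

lemma lrep_add_other: "j' \<noteq> j \<Longrightarrow> lrep (add_mem M j x) j' S = lrep M j' S"
  by (rule lrep_cong) (simp add: add_mem_other)

lemma lrep_del_other: "j' \<noteq> j \<Longrightarrow> lrep (del_mem M j x) j' S = lrep M j' S"
  by (rule lrep_cong) (simp add: del_mem_other)

lemma lrep_bij: "lrep M j S \<Longrightarrow> bij_betw (\<lambda>i. M (2, j, i, 0)) {..<card S} S"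
proof -
  assume l: "lrep M j S"
  have "x \<in> (\<lambda>i. M (2, j, i, 0)) ` {..<card S}" if "x \<in> S" for x
  proof (rule image_eqI)
    show "x = M (2, j, M (3, j, x, 0) - 1, 0)" using l that by (simp add: lrep_def)
    have "M (3, j, x, 0) \<le> card S" "M (3, j, x, 0) \<noteq> 0" using l that by (auto simp: lrep_def)
    then show "M (3, j, x, 0) - 1 \<in> {..<card S}" by auto
  qed
  moreover have "inj_on (\<lambda>i. M (2, j, i, 0)) {..<card S}"
    using l by (intro inj_on_inverseI[where g = "\<lambda>x. M (3, j, x, 0) - 1"]) (simp add: lrep_def)
  ultimately show ?thesis using l by (auto simp: bij_betw_def lrep_def)
qed

lemma lrep_sum: "lrep M j S \<Longrightarrow> (\<Sum>i<card S. f (M (2, j, i, 0))) = (\<Sum>x\<in>S. f x)"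
  using sum.reindex_bij_betw[OF lrep_bij] .

section \<open>Programs for insertion into and deletion from indexed sets\<close>

definition ladd :: "nexp \<Rightarrow> nexp \<Rightarrow> com" where
  "ladd j x = Seq (put 2 j (R 1 j (K 0) (K 0)) (K 0) x)
     (Seq (put 1 j (K 0) (K 0) (Op Plus (R 1 j (K 0) (K 0)) (K 1)))
       (put 3 j x (K 0) (R 1 j (K 0) (K 0))))"

text \<open>Registers 40 to 42 are scratch and lie above all registers that hold arguments, saved
  values or loop variables; callers rely on everything below 40.\<close>

definition ldel :: "nexp \<Rightarrow> nexp \<Rightarrow> com" where
  "ldel j x = Seq (asg 40 (Op Minus (R 3 j x (K 0)) (K 1)))
     (Seq (asg 41 (Op Minus (R 1 j (K 0) (K 0)) (K 1)))
     (Seq (asg 42 (R 2 j (V 41) (K 0)))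
     (Seq (put 2 j (V 40) (K 0) (V 42))
     (Seq (put 3 j (V 42) (K 0) (Op Plus (V 40) (K 1)))
     (Seq (put 2 j (V 41) (K 0) (K 0))
     (Seq (put 3 j x (K 0) (K 0))
       (put 1 j (K 0) (K 0) (V 41))))))))"

text \<open>Such an expression depends on low registers only, so it keeps its value while the code
  using it rewrites the memory.\<close>

definition simple_exp :: "nexp \<Rightarrow> bool" where
  "simple_exp e \<longleftrightarrow> reads e = {} \<and> vars e \<subseteq> {..<10} \<and> ecost e \<le> 3"

lemma nev_simple:
  assumes "simple_exp e" "\<And>r. r < 10 \<Longrightarrow> \<rho>' r = \<rho> r"
  shows "nev n W \<rho>' M' e = nev n W \<rho> M e"
  by (rule nev_cong) (use assms in \<open>auto simp: simple_exp_def\<close>)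

context ram
begin

lemma W_neq_Suc_0 [simp]: "W \<noteq> Suc 0"
  using W_ge(4) by simp

lemma supp_fun_upd: "supp M \<subseteq> Z \<Longrightarrow> k \<in> Z \<Longrightarrow> supp (M(k := x)) \<subseteq> Z"
  by (auto simp: supp_def)

lemma runs_put':
  assumes "\<rho> 0 = n" "finite Z" "card Z \<le> B" "supp M \<subseteq> Z" "k \<in> Z"
    and "k = (t mod 16, ev \<rho> M a mod N, ev \<rho> M b mod N, ev \<rho> M c mod N)" "x = ev \<rho> M e"
    and "30 + ecost a + ecost b + ecost c + ecost e \<le> T"
  shows "runs B (put t a b c e) \<rho> M T \<rho> (M(k := x))"
proof -
  have s: "supp (M(k := x)) \<subseteq> Z" by (rule supp_fun_upd[OF assms(4,5)])
  show "runs B (put t a b c e) \<rho> M T \<rho> (M(k := x))"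
    unfolding assms(6,7)
  proof (rule runs_mono[OF runs_put])
    show "sp M \<le> B" using sp_le assms by blast
    show "sp (M((t mod 16, ev \<rho> M a mod N, ev \<rho> M b mod N, ev \<rho> M c mod N) := ev \<rho> M e)) \<le> B"
      using sp_le[OF s] assms(2,3) unfolding assms(6,7) by blast
  qed (use assms in simp_all)
qed

lemma runs_asg':
  assumes "\<rho> 0 = n" "finite Z" "card Z \<le> B" "supp M \<subseteq> Z" "x = ev \<rho> M e" "1 + ecost e \<le> T"
  shows "runs B (asg r e) \<rho> M T (\<rho>(r := x)) M"
  unfolding assms(5) by (rule runs_mono[OF runs_asg]) (use assms sp_le in simp_all)

lemma runs_ladd:
  assumes "\<rho> 0 = n" "finite Z" "card Z \<le> B" "supp M \<subseteq> Z"
    and jx: "simple_exp j" "simple_exp x" and J: "ev \<rho> M j = J" "J < N" and X: "ev \<rho> M x = X" "X < n"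
    and l: "lrep M J S" "X \<notin> S" "S \<subseteq> {..<n}" and Z: "list_keys J (insert X S) \<subseteq> Z"
  shows "runs B (ladd j x) \<rho> M 1000 \<rho> (add_mem M J X)" "supp (add_mem M J X) \<subseteq> Z"
proof -
  have f: "finite S" using l by (simp add: lrep_def)
  define c where "c = card S"
  have cn: "c < n" using l(2,3) X(2) f psubset_card_mono[of "{..<n}" S] by (auto simp: c_def)
  have cW: "c < W" "Suc c < W" "c < N" using cn W_ge(3) by auto
  have c: "M (1, J, 0, 0) = c" "M (Suc 0, J, 0, 0) = c" using lrep_card[OF l(1)] by (auto simp: c_def)
  have j: "ev \<rho> M' j = J" for M' using nev_simple[OF jx(1)] J by metis
  have x: "ev \<rho> M' x = X" for M' using nev_simple[OF jx(2)] X by metis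
  have ec: "ecost j \<le> 3" "ecost x \<le> 3" using jx by (auto simp: simple_exp_def)
  have small: "J mod N = J" "X mod N = X" "c mod W = c" "c mod N = c" "Suc c mod W = Suc c" "X mod W = X"
    "1 mod W = 1" "Suc 0 mod W = Suc 0"
    using J X cn cW W_ge(3,4) by auto
  have Zk: "(2, J, c, 0) \<in> Z" "(1, J, 0, 0) \<in> Z" "(3, J, X, 0) \<in> Z"
    using Z l(2) f by (auto simp: list_keys_def c_def)
  let ?M1 = "M((2, J, c, 0) := X)"
  have 1: "runs B (put 2 j (R 1 j (K 0) (K 0)) (K 0) x) \<rho> M 300 \<rho> ?M1"
    by (rule runs_put'[where Z=Z and \<rho>=\<rho>, OF assms(1-4) Zk(1)]) (use ec in \<open>simp_all add: j x c small\<close>)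
  have s1: "supp ?M1 \<subseteq> Z" by (rule supp_fun_upd[OF assms(4) Zk(1)])
  let ?M2 = "?M1((1, J, 0, 0) := Suc c)"
  have 2: "runs B (put 1 j (K 0) (K 0) (Op Plus (R 1 j (K 0) (K 0)) (K 1))) \<rho> ?M1 300 \<rho> ?M2"
    by (rule runs_put'[where Z=Z and \<rho>=\<rho>, OF assms(1-3) s1 Zk(2)]) (use ec in \<open>simp_all add: j x c small\<close>)
  have s2: "supp ?M2 \<subseteq> Z" by (rule supp_fun_upd[OF s1 Zk(2)])
  let ?M3 = "?M2((3, J, X, 0) := Suc c)"
  have 3: "runs B (put 3 j x (K 0) (R 1 j (K 0) (K 0))) \<rho> ?M2 300 \<rho> ?M3"
    by (rule runs_put'[where Z=Z and \<rho>=\<rho>, OF assms(1-3) s2 Zk(3)]) (use ec in \<open>simp_all add: j x c small\<close>)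
  have s3: "supp ?M3 \<subseteq> Z" by (rule supp_fun_upd[OF s2 Zk(3)])
  have M3: "?M3 = add_mem M J X" by (simp add: add_mem_def c)
  show "runs B (ladd j x) \<rho> M 1000 \<rho> (add_mem M J X)"
    unfolding ladd_def M3[symmetric]
    by (rule runs_mono[OF runs_seq[OF 1 runs_seq[OF 2 3]]]) auto
  show "supp (add_mem M J X) \<subseteq> Z" using s3 M3 by simp
qed

lemma runs_ldel:
  assumes "\<rho> 0 = n" "finite Z" "card Z \<le> B" "supp M \<subseteq> Z"
    and jx: "simple_exp j" "simple_exp x" and J: "ev \<rho> M j = J" "J < N" and X: "ev \<rho> M x = X" "X < n"
    and l: "lrep M J S" "X \<in> S" "S \<subseteq> {..<n}" and Z: "list_keys J S \<subseteq> Z"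
  shows "\<exists>\<rho>'. runs B (ldel j x) \<rho> M 3000 \<rho>' (del_mem M J X) \<and> (\<forall>r < 40. \<rho>' r = \<rho> r)"
    "supp (del_mem M J X) \<subseteq> Z"
proof -
  have f: "finite S" using l by (simp add: lrep_def)
  define c where "c = card S"
  have cn: "c \<le> n" using l(3) card_mono[of "{..<n}" S] by (auto simp: c_def)
  have c0: "0 < c" using l(2) f by (auto simp: c_def card_gt_0_iff)
  have cW: "c < W" using cn W_ge(3) by auto
  define i where "i = M (3, J, X, 0) - 1"
  define y where "y = M (2, J, c - 1, 0)"
  have c: "M (1, J, 0, 0) = c" "M (Suc 0, J, 0, 0) = c" using lrep_card[OF l(1)] by (auto simp: c_def)
  have px: "M (3, J, X, 0) = Suc i" "i < c" using l(1,2) by (auto simp: lrep_def i_def c_def) (metis Suc_pred Suc_le_eq neq0_conv)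
  have yS: "y \<in> S" using l(1) c0 by (auto simp: lrep_def y_def c_def)
  then have yn: "y < n" using l(3) by auto
  have ec: "ecost j \<le> 3" "ecost x \<le> 3" using jx by (auto simp: simple_exp_def)
  have small: "J mod N = J" "X mod N = X" "c mod W = c" "c mod N = c" "X mod W = X" "y mod W = y" "y mod N = y"
    "1 mod W = 1" "Suc 0 mod W = Suc 0" "i mod W = i" "i mod N = i" "Suc i mod W = Suc i"
    "(c - Suc 0) mod W = c - Suc 0" "(c - Suc 0) mod N = c - Suc 0"
    using J X cn cW c0 px yn W_ge(3,4) by auto
  have Zk: "(1, J, 0, 0) \<in> Z" "(3, J, X, 0) \<in> Z" "(3, J, y, 0) \<in> Z" "\<And>k. k < c \<Longrightarrow> (2, J, k, 0) \<in> Z"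
    using Z l(2) f yS by (auto simp: list_keys_def c_def)
  define \<rho>1 where "\<rho>1 = \<rho>(40 := i)"
  define \<rho>2 where "\<rho>2 = \<rho>1(41 := c - 1)"
  define \<rho>3 where "\<rho>3 = \<rho>2(42 := y)"
  have z: "\<rho>1 0 = n" "\<rho>2 0 = n" "\<rho>3 0 = n" using assms(1) by (auto simp: \<rho>1_def \<rho>2_def \<rho>3_def)
  have v: "\<rho>2 41 = c - 1" "\<rho>3 40 = i" "\<rho>3 41 = c - 1" "\<rho>3 42 = y" by (simp_all add: \<rho>1_def \<rho>2_def \<rho>3_def)
  have j: "ev \<rho>' M' j = J" if "\<forall>r<10. \<rho>' r = \<rho> r" for M' \<rho>' using nev_simple[OF jx(1)] J that by metis
  have x: "ev \<rho>' M' x = X" if "\<forall>r<10. \<rho>' r = \<rho> r" for M' \<rho>' using nev_simple[OF jx(2)] X that by metis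
  have jx': "ev \<rho> M' j = J" "ev \<rho>1 M' j = J" "ev \<rho>2 M' j = J" "ev \<rho>3 M' j = J"
     "ev \<rho> M' x = X" "ev \<rho>1 M' x = X" "ev \<rho>2 M' x = X" "ev \<rho>3 M' x = X" for M'
    by (auto intro!: j x simp: \<rho>1_def \<rho>2_def \<rho>3_def)
  have 1: "runs B (asg 40 (Op Minus (R 3 j x (K 0)) (K 1))) \<rho> M 300 \<rho>1 M"
    unfolding \<rho>1_def by (rule runs_asg'[where Z=Z and \<rho>=\<rho>, OF assms(1-4)]) (use ec in \<open>simp_all add: jx' small px\<close>)
  have 2: "runs B (asg 41 (Op Minus (R 1 j (K 0) (K 0)) (K 1))) \<rho>1 M 300 \<rho>2 M"
    unfolding \<rho>2_def by (rule runs_asg'[where Z=Z and \<rho>=\<rho>1, OF z(1) assms(2-4)]) (use ec in \<open>simp_all add: jx' small c\<close>)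
  have 3: "runs B (asg 42 (R 2 j (V 41) (K 0))) \<rho>2 M 300 \<rho>3 M"
    unfolding \<rho>3_def by (rule runs_asg'[where Z=Z and \<rho>=\<rho>2, OF z(2) assms(2-4)]) (use ec in \<open>simp_all add: jx' small c v y_def[symmetric, simplified]\<close>)
  let ?M1 = "M((2, J, i, 0) := y)"
  have 4: "runs B (put 2 j (V 40) (K 0) (V 42)) \<rho>3 M 300 \<rho>3 ?M1"
    by (rule runs_put'[where Z=Z and \<rho>=\<rho>3, OF z(3) assms(2-4) Zk(4)[OF px(2)]]) (use ec in \<open>simp_all add: jx' v small\<close>)
  have s4: "supp ?M1 \<subseteq> Z" by (rule supp_fun_upd[OF assms(4) Zk(4)[OF px(2)]])
  let ?M2 = "?M1((3, J, y, 0) := Suc i)"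
  have 5: "runs B (put 3 j (V 42) (K 0) (Op Plus (V 40) (K 1))) \<rho>3 ?M1 300 \<rho>3 ?M2"
    by (rule runs_put'[where Z=Z and \<rho>=\<rho>3, OF z(3) assms(2-3) s4 Zk(3)]) (use ec in \<open>simp_all add: jx' v small\<close>)
  have s5: "supp ?M2 \<subseteq> Z" by (rule supp_fun_upd[OF s4 Zk(3)])
  let ?M3 = "?M2((2, J, c - 1, 0) := 0)"
  have Zl: "(2, J, c - 1, 0) \<in> Z" using Zk(4) c0 by simp
  have 6: "runs B (put 2 j (V 41) (K 0) (K 0)) \<rho>3 ?M2 300 \<rho>3 ?M3"
    by (rule runs_put'[where Z=Z and \<rho>=\<rho>3, OF z(3) assms(2-3) s5 Zl]) (use ec in \<open>simp_all add: jx' v small\<close>)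
  have s6: "supp ?M3 \<subseteq> Z" by (rule supp_fun_upd[OF s5 Zl])
  let ?M4 = "?M3((3, J, X, 0) := 0)"
  have 7: "runs B (put 3 j x (K 0) (K 0)) \<rho>3 ?M3 300 \<rho>3 ?M4"
    by (rule runs_put'[where Z=Z and \<rho>=\<rho>3, OF z(3) assms(2-3) s6 Zk(2)]) (use ec in \<open>simp_all add: jx' v small\<close>)
  have s7: "supp ?M4 \<subseteq> Z" by (rule supp_fun_upd[OF s6 Zk(2)])
  let ?M5 = "?M4((1, J, 0, 0) := c - 1)"
  have 8: "runs B (put 1 j (K 0) (K 0) (V 41)) \<rho>3 ?M4 300 \<rho>3 ?M5"
    by (rule runs_put'[where Z=Z and \<rho>=\<rho>3, OF z(3) assms(2-3) s7 Zk(1)]) (use ec in \<open>simp_all add: jx' v small\<close>)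
  have s8: "supp ?M5 \<subseteq> Z" by (rule supp_fun_upd[OF s7 Zk(1)])
  have M5: "?M5 = del_mem M J X" by (simp add: del_mem_def Let_def c y_def px)
  have "runs B (ldel j x) \<rho> M 3000 \<rho>3 (del_mem M J X)"
    unfolding ldel_def M5[symmetric]
    by (rule runs_mono[OF runs_seq[OF 1 runs_seq[OF 2 runs_seq[OF 3 runs_seq[OF 4 runs_seq[OF 5
          runs_seq[OF 6 runs_seq[OF 7 8]]]]]]]]) auto
  moreover have "\<forall>r < 40. \<rho>3 r = \<rho> r" by (auto simp: \<rho>1_def \<rho>2_def \<rho>3_def)
  ultimately show "\<exists>\<rho>'. runs B (ldel j x) \<rho> M 3000 \<rho>' (del_mem M J X) \<and> (\<forall>r < 40. \<rho>' r = \<rho> r)" by blast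
  show "supp (del_mem M J X) \<subseteq> Z" using s8 M5 by simp
qed

end

declare split_paired_All [simp del] split_paired_Ex [simp del]

section \<open>Edge updates for a fixed set of heavy vertices\<close>

definition graph :: "nat \<Rightarrow> (nat \<Rightarrow> nat \<Rightarrow> bool) \<Rightarrow> bool" where
  "graph n A \<longleftrightarrow> (\<forall>x y. A x y \<longrightarrow> A y x \<and> x \<noteq> y \<and> x < n)"

definition nb :: "(nat \<Rightarrow> nat \<Rightarrow> bool) \<Rightarrow> nat \<Rightarrow> nat set" where
  "nb A x = {y. A x y}"

definition add_edge :: "(nat \<Rightarrow> nat \<Rightarrow> bool) \<Rightarrow> nat \<Rightarrow> nat \<Rightarrow> (nat \<Rightarrow> nat \<Rightarrow> bool)" where
  "add_edge A u v = (\<lambda>x y. A x y \<or> x = u \<and> y = v \<or> x = v \<and> y = u)"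

definition del_edge :: "(nat \<Rightarrow> nat \<Rightarrow> bool) \<Rightarrow> nat \<Rightarrow> nat \<Rightarrow> (nat \<Rightarrow> nat \<Rightarrow> bool)" where
  "del_edge A u v = (\<lambda>x y. A x y \<and> \<not> (x = u \<and> y = v) \<and> \<not> (x = v \<and> y = u))"

definition addable :: "nat \<Rightarrow> (nat \<Rightarrow> nat \<Rightarrow> bool) \<Rightarrow> nat \<Rightarrow> nat \<Rightarrow> bool" where
  "addable n A u v \<longleftrightarrow> graph n A \<and> u < n \<and> v < n \<and> u \<noteq> v \<and> \<not> A u v"

text \<open>What the evaluation of a loop relies on: neighbourhoods and heavy set. The contents of
  the tables are a separate matter, as they are in transition while their own nest runs.\<close>

definition base :: "nat \<Rightarrow> nat \<Rightarrow> (key \<Rightarrow> nat) \<Rightarrow> (nat \<Rightarrow> nat \<Rightarrow> bool) \<Rightarrow> nat set \<Rightarrow> bool" where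
  "base n W M A H \<longleftrightarrow> n \<ge> 2 \<and> 4 ^ 12 \<le> W \<and> n + 3 < W \<and> graph n A \<and> H \<subseteq> {..<n} \<and>
     (\<forall>j<n. lrep M j (nb A j)) \<and> lrep M n H"

definition low_degree_le :: "nat \<Rightarrow> (nat \<Rightarrow> nat \<Rightarrow> bool) \<Rightarrow> nat set \<Rightarrow> nat \<Rightarrow> bool" where
  "low_degree_le n A H D \<longleftrightarrow> (\<forall>x<n. x \<notin> H \<longrightarrow> card (nb A x) \<le> D)"

lemma graph_sym: "graph n A \<Longrightarrow> A x y \<Longrightarrow> A y x"
  and graph_less: "graph n A \<Longrightarrow> A x y \<Longrightarrow> x < n \<and> y < n"
  and graph_irrefl: "graph n A \<Longrightarrow> \<not> A x x"
  unfolding graph_def by blast+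

lemma low_degree_mono:
  assumes "low_degree_le n A H D" "graph n A" "\<And>x y. A' x y \<Longrightarrow> A x y" "H \<subseteq> H'"
  shows "low_degree_le n A' H' D"
  unfolding low_degree_le_def
proof (intro allI impI)
  fix x assume "x < n" "x \<notin> H'"
  then have "card (nb A x) \<le> D" using assms by (auto simp: low_degree_le_def)
  moreover have "nb A x \<subseteq> {..<n}" using assms(2) by (auto simp: nb_def graph_def)
  then have "card (nb A' x) \<le> card (nb A x)"
    using assms(3) by (intro card_mono) (auto simp: nb_def intro: finite_subset)
  ultimately show "card (nb A' x) \<le> D" by simp
qed

lemma nb_subset: "graph n A \<Longrightarrow> nb A x \<subseteq> {..<n}"
  by (auto simp: nb_def graph_def)

lemma finite_nb [simp]: "graph n A \<Longrightarrow> finite (nb A x)"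
  by (meson finite_subset finite_lessThan nb_subset)

lemma graph_add: "addable n A u v \<Longrightarrow> graph n (add_edge A u v)"
  by (auto simp: addable_def graph_def add_edge_def)

lemma graph_del: "graph n A \<Longrightarrow> graph n (del_edge A u v)"
  by (auto simp: graph_def del_edge_def)

lemma nb_add: "u \<noteq> v \<Longrightarrow> nb (add_edge A u v) = (nb A)(u := insert v (nb A u), v := insert u (nb A v))"
  by (auto simp: nb_def add_edge_def fun_eq_iff)

lemma nb_del: "u \<noteq> v \<Longrightarrow> nb (del_edge A u v) = (nb A)(u := nb A u - {v}, v := nb A v - {u})"
  by (auto simp: nb_def del_edge_def fun_eq_iff)

lemma addable_del: "graph n A \<Longrightarrow> A u v \<Longrightarrow> addable n (del_edge A u v) u v"
  by (auto simp: addable_def graph_def del_edge_def)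

lemma add_del_edge: "graph n A \<Longrightarrow> A u v \<Longrightarrow> add_edge (del_edge A u v) u v = A"
  by (auto simp: graph_def add_edge_def del_edge_def fun_eq_iff)

text \<open>Excludes garbage: the remaining conditions on a state leave many cells of the tags below
  5 unconstrained, and these would count as space if they were non-zero.\<close>

definition shape :: "nat \<Rightarrow> key \<Rightarrow> bool" where
  "shape n k \<longleftrightarrow> 5 \<le> fst k \<or> k \<in> {(0, 0, 0, 0), (4, 0, 0, 0), (4, 1, 0, 0), (4, 2, 0, 0)} \<or>
     (\<exists>j<n + 3. \<exists>x. k = (1, j, 0, 0) \<or> k = (2, j, x, 0) \<or> k = (3, j, x, 0))"

text \<open>The word \<open>W - 1\<close> for \<open>W = (n + 2) ^ 12\<close>; no intermediate result reaches \<open>W\<close>.\<close>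

definition minus_one :: nexp where
  "minus_one = (let b = Op Plus (V 0) (K 2); b2 = Op Times b b; b4 = Op Times b2 b2;
      b11 = Op Times (Op Times b4 b4) (Op Times b2 b)
    in Op Plus (Op Times b11 (Op Plus (V 0) (K 1))) (Op Minus b11 (K 1)))"

text \<open>All that the update procedures know of a pattern. \<open>denT\<close> and
  \<open>denC\<close> describe the effect of a new edge \<open>uv\<close> as seen from the graph
  without it; a deletion uses them with opposite signs. \<open>denC\<close> is a congruence because
  the tables are stored modulo \<open>W\<close>, and \<open>emb_le\<close> makes the residue
  determine the count. \<open>tab_isolated\<close> is what permits a vertex to change sides.
  \<open>iters_le\<close> is the source of the time bounds: a double loop over light neighbourhoods
  or a loop over heavy vertices.\<close>

locale pattern =
  fixes p Kit :: nat and nC nT :: nest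
    and tab :: "nat \<Rightarrow> (nat \<Rightarrow> nat \<Rightarrow> bool) \<Rightarrow> nat set \<Rightarrow> key \<Rightarrow> int"
    and emb :: "nat \<Rightarrow> (nat \<Rightarrow> nat \<Rightarrow> bool) \<Rightarrow> nat"
  assumes p23: "p = 2 \<or> p = 3"
    and okC: "nest_ok 0 {1..<16} {0} nC" "scalar_nest nC"
    and okT: "nest_ok 0 {1, 2, 3} {5..<16} nT" "positive_nest nT"
    and tab_nonneg: "tab n A H k \<ge> 0"
    and tab_box: "tab n A H k \<noteq> 0 \<Longrightarrow> k \<in> {5..<16} \<times> {..<n} \<times> {..<n} \<times> {..<n}"
    and tab_mono: "(\<And>x y. A x y \<Longrightarrow> A' x y) \<Longrightarrow> tab n A H k \<le> tab n A' H k"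
    and tab_empty: "tab n (\<lambda>_ _. False) H k = 0"
    and tab_isolated: "graph n A \<Longrightarrow> nb A w = {} \<Longrightarrow> tab n A (insert w H) k = tab n A (H - {w}) k"
    and emb_empty: "emb n (\<lambda>_ _. False) = 0"
    and emb_le: "emb n A \<le> 8 * n ^ 4"
    and denT: "base n W M A H \<Longrightarrow> addable n A u v \<Longrightarrow> \<rho> 0 = n \<Longrightarrow> \<rho> 1 = u \<Longrightarrow> \<rho> 2 = v \<Longrightarrow> sg 3 = 1 \<Longrightarrow>
      den n W sg M \<rho> 0 nT k = tab n (add_edge A u v) H k - tab n A H k"
    and denC: "base n W M A H \<Longrightarrow> addable n A u v \<Longrightarrow> \<rho> 0 = n \<Longrightarrow> \<rho> 1 = u \<Longrightarrow> \<rho> 2 = v \<Longrightarrow> sg 3 = 1 \<Longrightarrow> sg 4 = -1 \<Longrightarrow>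
      (\<And>k. 5 \<le> fst k \<Longrightarrow> M k = nat (tab n A H k mod int W)) \<Longrightarrow>
      den n W sg M \<rho> 0 nC (0, 0, 0, 0) mod int W = (int (emb n (add_edge A u v)) - int (emb n A)) mod int W"
    and iters_le: "base n W M A H \<Longrightarrow> addable n A u v \<Longrightarrow> \<rho> 0 = n \<Longrightarrow> \<rho> 1 = u \<Longrightarrow> \<rho> 2 = v \<Longrightarrow>
      D \<ge> 1 \<Longrightarrow> low_degree_le n A H D \<Longrightarrow>
      iters n W M \<rho> 0 nC \<le> Kit * (D ^ (p - 1) + card H) \<and> iters n W M \<rho> 0 nT \<le> Kit * (D ^ (p - 1) + card H)"
begin

text \<open>\<open>nC\<close> reads the tables of the graph without \<open>uv\<close>. So it
  precedes \<open>nT\<close> here and follows it in \<open>del_prog\<close>; likewise the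
  neighbourhoods are changed last here and first there.\<close>

definition ins_prog :: com where
  "ins_prog = Seq (asg 3 (K 1)) (Seq (asg 4 minus_one) (Seq (comp 0 nC) (Seq (comp 0 nT)
     (Seq (ladd (V 1) (V 2)) (ladd (V 2) (V 1))))))"

definition del_prog :: com where
  "del_prog = Seq (asg 3 minus_one) (Seq (asg 4 (K 1)) (Seq (ldel (V 1) (V 2)) (Seq (ldel (V 2) (V 1))
     (Seq (comp 0 nT) (comp 0 nC)))))"

definition prim_cost :: nat where
  "prim_cost = (nsize nC + nsize nT) * Kit + 20000"

lemma tab_finite: "finite {k. tab n A H k \<noteq> 0}"
  by (rule finite_subset[of _ "{5..<16} \<times> {..<n} \<times> {..<n} \<times> {..<n}"]) (use tab_box in blast, simp)

end

section \<open>The represented state and the cells that it may occupy\<close>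

locale ds = ram E n W + pattern p Kit nC nT tab emb
  for E n W p Kit nC nT tab emb
begin

definition keys :: "(nat \<Rightarrow> nat set) \<Rightarrow> (nat \<Rightarrow> nat \<Rightarrow> bool) \<Rightarrow> nat set \<Rightarrow> key set" where
  "keys fam A H = {(0, 0, 0, 0), (4, 0, 0, 0), (4, 1, 0, 0), (4, 2, 0, 0)} \<union>
     (\<Union>j<N. list_keys j (fam j)) \<union> {k. tab n A H k \<noteq> 0}"

text \<open>In the middle of an update the neighbourhoods (\<open>fam\<close>), the tables (for
  \<open>A\<close>) and the count (for \<open>C\<close>) belong to different graphs, hence separate
  parameters. Besides the number of edges, \<open>s3\<close> records the order in which set
  \<open>n + 1\<close> is listed, since the scan in a recomputation goes through it by
  position.\<close>

definition rep where
  "rep M fam A H C s1 s2 s3 \<longleftrightarrow> (\<forall>j<N. lrep M j (fam j) \<and> fam j \<subseteq> {..<n}) \<and>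
     M (4, 0, 0, 0) = s1 \<and> M (4, 1, 0, 0) = s2 \<and> M (4, 2, 0, 0) = fst s3 \<and> (\<forall>i. M (2, n + 1, i, 0) = snd s3 i) \<and> M (0, 0, 0, 0) = emb n C \<and>
     (\<forall>k. 5 \<le> fst k \<longrightarrow> M k = nat (tab n A H k mod int W)) \<and> (\<forall>k. M k < W) \<and> (\<forall>k\<in>supp M. shape n k)"

definition fam_of where
  "fam_of A H U S = (\<lambda>j. if j < n then nb A j else if j = n then H else if j = n + 1 then U else S)"

definition Rep where
  "Rep M A H U S s1 s2 s3 \<longleftrightarrow> graph n A \<and> rep M (fam_of A H U S) A H A s1 s2 s3"

lemma emb_less: "emb n C < W"
proof -
  have "emb n C \<le> 8 * n ^ 4" by (rule emb_le)
  also have "\<dots> < 4096 * n ^ 4" using n2 by simp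
  also have "\<dots> \<le> W" by (rule W_ge)
  finally show ?thesis .
qed

lemma finite_keys: "(\<And>j. j < N \<Longrightarrow> fam j \<subseteq> {..<n}) \<Longrightarrow> finite (keys fam A H)"
  unfolding keys_def using tab_finite by (auto intro!: finite_UN_I finite_list_keys intro: finite_subset)

lemma keys_mono:
  assumes "\<And>j. j < N \<Longrightarrow> fam j \<subseteq> fam' j" "\<And>j. j < N \<Longrightarrow> fam' j \<subseteq> {..<n}"
    and "\<And>k. tab n A H k \<le> tab n A' H' k"
  shows "keys fam A H \<subseteq> keys fam' A' H'"
proof -
  have "list_keys j (fam j) \<subseteq> list_keys j (fam' j)" if "j < N" for j
    using that assms(1,2) finite_subset[OF assms(2) finite_lessThan] by (intro list_keys_mono) auto
  moreover have "tab n A' H' k \<noteq> 0" if "tab n A H k \<noteq> 0" for k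
    using that assms(3)[of k] tab_nonneg[of n A H k] by linarith
  ultimately show ?thesis unfolding keys_def by (intro Un_mono UN_mono) auto
qed

lemma rep_supp:
  assumes "rep M fam A H C s1 s2 s3" shows "supp M \<subseteq> keys fam A H"
proof
  fix k assume k: "k \<in> supp M"
  then have nz: "M k \<noteq> 0" and sh: "shape n k" using assms by (auto simp: supp_def rep_def)
  consider "5 \<le> fst k" | "k \<in> {(0, 0, 0, 0), (4, 0, 0, 0), (4, 1, 0, 0), (4, 2, 0, 0)}"
    | j x where "j < N" "k = (1, j, 0, 0) \<or> k = (2, j, x, 0) \<or> k = (3, j, x, 0)"
    using sh unfolding shape_def by blast
  then show "k \<in> keys fam A H"
  proof cases
    case 1
    then have "M k = nat (tab n A H k mod int W)" using assms by (simp add: rep_def)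
    then have "tab n A H k \<noteq> 0" using nz by auto
    then show ?thesis by (simp add: keys_def)
  next
    case 2
    then show ?thesis by (auto simp: keys_def)
  next
    case (3 j x)
    then have l: "lrep M j (fam j)" using assms by (simp add: rep_def)
    have "k \<in> list_keys j (fam j)"
      using 3(2)
    proof (elim disjE)
      assume "k = (1, j, 0, 0)"
      then show ?thesis using nz lrep_card[OF l] by (auto simp: list_keys_def)
    next
      assume "k = (2, j, x, 0)"
      moreover from this have "x < card (fam j)"
      proof -
        have "\<not> card (fam j) \<le> x" using nz l \<open>k = (2, j, x, 0)\<close> by (auto simp: lrep_def)
        then show ?thesis by simp
      qed
      ultimately show ?thesis by (auto simp: list_keys_def)
    next
      assume "k = (3, j, x, 0)"
      then show ?thesis using nz lrep_mem[OF l] by (auto simp: list_keys_def)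
    qed
    then show ?thesis using 3(1) by (auto simp: keys_def)
  qed
qed

lemma rep_add:
  assumes r: "rep M fam A H C s1 s2 s3" and J: "J < N" and X: "X < n" "X \<notin> fam J"
  shows "rep (add_mem M J X) (fam(J := insert X (fam J))) A H C s1 s2 (fst s3, \<lambda>i. add_mem M J X (2, n + 1, i, 0))"
proof -
  have l: "lrep M J (fam J)" "fam J \<subseteq> {..<n}" using r J by (auto simp: rep_def)
  have c: "card (fam J) < n"
    using l(2) X psubset_card_mono[of "{..<n}" "fam J"] by auto
  have less: "add_mem M J X k < W" for k
    using r c X W_ge(3) lrep_card[OF l(1)] by (auto simp: add_mem_def rep_def)
  have sh: "shape n k" if "k \<in> supp (add_mem M J X)" for k
  proof (cases "k \<in> supp M")
    case False
    then have "k = (2, J, M (1, J, 0, 0), 0) \<or> k = (1, J, 0, 0) \<or> k = (3, J, X, 0)"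
      using that by (auto simp: add_mem_def supp_def split: if_splits)
    then show ?thesis using J unfolding shape_def by blast
  qed (use r in \<open>simp add: rep_def\<close>)
  have o: "add_mem M J X (t, b) = M (t, b)" if "t \<notin> {1, 2, 3}" for t b
    using that add_mem_other[of t] by (cases b) auto
  have "lrep (add_mem M J X) j ((fam(J := insert X (fam J))) j)" if "j < N" for j
    using that r lrep_add[OF l(1) X(2)] lrep_add_other by (auto simp: rep_def)
  then show ?thesis using r less sh o X l(2) unfolding rep_def by (auto simp: o)
qed

lemma rep_del:
  assumes r: "rep M fam A H C s1 s2 s3" and J: "J < N" and X: "X \<in> fam J"
  shows "rep (del_mem M J X) (fam(J := fam J - {X})) A H C s1 s2 (fst s3, \<lambda>i. del_mem M J X (2, n + 1, i, 0))"
proof -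
  have l: "lrep M J (fam J)" "fam J \<subseteq> {..<n}" using r J by (auto simp: rep_def)
  have c: "card (fam J) \<le> n" using l(2) card_mono[of "{..<n}" "fam J"] by auto
  have "M (3, J, X, 0) \<le> card (fam J)" using l(1) X by (auto simp: lrep_def)
  then have p: "Suc (M (3, J, X, 0) - Suc 0) < W" using c W_ge(3) by linarith
  have less: "del_mem M J X k < W" for k
    using r p c X W_ge(3) lrep_card[OF l(1)] by (auto simp: del_mem_def rep_def Let_def)
  have sh: "shape n k" if "k \<in> supp (del_mem M J X)" for k
  proof (cases "k \<in> supp M")
    case False
    then have "\<exists>x. k = (2, J, x, 0) \<or> k = (1, J, 0, 0) \<or> k = (3, J, x, 0)"
      using that by (auto simp: del_mem_def supp_def Let_def split: if_splits)
    then show ?thesis using J unfolding shape_def by blast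
  qed (use r in \<open>simp add: rep_def\<close>)
  have o: "del_mem M J X (t, b) = M (t, b)" if "t \<notin> {1, 2, 3}" for t b
    using that del_mem_other[of t] by (cases b) auto
  have "lrep (del_mem M J X) j ((fam(J := fam J - {X})) j)" if "j < N" for j
    using that r lrep_del[OF l(1) X] lrep_del_other by (auto simp: rep_def)
  then show ?thesis using r less sh o l(2) unfolding rep_def by (auto simp: o)
qed

lemma run_ladd:
  assumes "\<rho> 0 = n" "simple_exp j" "simple_exp x" "ev \<rho> M j = J" "ev \<rho> M x = X"
    and r: "rep M fam A H C s1 s2 s3" and J: "J < N" and X: "X < n" "X \<notin> fam J"
    and Z: "finite Z" "card Z \<le> B" "keys (fam(J := insert X (fam J))) A H \<subseteq> Z"
  shows "\<exists>M' s3'. runs B (ladd j x) \<rho> M 1000 \<rho> M' \<and> rep M' (fam(J := insert X (fam J))) A H C s1 s2 s3' \<and>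
    fst s3' = fst s3 \<and> (J \<noteq> n + 1 \<longrightarrow> s3' = s3)"
proof -
  have fam: "lrep M j (fam j)" "fam j \<subseteq> {..<n}" if "j < N" for j using r that by (auto simp: rep_def)
  have "keys fam A H \<subseteq> keys (fam(J := insert X (fam J))) A H"
    by (rule keys_mono) (use fam X in auto)
  then have s: "supp M \<subseteq> Z" using rep_supp[OF r] Z by blast
  have k: "list_keys J (insert X (fam J)) \<subseteq> Z"
  proof -
    have "list_keys J (insert X (fam J)) \<subseteq> keys (fam(J := insert X (fam J))) A H"
    proof -
      have "list_keys J ((fam(J := insert X (fam J))) J) \<subseteq> (\<Union>j<N. list_keys j ((fam(J := insert X (fam J))) j))"
        using J by (intro UN_upper) simp
      then show ?thesis unfolding keys_def by auto
    qed
    then show ?thesis using Z by blast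
  qed
  have "runs B (ladd j x) \<rho> M 1000 \<rho> (add_mem M J X)"
    by (rule runs_ladd(1)[where Z = Z and S = "fam J"]) (use assms fam[OF J] s k in auto)
  moreover have "(fst s3, \<lambda>i. add_mem M J X (2, n + 1, i, 0)) = s3" if "J \<noteq> n + 1"
    using that r by (cases s3) (auto simp: rep_def add_mem_other)
  ultimately show ?thesis
    by (intro exI[of _ "add_mem M J X"] exI[of _ "(fst s3, \<lambda>i. add_mem M J X (2, n + 1, i, 0))"] conjI rep_add[OF r J X] impI) simp_all
qed

lemma run_ldel:
  assumes "\<rho> 0 = n" "simple_exp j" "simple_exp x" "ev \<rho> M j = J" "ev \<rho> M x = X"
    and r: "rep M fam A H C s1 s2 s3" and J: "J < N" and X: "X \<in> fam J"
    and Z: "finite Z" "card Z \<le> B" "keys fam A H \<subseteq> Z"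
  shows "\<exists>\<rho>' M' s3'. runs B (ldel j x) \<rho> M 3000 \<rho>' M' \<and> rep M' (fam(J := fam J - {X})) A H C s1 s2 s3' \<and> (\<forall>r<40. \<rho>' r = \<rho> r) \<and>
    fst s3' = fst s3 \<and> (J \<noteq> n + 1 \<longrightarrow> s3' = s3)"
proof -
  have fam: "lrep M j (fam j)" "fam j \<subseteq> {..<n}" if "j < N" for j using r that by (auto simp: rep_def)
  have s: "supp M \<subseteq> Z" using rep_supp[OF r] Z by blast
  have k: "list_keys J (fam J) \<subseteq> Z" using Z(3) J unfolding keys_def by blast
  have "X < n" using X fam[OF J] by auto
  then have "\<exists>\<rho>'. runs B (ldel j x) \<rho> M 3000 \<rho>' (del_mem M J X) \<and> (\<forall>r<40. \<rho>' r = \<rho> r)"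
    using runs_ldel(1)[where \<rho> = \<rho>, OF assms(1) Z(1,2) s assms(2-4) J assms(5) _ fam(1)[OF J] X fam(2)[OF J] k] by simp
  then obtain \<rho>' where "runs B (ldel j x) \<rho> M 3000 \<rho>' (del_mem M J X)" "\<forall>r<40. \<rho>' r = \<rho> r" by blast
  moreover have "(fst s3, \<lambda>i. del_mem M J X (2, n + 1, i, 0)) = s3" if "J \<noteq> n + 1"
    using that r by (cases s3) (auto simp: rep_def del_mem_other)
  ultimately show ?thesis
    by (intro exI[of _ \<rho>'] exI[of _ "del_mem M J X"] exI[of _ "(fst s3, \<lambda>i. del_mem M J X (2, n + 1, i, 0))"] conjI rep_del[OF r J X] impI) simp_all
qed

text \<open>With \<open>b = n + 2\<close> one has
  \<open>b ^ 12 - 1 = b ^ 11 * (b - 1) + (b ^ 11 - 1)\<close>. The direct way is closed: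
  \<open>b ^ 12\<close> is 0 modulo \<open>W\<close>, and subtraction truncates at 0.\<close>

lemma ev_minus_one: "\<rho> 0 = n \<Longrightarrow> ev \<rho> M minus_one = W - 1"
proof -
  assume z: "\<rho> 0 = n"
  define b where "b = n + 2"
  have b1: "b \<ge> 2" by (simp add: b_def)
  have W: "W = b ^ 12" by (simp add: W_eq b_def)
  have pw: "b ^ k < W" if "k < 12" for k unfolding W using b1 that by (intro power_strict_increasing) auto
  have pws: "b < W" "b * b < W" "b * b * (b * b) < W" "b * b * b < W"
     "(b * b * (b * b)) * (b * b * (b * b)) < W" "(b * b * (b * b)) * (b * b * (b * b)) * (b * b * b) < W"
    using pw[of 1] pw[of 2] pw[of 4] pw[of 3] pw[of 8] pw[of 11]
    by (simp_all add: power_numeral_even power_numeral_odd mult.assoc flip: power_Suc)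
  define q where "q = (b * b * (b * b)) * (b * b * (b * b)) * (b * b * b)"
  have q: "q * b = W" by (simp add: q_def W power_numeral_even power_numeral_odd mult.assoc)
  have q1: "q \<ge> 1" using q W_pos by (cases q) auto
  have bn: "\<rho> 0 mod W = n" "2 mod W = 2" "1 mod W = 1" "n + 2 = b" "n + 1 = b - 1"
    using z W_ge(3,4) by (auto simp: b_def)
  have m: "(n + 2) mod W = b" using pws bn by simp
  have "q * (n + 1) + q = q * b" by (simp add: b_def algebra_simps)
  then have sum: "q * (n + 1) + (q - 1) = W - 1" using q q1 by linarith
  then have ql: "q * (n + 1) < W" "q < W" "q - 1 < W" "q * (n + 1) + (q - 1) < W" using W_pos q1 pws(6) q_def by linarith+
  have n1: "(n + 1) mod W = n + 1" using W_ge(3) by simp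
  show ?thesis
    unfolding minus_one_def Let_def nev.simps binop_val.simps bn(1,2,3) m n1
    using pws ql sum by (simp only: mod_less q_def[symmetric])
qed

lemma ecost_minus_one: "ecost minus_one \<le> 200"
  by (simp add: minus_one_def Let_def)

lemma rep_base:
  assumes "rep M fam A' H C s1 s2 s3" "graph n A" "\<And>j. j < n \<Longrightarrow> fam j = nb A j" "fam n = H"
  shows "base n W M A H"
  unfolding base_def
proof (intro conjI)
  have *: "j < N \<Longrightarrow> lrep M j (fam j) \<and> fam j \<subseteq> {..<n}" for j using assms by (simp add: rep_def)
  show "H \<subseteq> {..<n}" using *[of n] assms by auto
  show "\<forall>j<n. lrep M j (nb A j)" using * assms by (metis trans_less_add1)
  show "lrep M n H" using *[of n] assms by auto
qed (use n2 W_ge assms in auto)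

lemma tab_mono_add: "tab n A H k \<le> tab n (add_edge A u v) H k"
  by (rule tab_mono) (simp add: add_edge_def)

text \<open>The loops always see the graph \<open>A\<close> without the edge \<open>uv\<close>; \<open>s\<close> is the sign of the update.\<close>

lemma run_tables:
  fixes s :: int
  assumes r: "rep M fam T H C s1 s2 s3" and A: "addable n A u v"
    and fam: "\<And>j. j < n \<Longrightarrow> fam j = nb A j" "fam n = H"
    and \<rho>: "\<rho> 0 = n" "\<rho> 1 = u" "\<rho> 2 = v" "int (\<rho> 3) mod int W = s mod int W" "int (\<rho> 4) mod int W = - s mod int W"
    and s: "s = 1 \<and> T = A \<and> T' = add_edge A u v \<or> s = -1 \<and> T = add_edge A u v \<and> T' = A"
    and Z: "finite Z" "card Z \<le> B" "keys fam (add_edge A u v) H \<subseteq> Z"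
    and D: "D \<ge> 1" "low_degree_le n A H D"
  shows "\<exists>\<rho>' M'. runs B (comp 0 nT) \<rho> M (nsize nT * (Kit * (D ^ (p - 1) + card H))) \<rho>' M' \<and>
     rep M' fam T' H C s1 s2 s3 \<and> (\<forall>r<10. \<rho>' r = \<rho> r)"
proof -
  have b: "base n W M A H" by (rule rep_base[OF r]) (use A fam in \<open>auto simp: addable_def\<close>)
  let ?A' = "add_edge A u v"
  define sg where "sg r = (if r = 3 then s else - s)" for r :: nat
  have sgn: "den n W sg M \<rho> 0 nT k = s * (tab n ?A' H k - tab n A H k)" for k
  proof -
    have p: "den n W (\<lambda>r. if r = 3 then 1 else - 1) M \<rho> 0 nT k = tab n ?A' H k - tab n A H k"
      by (rule denT[OF b A]) (use \<rho> in auto)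
    show ?thesis
    proof (cases "s = 1")
      case True
      then have "sg = (\<lambda>r. if r = 3 then 1 else - 1)" by (auto simp: sg_def)
      then show ?thesis using p True by simp
    next
      case False
      then have "sg = (\<lambda>r. - (if r = 3 then 1 else - 1))" using s by (auto simp: sg_def)
      then show ?thesis using den_uminus[of n W "\<lambda>r. if r = 3 then 1 else - 1"] p False s by simp
    qed
  qed
  have tm: "tab n A H k \<le> tab n ?A' H k" for k by (rule tab_mono_add)
  have famb: "fam j \<subseteq> {..<n}" if "j < N" for j using r that by (simp add: rep_def)
  have sZ: "supp M \<subseteq> Z"
  proof -
    have "keys fam T H \<subseteq> keys fam ?A' H" by (rule keys_mono) (use s tm famb in auto)
    then show ?thesis using rep_supp[OF r] Z by blast
  qed
  \<comment> \<open>A written cell receives at least 1 in the case of an insertion, so its entry for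
    \<open>add_edge A u v\<close> is positive and the cell belongs to the keys of that graph. The
    written cells do not depend on the sign, so this covers the deletion as well.\<close>
  have tZ: "touched n W M \<rho> 0 nT \<subseteq> Z"
  proof
    fix k assume "k \<in> touched n W M \<rho> 0 nT"
    then have "den n W (\<lambda>r. if r = 3 then 1 else - 1) M \<rho> 0 nT k \<ge> 1"
      using den_positive[OF okT(2), of "\<lambda>r. if r = 3 then 1 else - 1" W n M \<rho> 0 k] W_ge(4) by simp
    then have "tab n ?A' H k - tab n A H k \<ge> 1"
      using denT[OF b A, of \<rho> "\<lambda>r. if r = 3 then 1 else - 1"] \<rho> by simp
    then have "tab n ?A' H k \<noteq> 0" using tab_nonneg[of n A H k] by linarith
    then show "k \<in> Z" using Z by (auto simp: keys_def)
  qed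
  have Ml: "M k < W" for k using r by (simp add: rep_def)
  have "\<exists>\<rho>'. runs B (comp 0 nT) \<rho> M (nsize nT * iters n W M \<rho> 0 nT) \<rho>' (upd W M (den n W sg M \<rho> 0 nT)) \<and>
     (\<forall>r < 10 + 2 * 0. \<rho>' r = \<rho> r)"
    by (rule runs_nest[OF okT(1)]) (use \<rho> Ml Z sZ tZ in \<open>auto simp: sg_def\<close>)
  then obtain \<rho>' where run: "runs B (comp 0 nT) \<rho> M (nsize nT * iters n W M \<rho> 0 nT) \<rho>' (upd W M (den n W sg M \<rho> 0 nT))"
    and reg: "\<forall>r<10. \<rho>' r = \<rho> r" by auto
  define M' where "M' = upd W M (den n W sg M \<rho> 0 nT)"
  have it: "iters n W M \<rho> 0 nT \<le> Kit * (D ^ (p - 1) + card H)"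
    using iters_le[OF b A _ _ _ D] \<rho> by blast
  have same: "M' (t, b) = M (t, b)" if "t \<notin> {5..<16}" for t b
    unfolding M'_def by (rule upd_id) (use Ml den_zero[OF okT(1) that] in simp_all)
  have tabs: "M' k = nat (tab n T' H k mod int W)" if k: "5 \<le> fst k" for k
  proof -
    have "int (M k) = tab n T H k mod int W" using r k W_pos by (simp add: rep_def)
    then have "M' k = nat ((tab n T H k mod int W + s * (tab n ?A' H k - tab n A H k)) mod int W)"
      unfolding M'_def upd_def sgn by simp
    also have "\<dots> = nat ((tab n T H k + s * (tab n ?A' H k - tab n A H k)) mod int W)" by (simp add: mod_simps)
    also have "tab n T H k + s * (tab n ?A' H k - tab n A H k) = tab n T' H k" using s by auto
    finally show ?thesis .
  qed
  have "lrep M' j S = lrep M j S" for j S by (rule lrep_cong) (auto simp: same)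
  moreover have "shape n k" if "k \<in> supp M'" for k
  proof (cases "5 \<le> fst k")
    case False
    then have "M' k = M k" using same[of "fst k" "snd k"] by simp
    then show ?thesis using that r by (auto simp: supp_def rep_def)
  qed (simp add: shape_def)
  moreover have "M' k < W" for k by (simp add: M'_def upd_less)
  ultimately have "rep M' fam T' H C s1 s2 s3"
    using r tabs unfolding rep_def by (auto simp: same)
  moreover have "runs B (comp 0 nT) \<rho> M (nsize nT * (Kit * (D ^ (p - 1) + card H))) \<rho>' M'"
    unfolding M'_def by (rule runs_mono[OF run]) (use it in auto)
  ultimately show ?thesis using reg by blast
qed

text \<open>The tables belong to \<open>A\<close>, the graph without \<open>uv\<close>, in both
  directions; only the count passes between \<open>A\<close> and \<open>add_edge A u v\<close>. The
  residue is the exact count by \<open>emb_less\<close>.\<close>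

lemma run_count:
  fixes s :: int
  assumes r: "rep M fam A H C s1 s2 s3" and A: "addable n A u v"
    and fam: "\<And>j. j < n \<Longrightarrow> fam j = nb A j" "fam n = H"
    and \<rho>: "\<rho> 0 = n" "\<rho> 1 = u" "\<rho> 2 = v" "int (\<rho> 3) mod int W = s mod int W" "int (\<rho> 4) mod int W = - s mod int W"
    and s: "s = 1 \<and> C = A \<and> C' = add_edge A u v \<or> s = -1 \<and> C = add_edge A u v \<and> C' = A"
    and Z: "finite Z" "card Z \<le> B" "keys fam A H \<subseteq> Z"
    and D: "D \<ge> 1" "low_degree_le n A H D"
  shows "\<exists>\<rho>' M'. runs B (comp 0 nC) \<rho> M (nsize nC * (Kit * (D ^ (p - 1) + card H))) \<rho>' M' \<and>
     rep M' fam A H C' s1 s2 s3 \<and> (\<forall>r<10. \<rho>' r = \<rho> r)"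
proof -
  have b: "base n W M A H" by (rule rep_base[OF r]) (use A fam in \<open>auto simp: addable_def\<close>)
  let ?A' = "add_edge A u v"
  define sg where "sg r = (if r = 3 then s else - s)" for r :: nat
  have tabs: "M k = nat (tab n A H k mod int W)" if "5 \<le> fst k" for k using r that by (simp add: rep_def)
  have sgn: "den n W sg M \<rho> 0 nC (0, 0, 0, 0) mod int W = s * (int (emb n ?A') - int (emb n A)) mod int W"
  proof -
    have p: "den n W (\<lambda>r. if r = 3 then 1 else - 1) M \<rho> 0 nC (0, 0, 0, 0) mod int W = (int (emb n ?A') - int (emb n A)) mod int W"
      by (rule denC[OF b A]) (use \<rho> tabs in auto)
    show ?thesis
    proof (cases "s = 1")
      case True
      then have "sg = (\<lambda>r. if r = 3 then 1 else - 1)" by (auto simp: sg_def)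
      then show ?thesis using p True by simp
    next
      case False
      then have "sg = (\<lambda>r. - (if r = 3 then 1 else - 1))" using s by (auto simp: sg_def)
      then show ?thesis using den_uminus[of n W "\<lambda>r. if r = 3 then 1 else - 1"] p False s
        by (metis mod_minus_cong mult_minus1)
    qed
  qed
  have sZ: "supp M \<subseteq> Z" using rep_supp[OF r] Z by blast
  have "touched n W M \<rho> 0 nC \<subseteq> {(0, 0, 0, 0)}" using den_scalar[OF okC(2), of n W M \<rho> 0] by blast
  then have tZ: "touched n W M \<rho> 0 nC \<subseteq> Z" using Z(3) unfolding keys_def by blast
  have Ml: "M k < W" for k using r by (simp add: rep_def)
  have "\<exists>\<rho>'. runs B (comp 0 nC) \<rho> M (nsize nC * iters n W M \<rho> 0 nC) \<rho>' (upd W M (den n W sg M \<rho> 0 nC)) \<and>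
     (\<forall>r < 10 + 2 * 0. \<rho>' r = \<rho> r)"
    by (rule runs_nest[OF okC(1)]) (use \<rho> Ml Z sZ tZ in \<open>auto simp: sg_def\<close>)
  then obtain \<rho>' where run: "runs B (comp 0 nC) \<rho> M (nsize nC * iters n W M \<rho> 0 nC) \<rho>' (upd W M (den n W sg M \<rho> 0 nC))"
    and reg: "\<forall>r<10. \<rho>' r = \<rho> r" by auto
  define M' where "M' = upd W M (den n W sg M \<rho> 0 nC)"
  have it: "iters n W M \<rho> 0 nC \<le> Kit * (D ^ (p - 1) + card H)"
    using iters_le[OF b A _ _ _ D] \<rho> by blast
  have same: "M' k = M k" if "k \<noteq> (0, 0, 0, 0)" for k
    unfolding M'_def by (rule upd_id) (use Ml den_scalar[OF okC(2), of n W M \<rho> 0 k sg] that in auto)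
  have cnt: "M' (0, 0, 0, 0) = emb n C'"
  proof -
    have "int (M (0, 0, 0, 0)) = int (emb n C)" using r by (simp add: rep_def)
    then have "M' (0, 0, 0, 0) = nat ((int (emb n C) + s * (int (emb n ?A') - int (emb n A))) mod int W)"
      unfolding M'_def upd_def using sgn by (metis mod_add_right_eq)
    also have "int (emb n C) + s * (int (emb n ?A') - int (emb n A)) = int (emb n C')" using s by auto
    also have "nat (int (emb n C') mod int W) = emb n C'" using emb_less by (simp flip: of_nat_mod)
    finally show ?thesis .
  qed
  have "lrep M' j S = lrep M j S" for j S by (rule lrep_cong) (auto simp: same)
  moreover have "shape n k" if "k \<in> supp M'" for k
  proof (cases "k = (0, 0, 0, 0)")
    case False
    then show ?thesis using that r same[OF False] by (auto simp: supp_def rep_def)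
  qed (simp add: shape_def)
  moreover have "M' k < W" for k by (simp add: M'_def upd_less)
  moreover have "M' k = M k" if "5 \<le> fst k" for k using that same[of k] by (cases k) auto
  ultimately have "rep M' fam A H C' s1 s2 s3"
    using r cnt unfolding rep_def by (auto simp: same)
  moreover have "runs B (comp 0 nC) \<rho> M (nsize nC * (Kit * (D ^ (p - 1) + card H))) \<rho>' M'"
    unfolding M'_def by (rule runs_mono[OF run]) (use it in auto)
  ultimately show ?thesis using reg by blast
qed

lemma simple_V: "r < 10 \<Longrightarrow> simple_exp (V r)"
  by (simp add: simple_exp_def)

lemma fam_of_add: "u < n \<Longrightarrow> v < n \<Longrightarrow> u \<noteq> v \<Longrightarrow> fam_of (add_edge A u v) H U S =
    (fam_of A H U S)(u := insert v (fam_of A H U S u), v := insert u (fam_of A H U S v))"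
  by (rule ext) (auto simp: fam_of_def nb_add)

lemma fam_of_del: "u < n \<Longrightarrow> v < n \<Longrightarrow> u \<noteq> v \<Longrightarrow> fam_of (del_edge A u v) H U S =
    (fam_of A H U S)(u := fam_of A H U S u - {v}, v := fam_of A H U S v - {u})"
  by (rule ext) (auto simp: fam_of_def nb_del)

lemma fam_of_simps: "j < n \<Longrightarrow> fam_of A H U S j = nb A j" "fam_of A H U S n = H"
  by (simp_all add: fam_of_def)

lemma prim_cost_le:
  assumes "D \<ge> 1"
  shows "10000 + (nsize nC * (Kit * (D ^ (p - 1) + h)) + nsize nT * (Kit * (D ^ (p - 1) + h))) \<le> prim_cost * (D ^ (p - 1) + h)"
proof -
  have "1 \<le> D ^ (p - 1)" using assms by simp
  then have "1 \<le> D ^ (p - 1) + h" by simp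
  then have "20000 * 1 \<le> 20000 * (D ^ (p - 1) + h)" by (rule mult_le_mono2)
  then show ?thesis by (simp add: prim_cost_def algebra_simps)
qed

text \<open>Keys grow with the edge set, so the keys of the final graph contain those of every
  intermediate state and can serve as the space budget.\<close>

lemma run_ins:
  assumes R: "Rep M A H U S s1 s2 s3" and A: "addable n A u v"
    and \<rho>: "\<rho> 0 = n" "\<rho> 1 = u" "\<rho> 2 = v"
    and Z: "finite Z" "card Z \<le> B" "keys (fam_of (add_edge A u v) H U S) (add_edge A u v) H \<subseteq> Z"
    and D: "D \<ge> 1" "low_degree_le n A H D"
  shows "\<exists>\<rho>' M'. runs B ins_prog \<rho> M (prim_cost * (D ^ (p - 1) + card H)) \<rho>' M' \<and>
     Rep M' (add_edge A u v) H U S s1 s2 s3 \<and> (\<forall>r<10. r \<notin> {3, 4} \<longrightarrow> \<rho>' r = \<rho> r)"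
proof -
  let ?A' = "add_edge A u v" and ?f = "fam_of A H U S"
  have uv: "u < n" "v < n" "u \<noteq> v" "\<not> A u v" "\<not> A v u" and g: "graph n A"
    using A by (auto simp: addable_def graph_def)
  have r: "rep M ?f A H A s1 s2 s3" using R by (simp add: Rep_def)
  have b: "base n W M A H" by (rule rep_base[OF r]) (use g fam_of_simps in auto)
  have tm: "tab n A H k \<le> tab n ?A' H k" for k by (rule tab_mono_add)
  have fb: "?f j \<subseteq> {..<n}" if "j < N" for j using r that by (simp add: rep_def)
  let ?f1 = "?f(u := insert v (?f u))" and ?f2 = "?f(u := insert v (?f u), v := insert u (?f v))"
  have f2: "fam_of ?A' H U S = ?f2" by (rule fam_of_add) (use uv in auto)
  have f2b: "?f2 j \<subseteq> {..<n}" if "j < N" for j using fb that uv by auto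
  have k0: "keys ?f A H \<subseteq> Z" "keys ?f ?A' H \<subseteq> Z" "keys ?f1 ?A' H \<subseteq> Z" "keys ?f2 ?A' H \<subseteq> Z"
  proof -
    have "keys ?f A H \<subseteq> keys ?f2 ?A' H" by (rule keys_mono) (use f2b tm in auto)
    then show "keys ?f A H \<subseteq> Z" using Z f2 by auto
    have "keys ?f ?A' H \<subseteq> keys ?f2 ?A' H" by (rule keys_mono) (use f2b in auto)
    then show "keys ?f ?A' H \<subseteq> Z" using Z f2 by auto
    have "keys ?f1 ?A' H \<subseteq> keys ?f2 ?A' H" by (rule keys_mono) (use f2b in auto)
    then show "keys ?f1 ?A' H \<subseteq> Z" using Z f2 by auto
    show "keys ?f2 ?A' H \<subseteq> Z" using Z f2 by auto
  qed
  have sM: "supp M \<subseteq> Z" using rep_supp[OF r] k0 by blast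
  define \<rho>1 where "\<rho>1 = \<rho>(3 := 1)"
  define \<rho>2 where "\<rho>2 = \<rho>1(4 := W - 1)"
  have 1: "runs B (asg 3 (K 1)) \<rho> M 10 \<rho>1 M"
    unfolding \<rho>1_def by (rule runs_asg'[where \<rho> = \<rho>, OF \<rho>(1) Z(1,2) sM]) simp_all
  have z1: "\<rho>1 0 = n" using \<rho> by (simp add: \<rho>1_def)
  have 2: "runs B (asg 4 minus_one) \<rho>1 M 300 \<rho>2 M"
    unfolding \<rho>2_def by (rule runs_asg'[where \<rho> = \<rho>1, OF z1 Z(1,2) sM])
      (use ev_minus_one[of \<rho>1, OF z1] ecost_minus_one in simp_all)
  have z2: "\<rho>2 0 = n" "\<rho>2 1 = u" "\<rho>2 2 = v" "int (\<rho>2 3) mod int W = 1 mod int W" "int (\<rho>2 4) mod int W = - 1 mod int W"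
  proof -
    have "int (W - 1) = - 1 + int W" using W_pos by linarith
    then have "int (W - 1) mod int W = - 1 mod int W" by (metis mod_add_self2)
    then show "int (\<rho>2 4) mod int W = - 1 mod int W" by (simp add: \<rho>2_def)
  qed (use \<rho> in \<open>simp_all add: \<rho>1_def \<rho>2_def\<close>)
  obtain \<rho>3 M3 where 3: "runs B (comp 0 nC) \<rho>2 M (nsize nC * (Kit * (D ^ (p - 1) + card H))) \<rho>3 M3"
     and r3: "rep M3 ?f A H ?A' s1 s2 s3" and e3: "\<forall>r<10. \<rho>3 r = \<rho>2 r"
    using run_count[OF r A fam_of_simps z2 _ Z(1,2) k0(1) D, of ?A'] by auto
  have z3: "\<rho>3 0 = n" "\<rho>3 1 = u" "\<rho>3 2 = v" "int (\<rho>3 3) mod int W = 1 mod int W" "int (\<rho>3 4) mod int W = - 1 mod int W"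
    using z2 e3 by simp_all
  obtain \<rho>4 M4 where 4: "runs B (comp 0 nT) \<rho>3 M3 (nsize nT * (Kit * (D ^ (p - 1) + card H))) \<rho>4 M4"
     and r4: "rep M4 ?f ?A' H ?A' s1 s2 s3" and e4: "\<forall>r<10. \<rho>4 r = \<rho>3 r"
    using run_tables[OF r3 A fam_of_simps z3 _ Z(1,2) k0(2) D, of ?A'] by auto
  have z4: "\<rho>4 0 = n" "\<rho>4 1 = u" "\<rho>4 2 = v" using z3 e4 by simp_all
  have ev12: "ev \<rho>4 M' (V 1) = u" "ev \<rho>4 M' (V 2) = v" for M' using z4 uv W_ge(3) by simp_all
  have nuv: "v \<notin> ?f u" "u \<notin> ?f v" using uv by (auto simp: fam_of_def nb_def)
  obtain M5 where 5: "runs B (ladd (V 1) (V 2)) \<rho>4 M4 1000 \<rho>4 M5" and r5: "rep M5 ?f1 ?A' H ?A' s1 s2 s3"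
    using run_ladd[OF z4(1) simple_V simple_V ev12 r4 _ uv(2) nuv(1) Z(1,2) k0(3)] uv by auto
  have k2: "keys (?f1(v := insert u (?f1 v))) ?A' H \<subseteq> Z" using k0(4) uv by simp
  have nv: "u \<notin> ?f1 v" using nuv uv by simp
  obtain M6 where 6: "runs B (ladd (V 2) (V 1)) \<rho>4 M5 1000 \<rho>4 M6" and r6: "rep M6 (?f1(v := insert u (?f1 v))) ?A' H ?A' s1 s2 s3"
    using run_ladd[OF z4(1) simple_V simple_V ev12(2,1) r5 _ uv(1) nv Z(1,2) k2] uv by auto
  have "runs B ins_prog \<rho> M (prim_cost * (D ^ (p - 1) + card H)) \<rho>4 M6"
    unfolding ins_prog_def
    by (rule runs_mono[OF runs_seq[OF 1 runs_seq[OF 2 runs_seq[OF 3 runs_seq[OF 4 runs_seq[OF 5 6]]]]]])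
      (use prim_cost_le[OF D(1), of "card H"] in auto)
  moreover have "Rep M6 ?A' H U S s1 s2 s3" unfolding Rep_def f2 using r6 uv graph_add[OF A] by simp
  moreover have "\<forall>r<10. r \<notin> {3, 4} \<longrightarrow> \<rho>4 r = \<rho> r" using e3 e4 by (auto simp: \<rho>1_def \<rho>2_def)
  ultimately show ?thesis by blast
qed

text \<open>Here the graph with the edge is the initial one, and its keys dominate all later
  states.\<close>

lemma run_del:
  assumes R: "Rep M A H U S s1 s2 s3" and A: "A u v"
    and \<rho>: "\<rho> 0 = n" "\<rho> 1 = u" "\<rho> 2 = v"
    and Z: "finite Z" "card Z \<le> B" "keys (fam_of A H U S) A H \<subseteq> Z"
    and D: "D \<ge> 1" "low_degree_le n A H D"
  shows "\<exists>\<rho>' M'. runs B del_prog \<rho> M (prim_cost * (D ^ (p - 1) + card H)) \<rho>' M' \<and>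
     Rep M' (del_edge A u v) H U S s1 s2 s3 \<and> (\<forall>r<10. r \<notin> {3, 4} \<longrightarrow> \<rho>' r = \<rho> r)"
proof -
  let ?A0 = "del_edge A u v" and ?f = "fam_of A H U S"
  have g: "graph n A" using R by (simp add: Rep_def)
  have uv: "u < n" "v < n" "u \<noteq> v" "A v u" using A g by (auto simp: graph_def)
  have ad: "addable n ?A0 u v" by (rule addable_del[OF g A])
  have AA: "add_edge ?A0 u v = A" by (rule add_del_edge[OF g A])
  have r: "rep M ?f A H A s1 s2 s3" using R by (simp add: Rep_def)
  have fb: "?f j \<subseteq> {..<n}" if "j < N" for j using r that by (simp add: rep_def)
  let ?f1 = "?f(u := ?f u - {v})" and ?f2 = "?f(u := ?f u - {v}, v := ?f v - {u})"
  have f2: "fam_of ?A0 H U S = ?f2" by (rule fam_of_del) (use uv in auto)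
  have k0: "keys ?f A H \<subseteq> Z" "keys ?f1 A H \<subseteq> Z" "keys ?f2 A H \<subseteq> Z"
  proof -
    show *: "keys ?f A H \<subseteq> Z" using Z by auto
    have "keys ?f1 A H \<subseteq> keys ?f A H" by (rule keys_mono) (use fb in auto)
    then show "keys ?f1 A H \<subseteq> Z" using * by auto
    have "keys ?f2 A H \<subseteq> keys ?f A H" by (rule keys_mono) (use fb in auto)
    then show "keys ?f2 A H \<subseteq> Z" using * by auto
  qed
  have sM: "supp M \<subseteq> Z" using rep_supp[OF r] k0 by blast
  define \<rho>1 where "\<rho>1 = \<rho>(3 := W - 1)"
  define \<rho>2 where "\<rho>2 = \<rho>1(4 := 1)"
  have 1: "runs B (asg 3 minus_one) \<rho> M 300 \<rho>1 M"
    unfolding \<rho>1_def by (rule runs_asg'[where \<rho> = \<rho>, OF \<rho>(1) Z(1,2) sM])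
      (use ev_minus_one[of \<rho>, OF \<rho>(1)] ecost_minus_one in simp_all)
  have z1: "\<rho>1 0 = n" using \<rho> by (simp add: \<rho>1_def)
  have 2: "runs B (asg 4 (K 1)) \<rho>1 M 10 \<rho>2 M"
    unfolding \<rho>2_def by (rule runs_asg'[where \<rho> = \<rho>1, OF z1 Z(1,2) sM]) simp_all
  have z2: "\<rho>2 0 = n" "\<rho>2 1 = u" "\<rho>2 2 = v" "int (\<rho>2 3) mod int W = - 1 mod int W" "int (\<rho>2 4) mod int W = - (- 1) mod int W"
  proof -
    have "int (W - 1) = - 1 + int W" using W_pos by linarith
    then have "int (W - 1) mod int W = - 1 mod int W" by (metis mod_add_self2)
    then show "int (\<rho>2 3) mod int W = - 1 mod int W" by (simp add: \<rho>2_def \<rho>1_def)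
  qed (use \<rho> in \<open>simp_all add: \<rho>1_def \<rho>2_def\<close>)
  have ev12: "ev \<rho>' M' (V 1) = u" "ev \<rho>' M' (V 2) = v" if "\<rho>' 1 = u" "\<rho>' 2 = v" for M' \<rho>'
    using that uv W_ge(3) by simp_all
  have vu: "v \<in> ?f u" "u \<in> ?f1 v" using uv A by (auto simp: fam_of_def nb_def)
  obtain \<rho>3 M3 where 3: "runs B (ldel (V 1) (V 2)) \<rho>2 M 3000 \<rho>3 M3" and r3: "rep M3 ?f1 A H A s1 s2 s3" and e3: "\<forall>r<40. \<rho>3 r = \<rho>2 r"
    using run_ldel[OF z2(1) simple_V simple_V ev12[OF z2(2,3)] r _ vu(1) Z(1,2) k0(1)] uv by auto
  have z3: "\<rho>3 0 = n" "\<rho>3 1 = u" "\<rho>3 2 = v" using z2 e3 by simp_all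
  obtain \<rho>4 M4 where 4: "runs B (ldel (V 2) (V 1)) \<rho>3 M3 3000 \<rho>4 M4" and r4: "rep M4 (?f1(v := ?f1 v - {u})) A H A s1 s2 s3" and e4: "\<forall>r<40. \<rho>4 r = \<rho>3 r"
    using run_ldel[OF z3(1) simple_V simple_V ev12(2,1)[OF z3(2,3)] r3 _ vu(2) Z(1,2) k0(2)] uv by auto
  have r4': "rep M4 (fam_of ?A0 H U S) A H A s1 s2 s3" unfolding f2 using r4 uv by simp
  have z4: "\<rho>4 0 = n" "\<rho>4 1 = u" "\<rho>4 2 = v" "int (\<rho>4 3) mod int W = - 1 mod int W" "int (\<rho>4 4) mod int W = - (- 1) mod int W"
    using z2 e3 e4 by simp_all
  have k3: "keys (fam_of ?A0 H U S) (add_edge ?A0 u v) H \<subseteq> Z" unfolding AA f2 using k0(3) .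
  have D0: "low_degree_le n ?A0 H D"
    by (rule low_degree_mono[OF D(2) g]) (auto simp: del_edge_def)
  obtain \<rho>5 M5 where 5: "runs B (comp 0 nT) \<rho>4 M4 (nsize nT * (Kit * (D ^ (p - 1) + card H))) \<rho>5 M5"
     and r5: "rep M5 (fam_of ?A0 H U S) ?A0 H A s1 s2 s3" and e5: "\<forall>r<10. \<rho>5 r = \<rho>4 r"
    using run_tables[OF r4' ad fam_of_simps z4 _ Z(1,2) k3 D(1) D0, of ?A0] AA by auto
  have z5: "\<rho>5 0 = n" "\<rho>5 1 = u" "\<rho>5 2 = v" "int (\<rho>5 3) mod int W = - 1 mod int W" "int (\<rho>5 4) mod int W = - (- 1) mod int W"
    using z4 e5 by simp_all
  have b5: "base n W M5 ?A0 H" by (rule rep_base[OF r5]) (use graph_del[OF g] fam_of_simps in auto)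
  have k4: "keys (fam_of ?A0 H U S) ?A0 H \<subseteq> Z"
  proof -
    have "keys (fam_of ?A0 H U S) ?A0 H \<subseteq> keys (fam_of ?A0 H U S) (add_edge ?A0 u v) H"
      by (rule keys_mono) (use tab_mono_add r5 in \<open>auto simp: rep_def\<close>)
    then show ?thesis using k3 by blast
  qed
  obtain \<rho>6 M6 where 6: "runs B (comp 0 nC) \<rho>5 M5 (nsize nC * (Kit * (D ^ (p - 1) + card H))) \<rho>6 M6"
     and r6: "rep M6 (fam_of ?A0 H U S) ?A0 H ?A0 s1 s2 s3" and e6: "\<forall>r<10. \<rho>6 r = \<rho>5 r"
    using run_count[OF r5 ad fam_of_simps z5 _ Z(1,2) k4 D(1) D0, of ?A0] AA by auto
  have "runs B del_prog \<rho> M (prim_cost * (D ^ (p - 1) + card H)) \<rho>6 M6"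
    unfolding del_prog_def
    by (rule runs_mono[OF runs_seq[OF 1 runs_seq[OF 2 runs_seq[OF 3 runs_seq[OF 4 runs_seq[OF 5 6]]]]]])
      (use prim_cost_le[OF D(1), of "card H"] in auto)
  moreover have "Rep M6 ?A0 H U S s1 s2 s3" unfolding Rep_def using r6 graph_del[OF g] by simp
  moreover have "\<forall>r<10. r \<notin> {3, 4} \<longrightarrow> \<rho>6 r = \<rho> r" using e3 e4 e5 e6 by (auto simp: \<rho>1_def \<rho>2_def)
  ultimately show ?thesis by blast
qed

end

section \<open>Moving a vertex between the light and the heavy side\<close>

text \<open>A state in the middle of a move: the edges from \<open>w\<close> to \<open>S\<close> are
  removed, and \<open>S\<close> is the scratch set of neighbours that remain to be restored.\<close>

definition cut :: "(nat \<Rightarrow> nat \<Rightarrow> bool) \<Rightarrow> nat \<Rightarrow> nat set \<Rightarrow> (nat \<Rightarrow> nat \<Rightarrow> bool)" where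
  "cut A w S = (\<lambda>x y. A x y \<and> \<not> (x = w \<and> y \<in> S) \<and> \<not> (y = w \<and> x \<in> S))"

lemma cut_empty [simp]: "cut A w {} = A"
  by (simp add: cut_def)

lemma del_cut: "del_edge (cut A w S) w y = cut A w (insert y S)"
  by (auto simp: cut_def del_edge_def fun_eq_iff)

lemma add_cut: "graph n A \<Longrightarrow> A w y \<Longrightarrow> y \<in> S \<Longrightarrow> add_edge (cut A w S) w y = cut A w (S - {y})"
  by (auto simp: cut_def add_edge_def fun_eq_iff graph_def)

lemma nb_cut: "graph n A \<Longrightarrow> nb (cut A w S) w = nb A w - S"
  by (auto simp: cut_def nb_def graph_def)

lemma graph_cut: "graph n A \<Longrightarrow> graph n (cut A w S)"
  by (auto simp: cut_def graph_def)

definition HH :: nexp where "HH = V 0"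
definition VV :: nexp where "VV = Op Plus (V 0) (K 1)"
definition SS :: nexp where "SS = Op Plus (V 0) (K 2)"

lemma simple_HVS: "simple_exp HH" "simple_exp VV" "simple_exp SS"
  by (simp_all add: simple_exp_def HH_def VV_def SS_def)

context pattern
begin

definition out_cond :: nexp where "out_cond = R 1 (V 5) (K 0) (K 0)"
definition out_body :: com where
  "out_body = Seq (asg 1 (V 5)) (Seq (asg 2 (R 2 (V 5) (Op Minus (R 1 (V 5) (K 0) (K 0)) (K 1)) (K 0)))
     (Seq del_prog (ladd SS (V 2))))"
definition in_cond :: nexp where "in_cond = R 1 SS (K 0) (K 0)"
definition in_body :: com where
  "in_body = Seq (asg 1 (V 5)) (Seq (asg 2 (R 2 SS (Op Minus (R 1 SS (K 0) (K 0)) (K 1)) (K 0)))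
     (Seq (ldel SS (V 2)) ins_prog))"
definition flip_prog :: com where
  "flip_prog = Seq (loop out_cond out_body)
     (Seq (cond (R 3 HH (V 5) (K 0)) (ldel HH (V 5)) (ladd HH (V 5))) (loop in_cond in_body))"

end

context ds
begin

lemma ev_HVS: "\<rho> 0 = n \<Longrightarrow> ev \<rho> M HH = n" "\<rho> 0 = n \<Longrightarrow> ev \<rho> M VV = n + 1" "\<rho> 0 = n \<Longrightarrow> ev \<rho> M SS = n + 2"
  using W_ge(3,4) by (simp_all add: HH_def VV_def SS_def)

lemma Rep_lrep:
  assumes "Rep M A H U S s1 s2 s3"
  shows "j < n \<Longrightarrow> lrep M j (nb A j)" "lrep M n H" "lrep M (n + 1) U" "lrep M (n + 2) S"
    "H \<subseteq> {..<n}" "U \<subseteq> {..<n}" "S \<subseteq> {..<n}" "M k < W" "graph n A"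
proof -
  have *: "j < N \<Longrightarrow> lrep M j (fam_of A H U S j) \<and> fam_of A H U S j \<subseteq> {..<n}" for j
    using assms by (simp add: Rep_def rep_def)
  show "j < n \<Longrightarrow> lrep M j (nb A j)" "lrep M n H" "lrep M (n + 1) U" "lrep M (n + 2) S"
    "H \<subseteq> {..<n}" "U \<subseteq> {..<n}" "S \<subseteq> {..<n}"
    using *[of j] *[of n] *[of "n + 1"] *[of "n + 2"] by (simp_all add: fam_of_def)
  show "M k < W" "graph n A" using assms by (simp_all add: Rep_def rep_def)
qed

lemma keys_fam_mono:
  assumes "graph n A'" "H' \<subseteq> {..<n}" "U' \<subseteq> {..<n}" "S' \<subseteq> {..<n}"
    and "\<And>x y. A x y \<Longrightarrow> A' x y" "H \<subseteq> H'" "U \<subseteq> U'" "S \<subseteq> S'" "\<And>k. tab n A T k \<le> tab n A' T' k"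
  shows "keys (fam_of A H U S) A T \<subseteq> keys (fam_of A' H' U' S') A' T'"
proof (rule keys_mono)
  fix j
  show "fam_of A H U S j \<subseteq> fam_of A' H' U' S' j" using assms by (auto simp: fam_of_def nb_def)
  show "fam_of A' H' U' S' j \<subseteq> {..<n}" using assms nb_subset[of n A' j] by (auto simp: fam_of_def)
qed (rule assms(9))

lemma rep_cong_fam:
  assumes "rep M fam A H C s1 s2 s3" "\<And>j. j < N \<Longrightarrow> fam j = fam' j"
  shows "rep M fam' A H C s1 s2 s3"
  using assms unfolding rep_def by auto

lemma keys_cong_fam: "(\<And>j. j < N \<Longrightarrow> fam j = fam' j) \<Longrightarrow> keys fam A H = keys fam' A H"
  unfolding keys_def by simp

lemma last_elem:
  assumes "lrep M j S" "S \<noteq> {}"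
  shows "M (2, j, card S - 1, 0) \<in> S"
proof -
  have "card S > 0" using assms lrep_finite card_gt_0_iff by blast
  then show ?thesis using assms by (auto simp: lrep_def)
qed

lemma run_ladd_fam:
  assumes "\<rho> 0 = n" "simple_exp j" "simple_exp x" "ev \<rho> M j = J" "ev \<rho> M x = X"
    and r: "Rep M A H U S s1 s2 s3" and J: "J < N" and X: "X < n" "X \<notin> fam_of A H U S J"
    and Z: "finite Z" "card Z \<le> B" "keys (fam_of A H' U' S') A H \<subseteq> Z"
    and f: "\<And>j. j < N \<Longrightarrow> fam_of A H' U' S' j = ((fam_of A H U S)(J := insert X (fam_of A H U S J))) j"
    and t: "\<And>k. tab n A H' k = tab n A H k"
  shows "\<exists>M' s3'. runs B (ladd j x) \<rho> M 1000 \<rho> M' \<and> Rep M' A H' U' S' s1 s2 s3' \<and> fst s3' = fst s3 \<and> (J \<noteq> n + 1 \<longrightarrow> s3' = s3)"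
proof -
  have k: "keys ((fam_of A H U S)(J := insert X (fam_of A H U S J))) A H \<subseteq> Z"
    using keys_cong_fam[of "fam_of A H' U' S'" "(fam_of A H U S)(J := insert X (fam_of A H U S J))" A H] f Z(3) by auto
  obtain M' s3' where M': "runs B (ladd j x) \<rho> M 1000 \<rho> M'"
    "rep M' ((fam_of A H U S)(J := insert X (fam_of A H U S J))) A H A s1 s2 s3'" "fst s3' = fst s3" "J \<noteq> n + 1 \<longrightarrow> s3' = s3"
    using run_ladd[OF assms(1-5) _ J X Z(1,2) k] r unfolding Rep_def by blast
  have "rep M' (fam_of A H' U' S') A H A s1 s2 s3'" by (rule rep_cong_fam[OF M'(2)]) (simp add: f)
  then have "Rep M' A H' U' S' s1 s2 s3'" using r unfolding Rep_def rep_def t by simp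
  then show ?thesis using M' by blast
qed

lemma run_ldel_fam:
  assumes "\<rho> 0 = n" "simple_exp j" "simple_exp x" "ev \<rho> M j = J" "ev \<rho> M x = X"
    and r: "Rep M A H U S s1 s2 s3" and J: "J < N" and X: "X \<in> fam_of A H U S J"
    and Z: "finite Z" "card Z \<le> B" "keys (fam_of A H U S) A H \<subseteq> Z"
    and f: "\<And>j. j < N \<Longrightarrow> fam_of A H' U' S' j = ((fam_of A H U S)(J := fam_of A H U S J - {X})) j"
    and t: "\<And>k. tab n A H' k = tab n A H k"
  shows "\<exists>\<rho>' M' s3'. runs B (ldel j x) \<rho> M 3000 \<rho>' M' \<and> Rep M' A H' U' S' s1 s2 s3' \<and> (\<forall>r<40. \<rho>' r = \<rho> r) \<and>
    fst s3' = fst s3 \<and> (J \<noteq> n + 1 \<longrightarrow> s3' = s3)"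
proof -
  obtain \<rho>' M' s3' where M': "runs B (ldel j x) \<rho> M 3000 \<rho>' M'" "\<forall>r<40. \<rho>' r = \<rho> r"
    "rep M' ((fam_of A H U S)(J := fam_of A H U S J - {X})) A H A s1 s2 s3'" "fst s3' = fst s3" "J \<noteq> n + 1 \<longrightarrow> s3' = s3"
    using run_ldel[OF assms(1-5) _ J X Z] r unfolding Rep_def by blast
  have "rep M' (fam_of A H' U' S') A H A s1 s2 s3'" by (rule rep_cong_fam[OF M'(3)]) (simp add: f)
  then have "Rep M' A H' U' S' s1 s2 s3'" using r unfolding Rep_def rep_def t by simp
  then show ?thesis using M' by blast
qed

text \<open>The invariant ties the two together: the stored graph is \<open>cut A w S\<close> while
  the scratch set is \<open>S\<close>. Each round transfers the last listed neighbour, so the number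
  of rounds is the number of edges left at \<open>w\<close>.\<close>

lemma flip_out:
  assumes g: "graph n A" and w: "w < n"
    and Z: "finite Z" "card Z \<le> B" "keys (fam_of A H U (nb A w)) A H \<subseteq> Z"
    and D: "D \<ge> 1" "low_degree_le n A H D"
  shows "Rep M (cut A w S) H U S s1 s2 s3 \<Longrightarrow> S \<subseteq> nb A w \<Longrightarrow> \<rho> 0 = n \<Longrightarrow> \<rho> 5 = w \<Longrightarrow>
    \<exists>\<rho>' M'. runs B (loop out_cond out_body) \<rho> M (card (nb A w - S) * (prim_cost * (D ^ (p - 1) + card H) + 2000) + 100) \<rho>' M' \<and>
     Rep M' (cut A w (nb A w)) H U (nb A w) s1 s2 s3 \<and> (\<forall>r<10. r \<notin> {1, 2, 3, 4} \<longrightarrow> \<rho>' r = \<rho> r)"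
proof (induction "card (nb A w - S)" arbitrary: M S \<rho>)
  case 0
  have fin: "finite (nb A w)" using g by simp
  have S: "S = nb A w" using 0(1,3) fin by auto
  note R = Rep_lrep[OF 0(2)]
  have b: "H \<subseteq> {..<n}" "U \<subseteq> {..<n}" "nb A w \<subseteq> {..<n}" using R nb_subset[OF g] by auto
  have "keys (fam_of (cut A w S) H U S) (cut A w S) H \<subseteq> keys (fam_of A H U (nb A w)) A H"
    by (rule keys_fam_mono) (use g b S in \<open>auto simp: cut_def intro!: tab_mono\<close>)
  then have sM: "supp M \<subseteq> Z" using Z 0(2) rep_supp unfolding Rep_def by blast
  have "lrep M w (nb A w - S)" using R(1)[OF w] nb_cut[OF g] by simp
  then have "M (1, w, 0, 0) = 0" using S lrep_card by fastforce
  then have c: "ev \<rho> M out_cond = 0" using 0 w W_ge(3) by (simp add: out_cond_def)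
  have "runs B (loop out_cond out_body) \<rho> M 100 \<rho> M"
    by (rule runs_mono[OF runs_loop_end[OF 0(4) c sp_le[OF sM Z(1,2)]]]) (simp_all add: out_cond_def)
  then show ?case using 0 S by (intro exI[of _ \<rho>] exI[of _ M]) auto
next
  case (Suc m)
  have fin: "finite (nb A w)" using g by simp
  note R = Rep_lrep[OF Suc(3)]
  have b: "H \<subseteq> {..<n}" "U \<subseteq> {..<n}" "nb A w \<subseteq> {..<n}" using R nb_subset[OF g] by auto
  have kS: "keys (fam_of (cut A w S1) H U S2) (cut A w S1) H \<subseteq> Z" if "S1 \<subseteq> nb A w" "S2 \<subseteq> nb A w" for S1 S2
  proof -
    have "keys (fam_of (cut A w S1) H U S2) (cut A w S1) H \<subseteq> keys (fam_of A H U (nb A w)) A H"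
      by (rule keys_fam_mono) (use g b that in \<open>auto simp: cut_def intro!: tab_mono\<close>)
    then show ?thesis using Z by blast
  qed
  have sM: "supp M \<subseteq> Z" using kS[OF Suc(4,4)] Suc(3) rep_supp unfolding Rep_def by blast
  let ?c = "card (nb A w - S)"
  have l: "lrep M w (nb A w - S)" using R(1)[OF w] nb_cut[OF g] by simp
  have c1: "M (1, w, 0, 0) = ?c" "M (Suc 0, w, 0, 0) = ?c" using lrep_card[OF l] by auto
  have ne: "nb A w - S \<noteq> {}" using Suc(2) by (metis card.empty nat.distinct(1))
  have cn: "?c \<le> n" "?c > 0"
  proof -
    have "?c \<le> card {..<n}" by (rule card_mono) (use b in auto)
    then show "?c \<le> n" by simp
  qed (use Suc(2) in simp)
  define y where "y = M (2, w, ?c - 1, 0)"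
  have y: "y \<in> nb A w - S" unfolding y_def by (rule last_elem[OF l ne])
  then have yn: "y < n" using b by auto
  have small: "w mod W = w" "w mod N = w" "?c mod W = ?c" "(?c - 1) mod W = ?c - 1" "(?c - 1) mod N = ?c - 1" "y mod W = y"
      "(?c - Suc 0) mod W = ?c - Suc 0" "(?c - Suc 0) mod N = ?c - Suc 0"
    using w cn yn W_ge(3) by auto
  have cond: "ev \<rho> M out_cond \<noteq> 0" using Suc c1 small cn by (simp add: out_cond_def)
  define \<rho>1 where "\<rho>1 = \<rho>(1 := w)"
  define \<rho>2 where "\<rho>2 = \<rho>1(2 := y)"
  have 1: "runs B (asg 1 (V 5)) \<rho> M 10 \<rho>1 M"
    unfolding \<rho>1_def by (rule runs_asg'[where \<rho> = \<rho>, OF Suc(5) Z(1,2) sM]) (use Suc small in simp_all)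
  have z1: "\<rho>1 0 = n" "\<rho>1 5 = w" using Suc by (simp_all add: \<rho>1_def)
  have 2: "runs B (asg 2 (R 2 (V 5) (Op Minus (R 1 (V 5) (K 0) (K 0)) (K 1)) (K 0))) \<rho>1 M 200 \<rho>2 M"
    unfolding \<rho>2_def by (rule runs_asg'[where \<rho> = \<rho>1, OF z1(1) Z(1,2) sM])
      (use z1 small c1 in \<open>simp_all add: y_def[simplified, symmetric]\<close>)
  have z2: "\<rho>2 0 = n" "\<rho>2 1 = w" "\<rho>2 2 = y" "\<rho>2 5 = w" using Suc by (simp_all add: \<rho>1_def \<rho>2_def)
  have a: "cut A w S w y" using y g by (auto simp: cut_def nb_def graph_def)
  have D': "low_degree_le n (cut A w S) H D" by (rule low_degree_mono[OF D(2) g]) (auto simp: cut_def)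
  obtain \<rho>3 M3 where 3: "runs B del_prog \<rho>2 M (prim_cost * (D ^ (p - 1) + card H)) \<rho>3 M3"
    and r3: "Rep M3 (cut A w (insert y S)) H U S s1 s2 s3" and e3: "\<forall>r<10. r \<notin> {3, 4} \<longrightarrow> \<rho>3 r = \<rho>2 r"
    using run_del[OF Suc(3) a z2(1-3) Z(1,2) kS[OF Suc(4,4)] D(1) D'] unfolding del_cut by blast
  have z3: "\<rho>3 0 = n" "\<rho>3 2 = y" "\<rho>3 5 = w" using z2 e3 by simp_all
  have v2: "ev \<rho>3 M3 (V 2) = y" using z3 small by simp
  have nin: "y \<notin> fam_of (cut A w (insert y S)) H U S (n + 2)" using y by (simp add: fam_of_def)
  have insS: "insert y S \<subseteq> nb A w" using y Suc(4) by auto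
  have ff: "fam_of (cut A w (insert y S)) H U (insert y S) j =
     ((fam_of (cut A w (insert y S)) H U S)(n + 2 := insert y (fam_of (cut A w (insert y S)) H U S (n + 2)))) j" if "j < N" for j
    using that by (auto simp: fam_of_def)
  obtain M4 where 4: "runs B (ladd SS (V 2)) \<rho>3 M3 1000 \<rho>3 M4"
    and r4: "Rep M4 (cut A w (insert y S)) H U (insert y S) s1 s2 s3"
    using run_ladd_fam[OF z3(1) simple_HVS(3) simple_V ev_HVS(3)[of \<rho>3, OF z3(1)] v2 r3 _ yn nin Z(1,2) kS[OF insS insS] ff] by auto
  have "m = card (nb A w - insert y S)"
  proof -
    have "nb A w - insert y S = (nb A w - S) - {y}" by auto
    then show ?thesis using Suc(2) y fin by (simp add: card_Diff_singleton)
  qed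
  then obtain \<rho>5 M5 where 5: "runs B (loop out_cond out_body) \<rho>3 M4 (card (nb A w - insert y S) * (prim_cost * (D ^ (p - 1) + card H) + 2000) + 100) \<rho>5 M5"
    and r5: "Rep M5 (cut A w (nb A w)) H U (nb A w) s1 s2 s3" and e5: "\<forall>r<10. r \<notin> {1, 2, 3, 4} \<longrightarrow> \<rho>5 r = \<rho>3 r"
    using Suc(1)[OF _ r4 insS z3(1,3)] by blast
  have body: "runs B out_body \<rho> M (10 + (200 + (prim_cost * (D ^ (p - 1) + card H) + 1000))) \<rho>3 M4"
    unfolding out_body_def by (rule runs_seq[OF 1 runs_seq[OF 2 runs_seq[OF 3 4]]])
  have cc: "?c = Suc (card (nb A w - insert y S))" using Suc(2) \<open>m = card (nb A w - insert y S)\<close> by simp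
  have "runs B (loop out_cond out_body) \<rho> M (?c * (prim_cost * (D ^ (p - 1) + card H) + 2000) + 100) \<rho>5 M5"
    by (rule runs_mono[OF runs_loop_step[OF Suc(5) cond body 5]]) (auto simp: out_cond_def cc)
  moreover have "\<forall>r<10. r \<notin> {1, 2, 3, 4} \<longrightarrow> \<rho>5 r = \<rho> r" using e5 e3 by (auto simp: \<rho>1_def \<rho>2_def)
  ultimately show ?case using r5 by blast
qed

lemma flip_in:
  assumes g: "graph n A" and w: "w < n"
    and Z: "finite Z" "card Z \<le> B" "keys (fam_of A H U (nb A w)) A H \<subseteq> Z"
    and D: "D \<ge> 1" "low_degree_le n A H D"
  shows "Rep M (cut A w S) H U S s1 s2 s3 \<Longrightarrow> S \<subseteq> nb A w \<Longrightarrow> \<rho> 0 = n \<Longrightarrow> \<rho> 5 = w \<Longrightarrow>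
    \<exists>\<rho>' M'. runs B (loop in_cond in_body) \<rho> M (card S * (prim_cost * (D ^ (p - 1) + card H) + 5000) + 100) \<rho>' M' \<and>
     Rep M' A H U {} s1 s2 s3 \<and> (\<forall>r<10. r \<notin> {1, 2, 3, 4} \<longrightarrow> \<rho>' r = \<rho> r)"
proof (induction "card S" arbitrary: M S \<rho>)
  case 0
  have fin: "finite S" by (rule finite_subset[OF 0(3)]) (use g in simp)
  have S: "S = {}" using 0(1) fin by auto
  note R = Rep_lrep[OF 0(2)]
  have b: "H \<subseteq> {..<n}" "U \<subseteq> {..<n}" "nb A w \<subseteq> {..<n}" using R nb_subset[OF g] by auto
  have "keys (fam_of A H U {}) A H \<subseteq> keys (fam_of A H U (nb A w)) A H"
    by (rule keys_fam_mono) (use g b S in auto)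
  then have sM: "supp M \<subseteq> Z" using Z 0(2) rep_supp unfolding Rep_def S cut_empty by blast
  have "M (1, n + 2, 0, 0) = 0" using S lrep_card[OF R(4)] by simp
  then have c: "ev \<rho> M in_cond = 0" using 0 ev_HVS(3)[of \<rho>] by (simp add: in_cond_def)
  have "runs B (loop in_cond in_body) \<rho> M 100 \<rho> M"
    by (rule runs_mono[OF runs_loop_end[OF 0(4) c sp_le[OF sM Z(1,2)]]]) (simp_all add: in_cond_def SS_def)
  then show ?case using 0 S by (intro exI[of _ \<rho>] exI[of _ M]) auto
next
  case (Suc m)
  have fin: "finite S" by (rule finite_subset[OF Suc(4)]) (use g in simp)
  note R = Rep_lrep[OF Suc(3)]
  have b: "H \<subseteq> {..<n}" "U \<subseteq> {..<n}" "nb A w \<subseteq> {..<n}" using R nb_subset[OF g] by auto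
  have kS: "keys (fam_of (cut A w S1) H U S2) (cut A w S1) H \<subseteq> Z" if "S1 \<subseteq> nb A w" "S2 \<subseteq> nb A w" for S1 S2
  proof -
    have "keys (fam_of (cut A w S1) H U S2) (cut A w S1) H \<subseteq> keys (fam_of A H U (nb A w)) A H"
      by (rule keys_fam_mono) (use g b that in \<open>auto simp: cut_def intro!: tab_mono\<close>)
    then show ?thesis using Z by blast
  qed
  have sM: "supp M \<subseteq> Z" using kS[OF Suc(4,4)] Suc(3) rep_supp unfolding Rep_def by blast
  let ?c = "card S"
  have l: "lrep M (n + 2) S" by (rule R(4))
  have c1: "M (1, n + 2, 0, 0) = ?c" "M (Suc 0, n + 2, 0, 0) = ?c" "M (Suc 0, Suc (Suc n), 0, 0) = ?c"
    using lrep_card[OF l] by auto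
  have ne: "S \<noteq> {}" using Suc(2) by auto
  have cn: "?c \<le> n" "?c > 0"
  proof -
    have "?c \<le> card {..<n}" by (rule card_mono) (use b Suc(4) in auto)
    then show "?c \<le> n" by simp
  qed (use Suc(2) in simp)
  define y where "y = M (2, n + 2, ?c - 1, 0)"
  have y: "y \<in> S" unfolding y_def by (rule last_elem[OF l ne])
  then have yn: "y < n" and Ay: "A w y" using b Suc(4) by (auto simp: nb_def)
  have small: "w mod W = w" "w mod N = w" "?c mod W = ?c" "(?c - 1) mod W = ?c - 1" "(?c - 1) mod N = ?c - 1" "y mod W = y"
      "(?c - Suc 0) mod W = ?c - Suc 0" "(?c - Suc 0) mod N = ?c - Suc 0" "(n + 2) mod N = n + 2"
    using w cn yn W_ge(3) by auto
  have cond: "ev \<rho> M in_cond \<noteq> 0" using Suc c1 small cn ev_HVS(3)[of \<rho>] by (simp add: in_cond_def)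
  define \<rho>1 where "\<rho>1 = \<rho>(1 := w)"
  define \<rho>2 where "\<rho>2 = \<rho>1(2 := y)"
  have 1: "runs B (asg 1 (V 5)) \<rho> M 10 \<rho>1 M"
    unfolding \<rho>1_def by (rule runs_asg'[where \<rho> = \<rho>, OF Suc(5) Z(1,2) sM]) (use Suc small in simp_all)
  have z1: "\<rho>1 0 = n" "\<rho>1 5 = w" using Suc by (simp_all add: \<rho>1_def)
  have 2: "runs B (asg 2 (R 2 SS (Op Minus (R 1 SS (K 0) (K 0)) (K 1)) (K 0))) \<rho>1 M 200 \<rho>2 M"
    unfolding \<rho>2_def
  proof (rule runs_asg'[where \<rho> = \<rho>1, OF z1(1) Z(1,2) sM])
    show "y = ev \<rho>1 M (R 2 SS (Op Minus (R 1 SS (K 0) (K 0)) (K 1)) (K 0))"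
      using ev_HVS(3)[of \<rho>1, OF z1(1)] small c1 by (simp add: y_def[simplified, symmetric])
  qed (simp add: SS_def)
  have z2: "\<rho>2 0 = n" "\<rho>2 1 = w" "\<rho>2 2 = y" "\<rho>2 5 = w" using Suc by (simp_all add: \<rho>1_def \<rho>2_def)
  have v2: "ev \<rho>2 M (V 2) = y" using z2 small by simp
  have yin: "y \<in> fam_of (cut A w S) H U S (n + 2)" using y by (simp add: fam_of_def)
  have ff: "fam_of (cut A w S) H U (S - {y}) j =
     ((fam_of (cut A w S) H U S)(n + 2 := fam_of (cut A w S) H U S (n + 2) - {y})) j" if "j < N" for j
    using that by (auto simp: fam_of_def)
  obtain \<rho>3 M3 where 3: "runs B (ldel SS (V 2)) \<rho>2 M 3000 \<rho>3 M3"
    and r3: "Rep M3 (cut A w S) H U (S - {y}) s1 s2 s3" and e3: "\<forall>r<40. \<rho>3 r = \<rho>2 r"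
    using run_ldel_fam[OF z2(1) simple_HVS(3) simple_V ev_HVS(3)[of \<rho>2, OF z2(1)] v2 Suc(3) _ yin Z(1,2) kS[OF Suc(4,4)] ff] by auto
  have z3: "\<rho>3 0 = n" "\<rho>3 1 = w" "\<rho>3 2 = y" "\<rho>3 5 = w" using z2 e3 by simp_all
  have D': "low_degree_le n (cut A w S) H D" by (rule low_degree_mono[OF D(2) g]) (auto simp: cut_def)
  have ad: "addable n (cut A w S) w y"
    unfolding addable_def using graph_cut[OF g] w yn Ay y graph_irrefl[OF g] by (auto simp: cut_def)
  have Sy: "S - {y} \<subseteq> nb A w" using Suc(4) by auto
  have k': "keys (fam_of (add_edge (cut A w S) w y) H U (S - {y})) (add_edge (cut A w S) w y) H \<subseteq> Z"
    unfolding add_cut[OF g Ay y] by (rule kS[OF Sy Sy])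
  obtain \<rho>4 M4 where 4: "runs B ins_prog \<rho>3 M3 (prim_cost * (D ^ (p - 1) + card H)) \<rho>4 M4"
    and r4: "Rep M4 (cut A w (S - {y})) H U (S - {y}) s1 s2 s3" and e4: "\<forall>r<10. r \<notin> {3, 4} \<longrightarrow> \<rho>4 r = \<rho>3 r"
    using run_ins[OF r3 ad z3(1-3) Z(1,2) k' D(1) D'] unfolding add_cut[OF g Ay y] by blast
  have z4: "\<rho>4 0 = n" "\<rho>4 5 = w" using z3 e4 by simp_all
  have m: "m = card (S - {y})" using Suc(2) y fin by (simp add: card_Diff_singleton)
  then obtain \<rho>5 M5 where 5: "runs B (loop in_cond in_body) \<rho>4 M4 (card (S - {y}) * (prim_cost * (D ^ (p - 1) + card H) + 5000) + 100) \<rho>5 M5"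
    and r5: "Rep M5 A H U {} s1 s2 s3" and e5: "\<forall>r<10. r \<notin> {1, 2, 3, 4} \<longrightarrow> \<rho>5 r = \<rho>4 r"
    using Suc(1)[OF _ r4 Sy z4] by blast
  have body: "runs B in_body \<rho> M (10 + (200 + (3000 + prim_cost * (D ^ (p - 1) + card H)))) \<rho>4 M4"
    unfolding in_body_def by (rule runs_seq[OF 1 runs_seq[OF 2 runs_seq[OF 3 4]]])
  have cc: "?c = Suc (card (S - {y}))" using Suc(2) m by simp
  have "runs B (loop in_cond in_body) \<rho> M (?c * (prim_cost * (D ^ (p - 1) + card H) + 5000) + 100) \<rho>5 M5"
    by (rule runs_mono[OF runs_loop_step[OF Suc(5) cond body 5]]) (auto simp: in_cond_def SS_def cc)
  moreover have "\<forall>r<10. r \<notin> {1, 2, 3, 4} \<longrightarrow> \<rho>5 r = \<rho> r" using e5 e4 e3 by (auto simp: \<rho>1_def \<rho>2_def)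
  ultimately show ?case using r5 by blast
qed

definition toggle :: "nat \<Rightarrow> nat set \<Rightarrow> nat set" where
  "toggle w H = (if w \<in> H then H - {w} else insert w H)"

text \<open>The degree bound for \<open>H - {w}\<close> includes \<open>w\<close> itself. Hence it
  applies both while \<open>w\<close> is light and while it is heavy, and \<open>Z\<close> has to
  contain the keys for both sides.\<close>

lemma run_flip:
  assumes R: "Rep M A H U {} s1 s2 s3" and w: "w < n" and \<rho>: "\<rho> 0 = n" "\<rho> 5 = w"
    and Z: "finite Z" "card Z \<le> B" "keys (fam_of A H U (nb A w)) A H \<subseteq> Z"
      "keys (fam_of A (toggle w H) U (nb A w)) A (toggle w H) \<subseteq> Z"
    and D: "D \<ge> 1" "low_degree_le n A (H - {w}) D" and h: "card H \<le> h" "card (toggle w H) \<le> h"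
  shows "\<exists>\<rho>' M'. runs B flip_prog \<rho> M ((2 * card (nb A w) + 1) * ((prim_cost + 10000) * (D ^ (p - 1) + h))) \<rho>' M' \<and>
     Rep M' A (toggle w H) U {} s1 s2 s3 \<and> (\<forall>r<10. r \<notin> {1, 2, 3, 4} \<longrightarrow> \<rho>' r = \<rho> r)"
proof -
  note L = Rep_lrep[OF R]
  have g: "graph n A" by (rule L)
  have b: "H \<subseteq> {..<n}" "U \<subseteq> {..<n}" "nb A w \<subseteq> {..<n}" using L nb_subset[OF g] by auto
  have D1: "low_degree_le n A H D" "low_degree_le n A (toggle w H) D"
    by (rule low_degree_mono[OF D(2) g]; auto simp: toggle_def)+
  have R0: "Rep M (cut A w {}) H U {} s1 s2 s3" using R by simp
  let ?N = "nb A w" and ?A = "cut A w (nb A w)"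
  let ?t = "card ?N * (prim_cost * (D ^ (p - 1) + h) + 5000) + 100"
  obtain \<rho>1 M1 where 1: "runs B (loop out_cond out_body) \<rho> M (card (?N - {}) * (prim_cost * (D ^ (p - 1) + card H) + 2000) + 100) \<rho>1 M1"
    and r1: "Rep M1 ?A H U ?N s1 s2 s3" and e1: "\<forall>r<10. r \<notin> {1, 2, 3, 4} \<longrightarrow> \<rho>1 r = \<rho> r"
    using flip_out[OF g w Z(1-3) D(1) D1(1) R0 _ \<rho>] by blast
  have z1: "\<rho>1 0 = n" "\<rho>1 5 = w" using e1 \<rho> by simp_all
  have iso: "nb ?A w = {}" using nb_cut[OF g] by simp
  \<comment> \<open>The moment of the change: \<open>w\<close> has no edges, so the tables are
    correct for either side.\<close>
  have t: "tab n ?A (toggle w H) k = tab n ?A H k" for k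
    using tab_isolated[OF graph_cut[OF g] iso, of H k] by (auto simp: toggle_def insert_absorb)
  have tm: "tab n ?A T k \<le> tab n A T k" for T k by (rule tab_mono) (simp add: cut_def)
  have kk: "keys (fam_of ?A H U ?N) ?A H \<subseteq> Z" "keys (fam_of ?A (toggle w H) U ?N) ?A H \<subseteq> Z"
  proof -
    have "keys (fam_of ?A H U ?N) ?A H \<subseteq> keys (fam_of A H U ?N) A H"
      by (rule keys_fam_mono) (use g b tm in \<open>auto simp: cut_def\<close>)
    then show "keys (fam_of ?A H U ?N) ?A H \<subseteq> Z" using Z by blast
    have "tab n ?A H k \<le> tab n A (toggle w H) k" for k using tm[of "toggle w H" k] t[of k] by simp
    then have "keys (fam_of ?A (toggle w H) U ?N) ?A H \<subseteq> keys (fam_of A (toggle w H) U ?N) A (toggle w H)"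
      by (intro keys_fam_mono) (use g b w in \<open>auto simp: cut_def toggle_def\<close>)
    then show "keys (fam_of ?A (toggle w H) U ?N) ?A H \<subseteq> Z" using Z by blast
  qed
  have v5: "ev \<rho>1 M1 (V 5) = w" using z1 w W_ge(3) by simp
  have c: "ev \<rho>1 M1 (R 3 HH (V 5) (K 0)) = 0 \<longleftrightarrow> w \<notin> H"
    using ev_HVS(1)[of \<rho>1, OF z1(1)] v5 w lrep_mem(1)[OF Rep_lrep(2)[OF r1]] Rep_lrep(8)[OF r1] by simp
  have "\<exists>\<rho>2 M2. runs B (cond (R 3 HH (V 5) (K 0)) (ldel HH (V 5)) (ladd HH (V 5))) \<rho>1 M1 4000 \<rho>2 M2 \<and>
     Rep M2 ?A (toggle w H) U ?N s1 s2 s3 \<and> (\<forall>r<40. \<rho>2 r = \<rho>1 r)"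
  proof (cases "w \<in> H")
    case True
    have inn: "w \<in> fam_of ?A H U ?N n" using True by (simp add: fam_of_def)
    have ff: "fam_of ?A (toggle w H) U ?N j = ((fam_of ?A H U ?N)(n := fam_of ?A H U ?N n - {w})) j" if "j < N" for j
      using True by (auto simp: fam_of_def toggle_def)
    obtain \<rho>2 M2 where 2: "runs B (ldel HH (V 5)) \<rho>1 M1 3000 \<rho>2 M2"
      "Rep M2 ?A (toggle w H) U ?N s1 s2 s3" "\<forall>r<40. \<rho>2 r = \<rho>1 r"
      using run_ldel_fam[OF z1(1) simple_HVS(1) simple_V ev_HVS(1)[of \<rho>1, OF z1(1)] v5 r1 _ inn Z(1,2) kk(1) ff t] by auto
    have "runs B (cond (R 3 HH (V 5) (K 0)) (ldel HH (V 5)) (ladd HH (V 5))) \<rho>1 M1 (1 + ecost (R 3 HH (V 5) (K 0)) + 3000) \<rho>2 M2"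
      by (rule runs_cond) (use z1 2 c True in auto)
    then have "runs B (cond (R 3 HH (V 5) (K 0)) (ldel HH (V 5)) (ladd HH (V 5))) \<rho>1 M1 4000 \<rho>2 M2"
      by (rule runs_mono) (auto simp: HH_def)
    then show ?thesis using 2 by blast
  next
    case False
    have inn: "w \<notin> fam_of ?A H U ?N n" using False by (simp add: fam_of_def)
    have ff: "fam_of ?A (toggle w H) U ?N j = ((fam_of ?A H U ?N)(n := insert w (fam_of ?A H U ?N n))) j" if "j < N" for j
      using False by (auto simp: fam_of_def toggle_def)
    obtain M2 where 2: "runs B (ladd HH (V 5)) \<rho>1 M1 1000 \<rho>1 M2"
      "Rep M2 ?A (toggle w H) U ?N s1 s2 s3"
      using run_ladd_fam[OF z1(1) simple_HVS(1) simple_V ev_HVS(1)[of \<rho>1, OF z1(1)] v5 r1 _ w inn Z(1,2) kk(2) ff t] by auto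
    have "runs B (cond (R 3 HH (V 5) (K 0)) (ldel HH (V 5)) (ladd HH (V 5))) \<rho>1 M1 (1 + ecost (R 3 HH (V 5) (K 0)) + 1000) \<rho>1 M2"
      by (rule runs_cond) (use z1 2 c False in auto)
    then have "runs B (cond (R 3 HH (V 5) (K 0)) (ldel HH (V 5)) (ladd HH (V 5))) \<rho>1 M1 4000 \<rho>1 M2"
      by (rule runs_mono) (auto simp: HH_def)
    then show ?thesis using 2 by blast
  qed
  then obtain \<rho>2 M2 where 2: "runs B (cond (R 3 HH (V 5) (K 0)) (ldel HH (V 5)) (ladd HH (V 5))) \<rho>1 M1 4000 \<rho>2 M2"
    and r2: "Rep M2 ?A (toggle w H) U ?N s1 s2 s3" and e2: "\<forall>r<40. \<rho>2 r = \<rho>1 r" by blast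
  have z2: "\<rho>2 0 = n" "\<rho>2 5 = w" using e2 z1 by simp_all
  obtain \<rho>3 M3 where 3: "runs B (loop in_cond in_body) \<rho>2 M2 (card ?N * (prim_cost * (D ^ (p - 1) + card (toggle w H)) + 5000) + 100) \<rho>3 M3"
    and r3: "Rep M3 A (toggle w H) U {} s1 s2 s3" and e3: "\<forall>r<10. r \<notin> {1, 2, 3, 4} \<longrightarrow> \<rho>3 r = \<rho>2 r"
    using flip_in[OF g w Z(1,2,4) D(1) D1(2) r2 _ z2] by blast
  let ?X = "D ^ (p - 1) + h"
  have X: "1 \<le> ?X"
    using D(1) by (simp add: add_increasing2)
  have slack: "a + c \<le> b + 10000 * x" if "a \<le> b" "1 \<le> x" "c \<le> 5000" for a b c x :: nat using that by linarith
  have c1: "card (?N - {}) * (prim_cost * (D ^ (p - 1) + card H) + 2000) \<le> card ?N * ((prim_cost + 10000) * ?X)"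
  proof -
    have "prim_cost * (D ^ (p - 1) + card H) \<le> prim_cost * ?X" using h by simp
    then have "prim_cost * (D ^ (p - 1) + card H) + 2000 \<le> (prim_cost + 10000) * ?X"
      unfolding add_mult_distrib by (intro slack[OF _ X]) simp_all
    then show ?thesis by simp
  qed
  have c2: "card ?N * (prim_cost * (D ^ (p - 1) + card (toggle w H)) + 5000) \<le> card ?N * ((prim_cost + 10000) * ?X)"
  proof -
    have "prim_cost * (D ^ (p - 1) + card (toggle w H)) \<le> prim_cost * ?X" using h by simp
    then have "prim_cost * (D ^ (p - 1) + card (toggle w H)) + 5000 \<le> (prim_cost + 10000) * ?X"
      unfolding add_mult_distrib by (intro slack[OF _ X]) simp_all
    then show ?thesis by simp
  qed
  have c3: "4200 \<le> (prim_cost + 10000) * ?X"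
    using mult_le_mono2[OF X, of 10000] unfolding add_mult_distrib by simp
  have "runs B flip_prog \<rho> M ((2 * card ?N + 1) * ((prim_cost + 10000) * ?X)) \<rho>3 M3"
    unfolding flip_prog_def
  proof (rule runs_mono[OF runs_seq[OF 1 runs_seq[OF 2 3]]])
    have "(2 * card ?N + 1) * ((prim_cost + 10000) * ?X) = card ?N * ((prim_cost + 10000) * ?X) + card ?N * ((prim_cost + 10000) * ?X) + (prim_cost + 10000) * ?X"
      by (simp only: add_mult_distrib mult_2 mult_1)
    then show "card (?N - {}) * (prim_cost * (D ^ (p - 1) + card H) + 2000) + 100 + (4000 +
       (card ?N * (prim_cost * (D ^ (p - 1) + card (toggle w H)) + 5000) + 100))
      \<le> (2 * card ?N + 1) * ((prim_cost + 10000) * ?X)"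
      using c1 c2 c3 by linarith
  qed simp
  moreover have "\<forall>r<10. r \<notin> {1, 2, 3, 4} \<longrightarrow> \<rho>3 r = \<rho> r" using e1 e2 e3 by auto
  ultimately show ?thesis using r3 by blast
qed

end

section \<open>Restoring the thresholds after an update\<close>

definition degsum :: "nat \<Rightarrow> (nat \<Rightarrow> nat \<Rightarrow> bool) \<Rightarrow> nat" where
  "degsum n A = (\<Sum>x<n. card (nb A x))"

definition deg_exp :: nexp where "deg_exp = R 1 (V 5) (K 0) (K 0)"
definition in_exp :: "nexp \<Rightarrow> nexp" where "in_exp j = R 3 j (V 5) (K 0)"
definition theta_exp :: nexp where "theta_exp = Op Plus (R 4 (K 0) (K 0) (K 0)) (K 1)"
definition edges_exp :: nexp where "edges_exp = R 4 (K 2) (K 0) (K 0)"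

definition join_prog :: "nexp \<Rightarrow> com" where "join_prog j = cond (in_exp j) Skip (ladd j (V 5))"
definition leave_prog :: "nexp \<Rightarrow> com" where "leave_prog j = cond (in_exp j) (ldel j (V 5)) Skip"

context pattern
begin

definition q :: nat where "q = p - 1"

lemma p_Suc: "p = Suc q" and q12: "q = 1 \<or> q = 2"
  using p23 by (auto simp: q_def)

text \<open>For degree at most \<open>20 * \<theta>\<close>, twice the degree plus one is at most
  \<open>41 * \<theta>\<close>; and since \<open>q \<le> 2\<close>,
  \<open>(20 * \<theta>) ^ q + 1000 * \<theta> ^ q\<close> is at most
  \<open>1400 * \<theta> ^ q\<close>.\<close>

definition flip_cost :: nat where "flip_cost = 41 * 1400 * (prim_cost + 10000)"

text \<open>A light vertex becomes heavy when its degree exceeds \<open>2 * \<theta>\<close>. A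
  heavy vertex stays heavy until the next recomputation unless it becomes isolated, in which case it
  leaves without any move; the inequality in \<open>good\<close> keeps the heavy vertices
  few.\<close>

definition fix_prog :: com where
  "fix_prog = cond deg_exp
     (Seq (join_prog VV)
       (cond (Op Times (Op Equal (in_exp HH) (K 0)) (Op Less (Op Times (K 2) theta_exp) deg_exp)) flip_prog Skip))
     (Seq (leave_prog VV) (leave_prog HH))"

definition power_exp :: nexp where
  "power_exp = (if p = 2 then Op Times (V 8) (V 8) else Op Times (V 8) (Op Times (V 8) (V 8)))"

definition theta_cond :: nexp where "theta_cond = Op Less power_exp edges_exp"

definition theta_loop :: com where
  "theta_loop = loop theta_cond (asg 8 (Op Plus (V 8) (K 1)))"

definition scan_cond :: nexp where "scan_cond = Op Less (V 9) (R 1 VV (K 0) (K 0))"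
definition scan_body :: com where
  "scan_body = Seq (asg 5 (R 2 VV (V 9) (K 0)))
     (Seq (cond (Op Equal (Op Less (V 8) deg_exp) (Op Equal (in_exp HH) (K 0))) flip_prog Skip)
       (asg 9 (Op Plus (V 9) (K 1))))"

text \<open>Register 8 searches for the least \<theta> with \<open>m \<le> \<theta> ^ p\<close>.
  Counting up from 1 is affordable, as the result is of the order of the old threshold and far below
  the cost of the scan.\<close>

definition phase_prog :: com where
  "phase_prog = Seq (asg 8 (K 1)) (Seq theta_loop (Seq (put 4 (K 0) (K 0) (K 0) (Op Minus (V 8) (K 1)))
     (Seq (put 4 (K 1) (K 0) (K 0) (Op Divide edges_exp (K 2))) (Seq (asg 9 (K 0)) (loop scan_cond scan_body)))))"

end

context ds
begin

text \<open>\<open>B\<close> has room for twice the keys, because a move needs the keys for both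
  sides of the moved vertex. The slack has these origins: \<open>m\<close> refers to the graph after
  the update, and a deletion starts with one edge more, hence \<open>2 * m + 2\<close>; both
  endpoints may still join \<open>U\<close>, hence \<open>2 * m + 4\<close>; the factors 20 and 1000
  cover a recomputation, when the partition is between an old and a new threshold.\<close>

definition fits :: "nat \<Rightarrow> nat \<Rightarrow> nat \<Rightarrow> bool" where
  "fits B m \<theta> \<longleftrightarrow> (\<forall>A H U S. graph n A \<longrightarrow> degsum n A \<le> 2 * m + 2 \<longrightarrow> H \<subseteq> {..<n} \<longrightarrow> card H \<le> 1000 * \<theta> ^ q \<longrightarrow>
     low_degree_le n A H (20 * \<theta>) \<longrightarrow> U \<subseteq> {..<n} \<longrightarrow> card U \<le> 2 * m + 4 \<longrightarrow> S \<subseteq> {..<n} \<longrightarrow> card S \<le> 2 * m + 2 \<longrightarrow>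
     2 * card (keys (fam_of A H U S) A H) \<le> B)"

lemma fitsD:
  assumes "fits B m \<theta>" "graph n A" "degsum n A \<le> 2 * m + 2" "H \<subseteq> {..<n}" "card H \<le> 1000 * \<theta> ^ q"
     "low_degree_le n A H (20 * \<theta>)" "U \<subseteq> {..<n}" "card U \<le> 2 * m + 4" "S \<subseteq> {..<n}" "card S \<le> 2 * m + 2"
  shows "2 * card (keys (fam_of A H U S) A H) \<le> B" "finite (keys (fam_of A H U S) A H)"
proof -
  show "2 * card (keys (fam_of A H U S) A H) \<le> B" using assms unfolding fits_def by blast
  have "fam_of A H U S j \<subseteq> {..<n}" for j
    using assms nb_subset[OF assms(2), of j] by (auto simp: fam_of_def)
  then show "finite (keys (fam_of A H U S) A H)" by (intro finite_keys) auto
qed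

lemma card_nb_le_degsum: "graph n A \<Longrightarrow> w < n \<Longrightarrow> card (nb A w) \<le> degsum n A"
  unfolding degsum_def by (rule member_le_sum) auto

lemma run_flip_fits:
  assumes R: "Rep M A H U {} s1 s2 s3" and w: "w < n" and \<rho>: "\<rho> 0 = n" "\<rho> 5 = w"
    and B: "fits B m \<theta>" "degsum n A \<le> 2 * m + 2" "card U \<le> 2 * m + 4"
    and D: "\<theta> \<ge> 1" "low_degree_le n A (H - {w}) (20 * \<theta>)" "card H + 1 \<le> 1000 * \<theta> ^ q"
  shows "\<exists>\<rho>' M'. runs B flip_prog \<rho> M (flip_cost * (\<theta> ^ q * \<theta>)) \<rho>' M' \<and>
     Rep M' A (toggle w H) U {} s1 s2 s3 \<and> (\<forall>r<10. r \<notin> {1, 2, 3, 4} \<longrightarrow> \<rho>' r = \<rho> r)"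
proof -
  note L = Rep_lrep[OF R]
  have g: "graph n A" by (rule L)
  have fin: "finite H" using L(5) finite_subset by blast
  have ct: "card (toggle w H) \<le> 1000 * \<theta> ^ q"
    using D(3) fin card_Diff1_le[of H w] by (auto simp: toggle_def card_insert_if)
  have tn: "toggle w H \<subseteq> {..<n}" using L(5) w by (auto simp: toggle_def)
  have low: "low_degree_le n A H (20 * \<theta>)" "low_degree_le n A (toggle w H) (20 * \<theta>)"
    by (rule low_degree_mono[OF D(2) g]; auto simp: toggle_def)+
  have cS: "card (nb A w) \<le> 2 * m + 2" using card_nb_le_degsum[OF g w] B(2) by simp
  let ?K1 = "keys (fam_of A H U (nb A w)) A H" and ?K2 = "keys (fam_of A (toggle w H) U (nb A w)) A (toggle w H)"
  have k1: "2 * card ?K1 \<le> B" "finite ?K1"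
    using fitsD[OF B(1) g B(2) L(5) _ low(1) L(6) B(3) nb_subset[OF g] cS] D(3) by auto
  have k2: "2 * card ?K2 \<le> B" "finite ?K2"
    using fitsD[OF B(1) g B(2) tn ct low(2) L(6) B(3) nb_subset[OF g] cS] by auto
  let ?Z = "?K1 \<union> ?K2"
  have Z: "finite ?Z" "card ?Z \<le> B" using k1 k2 card_Un_le[of ?K1 ?K2] by auto
  have "card (nb A w) \<le> 20 * \<theta>" using D(2) w by (simp add: low_degree_le_def)
  have "\<exists>\<rho>' M'. runs B flip_prog \<rho> M ((2 * card (nb A w) + 1) * ((prim_cost + 10000) * ((20 * \<theta>) ^ q + 1000 * \<theta> ^ q))) \<rho>' M' \<and>
     Rep M' A (toggle w H) U {} s1 s2 s3 \<and> (\<forall>r<10. r \<notin> {1, 2, 3, 4} \<longrightarrow> \<rho>' r = \<rho> r)"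
    unfolding q_def
    by (rule run_flip[OF R w \<rho> Z]) (use D ct in \<open>auto simp: q_def\<close>)
  moreover have "(2 * card (nb A w) + 1) * ((prim_cost + 10000) * ((20 * \<theta>) ^ q + 1000 * \<theta> ^ q)) \<le> flip_cost * (\<theta> ^ q * \<theta>)"
  proof -
    have 1: "(20 * \<theta>) ^ q + 1000 * \<theta> ^ q \<le> 1400 * \<theta> ^ q" using q12 by (auto simp: power_mult_distrib)
    have 2: "2 * card (nb A w) + 1 \<le> 41 * \<theta>" using \<open>card (nb A w) \<le> 20 * \<theta>\<close> D(1) by linarith
    have "(2 * card (nb A w) + 1) * ((prim_cost + 10000) * ((20 * \<theta>) ^ q + 1000 * \<theta> ^ q)) \<le>
        (41 * \<theta>) * ((prim_cost + 10000) * (1400 * \<theta> ^ q))"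
      by (intro mult_le_mono 1 2 le_refl)
    also have "\<dots> = flip_cost * (\<theta> ^ q * \<theta>)" by (simp add: flip_cost_def algebra_simps)
    finally show ?thesis .
  qed
  ultimately show ?thesis by (meson runs_mono le_refl)
qed

lemma ev_in:
  assumes "Rep M A H U S s1 s2 s3" "\<rho> 0 = n" "\<rho> 5 = w" "w < n"
  shows "ev \<rho> M (in_exp HH) = 0 \<longleftrightarrow> w \<notin> H" "ev \<rho> M (in_exp VV) = 0 \<longleftrightarrow> w \<notin> U" "ev \<rho> M deg_exp = card (nb A w)"
proof -
  note L = Rep_lrep[OF assms(1)]
  have w: "w mod W = w" "w mod N = w" using assms(4) W_ge(3) by auto
  have m: "M k mod W = M k" for k using L(8) by simp
  show "ev \<rho> M (in_exp HH) = 0 \<longleftrightarrow> w \<notin> H"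
    using ev_HVS(1)[of \<rho>, OF assms(2)] assms(3) w m lrep_mem(1)[OF L(2)] by (simp add: in_exp_def)
  show "ev \<rho> M (in_exp VV) = 0 \<longleftrightarrow> w \<notin> U"
    using ev_HVS(2)[of \<rho>, OF assms(2)] assms(3) w m lrep_mem(1)[OF L(3)] by (simp add: in_exp_def)
  show "ev \<rho> M deg_exp = card (nb A w)"
    using assms(3) w m[of "(Suc 0, w, 0, 0)"] lrep_card(2)[OF L(1)[OF assms(4)]] by (simp add: deg_exp_def)
qed

lemma run_join_U:
  assumes R: "Rep M A H U {} s1 s2 s3" and w: "w < n" and \<rho>: "\<rho> 0 = n" "\<rho> 5 = w"
    and Z: "finite Z" "card Z \<le> B" "keys (fam_of A H (insert w U) {}) A H \<subseteq> Z"
  shows "\<exists>M' s3'. runs B (join_prog VV) \<rho> M 2000 \<rho> M' \<and> Rep M' A H (insert w U) {} s1 s2 s3' \<and> fst s3' = fst s3"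
proof -
  note L = Rep_lrep[OF R]
  have v5: "ev \<rho> M (V 5) = w" using \<rho> w W_ge(3) by simp
  have ec: "1 + ecost (in_exp VV) + 1000 \<le> 2000" by (simp add: in_exp_def VV_def)
  show ?thesis
  proof (cases "w \<in> U")
    case True
    then have k: "supp M \<subseteq> Z" using R Z rep_supp unfolding Rep_def by (metis insert_absorb order_trans)
    have "runs B (join_prog VV) \<rho> M (1 + ecost (in_exp VV) + 1000) \<rho> M"
      unfolding join_prog_def
      by (rule runs_cond) (use \<rho> ev_in[OF R \<rho> w] True sp_le[OF k Z(1,2)] runs_mono[OF runs_skip] in auto)
    then show ?thesis using True R runs_mono[OF _ ec] by (metis insert_absorb le_refl)
  next
    case False
    have nin: "w \<notin> fam_of A H U {} (n + 1)" using False by (simp add: fam_of_def)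
    have ff: "fam_of A H (insert w U) {} j = ((fam_of A H U {})(n + 1 := insert w (fam_of A H U {} (n + 1)))) j" if "j < N" for j
      by (auto simp: fam_of_def)
    have "\<exists>M' s3'. runs B (ladd VV (V 5)) \<rho> M 1000 \<rho> M' \<and> Rep M' A H (insert w U) {} s1 s2 s3' \<and> fst s3' = fst s3 \<and> (n + 1 \<noteq> n + 1 \<longrightarrow> s3' = s3)"
      by (rule run_ladd_fam[OF \<rho>(1) simple_HVS(2) simple_V ev_HVS(2)[of \<rho>, OF \<rho>(1)] v5 R _ w nin Z ff]) auto
    then obtain M' s3' where 2: "runs B (ladd VV (V 5)) \<rho> M 1000 \<rho> M'" "Rep M' A H (insert w U) {} s1 s2 s3'" "fst s3' = fst s3" by blast
    have "runs B (join_prog VV) \<rho> M (1 + ecost (in_exp VV) + 1000) \<rho> M'"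
      unfolding join_prog_def by (rule runs_cond) (use \<rho> ev_in[OF R \<rho> w] False 2 in auto)
    then show ?thesis using 2 runs_mono[OF _ ec] by blast
  qed
qed

lemma run_leave_U:
  assumes R: "Rep M A H U {} s1 s2 s3" and w: "w < n" and \<rho>: "\<rho> 0 = n" "\<rho> 5 = w"
    and Z: "finite Z" "card Z \<le> B" "keys (fam_of A H U {}) A H \<subseteq> Z"
  shows "\<exists>\<rho>' M' s3'. runs B (leave_prog VV) \<rho> M 4000 \<rho>' M' \<and> Rep M' A H (U - {w}) {} s1 s2 s3' \<and> fst s3' = fst s3 \<and> (\<forall>r<40. \<rho>' r = \<rho> r)"
proof -
  note L = Rep_lrep[OF R]
  have v5: "ev \<rho> M (V 5) = w" using \<rho> w W_ge(3) by simp
  have ec: "1 + ecost (in_exp VV) + 3000 \<le> 4000" by (simp add: in_exp_def VV_def)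
  show ?thesis
  proof (cases "w \<in> U")
    case False
    then have k: "supp M \<subseteq> Z" using R Z rep_supp unfolding Rep_def by blast
    have "runs B (leave_prog VV) \<rho> M (1 + ecost (in_exp VV) + 3000) \<rho> M"
      unfolding leave_prog_def
      by (rule runs_cond) (use \<rho> ev_in[OF R \<rho> w] False sp_le[OF k Z(1,2)] runs_mono[OF runs_skip] in auto)
    then have "runs B (leave_prog VV) \<rho> M 4000 \<rho> M" using runs_mono[OF _ ec] by blast
    moreover have "U - {w} = U" using False by auto
    ultimately show ?thesis using R by metis
  next
    case True
    have nin: "w \<in> fam_of A H U {} (n + 1)" using True by (simp add: fam_of_def)
    have ff: "fam_of A H (U - {w}) {} j = ((fam_of A H U {})(n + 1 := fam_of A H U {} (n + 1) - {w})) j" if "j < N" for j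
      by (auto simp: fam_of_def)
    have "\<exists>\<rho>' M' s3'. runs B (ldel VV (V 5)) \<rho> M 3000 \<rho>' M' \<and> Rep M' A H (U - {w}) {} s1 s2 s3' \<and> (\<forall>r<40. \<rho>' r = \<rho> r) \<and> fst s3' = fst s3 \<and> (n + 1 \<noteq> n + 1 \<longrightarrow> s3' = s3)"
      by (rule run_ldel_fam[OF \<rho>(1) simple_HVS(2) simple_V ev_HVS(2)[of \<rho>, OF \<rho>(1)] v5 R _ nin Z ff]) auto
    then obtain \<rho>' M' s3' where 2: "runs B (ldel VV (V 5)) \<rho> M 3000 \<rho>' M'" "Rep M' A H (U - {w}) {} s1 s2 s3'" "fst s3' = fst s3" "\<forall>r<40. \<rho>' r = \<rho> r" by blast
    have "runs B (leave_prog VV) \<rho> M (1 + ecost (in_exp VV) + 3000) \<rho>' M'"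
      unfolding leave_prog_def by (rule runs_cond) (use \<rho> ev_in[OF R \<rho> w] True 2 in auto)
    then show ?thesis using 2 runs_mono[OF _ ec] by blast
  qed
qed

lemma run_leave_H:
  assumes R: "Rep M A H U {} s1 s2 s3" and w: "w < n" and \<rho>: "\<rho> 0 = n" "\<rho> 5 = w" and iso: "nb A w = {}"
    and Z: "finite Z" "card Z \<le> B" "keys (fam_of A H U {}) A H \<subseteq> Z"
  shows "\<exists>\<rho>' M'. runs B (leave_prog HH) \<rho> M 4000 \<rho>' M' \<and> Rep M' A (H - {w}) U {} s1 s2 s3 \<and> (\<forall>r<40. \<rho>' r = \<rho> r)"
proof -
  note L = Rep_lrep[OF R]
  have v5: "ev \<rho> M (V 5) = w" using \<rho> w W_ge(3) by simp
  have ec: "1 + ecost (in_exp HH) + 3000 \<le> 4000" by (simp add: in_exp_def HH_def)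
  have t: "tab n A (H - {w}) k = tab n A H k" for k
    using tab_isolated[OF L(9) iso, of H k] by (cases "w \<in> H") (auto simp: insert_absorb)
  show ?thesis
  proof (cases "w \<in> H")
    case False
    then have k: "supp M \<subseteq> Z" using R Z rep_supp unfolding Rep_def by blast
    have "runs B (leave_prog HH) \<rho> M (1 + ecost (in_exp HH) + 3000) \<rho> M"
      unfolding leave_prog_def
      by (rule runs_cond) (use \<rho> ev_in[OF R \<rho> w] False sp_le[OF k Z(1,2)] runs_mono[OF runs_skip] in auto)
    then have "runs B (leave_prog HH) \<rho> M 4000 \<rho> M" using runs_mono[OF _ ec] by blast
    moreover have "H - {w} = H" using False by auto
    ultimately show ?thesis using R by metis
  next
    case True
    have nin: "w \<in> fam_of A H U {} n" using True by (simp add: fam_of_def)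
    have ff: "fam_of A (H - {w}) U {} j = ((fam_of A H U {})(n := fam_of A H U {} n - {w})) j" if "j < N" for j
      by (auto simp: fam_of_def)
    have "\<exists>\<rho>' M' s3'. runs B (ldel HH (V 5)) \<rho> M 3000 \<rho>' M' \<and> Rep M' A (H - {w}) U {} s1 s2 s3' \<and> (\<forall>r<40. \<rho>' r = \<rho> r) \<and> fst s3' = fst s3 \<and> (n \<noteq> n + 1 \<longrightarrow> s3' = s3)"
      by (rule run_ldel_fam[OF \<rho>(1) simple_HVS(1) simple_V ev_HVS(1)[of \<rho>, OF \<rho>(1)] v5 R _ nin Z ff t]) auto
    then obtain \<rho>' M' where 2: "runs B (ldel HH (V 5)) \<rho> M 3000 \<rho>' M'" "Rep M' A (H - {w}) U {} s1 s2 s3" "\<forall>r<40. \<rho>' r = \<rho> r" by auto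
    have "runs B (leave_prog HH) \<rho> M (1 + ecost (in_exp HH) + 3000) \<rho>' M'"
      unfolding leave_prog_def by (rule runs_cond) (use \<rho> ev_in[OF R \<rho> w] True 2 in auto)
    then show ?thesis using 2 runs_mono[OF _ ec] by blast
  qed
qed

definition fixed_U where "fixed_U A w U = (if nb A w = {} then U - {w} else insert w U)"
definition fixed_H where
  "fixed_H A \<theta> w H = (if nb A w = {} then H - {w} else if w \<notin> H \<and> 2 * \<theta> < card (nb A w) then insert w H else H)"

lemma run_fix:
  assumes R: "Rep M A H U {} (\<theta> - 1) s2 s3" and w: "w < n" and \<rho>: "\<rho> 0 = n" "\<rho> 5 = w"
    and B: "fits B m \<theta>" "degsum n A \<le> 2 * m + 2" "card U + 1 \<le> 2 * m + 4"
    and D: "\<theta> \<ge> 1" "low_degree_le n A H (20 * \<theta>)" "card H + 1 \<le> 1000 * \<theta> ^ q" "2 * \<theta> < W"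
  shows "\<exists>\<rho>' M' s3'. runs B fix_prog \<rho> M (10000 + (if w \<notin> H \<and> 2 * \<theta> < card (nb A w) then flip_cost * (\<theta> ^ q * \<theta>) else 0)) \<rho>' M' \<and>
     Rep M' A (fixed_H A \<theta> w H) (fixed_U A w U) {} (\<theta> - 1) s2 s3' \<and> fst s3' = fst s3 \<and> (\<forall>r<10. r \<notin> {1, 2, 3, 4} \<longrightarrow> \<rho>' r = \<rho> r)"
proof -
  note L = Rep_lrep[OF R]
  have g: "graph n A" by (rule L)
  have cH: "card H \<le> 1000 * \<theta> ^ q" using D(3) by simp
  have finU: "finite U" using L(6) finite_subset by blast
  have k: "card (keys (fam_of A H U' {}) A H) \<le> B" "finite (keys (fam_of A H U' {}) A H)"
    if "U' \<subseteq> insert w U" for U'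
  proof -
    have "card U' \<le> card (insert w U)" using that finU by (intro card_mono) auto
    then have c: "card U' \<le> 2 * m + 4" using B(3) finU by (auto simp: card_insert_if split: if_splits)
    have "U' \<subseteq> {..<n}" using that L(6) w by auto
    from fitsD[OF B(1) g B(2) L(5) cH D(2) this c, of "{}"]
    show "card (keys (fam_of A H U' {}) A H) \<le> B" "finite (keys (fam_of A H U' {}) A H)" by auto
  qed
  have ecd: "ecost deg_exp = 30" by (simp add: deg_exp_def)
  show ?thesis
  proof (cases "nb A w = {}")
    case True
    obtain \<rho>1 M1 s3' where 1: "runs B (leave_prog VV) \<rho> M 4000 \<rho>1 M1" "Rep M1 A H (U - {w}) {} (\<theta> - 1) s2 s3'" "fst s3' = fst s3" "\<forall>r<40. \<rho>1 r = \<rho> r"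
      using run_leave_U[OF R w \<rho> k(2,1)[OF subset_insertI] order_refl] by blast
    have z1: "\<rho>1 0 = n" "\<rho>1 5 = w" using 1(4) \<rho> by simp_all
    have sub: "U - {w} \<subseteq> insert w U" by auto
    obtain \<rho>2 M2 where 2: "runs B (leave_prog HH) \<rho>1 M1 4000 \<rho>2 M2" "Rep M2 A (H - {w}) (U - {w}) {} (\<theta> - 1) s2 s3'" "\<forall>r<40. \<rho>2 r = \<rho>1 r"
      using run_leave_H[OF 1(2) w z1 True k(2,1)[of "U - {w}", OF sub] order_refl] by blast
    have "runs B fix_prog \<rho> M (1 + ecost deg_exp + (4000 + 4000)) \<rho>2 M2"
      unfolding fix_prog_def
      by (rule runs_cond) (use \<rho> ev_in(3)[OF R \<rho> w] True runs_seq[OF 1(1) 2(1)] in auto)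
    then have "runs B fix_prog \<rho> M (10000 + (if w \<notin> H \<and> 2 * \<theta> < card (nb A w) then flip_cost * (\<theta> ^ q * \<theta>) else 0)) \<rho>2 M2"
      by (rule runs_mono) (simp_all add: ecd)
    moreover have "\<forall>r<10. r \<notin> {1, 2, 3, 4} \<longrightarrow> \<rho>2 r = \<rho> r" using 1(4) 2(3) by simp
    ultimately show ?thesis using 2(2) 1(3) True by (auto simp: fixed_H_def fixed_U_def)
  next
    case False
    have dpos: "card (nb A w) > 0" using False g by (simp add: card_gt_0_iff)
    obtain M1 s3' where 1: "runs B (join_prog VV) \<rho> M 2000 \<rho> M1" "Rep M1 A H (insert w U) {} (\<theta> - 1) s2 s3'" "fst s3' = fst s3"
      using run_join_U[OF R w \<rho> k(2,1)[OF order_refl] order_refl] by blast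
    let ?c = "Op Times (Op Equal (in_exp HH) (K 0)) (Op Less (Op Times (K 2) theta_exp) deg_exp)"
    have th: "ev \<rho> M1 theta_exp = \<theta>"
    proof -
      have "M1 (4, 0, 0, 0) = \<theta> - 1" using 1(2) by (simp add: Rep_def rep_def)
      then show ?thesis using D by (simp add: theta_exp_def)
    qed
    have c: "ev \<rho> M1 ?c \<noteq> 0 \<longleftrightarrow> w \<notin> H \<and> 2 * \<theta> < card (nb A w)"
      using ev_in[OF 1(2) \<rho> w] th D(4) W_ge(4) by (simp add: of_bool_def)
    have ecc: "ecost ?c \<le> 300" by (simp add: in_exp_def HH_def theta_exp_def deg_exp_def)
    show ?thesis
    proof (cases "w \<notin> H \<and> 2 * \<theta> < card (nb A w)")
      case T: True
      have low: "low_degree_le n A (H - {w}) (20 * \<theta>)" using D(2) T by simp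
      have cU: "card (insert w U) \<le> 2 * m + 4" using B(3) finU by (auto simp: card_insert_if)
      obtain \<rho>2 M2 where 2: "runs B flip_prog \<rho> M1 (flip_cost * (\<theta> ^ q * \<theta>)) \<rho>2 M2"
        "Rep M2 A (toggle w H) (insert w U) {} (\<theta> - 1) s2 s3'" "\<forall>r<10. r \<notin> {1, 2, 3, 4} \<longrightarrow> \<rho>2 r = \<rho> r"
        using run_flip_fits[OF 1(2) w \<rho> B(1,2) cU D(1) low D(3)] by blast
      have 3: "runs B (cond ?c flip_prog Skip) \<rho> M1 (1 + ecost ?c + flip_cost * (\<theta> ^ q * \<theta>)) \<rho>2 M2"
        by (rule runs_cond) (use \<rho> c T 2 in auto)
      have "runs B fix_prog \<rho> M (1 + ecost deg_exp + (2000 + (1 + ecost ?c + flip_cost * (\<theta> ^ q * \<theta>)))) \<rho>2 M2"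
        unfolding fix_prog_def
        by (rule runs_cond) (use \<rho> ev_in(3)[OF R \<rho> w] dpos runs_seq[OF 1(1) 3] in auto)
      then have "runs B fix_prog \<rho> M (10000 + (if w \<notin> H \<and> 2 * \<theta> < card (nb A w) then flip_cost * (\<theta> ^ q * \<theta>) else 0)) \<rho>2 M2"
        by (rule runs_mono) (use T ecc in \<open>simp_all add: ecd\<close>)
      then show ?thesis using 2(2,3) 1(3) False T by (auto simp: fixed_H_def fixed_U_def toggle_def)
    next
      case F: False
      have "supp M1 \<subseteq> keys (fam_of A H (insert w U) {}) A H" using rep_supp 1(2) unfolding Rep_def by blast
      then have s1: "sp M1 \<le> B" by (rule sp_le[OF _ k(2,1)[OF order_refl]])
      have 3: "runs B (cond ?c flip_prog Skip) \<rho> M1 (1 + ecost ?c + 1) \<rho> M1"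
        by (rule runs_cond) (use \<rho> c F s1 runs_skip in auto)
      have "runs B fix_prog \<rho> M (1 + ecost deg_exp + (2000 + (1 + ecost ?c + 1))) \<rho> M1"
        unfolding fix_prog_def
        by (rule runs_cond) (use \<rho> ev_in(3)[OF R \<rho> w] dpos runs_seq[OF 1(1) 3] in auto)
      then have "runs B fix_prog \<rho> M (10000 + (if w \<notin> H \<and> 2 * \<theta> < card (nb A w) then flip_cost * (\<theta> ^ q * \<theta>) else 0)) \<rho> M1"
        by (rule runs_mono) (use ecc in \<open>simp_all add: ecd\<close>)
      then show ?thesis using 1 False F by (auto simp: fixed_H_def fixed_U_def)
    qed
  qed
qed

lemma Rep_scalar:
  assumes "Rep M A H U S s1 s2 s3" "x < W"
  shows "Rep (M((4, 0, 0, 0) := x)) A H U S x s2 s3" "Rep (M((4, 1, 0, 0) := x)) A H U S s1 x s3"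
    "Rep (M((4, 2, 0, 0) := x)) A H U S s1 s2 (x, snd s3)"
proof -
  have l: "lrep (M((4, i, 0, 0) := x)) j T = lrep M j T" for i j T by (rule lrep_cong) auto
  have sh: "shape n k" if "k \<in> supp (M((4, i, 0, 0) := x))" "i < 3" for k i
  proof (cases "k = (4, i, 0, 0)")
    case True
    then show ?thesis using that(2) by (auto simp: shape_def less_Suc_eq numeral_eq_Suc)
  next
    case False
    then have "k \<in> supp M" using that(1) by (auto simp: supp_def)
    then show ?thesis using assms(1) by (simp add: Rep_def rep_def)
  qed
  have k5: "(M((4, i, 0, 0) := x)) k = M k" if "5 \<le> fst k" for k i using that by auto
  show "Rep (M((4, 0, 0, 0) := x)) A H U S x s2 s3" "Rep (M((4, 1, 0, 0) := x)) A H U S s1 x s3"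
    "Rep (M((4, 2, 0, 0) := x)) A H U S s1 s2 (x, snd s3)"
    using assms sh unfolding Rep_def rep_def by (auto simp: l k5)
qed

lemma power_exp_ev:
  assumes "\<rho> 8 = x" "x ^ p < W"
  shows "ev \<rho> M power_exp = x ^ p"
proof -
  have "x ^ k < W" if "k \<le> p" "x \<ge> 1" for k
    using assms(2) power_increasing[OF that(1), of x] that(2) by linarith
  then have "x < W" "x * x < W" if "x \<ge> 1"
    using that p23 by (metis le_refl power_one_right one_le_numeral, metis power2_eq_square order_refl numeral_le_iff semiring_norm(76) semiring_norm(73) le_numeral_extra(4) eval_nat_numeral(3) le_SucI)
  then have *: "x < W" "x * x < W" by (cases "x = 0"; simp)+
  show ?thesis
    using p23
  proof
    assume "p = 2"
    then show ?thesis using * assms(1) unfolding power_exp_def by (simp add: power2_eq_square)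
  next
    assume "p = 3"
    then show ?thesis using * assms unfolding power_exp_def by (simp add: power3_eq_cube mult.assoc)
  qed
qed

lemma run_theta_loop:
  assumes R: "Rep M A H U {} s1 s2 s3" and m: "fst s3 = m" "8 * m + 8 < W"
    and Z: "finite Z" "card Z \<le> B" "supp M \<subseteq> Z"
  shows "\<rho> 0 = n \<Longrightarrow> \<rho> 8 = x \<Longrightarrow> x \<ge> 1 \<Longrightarrow> (x - 1) ^ p < max 1 m \<Longrightarrow>
    \<exists>\<rho>' y. runs B theta_loop \<rho> M ((y + 1 - x) * 100) \<rho>' M \<and> \<rho>' 8 = y \<and> (\<forall>r<10. r \<noteq> 8 \<longrightarrow> \<rho>' r = \<rho> r) \<and>
      y \<ge> x \<and> (y - 1) ^ p < max 1 m \<and> m \<le> y ^ p"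
proof (induction "m + 1 - x" arbitrary: x \<rho> rule: less_induct)
  case less
  \<comment> \<open>The tested power may exceed \<open>m\<close>, but the previous candidate was
    still too small and \<open>x \<le> 2 * (x - 1)\<close>; so the power stays below
    \<open>W\<close> and the comparison is not spoilt by overflow.\<close>
  have pw: "x ^ p \<le> 8 * max 1 m"
  proof (cases "x = 1")
    case False
    then have "x \<le> 2 * (x - 1)" using less.prems by simp
    then have "x ^ p \<le> (2 * (x - 1)) ^ p" by (rule power_mono) simp
    also have "\<dots> = 2 ^ p * (x - 1) ^ p" by (rule power_mult_distrib)
    also have "\<dots> \<le> 8 * (x - 1) ^ p" using p23 by (intro mult_right_mono) auto
    also have "\<dots> \<le> 8 * max 1 m" using less.prems by simp
    finally show ?thesis .
  qed simp
  then have xW: "x ^ p < W" using m(2) by (auto simp: max_def split: if_splits)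
  have e: "ev \<rho> M edges_exp = m"
  proof -
    have "M (4, 2, 0, 0) = m" using R m by (simp add: Rep_def rep_def)
    then show ?thesis using m(2) W_ge(3) by (simp add: edges_exp_def)
  qed
  have c: "ev \<rho> M theta_cond = of_bool (x ^ p < m)"
    using power_exp_ev[of \<rho> x, OF less.prems(2) xW] e by (simp add: theta_cond_def)
  have ec: "ecost theta_cond \<le> 80" by (simp add: theta_cond_def power_exp_def edges_exp_def)
  show ?case
  proof (cases "x ^ p < m")
    case False
    have "runs B theta_loop \<rho> M (1 + ecost theta_cond) \<rho> M"
      unfolding theta_loop_def by (rule runs_loop_end) (use less.prems c False sp_le[OF Z(3,1,2)] in auto)
    then have "runs B theta_loop \<rho> M ((x + 1 - x) * 100) \<rho> M" by (rule runs_mono) (use ec in simp_all)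
    then show ?thesis using less.prems False by (intro exI[of _ \<rho>] exI[of _ x]) auto
  next
    case True
    have "x \<le> x ^ p" using less.prems p23 by (intro self_le_power) auto
    then have xm: "x < m" using True by simp
    let ?\<rho> = "\<rho>(8 := x + 1)"
    have a: "runs B (asg 8 (Op Plus (V 8) (K 1))) \<rho> M 10 ?\<rho> M"
      by (rule runs_asg'[where \<rho> = \<rho>, OF less.prems(1) Z]) (use less.prems xm m(2) in simp_all)
    have "\<exists>\<rho>' y. runs B theta_loop ?\<rho> M ((y + 1 - (x + 1)) * 100) \<rho>' M \<and> \<rho>' 8 = y \<and> (\<forall>r<10. r \<noteq> 8 \<longrightarrow> \<rho>' r = ?\<rho> r) \<and>
      y \<ge> x + 1 \<and> (y - 1) ^ p < max 1 m \<and> m \<le> y ^ p"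
      by (rule less.hyps) (use less.prems True xm in auto)
    then obtain \<rho>' y where 1: "runs B theta_loop ?\<rho> M ((y + 1 - (x + 1)) * 100) \<rho>' M" "\<rho>' 8 = y" "\<forall>r<10. r \<noteq> 8 \<longrightarrow> \<rho>' r = ?\<rho> r"
      "y \<ge> x + 1" "(y - 1) ^ p < max 1 m" "m \<le> y ^ p" by blast
    have cn: "ev \<rho> M theta_cond \<noteq> 0" using c True by simp
    have "runs B theta_loop \<rho> M ((y + 1 - x) * 100) \<rho>' M"
      unfolding theta_loop_def
      by (rule runs_mono[OF runs_loop_step[OF less.prems(1) cn a 1(1)[unfolded theta_loop_def]]]) (use ec 1(4) in auto)
    then show ?thesis using 1 by (intro exI[of _ \<rho>'] exI[of _ y]) auto
  qed
qed

text \<open>Moves do not touch the list of non-isolated vertices, although a vertex is isolated for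
  a while; therefore one enumeration \<open>e\<close> serves the whole scan.\<close>

definition scanned :: "(nat \<Rightarrow> nat \<Rightarrow> bool) \<Rightarrow> nat \<Rightarrow> (nat \<Rightarrow> nat) \<Rightarrow> nat set \<Rightarrow> nat \<Rightarrow> nat set" where
  "scanned A y e H i = {w. (\<exists>k<i. e k = w) \<and> y < card (nb A w)} \<union> {w \<in> H. \<forall>k<i. e k \<noteq> w}"

definition must_flip where
  "must_flip A y H w \<longleftrightarrow> (y < card (nb A w) \<longleftrightarrow> w \<notin> H)"

text \<open>Every intermediate heavy set is contained in the union of the old one and the vertices
  of degree above \<open>y\<close>; the size of this union controls space and time in all rounds. A
  full move is paid only for vertices on the wrong side.\<close>

lemma run_scan:
  assumes U: "U \<subseteq> {..<n}" and H: "H \<subseteq> {..<n}" and y: "y \<le> 20 * \<theta>" "y < W"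
    and B: "fits B m \<theta>" "degsum n A \<le> 2 * m + 2" "card U \<le> 2 * m + 4"
    and D: "\<theta> \<ge> 1" "low_degree_le n A H (20 * \<theta>)" "card (H \<union> {x. x < n \<and> y < card (nb A x)}) + 1 \<le> 1000 * \<theta> ^ q"
  shows "Rep M A (scanned A y (snd s3) H i) U {} s1 s2 s3 \<Longrightarrow> i \<le> card U \<Longrightarrow> \<rho> 0 = n \<Longrightarrow> \<rho> 8 = y \<Longrightarrow> \<rho> 9 = i \<Longrightarrow>
    \<exists>\<rho>' M'. runs B (loop scan_cond scan_body) \<rho> M ((\<Sum>k=i..<card U. 1000 + (if must_flip A y H (snd s3 k) then flip_cost * (\<theta> ^ q * \<theta>) else 0)) + 200) \<rho>' M' \<and>
     Rep M' A (scanned A y (snd s3) H (card U)) U {} s1 s2 s3"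
proof (induction "card U - i" arbitrary: i M \<rho>)
  case 0
  note L = Rep_lrep[OF 0(2)]
  let ?H = "scanned A y (snd s3) H i"
  have cHi: "card ?H \<le> 1000 * \<theta> ^ q"
  proof -
    have "?H \<subseteq> H \<union> {x. x < n \<and> y < card (nb A x)}" using L(5) by (auto simp: scanned_def)
    then have "card ?H \<le> card (H \<union> {x. x < n \<and> y < card (nb A x)})" using H by (intro card_mono) (auto intro: finite_subset)
    then show ?thesis using D(3) by simp
  qed
  have low: "low_degree_le n A ?H (20 * \<theta>)" using D(2) y by (auto simp: low_degree_le_def scanned_def)
  have k: "2 * card (keys (fam_of A ?H U {}) A ?H) \<le> B" "finite (keys (fam_of A ?H U {}) A ?H)"
    using fitsD[OF B(1) L(9) B(2) L(5) cHi low L(6) B(3), of "{}"] by auto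
  have "supp M \<subseteq> keys (fam_of A ?H U {}) A ?H" using 0(2) rep_supp unfolding Rep_def by blast
  then have sp: "sp M \<le> B" by (rule sp_le) (use k in auto)
  have cU: "M (1, n + 1, 0, 0) = card U" "M (Suc 0, n + 1, 0, 0) = card U" "M (Suc 0, Suc n, 0, 0) = card U"
    using lrep_card[OF L(3)] by auto
  have "ev \<rho> M scan_cond = 0" using 0 ev_HVS(2)[of \<rho> M] cU by (simp add: scan_cond_def)
  then have "runs B (loop scan_cond scan_body) \<rho> M (1 + ecost scan_cond) \<rho> M"
    using 0(4) sp by (intro runs_loop_end)
  then have "runs B (loop scan_cond scan_body) \<rho> M ((\<Sum>k=i..<card U. 1000 + (if must_flip A y H (snd s3 k) then flip_cost * (\<theta> ^ q * \<theta>) else 0)) + 200) \<rho> M"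
    by (rule runs_mono) (simp_all add: scan_cond_def VV_def)
  moreover have "i = card U" using 0 by simp
  ultimately show ?case using 0(2) by auto
next
  case (Suc d)
  note L = Rep_lrep[OF Suc(3)]
  let ?H = "scanned A y (snd s3) H i"
  have i: "i < card U" using Suc(2) by simp
  have finU: "finite U" using U finite_subset by blast
  have cU: "M (1, n + 1, 0, 0) = card U" "M (Suc 0, n + 1, 0, 0) = card U" "M (Suc 0, Suc n, 0, 0) = card U"
    using lrep_card[OF L(3)] by auto
  have "card U \<le> card {..<n}" using U by (intro card_mono) auto
  then have cn: "card U \<le> n" by simp
  define w where "w = snd s3 i"
  have Mi: "M (2, n + 1, j, 0) = snd s3 j" "M (2, Suc n, j, 0) = snd s3 j" for j
    using Suc(3) by (auto simp: Rep_def rep_def)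
  have wU: "w \<in> U" using L(3) i Mi unfolding lrep_def w_def by auto
  then have w: "w < n" using U by auto
  \<comment> \<open>Positions in the list are unique, so \<open>w\<close> has not been treated
    before and is still on its old side.\<close>
  have inj: "snd s3 k \<noteq> w" if "k < i" for k
  proof -
    have "M (3, n + 1, snd s3 k, 0) = Suc k" "M (3, n + 1, snd s3 i, 0) = Suc i"
      using L(3) i that Mi unfolding lrep_def by (metis less_trans)+
    then show ?thesis using that by (auto simp: w_def)
  qed
  have wH: "w \<in> ?H \<longleftrightarrow> w \<in> H" using inj by (auto simp: scanned_def)
  have cHi: "card ?H + 1 \<le> 1000 * \<theta> ^ q"
  proof -
    have "?H \<subseteq> H \<union> {x. x < n \<and> y < card (nb A x)}" using L(5) by (auto simp: scanned_def)
    then have "card ?H \<le> card (H \<union> {x. x < n \<and> y < card (nb A x)})" using H by (intro card_mono) (auto intro: finite_subset)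
    then show ?thesis using D(3) by simp
  qed
  have low: "low_degree_le n A ?H (20 * \<theta>)" using D(2) y by (auto simp: low_degree_le_def scanned_def)
  have cHi': "card ?H \<le> 1000 * \<theta> ^ q" using cHi by simp
  have k: "2 * card (keys (fam_of A ?H U {}) A ?H) \<le> B" "finite (keys (fam_of A ?H U {}) A ?H)"
    using fitsD[OF B(1) L(9) B(2) L(5) cHi' low L(6) B(3), of "{}"] by auto
  have sM: "supp M \<subseteq> keys (fam_of A ?H U {}) A ?H" using Suc(3) rep_supp unfolding Rep_def by blast
  have kB: "card (keys (fam_of A ?H U {}) A ?H) \<le> B" using k by simp
  have iW: "i mod W = i" "i mod N = i" using i cn W_ge(3) by auto
  have cond: "ev \<rho> M scan_cond \<noteq> 0" using Suc(5,7) ev_HVS(2)[of \<rho> M] cU i iW cn W_ge(3) by (simp add: scan_cond_def)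
  define \<rho>1 where "\<rho>1 = \<rho>(5 := w)"
  have 1: "runs B (asg 5 (R 2 VV (V 9) (K 0))) \<rho> M 100 \<rho>1 M"
    unfolding \<rho>1_def
  proof (rule runs_asg'[where \<rho> = \<rho>, OF Suc(5) k(2) kB sM])
    show "w = ev \<rho> M (R 2 VV (V 9) (K 0))"
      using Suc(5,7) ev_HVS(2)[of \<rho> M] iW Mi w W_ge(3) by (simp add: w_def[symmetric])
  qed (simp add: VV_def)
  have z1: "\<rho>1 0 = n" "\<rho>1 5 = w" "\<rho>1 8 = y" "\<rho>1 9 = i" using Suc by (simp_all add: \<rho>1_def)
  let ?c = "Op Equal (Op Less (V 8) deg_exp) (Op Equal (in_exp HH) (K 0))"
  have c: "ev \<rho>1 M ?c \<noteq> 0 \<longleftrightarrow> must_flip A y H w"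
    using ev_in[OF Suc(3) z1(1,2) w] wH z1(3) y(2) by (auto simp: must_flip_def of_bool_def)
  have ecc: "ecost ?c \<le> 200" by (simp add: in_exp_def HH_def deg_exp_def)
  let ?F = "if must_flip A y H w then flip_cost * (\<theta> ^ q * \<theta>) else 0"
  have step: "scanned A y (snd s3) H (Suc i) = (if must_flip A y H w then toggle w ?H else ?H)"
    using wH unfolding scanned_def must_flip_def toggle_def w_def[symmetric]
    by (auto simp: less_Suc_eq w_def[symmetric])
  have "\<exists>\<rho>2 M2. runs B (cond ?c flip_prog Skip) \<rho>1 M (300 + ?F) \<rho>2 M2 \<and> Rep M2 A (scanned A y (snd s3) H (Suc i)) U {} s1 s2 s3 \<and>
     (\<forall>r<10. r \<notin> {1, 2, 3, 4} \<longrightarrow> \<rho>2 r = \<rho>1 r)"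
  proof (cases "must_flip A y H w")
    case True
    have low': "low_degree_le n A (?H - {w}) (20 * \<theta>)"
    proof (cases "w \<in> H")
      case T: True
      then have "card (nb A w) \<le> 20 * \<theta>" using True y by (auto simp: must_flip_def)
      then show ?thesis using low by (auto simp: low_degree_le_def)
    next
      case False
      then show ?thesis using low wH by simp
    qed
    obtain \<rho>2 M2 where 2: "runs B flip_prog \<rho>1 M (flip_cost * (\<theta> ^ q * \<theta>)) \<rho>2 M2"
        "Rep M2 A (toggle w ?H) U {} s1 s2 s3" "\<forall>r<10. r \<notin> {1, 2, 3, 4} \<longrightarrow> \<rho>2 r = \<rho>1 r"
      using run_flip_fits[OF Suc(3) w z1(1,2) B D(1) low' cHi] by blast
    have "runs B (cond ?c flip_prog Skip) \<rho>1 M (1 + ecost ?c + flip_cost * (\<theta> ^ q * \<theta>)) \<rho>2 M2"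
      by (rule runs_cond) (use z1 c True 2 in auto)
    then have "runs B (cond ?c flip_prog Skip) \<rho>1 M (300 + ?F) \<rho>2 M2"
      by (rule runs_mono) (use True ecc in simp_all)
    then show ?thesis using 2 step True by auto
  next
    case False
    have "runs B (cond ?c flip_prog Skip) \<rho>1 M (1 + ecost ?c + 1) \<rho>1 M"
      by (rule runs_cond) (use z1 c False runs_skip sp_le[OF sM k(2) kB] in auto)
    then have "runs B (cond ?c flip_prog Skip) \<rho>1 M (300 + ?F) \<rho>1 M"
      by (rule runs_mono) (use False ecc in simp_all)
    then show ?thesis using Suc(3) step False by auto
  qed
  then obtain \<rho>2 M2 where 2: "runs B (cond ?c flip_prog Skip) \<rho>1 M (300 + ?F) \<rho>2 M2"
    and r2: "Rep M2 A (scanned A y (snd s3) H (Suc i)) U {} s1 s2 s3" and e2: "\<forall>r<10. r \<notin> {1, 2, 3, 4} \<longrightarrow> \<rho>2 r = \<rho>1 r" by blast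
  have z2: "\<rho>2 0 = n" "\<rho>2 8 = y" "\<rho>2 9 = i" using z1 e2 by simp_all
  note L2 = Rep_lrep[OF r2]
  let ?H2 = "scanned A y (snd s3) H (Suc i)"
  have cH2: "card ?H2 \<le> 1000 * \<theta> ^ q"
  proof -
    have "?H2 \<subseteq> H \<union> {x. x < n \<and> y < card (nb A x)}" using L2(5) by (auto simp: scanned_def)
    then have "card ?H2 \<le> card (H \<union> {x. x < n \<and> y < card (nb A x)})" using H by (intro card_mono) (auto intro: finite_subset)
    then show ?thesis using D(3) by simp
  qed
  have low2: "low_degree_le n A ?H2 (20 * \<theta>)" using D(2) y by (auto simp: low_degree_le_def scanned_def)
  have k2: "2 * card (keys (fam_of A ?H2 U {}) A ?H2) \<le> B" "finite (keys (fam_of A ?H2 U {}) A ?H2)"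
    using fitsD[OF B(1) L(9) B(2) L2(5) cH2 low2 L(6) B(3), of "{}"] by auto
  have sM2: "supp M2 \<subseteq> keys (fam_of A ?H2 U {}) A ?H2" using r2 rep_supp unfolding Rep_def by blast
  have kB2: "card (keys (fam_of A ?H2 U {}) A ?H2) \<le> B" using k2 by simp
  define \<rho>3 where "\<rho>3 = \<rho>2(9 := Suc i)"
  have 3: "runs B (asg 9 (Op Plus (V 9) (K 1))) \<rho>2 M2 10 \<rho>3 M2"
    unfolding \<rho>3_def
    by (rule runs_asg'[where \<rho> = \<rho>2, OF z2(1) k2(2) kB2 sM2]) (use z2 i cn W_ge(3) in simp_all)
  have z3: "\<rho>3 0 = n" "\<rho>3 8 = y" "\<rho>3 9 = Suc i" using z2 by (simp_all add: \<rho>3_def)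
  have "d = card U - Suc i" using Suc(2) by simp
  then obtain \<rho>4 M4 where 4: "runs B (loop scan_cond scan_body) \<rho>3 M2 ((\<Sum>k=Suc i..<card U. 1000 + (if must_flip A y H (snd s3 k) then flip_cost * (\<theta> ^ q * \<theta>) else 0)) + 200) \<rho>4 M4"
    and r4: "Rep M4 A (scanned A y (snd s3) H (card U)) U {} s1 s2 s3"
    using Suc(1)[OF _ r2 _ z3] i by auto
  have body: "runs B scan_body \<rho> M (100 + (300 + ?F + 10)) \<rho>3 M2"
    unfolding scan_body_def by (rule runs_seq[OF 1 runs_seq[OF 2 3]])
  have "runs B (loop scan_cond scan_body) \<rho> M ((\<Sum>k=i..<card U. 1000 + (if must_flip A y H (snd s3 k) then flip_cost * (\<theta> ^ q * \<theta>) else 0)) + 200) \<rho>4 M4"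
    by (rule runs_mono[OF runs_loop_step[OF Suc(5) cond body 4]])
      (use i in \<open>auto simp: scan_cond_def VV_def sum.atLeast_Suc_lessThan w_def[symmetric]\<close>)
  then show ?case using r4 by blast
qed

end

section \<open>Updates and their amortized cost\<close>

definition exc :: "nat \<Rightarrow> (nat \<Rightarrow> nat \<Rightarrow> bool) \<Rightarrow> nat set \<Rightarrow> nat \<Rightarrow> nat" where
  "exc n A H \<theta> = (\<Sum>x\<in>{..<n} - H. card (nb A x) - \<theta>)"

definition edges_inc :: nexp where "edges_inc = Op Plus edges_exp (K 1)"
definition edges_dec :: nexp where "edges_dec = Op Minus edges_exp (K 1)"
definition rem_exp :: nexp where "rem_exp = R 4 (K 1) (K 0) (K 0)"

context pattern
begin

text \<open>A recomputation moves at most \<open>810 * \<theta> ^ q\<close> vertices, see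
  \<open>run_phase\<close>; the rest is a loop over at most \<open>6 * \<theta> ^ p\<close>
  non-isolated vertices and the search for the threshold.\<close>

definition phase_cost :: nat where "phase_cost = 20000 + 811 * flip_cost"
text \<open>In units of \<open>\<theta> ^ q\<close>: the edge update itself, a rise of the excess by
  at most 2, and a deposit of \<open>16 * phase_cost\<close> for the next recomputation.\<close>

definition update_cost :: nat where
  "update_cost = 1400 * prim_cost + 30000 + 2 * flip_cost + 16 * phase_cost"

definition tick_prog :: com where
  "tick_prog = cond rem_exp (put 4 (K 1) (K 0) (K 0) (Op Minus rem_exp (K 1))) phase_prog"

text \<open>The endpoints are saved in registers 6 and 7, since moves overwrite registers 1 to 4 and
  expect the moved vertex in register 5.\<close>

definition update_prog :: "com \<Rightarrow> nexp \<Rightarrow> com" where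
  "update_prog core e = Seq (asg 6 (V 1)) (Seq (asg 7 (V 2)) (Seq core (Seq (put 4 (K 2) (K 0) (K 0) e)
     (Seq (asg 5 (V 6)) (Seq fix_prog (Seq (asg 5 (V 7)) (Seq fix_prog tick_prog)))))))"

text \<open>Here \<open>m0\<close> is the number of edges when \<theta> was last computed, and
  \<open>m0 div 2 - rem\<close> the number of updates since then. The bound on
  \<open>\<theta> * card H + exc n A H \<theta>\<close> limits the heavy vertices: it starts with at
  most \<open>2 * m0\<close>, the sum of the degrees, an update raises the sum by at most 2, and
  turning a vertex heavy does not raise it.\<close>

definition good :: "nat \<Rightarrow> (nat \<Rightarrow> nat \<Rightarrow> bool) \<Rightarrow> nat set \<Rightarrow> nat \<Rightarrow> nat \<Rightarrow> nat \<Rightarrow> nat \<Rightarrow> bool" where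
  "good n A H \<theta> rem m m0 \<longleftrightarrow> \<theta> \<ge> 1 \<and> (\<theta> - 1) ^ p < max 1 m0 \<and> m0 \<le> \<theta> ^ p \<and> rem \<le> m0 div 2 \<and>
     m \<le> m0 + (m0 div 2 - rem) \<and> m0 \<le> m + (m0 div 2 - rem) \<and> low_degree_le n A H (2 * \<theta>) \<and>
     \<theta> * card H + exc n A H \<theta> \<le> 2 * m0 + 2 * (m0 div 2 - rem) \<and> degsum n A = 2 * m \<and> H \<subseteq> {x. nb A x \<noteq> {}}"

text \<open>A unit of excess is worth \<open>\<theta> ^ q * flip_cost\<close>. A vertex that is
  moved at a degree above \<open>2 * \<theta>\<close> releases more than \<theta> units, which is
  the price of the move. The second term collects the deposits for the recomputation.\<close>

definition pot :: "nat \<Rightarrow> (nat \<Rightarrow> nat \<Rightarrow> bool) \<Rightarrow> nat set \<Rightarrow> nat \<Rightarrow> nat \<Rightarrow> nat \<Rightarrow> nat" where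
  "pot n A H \<theta> rem m0 = \<theta> ^ q * (flip_cost * exc n A H \<theta> + 16 * phase_cost * (m0 div 2 - rem))"

lemma power_p: "x ^ p = x ^ q * (x :: nat)"
  using p_Suc by (metis power_Suc2)

text \<open>Minimality of \<theta>: for \<open>\<theta> \<ge> 2\<close> one has
  \<open>\<theta> \<le> 2 * (\<theta> - 1)\<close>, at the expense of the factor
  \<open>2 ^ p \<le> 8\<close>.\<close>

lemma power_theta_le:
  fixes \<theta> m :: nat
  assumes "\<theta> \<ge> 1" "(\<theta> - 1) ^ p < max 1 m" shows "\<theta> ^ p \<le> 8 * max 1 m"
proof (cases "\<theta> = 1")
  case False
  then have "\<theta> \<le> 2 * (\<theta> - 1)" using assms(1) by simp
  then have "\<theta> ^ p \<le> (2 * (\<theta> - 1)) ^ p" by (rule power_mono) simp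
  also have "\<dots> = 2 ^ p * (\<theta> - 1) ^ p" by (rule power_mult_distrib)
  also have "\<dots> \<le> 8 * (\<theta> - 1) ^ p" using p23 by (intro mult_right_mono) auto
  also have "\<dots> \<le> 8 * max 1 m" using assms by simp
  finally show ?thesis .
qed simp

text \<open>At most \<open>m0 div 2\<close> updates have passed, so \<open>m\<close> and
  \<open>m0\<close> stay within a factor of 2, and
  \<open>\<theta> * card H \<le> 3 * m0 \<le> 3 * \<theta> ^ p\<close>.\<close>

lemma good_bounds:
  assumes "good n A H \<theta> rem m m0"
  shows "card H \<le> 3 * \<theta> ^ q" "m \<le> 2 * \<theta> ^ p" "m0 \<le> 2 * m" "\<theta> ^ p \<le> 8 * max 1 m0"
    "1 \<le> \<theta> ^ q" "\<theta> \<le> \<theta> ^ p"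
proof -
  note G = assms[unfolded good_def]
  have t1: "\<theta> \<ge> 1" using G by simp
  have "\<theta> * card H + exc n A H \<theta> \<le> 2 * m0 + 2 * (m0 div 2 - rem)" using G by blast
  then have "\<theta> * card H \<le> 2 * m0 + 2 * (m0 div 2 - rem)" by (rule add_leD1)
  also have "\<dots> \<le> 3 * m0" by linarith
  also have "m0 \<le> \<theta> ^ p" using G by blast
  also have "\<theta> ^ p = \<theta> * \<theta> ^ q" by (simp add: power_p)
  finally have "\<theta> * card H \<le> \<theta> * (3 * \<theta> ^ q)" by (simp add: algebra_simps mult_le_mono2)
  then show "card H \<le> 3 * \<theta> ^ q" using t1 by simp
  have mm: "m \<le> m0 + (m0 div 2 - rem)" "m0 \<le> m + (m0 div 2 - rem)" "m0 \<le> \<theta> ^ p" using G by blast+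
  show "m \<le> 2 * \<theta> ^ p" using mm(1,3) by linarith
  show "m0 \<le> 2 * m" using mm(2) by linarith
  show "\<theta> ^ p \<le> 8 * max 1 m0" by (rule power_theta_le) (use G in auto)
  show "1 \<le> \<theta> ^ q" "\<theta> \<le> \<theta> ^ p" using t1 p23 by (auto intro: self_le_power)
qed

end

context ds
begin

text \<open>Turning \<open>w\<close> heavy removes an excess of at least
  \<open>\<theta> + 1\<close>, because its degree exceeds \<open>2 * \<theta>\<close>, and adds only
  \<theta> for the new heavy vertex. An isolated vertex has no excess, so it may leave
  \<open>H\<close> freely.\<close>

lemma exc_fixed:
  assumes w: "w < n" and H: "finite H" and \<theta>: "\<theta> \<ge> 1"
  shows "exc n A (fixed_H A \<theta> w H) \<theta> + (if w \<notin> H \<and> 2 * \<theta> < card (nb A w) then \<theta> + 1 else 0) \<le> exc n A H \<theta>"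
    "\<theta> * card (fixed_H A \<theta> w H) + exc n A (fixed_H A \<theta> w H) \<theta> \<le> \<theta> * card H + exc n A H \<theta>"
    "card (fixed_H A \<theta> w H) \<le> card H + 1"
proof -
  consider (iso) "nb A w = {}" | (flip) "nb A w \<noteq> {}" "w \<notin> H \<and> 2 * \<theta> < card (nb A w)" | (no) "nb A w \<noteq> {}" "\<not> (w \<notin> H \<and> 2 * \<theta> < card (nb A w))" by blast
  then have "exc n A (fixed_H A \<theta> w H) \<theta> + (if w \<notin> H \<and> 2 * \<theta> < card (nb A w) then \<theta> + 1 else 0) \<le> exc n A H \<theta> \<and>
    \<theta> * card (fixed_H A \<theta> w H) + exc n A (fixed_H A \<theta> w H) \<theta> \<le> \<theta> * card H + exc n A H \<theta> \<and> card (fixed_H A \<theta> w H) \<le> card H + 1"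
  proof cases
    case iso
    have "exc n A (H - {w}) \<theta> = exc n A H \<theta>"
      unfolding exc_def by (rule sum.mono_neutral_right) (use iso in auto)
    moreover have "card (H - {w}) \<le> card H" by (rule card_Diff1_le)
    ultimately show ?thesis using iso by (auto simp: fixed_H_def)
  next
    case flip
    have "{..<n} - H = insert w ({..<n} - insert w H)" using flip w by auto
    then have "exc n A H \<theta> = (card (nb A w) - \<theta>) + exc n A (insert w H) \<theta>"
      unfolding exc_def by (metis (no_types, lifting) Diff_iff finite_Diff finite_lessThan insertI1 sum.insert)
    moreover have "card (nb A w) - \<theta> \<ge> \<theta> + 1"
    proof -
      have "2 * \<theta> < card (nb A w)" using flip by blast
      then show ?thesis by linarith
    qed
    ultimately show ?thesis using flip H by (auto simp: fixed_H_def algebra_simps)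
  qed (auto simp: fixed_H_def)
  then show "exc n A (fixed_H A \<theta> w H) \<theta> + (if w \<notin> H \<and> 2 * \<theta> < card (nb A w) then \<theta> + 1 else 0) \<le> exc n A H \<theta>"
    "\<theta> * card (fixed_H A \<theta> w H) + exc n A (fixed_H A \<theta> w H) \<theta> \<le> \<theta> * card H + exc n A H \<theta>"
    "card (fixed_H A \<theta> w H) \<le> card H + 1" by auto
qed

text \<open>Only the two endpoints change their degrees, each by at most one upwards.\<close>

lemma exc_change:
  assumes "\<And>x. x \<notin> {u, v} \<Longrightarrow> nb A' x = nb A x" "\<And>x. card (nb A' x) \<le> card (nb A x) + 1"
  shows "exc n A' H \<theta> \<le> exc n A H \<theta> + 2"
proof -
  have "exc n A' H \<theta> \<le> (\<Sum>x\<in>{..<n} - H. (card (nb A x) - \<theta>) + of_bool (x \<in> {u, v}))"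
    unfolding exc_def
  proof (rule sum_mono)
    fix x assume "x \<in> {..<n} - H"
    show "card (nb A' x) - \<theta> \<le> card (nb A x) - \<theta> + of_bool (x \<in> {u, v})"
      using assms(1)[of x] assms(2)[of x] by (cases "x \<in> {u, v}") auto
  qed
  also have "\<dots> = exc n A H \<theta> + card (({..<n} - H) \<inter> {u, v})"
    unfolding sum.distrib exc_def
    by (simp only: of_bool_def sum.inter_restrict[symmetric, OF finite_Diff[OF finite_lessThan]] card_eq_sum)
  also have "card (({..<n} - H) \<inter> {u, v}) \<le> card {u, v}" by (intro card_mono) auto
  also have "card {u, v} \<le> 2" by (simp add: card_insert_if)
  finally show ?thesis by simp
qed

text \<open>The degrees add up to \<open>2 * m\<close>, and each of these vertices contributes more
  than \<open>y\<close>.\<close>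

lemma many_heavy:
  assumes "y \<ge> 1" "degsum n A = 2 * m" "m \<le> y ^ p"
  shows "y * card {x. x < n \<and> y < card (nb A x)} \<le> 2 * m" "card {x. x < n \<and> y < card (nb A x)} \<le> 2 * y ^ q"
proof -
  let ?X = "{x. x < n \<and> y < card (nb A x)}"
  have "y * card ?X = (\<Sum>x\<in>?X. y)" by simp
  also have "\<dots> \<le> (\<Sum>x\<in>?X. card (nb A x))" by (rule sum_mono) auto
  also have "\<dots> \<le> degsum n A" unfolding degsum_def by (rule sum_mono2) auto
  finally show 1: "y * card ?X \<le> 2 * m" using assms(2) by simp
  also have "\<dots> \<le> y * (2 * y ^ q)" using assms(3) by (simp add: power_p algebra_simps)
  finally show "card ?X \<le> 2 * y ^ q" using assms(1) by simp
qed

text \<open>Old and new threshold are of the same order. The vertices that change sides are among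
  the old heavy ones, at most \<open>10 * \<theta> ^ q\<close>, and the new ones, at most
  \<open>2 * y ^ q \<le> 800 * \<theta> ^ q\<close>; each move costs the order of
  \<open>\<theta> ^ q * \<theta>\<close>.\<close>

lemma run_phase:
  assumes R: "Rep M A H U {} s1 s2 s3" and m: "fst s3 = m" "8 * m + 8 < W" "m \<le> 3 * \<theta> ^ p" "degsum n A = 2 * m"
    and \<rho>: "\<rho> 0 = n" and B: "fits B m \<theta>" "card U \<le> 2 * m"
    and D: "\<theta> \<ge> 1" "low_degree_le n A H (20 * \<theta>)" "card H \<le> 10 * \<theta> ^ q" and U: "H \<subseteq> U"
  shows "\<exists>\<rho>' M' y. runs B phase_prog \<rho> M (phase_cost * (\<theta> ^ q * (\<theta> ^ q * \<theta>))) \<rho>' M' \<and>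
     Rep M' A {x \<in> U. y < card (nb A x)} U {} (y - 1) (m div 2) s3 \<and> y \<ge> 1 \<and> (y - 1) ^ p < max 1 m \<and> m \<le> y ^ p"
proof -
  note L = Rep_lrep[OF R]
  have t1: "1 \<le> \<theta> ^ q" using D(1) by simp
  have cH: "card H \<le> 1000 * \<theta> ^ q" using D(3) by linarith
  have dsum: "degsum n A \<le> 2 * m + 2" using m by simp
  have cU: "card U \<le> 2 * m + 4" using B by simp
  let ?Z = "keys (fam_of A H U {}) A H"
  have Z: "finite ?Z" "card ?Z \<le> B" using fitsD[OF B(1) L(9) dsum L(5) cH D(2) L(6) cU, of "{}"] by auto
  have s: "supp M \<subseteq> ?Z" using R rep_supp unfolding Rep_def by blast
  have sc: "(4, 0, 0, 0) \<in> ?Z" "(4, 1, 0, 0) \<in> ?Z" by (auto simp: keys_def)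
  define \<rho>1 where "\<rho>1 = \<rho>(8 := 1)"
  have 1: "runs B (asg 8 (K 1)) \<rho> M 10 \<rho>1 M"
    unfolding \<rho>1_def by (rule runs_asg'[where \<rho> = \<rho>, OF \<rho> Z s]) simp_all
  have z1: "\<rho>1 0 = n" "\<rho>1 8 = 1" using \<rho> by (simp_all add: \<rho>1_def)
  have p0: "(1 - 1) ^ p < max 1 m" using p23 by auto
  obtain \<rho>2 y where 2: "runs B theta_loop \<rho>1 M ((y + 1 - 1) * 100) \<rho>2 M" and y8: "\<rho>2 8 = y" and e2: "\<forall>r<10. r \<noteq> 8 \<longrightarrow> \<rho>2 r = \<rho>1 r"
    and y1: "y \<ge> 1" and y2: "(y - 1) ^ p < max 1 m" and y3: "m \<le> y ^ p"
    using run_theta_loop[OF R m(1,2) Z s z1 _ p0] by auto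
  have z2: "\<rho>2 0 = n" using e2 z1 by simp
  have yp: "y ^ p \<le> 8 * max 1 m" by (rule power_theta_le[OF y1 y2])
  have yy: "y \<le> y ^ p" using y1 p23 by (intro self_le_power) auto
  have yW: "y < W" using yy yp m(2) by (auto simp: max_def split: if_splits)
  \<comment> \<open>Minimality of \<open>y\<close> gives \<open>y ^ p \<le> 8 * max 1 m\<close>, and
    \<open>m \<le> 3 * \<theta> ^ p\<close>; the resulting factor 24 is below
    \<open>20 ^ p\<close>.\<close>
  have y\<theta>: "y \<le> 20 * \<theta>"
  proof -
    have "1 \<le> \<theta> ^ p" using D(1) by simp
    then have "max 1 m \<le> 3 * \<theta> ^ p" using m(3) by auto
    then have "y ^ p \<le> 24 * \<theta> ^ p" using yp by linarith
    also have "24 * \<theta> ^ p \<le> 20 ^ p * \<theta> ^ p" using p23 by (intro mult_right_mono) auto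
    also have "\<dots> = (20 * \<theta>) ^ p" by (simp only: power_mult_distrib)
    finally have le: "y ^ p \<le> (20 * \<theta>) ^ p" .
    show ?thesis
    proof (rule ccontr)
      assume "\<not> y \<le> 20 * \<theta>"
      then have "(20 * \<theta>) ^ p < y ^ p" using p23 by (intro power_strict_mono) auto
      then show False using le by simp
    qed
  qed
  have yq: "y ^ q \<le> 400 * \<theta> ^ q"
  proof -
    have "y ^ q \<le> (20 * \<theta>) ^ q" using y\<theta> by (rule power_mono) simp
    also have "\<dots> \<le> 400 * \<theta> ^ q" using q12 by (auto simp: power_mult_distrib)
    finally show ?thesis .
  qed
  let ?M3 = "M((4, 0, 0, 0) := y - 1)"
  have 3: "runs B (put 4 (K 0) (K 0) (K 0) (Op Minus (V 8) (K 1))) \<rho>2 M 100 \<rho>2 ?M3"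
    by (rule runs_put'[where \<rho> = \<rho>2 and Z = ?Z, OF z2 Z s sc(1)]) (use y8 yW in \<open>simp_all\<close>)
  have s3': "supp ?M3 \<subseteq> ?Z" by (rule supp_fun_upd[OF s sc(1)])
  have R3: "Rep ?M3 A H U {} (y - 1) s2 s3" by (rule Rep_scalar(1)[OF R]) (use yW in simp)
  have m3: "?M3 (4, 2, 0, 0) = m" using R3 m(1) by (simp add: Rep_def rep_def)
  let ?M4 = "?M3((4, 1, 0, 0) := m div 2)"
  have 4: "runs B (put 4 (K 1) (K 0) (K 0) (Op Divide edges_exp (K 2))) \<rho>2 ?M3 100 \<rho>2 ?M4"
  proof (rule runs_put'[where \<rho> = \<rho>2 and Z = ?Z, OF z2 Z s3' sc(2)])
    have "m mod W = m" "m div 2 mod W = m div 2" "2 mod W = 2" "2 mod N = 2" using m(2) W_ge(4) n2 by auto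
    then show "m div 2 = ev \<rho>2 ?M3 (Op Divide edges_exp (K 2))" using m3 by (simp add: edges_exp_def)
    show "(4::nat, 1, 0, 0) = (4 mod 16, ev \<rho>2 ?M3 (K 1) mod N, ev \<rho>2 ?M3 (K 0) mod N, ev \<rho>2 ?M3 (K 0) mod N)" by simp
  qed (simp add: edges_exp_def)
  have R4: "Rep ?M4 A H U {} (y - 1) (m div 2) s3" by (rule Rep_scalar(2)[OF R3]) (use m(2) in simp)
  have s4: "supp ?M4 \<subseteq> ?Z" by (rule supp_fun_upd[OF s3' sc(2)])
  define \<rho>5 where "\<rho>5 = \<rho>2(9 := 0)"
  have 5: "runs B (asg 9 (K 0)) \<rho>2 ?M4 10 \<rho>5 ?M4"
    unfolding \<rho>5_def by (rule runs_asg'[where \<rho> = \<rho>2, OF z2 Z s4]) simp_all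
  have z5: "\<rho>5 0 = n" "\<rho>5 8 = y" "\<rho>5 9 = 0" using z2 y8 by (simp_all add: \<rho>5_def)
  let ?X = "{x. x < n \<and> y < card (nb A x)}"
  have cX: "card ?X \<le> 2 * y ^ q" by (rule many_heavy[OF y1 m(4) y3])
  have cHX: "card (H \<union> ?X) \<le> 810 * \<theta> ^ q" using card_Un_le[of H ?X] cX yq D(3) by linarith
  then have cHX1: "card (H \<union> ?X) + 1 \<le> 1000 * \<theta> ^ q" using t1 by linarith
  have R5: "Rep ?M4 A (scanned A y (snd s3) H 0) U {} (y - 1) (m div 2) s3" using R4 by (simp add: scanned_def)
  obtain \<rho>6 M6 where 6: "runs B (loop scan_cond scan_body) \<rho>5 ?M4 ((\<Sum>k=0..<card U. 1000 + (if must_flip A y H (snd s3 k) then flip_cost * (\<theta> ^ q * \<theta>) else 0)) + 200) \<rho>6 M6"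
    and R6: "Rep M6 A (scanned A y (snd s3) H (card U)) U {} (y - 1) (m div 2) s3"
    using run_scan[OF L(6) L(5) y\<theta> yW B(1) dsum cU D(1,2) cHX1 R5 _ z5] by auto
  have el: "M (2, n + 1, k, 0) = snd s3 k" for k using R by (simp add: Rep_def rep_def)
  have bij: "bij_betw (snd s3) {..<card U} U" using lrep_bij[OF L(3)] el by simp
  have sc6: "scanned A y (snd s3) H (card U) = {x \<in> U. y < card (nb A x)}"
  proof -
    have "snd s3 ` {..<card U} = U" using bij by (simp add: bij_betw_def)
    moreover have "(\<exists>k<card U. snd s3 k = w) \<longleftrightarrow> w \<in> snd s3 ` {..<card U}" for w by auto
    ultimately have im: "(\<exists>k<card U. snd s3 k = w) \<longleftrightarrow> w \<in> U" for w by simp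
    then show ?thesis using U unfolding scanned_def by blast
  qed
  \<comment> \<open>The list enumerates \<open>U\<close> without repetition, so positions with a
    move inject into the vertices heavy before or after.\<close>
  have fl: "card {k \<in> {..<card U}. must_flip A y H (snd s3 k)} \<le> 810 * \<theta> ^ q"
  proof -
    have "card {k \<in> {..<card U}. must_flip A y H (snd s3 k)} \<le> card (H \<union> ?X)"
    proof (rule card_inj_on_le[where f = "snd s3"])
      show "inj_on (snd s3) {k \<in> {..<card U}. must_flip A y H (snd s3 k)}"
        using bij by (auto simp: bij_betw_def intro: inj_on_subset)
      show "snd s3 ` {k \<in> {..<card U}. must_flip A y H (snd s3 k)} \<subseteq> H \<union> ?X"
        using bij L(6) by (auto simp: bij_betw_def must_flip_def)
      show "finite (H \<union> ?X)" using L(5) finite_subset by auto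
    qed
    then show ?thesis using cHX by simp
  qed
  have T6: "(\<Sum>k=0..<card U. 1000 + (if must_flip A y H (snd s3 k) then flip_cost * (\<theta> ^ q * \<theta>) else 0)) \<le>
     1000 * card U + 810 * \<theta> ^ q * (flip_cost * (\<theta> ^ q * \<theta>))"
  proof -
    have "(\<Sum>k=0..<card U. 1000 + (if must_flip A y H (snd s3 k) then flip_cost * (\<theta> ^ q * \<theta>) else 0)) =
      1000 * card U + card {k \<in> {..<card U}. must_flip A y H (snd s3 k)} * (flip_cost * (\<theta> ^ q * \<theta>))"
      by (simp add: sum.distrib sum.If_cases Int_def atLeast0LessThan)
    also have "\<dots> \<le> 1000 * card U + 810 * \<theta> ^ q * (flip_cost * (\<theta> ^ q * \<theta>))"
      using fl by (intro add_left_mono mult_right_mono) auto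
    finally show ?thesis .
  qed
  define X where "X = \<theta> ^ q * (\<theta> ^ q * \<theta>)"
  have X1: "\<theta> \<le> X" "1 \<le> X" "\<theta> ^ q * \<theta> \<le> X"
  proof -
    have "1 * (\<theta> ^ q * \<theta>) \<le> X" unfolding X_def using t1 by (intro mult_right_mono) auto
    then show x: "\<theta> ^ q * \<theta> \<le> X" by simp
    have "1 * \<theta> \<le> \<theta> ^ q * \<theta>" using t1 by (intro mult_right_mono) auto
    with x show y: "\<theta> \<le> X" by linarith
    show "1 \<le> X" using y D(1) by linarith
  qed
  have c1: "card U \<le> 6 * X"
  proof -
    have "card U \<le> 6 * \<theta> ^ p" using B(2) m(3) by simp
    also have "\<theta> ^ p = \<theta> ^ q * \<theta>" by (simp add: power_p)
    finally show ?thesis using X1 by simp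
  qed
  have c2: "810 * \<theta> ^ q * (flip_cost * (\<theta> ^ q * \<theta>)) = 810 * flip_cost * X" by (simp add: X_def algebra_simps)
  have time: "10 + ((y + 1 - 1) * 100 + (100 + (100 + (10 + ((\<Sum>k=0..<card U. 1000 + (if must_flip A y H (snd s3 k) then flip_cost * (\<theta> ^ q * \<theta>) else 0)) + 200)))))
    \<le> phase_cost * X"
  proof -
    have "phase_cost * X = 20000 * X + 811 * flip_cost * X" by (simp add: phase_cost_def algebra_simps)
    moreover have "810 * flip_cost * X \<le> 811 * flip_cost * X" by simp
    moreover have "(y + 1 - 1) * 100 \<le> 2000 * X" using y\<theta> X1 by simp
    moreover have "420 \<le> 500 * X" using X1 by simp
    ultimately show ?thesis using T6 c1 c2 by linarith
  qed
  have "runs B phase_prog \<rho> M (phase_cost * X) \<rho>6 M6"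
    unfolding phase_prog_def
    by (rule runs_mono[OF runs_seq[OF 1 runs_seq[OF 2 runs_seq[OF 3 runs_seq[OF 4 runs_seq[OF 5 6]]]]] time order_refl])
  then show ?thesis using R6 y1 y2 y3 unfolding sc6 X_def by blast
qed

text \<open>The edge update is carried out for the old partition; afterwards only \<open>u\<close>
  and \<open>v\<close> can violate the invariant. When the counter is exhausted, \<theta> is
  recomputed, and since no light vertex then exceeds the new threshold, the potential drops to 0 and
  its former value pays for the work.\<close>

lemma run_update:
  assumes R: "Rep M A H {x. nb A x \<noteq> {}} {} (\<theta> - 1) rem s3" and s3: "fst s3 = m" and G: "good n A H \<theta> rem m m0"
    and \<rho>: "\<rho> 0 = n" "\<rho> 1 = u" "\<rho> 2 = v" and uv: "u < n" "v < n" and g: "graph n A'"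
    and core: "\<And>\<rho>. \<rho> 0 = n \<Longrightarrow> \<rho> 1 = u \<Longrightarrow> \<rho> 2 = v \<Longrightarrow> \<exists>\<rho>' M'. runs B core \<rho> M (prim_cost * (1400 * \<theta> ^ q)) \<rho>' M' \<and>
       Rep M' A' H {x. nb A x \<noteq> {}} {} (\<theta> - 1) rem s3 \<and> (\<forall>r<10. r \<notin> {3, 4} \<longrightarrow> \<rho>' r = \<rho> r)"
    and e: "\<And>\<rho> M. M (4, 2, 0, 0) = m \<Longrightarrow> ev \<rho> M e = m'" "ecost e \<le> 60"
    and nb: "\<And>x. x \<notin> {u, v} \<Longrightarrow> nb A' x = nb A x" "\<And>x. card (nb A' x) \<le> card (nb A x) + 1"
    and m': "degsum n A' = 2 * m'" "m' \<le> m + 1" "m \<le> m' + 1" and B: "fits B m' \<theta>"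
  shows "\<exists>\<rho>' M' t H' \<theta>' rem' s3' m0'. runs B (update_prog core e) \<rho> M t \<rho>' M' \<and>
     Rep M' A' H' {x. nb A' x \<noteq> {}} {} (\<theta>' - 1) rem' s3' \<and> fst s3' = m' \<and> good n A' H' \<theta>' rem' m' m0' \<and>
     t + pot n A' H' \<theta>' rem' m0' \<le> update_cost * \<theta> ^ q + pot n A H \<theta> rem m0"
proof -
  note L = Rep_lrep[OF R]
  note GB = good_bounds[OF G] and GD = G[unfolded good_def]
  let ?U = "{x. nb A x \<noteq> {}}" and ?U' = "{x. nb A' x \<noteq> {}}"
  have t1: "\<theta> \<ge> 1" using GD by simp
  have tp: "1 \<le> \<theta> ^ p" using t1 by simp
  have finH: "finite H" using L(5) finite_subset by blast
  have finU: "finite ?U" using L(6) finite_subset by blast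
  have card_supp: "card {x. nb A'' x \<noteq> {}} \<le> degsum n A''" if g'': "graph n A''" for A''
  proof -
    have "card {x. nb A'' x \<noteq> {}} = (\<Sum>x\<in>{x. nb A'' x \<noteq> {}}. 1)" by simp
    also have "\<dots> \<le> (\<Sum>x\<in>{x. nb A'' x \<noteq> {}}. card (nb A'' x))"
      by (rule sum_mono) (use g'' in \<open>auto simp: Suc_le_eq card_gt_0_iff\<close>)
    also have "\<dots> \<le> (\<Sum>x<n. card (nb A'' x))"
      by (rule sum_mono2) (use g'' in \<open>auto simp: nb_def graph_def\<close>)
    finally show ?thesis by (simp add: degsum_def)
  qed
  have cU: "card ?U \<le> 2 * m' + 2" using card_supp[OF L(9)] GD m' by simp
  have mW: "8 * m' + 8 < W" "2 * \<theta> < W"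
  proof -
    have "degsum n A' \<le> (\<Sum>x<n. n)"
      unfolding degsum_def
    proof (rule sum_mono)
      fix x show "card (nb A' x) \<le> n" using card_mono[OF _ nb_subset[OF g, of x]] by simp
    qed
    then have mn: "2 * m' \<le> n * n" using m' by simp
    have nn: "n * n \<le> n ^ 4"
    proof -
      have "n ^ 2 \<le> n ^ 4" using n2 by (intro power_increasing) auto
      then show ?thesis by (simp add: power2_eq_square)
    qed
    have n4: "16 \<le> n ^ 4" using power_mono[OF n2, of 4] by simp
    have W: "4096 * n ^ 4 \<le> W" by (rule W_ge)
    show "8 * m' + 8 < W" using mn nn n4 W by linarith
    have "\<theta> \<le> 8 * max 1 m0" using GB(4,6) by linarith
    moreover have "max 1 m0 \<le> 2 * m' + 3" using GB(3) m'(3) by (auto simp: max_def)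
    then have "8 * max 1 m0 \<le> 8 * (2 * m' + 3)" by (rule mult_le_mono2)
    ultimately have "\<theta> \<le> 8 * (2 * m' + 3)" by (blast intro: order_trans)
    then have "2 * \<theta> \<le> 32 * m' + 48" by simp
    also have "\<dots> < W" using mn nn n4 W by linarith
    finally show "2 * \<theta> < W" .
  qed
  have dsum: "degsum n A' \<le> 2 * m' + 2" using m' by simp
  have lowA': "low_degree_le n A' H (20 * \<theta>)"
    unfolding low_degree_le_def
  proof (intro allI impI)
    fix x assume "x < n" "x \<notin> H"
    then have "card (nb A x) \<le> 2 * \<theta>" using GD by (simp add: low_degree_le_def)
    then show "card (nb A' x) \<le> 20 * \<theta>" using nb(2)[of x] t1 by simp
  qed
  have tq: "1 \<le> \<theta> ^ q" by (rule GB)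
  have cH: "card H \<le> 1000 * \<theta> ^ q" "card H + 1 \<le> 1000 * \<theta> ^ q" using GB(1) tq by linarith+
  have dA: "degsum n A \<le> 2 * m' + 2" using GD m' by simp
  have lowA: "low_degree_le n A H (20 * \<theta>)" using GD by (auto simp: low_degree_le_def intro: order_trans)
  have cU4: "card ?U \<le> 2 * m' + 4" using cU by simp
  let ?Z = "keys (fam_of A H ?U {}) A H"
  have Z: "finite ?Z" "card ?Z \<le> B" using fitsD[OF B L(9) dA L(5) cH(1) lowA L(6) cU4, of "{}"] by auto
  have sM: "supp M \<subseteq> ?Z" using R rep_supp unfolding Rep_def by blast
  have uvW: "u mod W = u" "v mod W = v" using uv W_ge(3) by auto
  define \<rho>1 where "\<rho>1 = \<rho>(6 := u)"
  have 1: "runs B (asg 6 (V 1)) \<rho> M 10 \<rho>1 M"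
    unfolding \<rho>1_def by (rule runs_asg'[where \<rho> = \<rho>, OF \<rho>(1) Z sM]) (use \<rho> uvW in simp_all)
  have z1: "\<rho>1 0 = n" "\<rho>1 1 = u" "\<rho>1 2 = v" "\<rho>1 6 = u" using \<rho> by (simp_all add: \<rho>1_def)
  define \<rho>2 where "\<rho>2 = \<rho>1(7 := v)"
  have 2: "runs B (asg 7 (V 2)) \<rho>1 M 10 \<rho>2 M"
    unfolding \<rho>2_def by (rule runs_asg'[where \<rho> = \<rho>1, OF z1(1) Z sM]) (use z1 uvW in simp_all)
  have z2: "\<rho>2 0 = n" "\<rho>2 1 = u" "\<rho>2 2 = v" "\<rho>2 6 = u" "\<rho>2 7 = v" using z1 by (simp_all add: \<rho>2_def)
  obtain \<rho>3 M3 where 3: "runs B core \<rho>2 M (prim_cost * (1400 * \<theta> ^ q)) \<rho>3 M3"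
    and R3: "Rep M3 A' H ?U {} (\<theta> - 1) rem s3" and e3: "\<forall>r<10. r \<notin> {3, 4} \<longrightarrow> \<rho>3 r = \<rho>2 r"
    using core[OF z2(1-3)] by blast
  have z3: "\<rho>3 0 = n" "\<rho>3 6 = u" "\<rho>3 7 = v" using e3 z2 by simp_all
  let ?Z3 = "keys (fam_of A' H ?U {}) A' H"
  have Z3: "finite ?Z3" "card ?Z3 \<le> B" using fitsD[OF B g dsum L(5) cH(1) lowA' L(6) cU4, of "{}"] by auto
  have sM3: "supp M3 \<subseteq> ?Z3" using R3 rep_supp unfolding Rep_def by blast
  have sc: "(4, 2, 0, 0) \<in> ?Z3" by (simp add: keys_def)
  let ?M4 = "M3((4, 2, 0, 0) := m')"
  have m3: "M3 (4, 2, 0, 0) = m" using R3 s3 by (simp add: Rep_def rep_def)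
  have 4: "runs B (put 4 (K 2) (K 0) (K 0) e) \<rho>3 M3 200 \<rho>3 ?M4"
  proof (rule runs_put'[where \<rho> = \<rho>3 and Z = ?Z3, OF z3(1) Z3 sM3 sc])
    have "2 mod W = 2" "2 mod N = 2" using W_ge(4) n2 by auto
    then show "(4::nat, 2, 0, 0) = (4 mod 16, ev \<rho>3 M3 (K 2) mod N, ev \<rho>3 M3 (K 0) mod N, ev \<rho>3 M3 (K 0) mod N)" by simp
    show "m' = ev \<rho>3 M3 e" using e(1)[where M = M3 and \<rho> = \<rho>3, OF m3] by simp
  qed (use e(2) in simp)
  have R4: "Rep ?M4 A' H ?U {} (\<theta> - 1) rem (m', snd s3)" by (rule Rep_scalar(3)[OF R3]) (use mW in simp)
  have sM4: "supp ?M4 \<subseteq> ?Z3" by (rule supp_fun_upd[OF sM3 sc])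
  define \<rho>5 where "\<rho>5 = \<rho>3(5 := u)"
  have 5: "runs B (asg 5 (V 6)) \<rho>3 ?M4 10 \<rho>5 ?M4"
    unfolding \<rho>5_def by (rule runs_asg'[where \<rho> = \<rho>3, OF z3(1) Z3 sM4]) (use z3 uvW in simp_all)
  have z5: "\<rho>5 0 = n" "\<rho>5 5 = u" "\<rho>5 7 = v" using z3 by (simp_all add: \<rho>5_def)
  let ?H1 = "fixed_H A' \<theta> u H" and ?U1 = "fixed_U A' u ?U"
  let ?f1 = "if u \<notin> H \<and> 2 * \<theta> < card (nb A' u) then flip_cost * (\<theta> ^ q * \<theta>) else 0"
  have cU1: "card ?U + 1 \<le> 2 * m' + 4" using cU by simp
  obtain \<rho>6 M6 s6 where 6: "runs B fix_prog \<rho>5 ?M4 (10000 + ?f1) \<rho>6 M6"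
    and R6: "Rep M6 A' ?H1 ?U1 {} (\<theta> - 1) rem s6" and s6: "fst s6 = m'" and e6: "\<forall>r<10. r \<notin> {1, 2, 3, 4} \<longrightarrow> \<rho>6 r = \<rho>5 r"
    using run_fix[OF R4 uv(1) z5(1,2) B dsum cU1 t1 lowA' cH(2) mW(2)] by (metis fst_conv)
  have z6: "\<rho>6 0 = n" "\<rho>6 7 = v" using e6 z5 by simp_all
  have low1: "low_degree_le n A' ?H1 (20 * \<theta>)"
    using lowA' by (auto simp: low_degree_le_def fixed_H_def)
  note X1 = exc_fixed[OF uv(1) finH t1, of A']
  have fin1: "finite ?H1" using finH by (auto simp: fixed_H_def)
  have cH1: "card ?H1 + 1 \<le> 1000 * \<theta> ^ q" "card ?H1 \<le> 1000 * \<theta> ^ q" using X1(3) GB(1) tq by linarith+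
  have cU1': "card ?U1 \<le> card ?U + 1"
    using finU card_Diff1_le[of ?U u] by (auto simp: fixed_U_def card_insert_if intro: le_SucI)
  have cU1'': "card ?U1 + 1 \<le> 2 * m' + 4" "card ?U1 \<le> 2 * m' + 4" using cU1' cU by linarith+
  let ?Z6 = "keys (fam_of A' ?H1 ?U1 {}) A' ?H1"
  have Z6: "finite ?Z6" "card ?Z6 \<le> B"
    using fitsD[OF B g dsum Rep_lrep(5)[OF R6] cH1(2) low1 Rep_lrep(6)[OF R6] cU1''(2), of "{}"] by auto
  have sM6: "supp M6 \<subseteq> ?Z6" using R6 rep_supp unfolding Rep_def by blast
  define \<rho>7 where "\<rho>7 = \<rho>6(5 := v)"
  have 7: "runs B (asg 5 (V 7)) \<rho>6 M6 10 \<rho>7 M6"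
    unfolding \<rho>7_def by (rule runs_asg'[where \<rho> = \<rho>6, OF z6(1) Z6 sM6]) (use z6 uvW in simp_all)
  have z7: "\<rho>7 0 = n" "\<rho>7 5 = v" using z6 by (simp_all add: \<rho>7_def)
  let ?H2 = "fixed_H A' \<theta> v ?H1" and ?U2 = "fixed_U A' v ?U1"
  let ?f2 = "if v \<notin> ?H1 \<and> 2 * \<theta> < card (nb A' v) then flip_cost * (\<theta> ^ q * \<theta>) else 0"
  obtain \<rho>8 M8 s8 where 8: "runs B fix_prog \<rho>7 M6 (10000 + ?f2) \<rho>8 M8"
    and R8: "Rep M8 A' ?H2 ?U2 {} (\<theta> - 1) rem s8" and s8: "fst s8 = m'" and e8: "\<forall>r<10. r \<notin> {1, 2, 3, 4} \<longrightarrow> \<rho>8 r = \<rho>7 r"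
    using run_fix[OF R6 uv(2) z7 B dsum cU1''(1) t1 low1 cH1(1) mW(2)] s6 by metis
  have z8: "\<rho>8 0 = n" using e8 z7 by simp
  note X2 = exc_fixed[OF uv(2) fin1 t1, of A']
  have low2: "low_degree_le n A' ?H2 (20 * \<theta>)" using low1 by (auto simp: low_degree_le_def fixed_H_def)
  have cH2: "card ?H2 \<le> 10 * \<theta> ^ q" "card ?H2 \<le> 1000 * \<theta> ^ q" using X1(3) X2(3) GB(1) tq by linarith+
  have U2: "?U2 = ?U'"
  proof (rule set_eqI)
    fix z
    show "z \<in> ?U2 \<longleftrightarrow> z \<in> ?U'" using nb(1)[of z] by (cases "z \<in> {u, v}") (auto simp: fixed_U_def)
  qed
  have HU: "?H2 \<subseteq> ?U'"
  proof
    fix x assume x: "x \<in> ?H2"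
    show "x \<in> ?U'"
    proof (cases "x \<in> {u, v}")
      case True
      then show ?thesis using x by (auto simp: fixed_H_def split: if_splits)
    next
      case False
      then have "x \<in> H" using x by (auto simp: fixed_H_def split: if_splits)
      then show ?thesis using GD nb(1)[OF False] by auto
    qed
  qed
  have exc2: "exc n A' ?H2 \<theta> + (if v \<notin> ?H1 \<and> 2 * \<theta> < card (nb A' v) then \<theta> + 1 else 0) + (if u \<notin> H \<and> 2 * \<theta> < card (nb A' u) then \<theta> + 1 else 0) \<le> exc n A H \<theta> + 2"
    using X1(1) X2(1) exc_change[where u = u and v = v, OF nb, where H = H and \<theta> = \<theta>] by linarith
  have Hexc: "\<theta> * card ?H2 + exc n A' ?H2 \<theta> \<le> \<theta> * card H + exc n A H \<theta> + 2"
    using X1(2) X2(2) exc_change[where u = u and v = v, OF nb, where H = H and \<theta> = \<theta>] by linarith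
  \<comment> \<open>Each move is charged to the excess of at least \<open>\<theta> + 1\<close> that
    it releases. The additive term stems from the rise of the excess by the new edge.\<close>
  have flips: "?f1 + ?f2 + \<theta> ^ q * (flip_cost * exc n A' ?H2 \<theta>) \<le> \<theta> ^ q * (flip_cost * exc n A H \<theta>) + 2 * flip_cost * \<theta> ^ q"
  proof -
    define a where "a = (if u \<notin> H \<and> 2 * \<theta> < card (nb A' u) then \<theta> + 1 else 0)"
    define b where "b = (if v \<notin> ?H1 \<and> 2 * \<theta> < card (nb A' v) then \<theta> + 1 else 0)"
    have fa: "?f1 \<le> \<theta> ^ q * (flip_cost * a)" by (simp add: a_def algebra_simps)
    have fb: "?f2 \<le> \<theta> ^ q * (flip_cost * b)" by (simp add: b_def algebra_simps)
    have "\<theta> ^ q * (flip_cost * (exc n A' ?H2 \<theta> + b + a)) \<le> \<theta> ^ q * (flip_cost * (exc n A H \<theta> + 2))"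
      using exc2 unfolding a_def b_def by (intro mult_left_mono) auto
    then show ?thesis using fa fb by (simp add: algebra_simps)
  qed
  have low2': "low_degree_le n A' ?H2 (2 * \<theta>)"
    unfolding low_degree_le_def
  proof (intro allI impI)
    fix x assume x: "x < n" "x \<notin> ?H2"
    show "card (nb A' x) \<le> 2 * \<theta>"
    proof (cases "x \<in> {u, v}")
      case True
      then show ?thesis using x by (auto simp: fixed_H_def split: if_splits)
    next
      case False
      then have "x \<notin> H" using x by (auto simp: fixed_H_def split: if_splits)
      then show ?thesis using GD x nb(1)[OF False] by (simp add: low_degree_le_def)
    qed
  qed
  have cU': "card ?U' \<le> 2 * m'" using card_supp[OF g] m'(1) by simp
  then have cU'4: "card ?U' \<le> 2 * m' + 4" by simp
  note R8' = R8[unfolded U2]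
  let ?Z8 = "keys (fam_of A' ?H2 ?U' {}) A' ?H2"
  have Z8: "finite ?Z8" "card ?Z8 \<le> B"
    using fitsD[OF B g dsum Rep_lrep(5)[OF R8'] cH2(2) low2 Rep_lrep(6)[OF R8'] cU'4, of "{}"] by auto
  have sM8: "supp M8 \<subseteq> ?Z8" using R8' rep_supp unfolding Rep_def by blast
  have rW: "rem < W" and r8: "M8 (4, 1, 0, 0) = rem" "M8 (4, Suc 0, 0, 0) = rem"
    using R8' by (auto simp: Rep_def rep_def)
  have evrem: "ev \<rho>8 M8 rem_exp = rem" using r8 rW by (simp add: rem_exp_def)
  let ?t0 = "prim_cost * (1400 * \<theta> ^ q) + 20240 + ?f1 + ?f2"
  have pre: "runs B (update_prog core e) \<rho> M (?t0 + t) \<rho>' M'" if "runs B tick_prog \<rho>8 M8 t \<rho>' M'" for t \<rho>' M'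
    unfolding update_prog_def
    by (rule runs_mono[OF runs_seq[OF 1 runs_seq[OF 2 runs_seq[OF 3 runs_seq[OF 4 runs_seq[OF 5 runs_seq[OF 6 runs_seq[OF 7 runs_seq[OF 8 that]]]]]]]]])
      auto
  show ?thesis
  proof (cases "rem = 0")
    case False
    have sc8: "(4, 1, 0, 0) \<in> ?Z8" by (simp add: keys_def)
    let ?M9 = "M8((4, 1, 0, 0) := rem - 1)"
    have 9: "runs B (put 4 (K 1) (K 0) (K 0) (Op Minus rem_exp (K 1))) \<rho>8 M8 200 \<rho>8 ?M9"
      by (rule runs_put'[where \<rho> = \<rho>8 and Z = ?Z8, OF z8 Z8 sM8 sc8]) (use evrem rW in \<open>simp_all, simp add: rem_exp_def\<close>)
    have "runs B tick_prog \<rho>8 M8 (1 + ecost rem_exp + 200) \<rho>8 ?M9"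
      unfolding tick_prog_def by (rule runs_cond) (use z8 evrem False 9 in auto)
    then have tick: "runs B tick_prog \<rho>8 M8 300 \<rho>8 ?M9" by (rule runs_mono) (simp_all add: rem_exp_def)
    have R9: "Rep ?M9 A' ?H2 ?U' {} (\<theta> - 1) (rem - 1) s8" by (rule Rep_scalar(2)[OF R8']) (use rW in simp)
    have el: "m0 div 2 - (rem - 1) = Suc (m0 div 2 - rem)" using GD False by linarith
    have r: "rem \<le> m0 div 2" "m \<le> m0 + (m0 div 2 - rem)" "m0 \<le> m + (m0 div 2 - rem)"
      "\<theta> * card H + exc n A H \<theta> \<le> 2 * m0 + 2 * (m0 div 2 - rem)" using GD by blast+
    have "rem - 1 \<le> m0 div 2" "m' \<le> m0 + Suc (m0 div 2 - rem)" "m0 \<le> m' + Suc (m0 div 2 - rem)"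
      using r(1-3) m' by linarith+
    moreover have "\<theta> * card ?H2 + exc n A' ?H2 \<theta> \<le> 2 * m0 + 2 * Suc (m0 div 2 - rem)" using Hexc r(4) unfolding mult_Suc_right by linarith
    ultimately have gd: "good n A' ?H2 \<theta> (rem - 1) m' m0"
      unfolding good_def el using GD m'(1) low2' HU by blast
    have "?t0 + 300 + pot n A' ?H2 \<theta> (rem - 1) m0 \<le> update_cost * \<theta> ^ q + pot n A H \<theta> rem m0"
    proof -
      have p1: "pot n A' ?H2 \<theta> (rem - 1) m0 = \<theta> ^ q * (flip_cost * exc n A' ?H2 \<theta>) + \<theta> ^ q * (16 * phase_cost * (m0 div 2 - rem)) + 16 * phase_cost * \<theta> ^ q"
        unfolding pot_def el by (simp add: algebra_simps)
      have p2: "pot n A H \<theta> rem m0 = \<theta> ^ q * (flip_cost * exc n A H \<theta>) + \<theta> ^ q * (16 * phase_cost * (m0 div 2 - rem))"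
        unfolding pot_def by (simp add: algebra_simps)
      have p3: "update_cost * \<theta> ^ q = prim_cost * (1400 * \<theta> ^ q) + 30000 * \<theta> ^ q + 2 * flip_cost * \<theta> ^ q + 16 * phase_cost * \<theta> ^ q"
        by (simp add: update_cost_def algebra_simps)
      have "30000 \<le> 30000 * \<theta> ^ q" using tq by simp
      then show ?thesis using flips unfolding p1 p2 p3 by linarith
    qed
    then show ?thesis using pre[OF tick] R9 s8 gd by blast
  next
    case True
    have m3: "m' \<le> 3 * \<theta> ^ p" using GB(2) m'(2) tp by linarith
    have lowH2: "low_degree_le n A' ?H2 (20 * \<theta>)" by (rule low2)
    obtain \<rho>9 M9 y where 9: "runs B phase_prog \<rho>8 M8 (phase_cost * (\<theta> ^ q * (\<theta> ^ q * \<theta>))) \<rho>9 M9"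
      and R9: "Rep M9 A' {x \<in> ?U'. y < card (nb A' x)} ?U' {} (y - 1) (m' div 2) s8"
      and y: "y \<ge> 1" "(y - 1) ^ p < max 1 m'" "m' \<le> y ^ p"
      using run_phase[where \<rho> = \<rho>8, OF R8' s8 mW(1) m3 m'(1) z8 B cU' t1 lowH2 cH2(1) HU] by blast
    have "runs B tick_prog \<rho>8 M8 (1 + ecost rem_exp + phase_cost * (\<theta> ^ q * (\<theta> ^ q * \<theta>))) \<rho>9 M9"
      unfolding tick_prog_def by (rule runs_cond) (use z8 evrem True 9 in auto)
    then have tick: "runs B tick_prog \<rho>8 M8 (100 + phase_cost * (\<theta> ^ q * (\<theta> ^ q * \<theta>))) \<rho>9 M9"
      by (rule runs_mono) (simp_all add: rem_exp_def)
    let ?H3 = "{x \<in> ?U'. y < card (nb A' x)}"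
    have H3: "?H3 = {x. x < n \<and> y < card (nb A' x)}"
    proof -
      have "x < n" if "nb A' x \<noteq> {}" for x using that g by (auto simp: nb_def graph_def)
      moreover have "nb A' x \<noteq> {}" if "y < card (nb A' x)" for x using that by auto
      ultimately show ?thesis by blast
    qed
    have ex0: "exc n A' ?H3 y = 0" unfolding exc_def H3 by auto
    have gd: "good n A' ?H3 y (m' div 2) m' m'"
      unfolding good_def ex0
      using y m'(1) many_heavy(1)[OF y(1) m'(1) y(3)] H3 by (auto simp: low_degree_le_def)
    have pot0: "pot n A' ?H3 y (m' div 2) m' = 0" unfolding pot_def ex0 by simp
    have tot: "?t0 + (100 + phase_cost * (\<theta> ^ q * (\<theta> ^ q * \<theta>))) \<le> update_cost * \<theta> ^ q + pot n A H \<theta> rem m0"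
    proof -
      have p2: "pot n A H \<theta> rem m0 = \<theta> ^ q * (flip_cost * exc n A H \<theta>) + 16 * phase_cost * \<theta> ^ q * (m0 div 2)"
        unfolding pot_def True by (simp add: algebra_simps)
      have p3: "update_cost * \<theta> ^ q = prim_cost * (1400 * \<theta> ^ q) + 30000 * \<theta> ^ q + 2 * flip_cost * \<theta> ^ q + 16 * phase_cost * \<theta> ^ q"
        by (simp add: update_cost_def algebra_simps)
      \<comment> \<open>From
        \<open>\<theta> ^ p \<le> 8 * max 1 m0 \<le> 16 * (m0 div 2 + 1)\<close>: the recomputation
        is covered by the deposits of the \<open>m0 div 2\<close> earlier updates and of the present
        one. This is the origin of the factor 16.\<close>
      have "\<theta> ^ q * \<theta> = \<theta> ^ p" by (simp add: power_p)
      also have "\<dots> \<le> 8 * max 1 m0" by (rule GB)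
      also have "8 * max 1 m0 \<le> 16 * (m0 div 2 + 1)" by (auto simp: max_def)
      finally have "phase_cost * \<theta> ^ q * (\<theta> ^ q * \<theta>) \<le> phase_cost * \<theta> ^ q * (16 * (m0 div 2 + 1))"
        by (intro mult_left_mono) auto
      also have "\<dots> = 16 * phase_cost * \<theta> ^ q * (m0 div 2) + 16 * phase_cost * \<theta> ^ q" by (simp add: algebra_simps)
      finally have ph: "phase_cost * (\<theta> ^ q * (\<theta> ^ q * \<theta>)) \<le> 16 * phase_cost * \<theta> ^ q * (m0 div 2) + 16 * phase_cost * \<theta> ^ q"
        by (simp add: algebra_simps)
      have "30000 \<le> 30000 * \<theta> ^ q" using tq by simp
      then show ?thesis using flips ph unfolding p2 p3 by linarith
    qed
    then have "?t0 + (100 + phase_cost * (\<theta> ^ q * (\<theta> ^ q * \<theta>))) + pot n A' ?H3 y (m' div 2) m' \<le> update_cost * \<theta> ^ q + pot n A H \<theta> rem m0"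
      unfolding pot0 by simp
    then show ?thesis using pre[OF tick] R9 s8 gd by blast
  qed
qed

end

section \<open>From the update procedures to maintainability\<close>

definition adj :: "nat set set \<Rightarrow> nat \<Rightarrow> nat \<Rightarrow> bool" where
  "adj E x y \<longleftrightarrow> {x, y} \<in> E"

definition edge_set :: "nat \<Rightarrow> nat set set \<Rightarrow> bool" where
  "edge_set n E \<longleftrightarrow> (\<forall>e\<in>E. e \<subseteq> {..<n} \<and> card e = 2)"

lemma finite_edge_set: "edge_set n E \<Longrightarrow> finite E"
  by (rule finite_subset[of _ "Pow {..<n}"]) (auto simp: edge_set_def)

lemma adj_insert: "adj (insert {u, v} E) = add_edge (adj E) u v"
  by (auto simp: adj_def add_edge_def fun_eq_iff doubleton_eq_iff)

lemma adj_delete: "adj (E - {{u, v}}) = del_edge (adj E) u v"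
  by (auto simp: adj_def del_edge_def fun_eq_iff doubleton_eq_iff)

lemma adj_empty: "adj {} = (\<lambda>_ _. False)"
  by (auto simp: adj_def fun_eq_iff)

lemma degsum_add:
  assumes "addable n A u v" shows "degsum n (add_edge A u v) = degsum n A + 2"
proof -
  have uv: "u < n" "v < n" "u \<noteq> v" "v \<notin> nb A u" "u \<notin> nb A v" and g: "graph n A"
    using assms by (auto simp: addable_def nb_def graph_def)
  have "degsum n (add_edge A u v) = (\<Sum>x<n. card (nb A x) + ((if x = u then 1 else 0) + (if x = v then 1 else 0)))"
    unfolding degsum_def nb_add[OF uv(3)]
    by (rule sum.cong) (use uv g in auto)
  also have "\<dots> = degsum n A + 2" using uv by (simp add: sum.distrib degsum_def)
  finally show ?thesis .
qed

lemma degsum_del: "graph n A \<Longrightarrow> A u v \<Longrightarrow> degsum n A = degsum n (del_edge A u v) + 2"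
  using degsum_add[OF addable_del] add_del_edge by metis

lemma degsum_adj_le:
  assumes "graph n A" shows "degsum n A \<le> n * n"
proof -
  have "degsum n A \<le> (\<Sum>x<n. n)"
    unfolding degsum_def
  proof (rule sum_mono)
    fix x show "card (nb A x) \<le> n" using card_mono[OF _ nb_subset[OF assms, of x]] by simp
  qed
  then show ?thesis by simp
qed

lemma finite_subgraphs: "finite X \<Longrightarrow> finite E \<Longrightarrow> finite {H. subgraph H (X, E) \<and> Q H}"
  by (rule finite_subset[of _ "Pow X \<times> Pow E"]) (auto simp: subgraph_def)

text \<open>Copies that avoid \<open>e\<close> are the copies in the graph without \<open>e\<close>.
  Hence an edge query is a difference of two counts.\<close>

lemma subgraph_count_split:
  assumes "finite X" "finite E"
  shows "subgraph_count (X, E) P = subgraph_count (X, E - {e}) P + subgraph_count_edge (X, E) P e"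
proof -
  let ?A = "{H. subgraph H (X, E - {e}) \<and> isomorphic H P}" and ?B = "{H. subgraph H (X, E) \<and> isomorphic H P \<and> e \<in> snd H}"
  have "{H. subgraph H (X, E) \<and> isomorphic H P} = ?A \<union> ?B" by (auto simp: subgraph_def)
  moreover have "?A \<inter> ?B = {}" by (auto simp: subgraph_def)
  ultimately show ?thesis
    unfolding subgraph_count_def subgraph_count_edge_def
    using finite_subgraphs[OF assms(1), of "E - {e}" "\<lambda>H. isomorphic H P"] finite_subgraphs[OF assms, of "\<lambda>H. isomorphic H P \<and> e \<in> snd H"] assms(2)
    by (simp add: card_Un_disjoint)
qed

definition count_exp :: nexp where "count_exp = R 0 (K 0) (K 0) (K 0)"

text \<open>The key \<open>(0, 0, 0, 0)\<close> has address 0 for every \<open>n\<close>, so the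
  count is read without an address computation.\<close>

definition count_com :: "nat \<Rightarrow> com" where
  "count_com \<kappa> = Assign 0 (Bin Divide (Mem (Const 0)) (Const \<kappa>))"

context pattern
begin

definition query_com :: "nat \<Rightarrow> com" where
  "query_com \<kappa> = Seq (asg 6 count_exp) (Seq del_prog (Seq (asg 7 count_exp) (Seq ins_prog
     (asg 0 (Op Divide (Op Minus (V 6) (V 7)) (K \<kappa>))))))"

definition dyn_structure :: "nat \<Rightarrow> data_structure" where
  "dyn_structure \<kappa> = Data_Structure (update_prog ins_prog edges_inc) (update_prog del_prog edges_dec)
     (query_com \<kappa>) (count_com \<kappa>)"

end

context ds
begin

text \<open>Speaks of the memory and the edge set \<open>F\<close> only. It can thus be handed from
  one call to the next, although each call runs on a machine with a different graph.\<close>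

definition Inv :: "nat set set \<Rightarrow> memory \<Rightarrow> nat \<Rightarrow> bool" where
  "Inv F \<mu> \<Phi> \<longleftrightarrow> (\<exists>M H \<theta> rem s3 m0. \<mu> = mem_of N M \<and>
     Rep M (adj F) H {x. nb (adj F) x \<noteq> {}} {} (\<theta> - 1) rem s3 \<and> fst s3 = card F \<and>
     good n (adj F) H \<theta> rem (card F) m0 \<and> \<Phi> = pot n (adj F) H \<theta> rem m0)"

text \<open>Storing \<open>\<theta> - 1\<close> makes the zero memory represent the empty graph with
  threshold 1.\<close>

lemma Inv_empty: "Inv {} (\<lambda>_. 0) 0"
proof -
  let ?A = "\<lambda>_ _. False" and ?M = "\<lambda>_::key. 0::nat"
  have U: "{x. nb ?A x \<noteq> {}} = {}" by (simp add: nb_def)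
  have r: "Rep ?M ?A {} {} {} (1 - 1) 0 (0, \<lambda>_. 0)"
    unfolding Rep_def rep_def
    using lrep_empty emb_empty tab_empty W_pos by (auto simp: graph_def fam_of_def nb_def supp_def)
  have g: "good n ?A {} 1 0 0 0"
    using p23 by (auto simp: good_def low_degree_le_def exc_def degsum_def nb_def)
  have "pot n ?A {} 1 0 0 = 0" by (simp add: pot_def exc_def nb_def)
  then show ?thesis
    unfolding Inv_def adj_empty U using r g mem_of_zero[of N]
    by (intro exI[of _ ?M] exI[of _ "{}"] exI[of _ 1] exI[of _ 0] exI[of _ "(0, \<lambda>_. 0)"] exI[of _ 0]) simp
qed

lemma card_keys:
  assumes "graph n A" "H \<subseteq> {..<n}" "U \<subseteq> {..<n}" "S \<subseteq> {..<n}"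
  shows "card (keys (fam_of A H U S) A H) \<le> 4 + 3 * (degsum n A + card H + card U + card S) + card {k. tab n A H k \<noteq> 0}"
proof -
  let ?f = "fam_of A H U S"
  let ?S = "{(0, 0, 0, 0), (4, 0, 0, 0), (4, 1, 0, 0), (4, 2, 0, 0)} :: key set" and ?L = "\<Union>j<N. list_keys j (?f j)"
  have fin: "finite (?f j)" for j
    using assms nb_subset[OF assms(1), of j] finite_subset[of _ "{..<n}"] by (auto simp: fam_of_def)
  have "card ?L \<le> (\<Sum>j<N. card (list_keys j (?f j)))" by (rule card_UN_le) simp
  also have "\<dots> \<le> (\<Sum>j<N. 3 * card (?f j))" by (intro sum_mono card_list_keys fin)
  also have "(\<Sum>j<N. 3 * card (?f j)) = (\<Sum>j<n. 3 * card (?f j)) + 3 * card H + 3 * card U + 3 * card S"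
  proof -
    have eq: "{..<N} = {..<Suc (Suc (Suc n))}" by auto
    show ?thesis unfolding eq sum.lessThan_Suc by (simp add: fam_of_def)
  qed
  also have "(\<Sum>j<n. 3 * card (?f j)) = 3 * degsum n A"
    unfolding degsum_def sum_distrib_left by (rule sum.cong) (auto simp: fam_of_def)
  finally have L: "card ?L \<le> 3 * (degsum n A + card H + card U + card S)" by simp
  have "card (keys ?f A H) \<le> card (?S \<union> ?L) + card {k. tab n A H k \<noteq> 0}"
    unfolding keys_def by (rule card_Un_le)
  also have "card (?S \<union> ?L) \<le> card ?S + card ?L" by (rule card_Un_le)
  also have "card ?S \<le> 4" by (simp add: card_insert_if)
  finally show ?thesis using L by linarith
qed

lemma exec_of_runs: "runs B c \<rho> M t \<rho>' M' \<Longrightarrow> \<exists>t' k. exec E W c (\<rho>, mem_of N M) t' k (\<rho>', mem_of N M') \<and> t' \<le> t \<and> k \<le> B"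
  by (simp add: runs_def)

text \<open>The time bounds refer to the graph after the operation:
  \<open>m0 \<le> 2 * m \<le> 2 * (m' + 1) \<le> 4 * max 1 m'\<close>, and 8 times 4 is 32.\<close>

lemma theta_le:
  assumes "good n A H \<theta> rem m m0" "m \<le> m' + 1"
  shows "\<theta> ^ p \<le> 32 * max 1 m'"
proof -
  have "\<theta> ^ p \<le> 8 * max 1 m0" "m0 \<le> 2 * m" using good_bounds[OF assms(1)] by auto
  then show ?thesis using assms(2) by (auto simp: max_def split: if_splits)
qed

lemma core_cost:
  assumes "good n A H \<theta> rem m m0"
  shows "prim_cost * ((20 * \<theta>) ^ (p - 1) + card H) \<le> prim_cost * (1400 * \<theta> ^ q)"
proof -
  have "(20 * \<theta>) ^ q \<le> 400 * \<theta> ^ q" using q12 by (auto simp: power_mult_distrib)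
  then have "(20 * \<theta>) ^ q + card H \<le> 1400 * \<theta> ^ q" using good_bounds(1)[OF assms] by linarith
  then show ?thesis by (simp add: q_def)
qed

lemma update_step:
  assumes I: "Inv F \<mu> \<Phi>" and F: "edge_set n F" and l: "legal_op n F x" and x: "is_update x"
    and B: "\<And>\<theta>. \<theta> \<ge> 1 \<Longrightarrow> \<theta> ^ p \<le> 32 * max 1 (card (apply_op x F)) \<Longrightarrow> fits B (card (apply_op x F)) \<theta>"
  shows "\<exists>t k \<rho> \<mu>' \<Phi>' \<theta>. exec E W (prog (dyn_structure \<kappa>) x) (init_regs n x, \<mu>) t k (\<rho>, \<mu>') \<and> k \<le> B \<and>
    edge_set n (apply_op x F) \<and> Inv (apply_op x F) \<mu>' \<Phi>' \<and> t + \<Phi>' \<le> update_cost * \<theta> ^ q + \<Phi> \<and>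
    \<theta> ^ p \<le> 32 * max 1 (card (apply_op x F))"
proof -
  obtain M H \<theta> rem s3 m0 where \<mu>: "\<mu> = mem_of N M" and R: "Rep M (adj F) H {x. nb (adj F) x \<noteq> {}} {} (\<theta> - 1) rem s3"
    and s3: "fst s3 = card F" and G: "good n (adj F) H \<theta> rem (card F) m0" and \<Phi>: "\<Phi> = pot n (adj F) H \<theta> rem m0"
    using I unfolding Inv_def by blast
  note L = Rep_lrep[OF R] and GD = G[unfolded good_def] and GB = good_bounds[OF G]
  let ?A = "adj F" and ?U = "{x. nb (adj F) x \<noteq> {}}"
  have fin: "finite F" by (rule finite_edge_set[OF F])
  have t1: "\<theta> \<ge> 1" using GD by blast
  have dA: "degsum n ?A = 2 * card F" using GD by blast
  have low: "low_degree_le n ?A H (2 * \<theta>)" using GD by blast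
  have low20: "low_degree_le n ?A H (20 * \<theta>)" using low by (auto simp: low_degree_le_def intro: order_trans)
  have cU: "card ?U \<le> 2 * card F"
  proof -
    have "card ?U = (\<Sum>x\<in>?U. 1)" by simp
    also have "\<dots> \<le> (\<Sum>x\<in>?U. card (nb ?A x))"
      by (rule sum_mono) (use L(9) in \<open>auto simp: Suc_le_eq card_gt_0_iff\<close>)
    also have "\<dots> \<le> (\<Sum>x<n. card (nb ?A x))"
      by (rule sum_mono2) (use L(6) in auto)
    finally show ?thesis using dA by (simp add: degsum_def)
  qed
  have cH: "card H \<le> 1000 * \<theta> ^ q" using GB(1,5) by linarith
  have D20: "20 * \<theta> \<ge> 1" using t1 by simp
  have mW: "card F + 1 < W"
  proof -
    have "2 * card F \<le> n * n" using degsum_adj_le[OF L(9)] dA by simp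
    moreover have "n * n \<le> n ^ 4"
    proof -
      have "n ^ 2 \<le> n ^ 4" using n2 by (intro power_increasing) auto
      then show ?thesis by (simp add: power2_eq_square)
    qed
    moreover have "16 \<le> n ^ 4" using power_mono[OF n2, of 4] by simp
    ultimately show ?thesis using W_ge(1) by linarith
  qed
  have e2: "2 mod W = 2" "2 mod N = 2" using W_ge(4) n2 by auto
  have fin_update: ?thesis
    if run: "\<exists>\<rho>' M' t H' \<theta>' rem' s3' m0'. runs B (prog (dyn_structure \<kappa>) x) (init_regs n x) M t \<rho>' M' \<and>
     Rep M' (adj (apply_op x F)) H' {z. nb (adj (apply_op x F)) z \<noteq> {}} {} (\<theta>' - 1) rem' s3' \<and> fst s3' = card (apply_op x F) \<and>
     good n (adj (apply_op x F)) H' \<theta>' rem' (card (apply_op x F)) m0' \<and>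
     t + pot n (adj (apply_op x F)) H' \<theta>' rem' m0' \<le> update_cost * \<theta> ^ q + pot n ?A H \<theta> rem m0"
     and es: "edge_set n (apply_op x F)" and th: "\<theta> ^ p \<le> 32 * max 1 (card (apply_op x F))"
  proof -
    obtain \<rho>' M' t H' \<theta>' rem' s3' m0' where r: "runs B (prog (dyn_structure \<kappa>) x) (init_regs n x) M t \<rho>' M'"
      and R': "Rep M' (adj (apply_op x F)) H' {z. nb (adj (apply_op x F)) z \<noteq> {}} {} (\<theta>' - 1) rem' s3'" "fst s3' = card (apply_op x F)"
        "good n (adj (apply_op x F)) H' \<theta>' rem' (card (apply_op x F)) m0'"
      and c: "t + pot n (adj (apply_op x F)) H' \<theta>' rem' m0' \<le> update_cost * \<theta> ^ q + pot n ?A H \<theta> rem m0"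
      using run by blast
    obtain t' k where ex: "exec E W (prog (dyn_structure \<kappa>) x) (init_regs n x, mem_of N M) t' k (\<rho>', mem_of N M')" "t' \<le> t" "k \<le> B"
      using exec_of_runs[OF r] by blast
    have "Inv (apply_op x F) (mem_of N M') (pot n (adj (apply_op x F)) H' \<theta>' rem' m0')"
      unfolding Inv_def using R' by blast
    then show ?thesis using ex c es th unfolding \<mu> \<Phi>
      by (intro exI[of _ t'] exI[of _ k] exI[of _ \<rho>'] exI[of _ "mem_of N M'"] exI[of _ "pot n (adj (apply_op x F)) H' \<theta>' rem' m0'"] exI[of _ \<theta>]) auto
  qed
  show ?thesis
  proof (cases x)
    case (Insert u v)
    have uv: "u < n" "v < n" "u \<noteq> v" "{u, v} \<notin> F" using l Insert by auto
    have ad: "addable n ?A u v" using uv L(9) by (simp add: addable_def adj_def)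
    have A': "adj (apply_op x F) = add_edge ?A u v" using Insert adj_insert by simp
    have c': "card (apply_op x F) = card F + 1" using Insert uv fin by simp
    have es: "edge_set n (apply_op x F)" using F uv Insert by (auto simp: edge_set_def)
    have th: "\<theta> ^ p \<le> 32 * max 1 (card (apply_op x F))" by (rule theta_le[OF G]) (simp add: c')
    have fit: "fits B (card F + 1) \<theta>" using B[OF t1 th] c' by simp
    have g': "graph n (add_edge ?A u v)" by (rule graph_add[OF ad])
    have nb1: "nb (add_edge ?A u v) z = nb ?A z" if "z \<notin> {u, v}" for z using that uv by (simp add: nb_add)
    have nb2: "card (nb (add_edge ?A u v) z) \<le> card (nb ?A z) + 1" for z
      using uv L(9) by (auto simp: nb_add card_insert_if)
    have low': "low_degree_le n (add_edge ?A u v) H (20 * \<theta>)"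
      unfolding low_degree_le_def
    proof (intro allI impI)
      fix z assume "z < n" "z \<notin> H"
      then have "card (nb ?A z) \<le> 2 * \<theta>" using low by (simp add: low_degree_le_def)
      then show "card (nb (add_edge ?A u v) z) \<le> 20 * \<theta>" using nb2[of z] t1 by linarith
    qed
    have d': "degsum n (add_edge ?A u v) = 2 * (card F + 1)" using degsum_add[OF ad] dA by simp
    let ?Z = "keys (fam_of (add_edge ?A u v) H ?U {}) (add_edge ?A u v) H"
    have Z: "finite ?Z" "card ?Z \<le> B"
      using fitsD[OF fit g' _ L(5) cH low' L(6) _ empty_subsetI] d' cU by auto
    have core: "\<exists>\<rho>' M'. runs B ins_prog \<rho> M (prim_cost * (1400 * \<theta> ^ q)) \<rho>' M' \<and>
       Rep M' (add_edge ?A u v) H ?U {} (\<theta> - 1) rem s3 \<and> (\<forall>r<10. r \<notin> {3, 4} \<longrightarrow> \<rho>' r = \<rho> r)"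
      if \<rho>: "\<rho> 0 = n" "\<rho> 1 = u" "\<rho> 2 = v" for \<rho>
    proof -
      obtain \<rho>' M' where *: "runs B ins_prog \<rho> M (prim_cost * ((20 * \<theta>) ^ (p - 1) + card H)) \<rho>' M'"
        "Rep M' (add_edge ?A u v) H ?U {} (\<theta> - 1) rem s3" "\<forall>r<10. r \<notin> {3, 4} \<longrightarrow> \<rho>' r = \<rho> r"
        using run_ins[OF R ad \<rho> Z order_refl D20 low20] by blast
      show ?thesis using runs_mono[OF *(1) core_cost[OF G] order_refl] *(2,3) by blast
    qed
    have ee: "ev \<rho> M edges_inc = card F + 1" if "M (4, 2, 0, 0) = card F" for \<rho> M
      using that e2 mW by (simp add: edges_inc_def edges_exp_def)
    have ec: "ecost edges_inc \<le> 60" by (simp add: edges_inc_def edges_exp_def)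
    have "\<exists>\<rho>' M' t H' \<theta>' rem' s3' m0'. runs B (update_prog ins_prog edges_inc) (init_regs n x) M t \<rho>' M' \<and>
     Rep M' (add_edge ?A u v) H' {z. nb (add_edge ?A u v) z \<noteq> {}} {} (\<theta>' - 1) rem' s3' \<and> fst s3' = card F + 1 \<and>
     good n (add_edge ?A u v) H' \<theta>' rem' (card F + 1) m0' \<and>
     t + pot n (add_edge ?A u v) H' \<theta>' rem' m0' \<le> update_cost * \<theta> ^ q + pot n ?A H \<theta> rem m0"
      by (rule run_update[OF R s3 G _ _ _ uv(1,2) g' core ee ec nb1 nb2 d' _ _ fit]) (auto simp: Insert)
    then have "\<exists>\<rho>' M' t H' \<theta>' rem' s3' m0'. runs B (prog (dyn_structure \<kappa>) x) (init_regs n x) M t \<rho>' M' \<and>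
     Rep M' (adj (apply_op x F)) H' {z. nb (adj (apply_op x F)) z \<noteq> {}} {} (\<theta>' - 1) rem' s3' \<and> fst s3' = card (apply_op x F) \<and>
     good n (adj (apply_op x F)) H' \<theta>' rem' (card (apply_op x F)) m0' \<and>
     t + pot n (adj (apply_op x F)) H' \<theta>' rem' m0' \<le> update_cost * \<theta> ^ q + pot n ?A H \<theta> rem m0"
      unfolding A' c' by (simp add: dyn_structure_def Insert)
    then show ?thesis by (rule fin_update[OF _ es th])
  next
    case (Delete u v)
    have uvF: "{u, v} \<in> F" using l Delete by simp
    then have a: "?A u v" by (simp add: adj_def)
    have uv: "u < n" "v < n" "u \<noteq> v" using a L(9) by (auto simp: graph_def)
    have A': "adj (apply_op x F) = del_edge ?A u v" using Delete adj_delete by simp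
    have c0: "card F \<ge> 1" using uvF fin by (auto simp: Suc_le_eq card_gt_0_iff)
    have c': "card (apply_op x F) = card F - 1" using Delete uvF fin by simp
    have es: "edge_set n (apply_op x F)" using F Delete by (auto simp: edge_set_def)
    have th: "\<theta> ^ p \<le> 32 * max 1 (card (apply_op x F))" by (rule theta_le[OF G]) (simp add: c')
    have fit: "fits B (card F - 1) \<theta>" using B[OF t1 th] c' by simp
    have g': "graph n (del_edge ?A u v)" by (rule graph_del[OF L(9)])
    have nb1: "nb (del_edge ?A u v) z = nb ?A z" if "z \<notin> {u, v}" for z using that uv by (simp add: nb_del)
    have nb2: "card (nb (del_edge ?A u v) z) \<le> card (nb ?A z) + 1" for z
    proof -
      have "card (nb (del_edge ?A u v) z) \<le> card (nb ?A z)"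
        by (rule card_mono[OF finite_nb[OF L(9)]]) (auto simp: nb_def del_edge_def)
      then show ?thesis by simp
    qed
    have d': "degsum n (del_edge ?A u v) = 2 * (card F - 1)" using degsum_del[OF L(9) a] dA by simp
    let ?Z = "keys (fam_of ?A H ?U {}) ?A H"
    have Z: "finite ?Z" "card ?Z \<le> B"
    proof -
      have "degsum n ?A \<le> 2 * (card F - 1) + 2" "card ?U \<le> 2 * (card F - 1) + 4" using dA cU c0 by linarith+
      from fitsD[OF fit L(9) this(1) L(5) cH low20 L(6) this(2) empty_subsetI]
      show "finite ?Z" "card ?Z \<le> B" by auto
    qed
    have core: "\<exists>\<rho>' M'. runs B del_prog \<rho> M (prim_cost * (1400 * \<theta> ^ q)) \<rho>' M' \<and>
       Rep M' (del_edge ?A u v) H ?U {} (\<theta> - 1) rem s3 \<and> (\<forall>r<10. r \<notin> {3, 4} \<longrightarrow> \<rho>' r = \<rho> r)"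
      if \<rho>: "\<rho> 0 = n" "\<rho> 1 = u" "\<rho> 2 = v" for \<rho>
    proof -
      obtain \<rho>' M' where *: "runs B del_prog \<rho> M (prim_cost * ((20 * \<theta>) ^ (p - 1) + card H)) \<rho>' M'"
        "Rep M' (del_edge ?A u v) H ?U {} (\<theta> - 1) rem s3" "\<forall>r<10. r \<notin> {3, 4} \<longrightarrow> \<rho>' r = \<rho> r"
        using run_del[OF R a \<rho> Z order_refl D20 low20] by blast
      show ?thesis using runs_mono[OF *(1) core_cost[OF G] order_refl] *(2,3) by blast
    qed
    have ee: "ev \<rho> M edges_dec = card F - 1" if "M (4, 2, 0, 0) = card F" for \<rho> M
      using that e2 mW by (simp add: edges_dec_def edges_exp_def)
    have ec: "ecost edges_dec \<le> 60" by (simp add: edges_dec_def edges_exp_def)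
    have "\<exists>\<rho>' M' t H' \<theta>' rem' s3' m0'. runs B (update_prog del_prog edges_dec) (init_regs n x) M t \<rho>' M' \<and>
     Rep M' (del_edge ?A u v) H' {z. nb (del_edge ?A u v) z \<noteq> {}} {} (\<theta>' - 1) rem' s3' \<and> fst s3' = card F - 1 \<and>
     good n (del_edge ?A u v) H' \<theta>' rem' (card F - 1) m0' \<and>
     t + pot n (del_edge ?A u v) H' \<theta>' rem' m0' \<le> update_cost * \<theta> ^ q + pot n ?A H \<theta> rem m0"
      by (rule run_update[OF R s3 G _ _ _ uv(1,2) g' core ee ec nb1 nb2 d' _ _ fit]) (use c0 in \<open>auto simp: Delete\<close>)
    then have "\<exists>\<rho>' M' t H' \<theta>' rem' s3' m0'. runs B (prog (dyn_structure \<kappa>) x) (init_regs n x) M t \<rho>' M' \<and>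
     Rep M' (adj (apply_op x F)) H' {z. nb (adj (apply_op x F)) z \<noteq> {}} {} (\<theta>' - 1) rem' s3' \<and> fst s3' = card (apply_op x F) \<and>
     good n (adj (apply_op x F)) H' \<theta>' rem' (card (apply_op x F)) m0' \<and>
     t + pot n (adj (apply_op x F)) H' \<theta>' rem' m0' \<le> update_cost * \<theta> ^ q + pot n ?A H \<theta> rem m0"
      unfolding A' c' by (simp add: dyn_structure_def Delete)
    then show ?thesis by (rule fin_update[OF _ es th])
  qed (use x in auto)
qed

text \<open>The temporary deletion leaves partition, threshold and counters alone, so the invariant
  returns with the same potential. Nothing is amortized: the cost is that of two edge updates with a
  fixed partition.\<close>

lemma query_step:
  assumes I: "Inv F \<mu> \<Phi>" and F: "edge_set n F" and l: "{u, v} \<in> F" and \<kappa>: "\<kappa> > 0" "\<kappa> < 4 ^ 12"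
    and B: "\<And>\<theta>. \<theta> \<ge> 1 \<Longrightarrow> \<theta> ^ p \<le> 32 * max 1 (card F) \<Longrightarrow> fits B (card F) \<theta>"
  shows "\<exists>t k \<rho> \<mu>' \<theta>. exec E W (query_com \<kappa>) (init_regs n (Query u v), \<mu>) t k (\<rho>, \<mu>') \<and> k \<le> B \<and>
    Inv F \<mu>' \<Phi> \<and> t \<le> (2800 * prim_cost + 1000) * \<theta> ^ q \<and> \<theta> ^ p \<le> 32 * max 1 (card F) \<and>
    \<rho> 0 = (emb n (adj F) - emb n (adj (F - {{u, v}}))) div \<kappa>"
proof -
  obtain M H \<theta> rem s3 m0 where \<mu>: "\<mu> = mem_of N M" and R: "Rep M (adj F) H {x. nb (adj F) x \<noteq> {}} {} (\<theta> - 1) rem s3"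
    and s3: "fst s3 = card F" and G: "good n (adj F) H \<theta> rem (card F) m0" and \<Phi>: "\<Phi> = pot n (adj F) H \<theta> rem m0"
    using I unfolding Inv_def by blast
  note L = Rep_lrep[OF R] and GD = G[unfolded good_def] and GB = good_bounds[OF G]
  let ?A = "adj F" and ?U = "{x. nb (adj F) x \<noteq> {}}"
  have t1: "\<theta> \<ge> 1" using GD by blast
  have dA: "degsum n ?A = 2 * card F" using GD by blast
  have low: "low_degree_le n ?A H (2 * \<theta>)" using GD by blast
  have low20: "low_degree_le n ?A H (20 * \<theta>)" using low by (auto simp: low_degree_le_def intro: order_trans)
  have cU: "card ?U \<le> 2 * card F"
  proof -
    have "card ?U = (\<Sum>x\<in>?U. 1)" by simp
    also have "\<dots> \<le> (\<Sum>x\<in>?U. card (nb ?A x))"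
      by (rule sum_mono) (use L(9) in \<open>auto simp: Suc_le_eq card_gt_0_iff\<close>)
    also have "\<dots> \<le> (\<Sum>x<n. card (nb ?A x))"
      by (rule sum_mono2) (use L(6) in auto)
    finally show ?thesis using dA by (simp add: degsum_def)
  qed
  have cH: "card H \<le> 1000 * \<theta> ^ q" using GB(1,5) by linarith
  have D20: "20 * \<theta> \<ge> 1" using t1 by simp
  have a: "?A u v" using l by (simp add: adj_def)
  have uv: "u < n" "v < n" "u \<noteq> v" using a L(9) by (auto simp: graph_def)
  have th: "\<theta> ^ p \<le> 32 * max 1 (card F)" by (rule theta_le[OF G]) simp
  have fit: "fits B (card F) \<theta>" by (rule B[OF t1 th])
  let ?Z = "keys (fam_of ?A H ?U {}) ?A H"
  have Z: "finite ?Z" "card ?Z \<le> B"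
    using fitsD[OF fit L(9) _ L(5) cH low20 L(6) _ empty_subsetI] dA cU by auto
  have sM: "supp M \<subseteq> ?Z" using R rep_supp unfolding Rep_def by blast
  have evc: "ev \<rho> M' count_exp = emb n A'" if "Rep M' A' H' U' S' s1 s2 s3'" for \<rho> M' A' H' U' S' s1 s2 s3'
    using that emb_less[of A'] by (simp add: count_exp_def Rep_def rep_def)
  let ?\<rho> = "init_regs n (Query u v)"
  have z: "?\<rho> 0 = n" "?\<rho> 1 = u" "?\<rho> 2 = v" by simp_all
  define \<rho>1 where "\<rho>1 = ?\<rho>(6 := emb n ?A)"
  have 1: "runs B (asg 6 count_exp) ?\<rho> M 100 \<rho>1 M"
    unfolding \<rho>1_def by (rule runs_asg'[where \<rho> = ?\<rho>, OF z(1) Z sM]) (use evc[OF R] in \<open>simp_all, simp add: count_exp_def\<close>)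
  have z1: "\<rho>1 0 = n" "\<rho>1 1 = u" "\<rho>1 2 = v" "\<rho>1 6 = emb n ?A" by (simp_all add: \<rho>1_def)
  let ?Adel = "del_edge ?A u v"
  obtain \<rho>2 M2 where 2: "runs B del_prog \<rho>1 M (prim_cost * ((20 * \<theta>) ^ (p - 1) + card H)) \<rho>2 M2"
    and R2: "Rep M2 ?Adel H ?U {} (\<theta> - 1) rem s3" and e2: "\<forall>r<10. r \<notin> {3, 4} \<longrightarrow> \<rho>2 r = \<rho>1 r"
    using run_del[OF R a z1(1-3) Z order_refl D20 low20] by blast
  have z2: "\<rho>2 0 = n" "\<rho>2 1 = u" "\<rho>2 2 = v" "\<rho>2 6 = emb n ?A" using z1 e2 by simp_all
  have "keys (fam_of ?Adel H ?U {}) ?Adel H \<subseteq> ?Z"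
    by (rule keys_fam_mono) (use L in \<open>auto simp: del_edge_def intro!: tab_mono\<close>)
  then have sM2: "supp M2 \<subseteq> ?Z" using R2 rep_supp unfolding Rep_def by blast
  define \<rho>3 where "\<rho>3 = \<rho>2(7 := emb n ?Adel)"
  have 3: "runs B (asg 7 count_exp) \<rho>2 M2 100 \<rho>3 M2"
    unfolding \<rho>3_def by (rule runs_asg'[where \<rho> = \<rho>2, OF z2(1) Z sM2]) (use evc[OF R2] in \<open>simp_all, simp add: count_exp_def\<close>)
  have z3: "\<rho>3 0 = n" "\<rho>3 1 = u" "\<rho>3 2 = v" "\<rho>3 6 = emb n ?A" "\<rho>3 7 = emb n ?Adel" using z2 by (simp_all add: \<rho>3_def)
  have ad: "addable n ?Adel u v" by (rule addable_del[OF L(9) a])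
  have AA: "add_edge ?Adel u v = ?A" by (rule add_del_edge[OF L(9) a])
  have low0: "low_degree_le n ?Adel H (20 * \<theta>)" by (rule low_degree_mono[OF low20 L(9)]) (auto simp: del_edge_def)
  have kZ: "keys (fam_of (add_edge ?Adel u v) H ?U {}) (add_edge ?Adel u v) H \<subseteq> ?Z" by (simp add: AA)
  obtain \<rho>4 M4 where 4: "runs B ins_prog \<rho>3 M2 (prim_cost * ((20 * \<theta>) ^ (p - 1) + card H)) \<rho>4 M4"
    and R4: "Rep M4 ?A H ?U {} (\<theta> - 1) rem s3" and e4: "\<forall>r<10. r \<notin> {3, 4} \<longrightarrow> \<rho>4 r = \<rho>3 r"
    using run_ins[OF R2 ad z3(1-3) Z kZ D20 low0] unfolding AA by blast
  have z4: "\<rho>4 0 = n" "\<rho>4 6 = emb n ?A" "\<rho>4 7 = emb n ?Adel" using z3 e4 by simp_all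
  have sM4: "supp M4 \<subseteq> ?Z" using R4 rep_supp unfolding Rep_def by blast
  let ?r = "(emb n ?A - emb n ?Adel) div \<kappa>"
  have rW: "?r < W" "emb n ?A - emb n ?Adel < W" "\<kappa> < W"
    using emb_less[of ?A] div_le_dividend[of "emb n ?A - emb n ?Adel" \<kappa>] \<kappa> W_ge(5) by linarith+
  have ev5: "?r = ev \<rho>4 M4 (Op Divide (Op Minus (V 6) (V 7)) (K \<kappa>))"
    using z4 emb_less rW by simp
  have 5: "runs B (asg 0 (Op Divide (Op Minus (V 6) (V 7)) (K \<kappa>))) \<rho>4 M4 100 (\<rho>4(0 := ?r)) M4"
    by (rule runs_asg'[where \<rho> = \<rho>4, OF z4(1) Z sM4 ev5]) simp
  have "runs B (query_com \<kappa>) ?\<rho> M ((2800 * prim_cost + 1000) * \<theta> ^ q) (\<rho>4(0 := ?r)) M4"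
    unfolding query_com_def
  proof (rule runs_mono[OF runs_seq[OF 1 runs_seq[OF 2 runs_seq[OF 3 runs_seq[OF 4 5]]]]])
    have "(2800 * prim_cost + 1000) * \<theta> ^ q = prim_cost * (1400 * \<theta> ^ q) + prim_cost * (1400 * \<theta> ^ q) + 1000 * \<theta> ^ q"
      by (simp add: algebra_simps)
    moreover have "1000 \<le> 1000 * \<theta> ^ q" using GB(5) by simp
    ultimately show "100 + (prim_cost * ((20 * \<theta>) ^ (p - 1) + card H) + (100 + (prim_cost * ((20 * \<theta>) ^ (p - 1) + card H) + 100)))
      \<le> (2800 * prim_cost + 1000) * \<theta> ^ q"
      using core_cost[OF G] by linarith
  qed simp
  then obtain t k where ex: "exec E W (query_com \<kappa>) (?\<rho>, mem_of N M) t k (\<rho>4(0 := ?r), mem_of N M4)"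
      "t \<le> (2800 * prim_cost + 1000) * \<theta> ^ q" "k \<le> B" using exec_of_runs by blast
  have "Inv F (mem_of N M4) \<Phi>" unfolding Inv_def \<Phi> using R4 s3 G by blast
  moreover have "(\<rho>4(0 := ?r)) 0 = (emb n (adj F) - emb n (adj (F - {{u, v}}))) div \<kappa>" by (simp add: adj_delete)
  ultimately show ?thesis using ex th unfolding \<mu> by blast
qed

lemma count_step:
  assumes I: "Inv F \<mu> \<Phi>" and \<kappa>: "\<kappa> > 0" "\<kappa> < 4 ^ 12"
    and B: "\<And>\<theta>. \<theta> \<ge> 1 \<Longrightarrow> \<theta> ^ p \<le> 32 * max 1 (card F) \<Longrightarrow> fits B (card F) \<theta>"
  shows "\<exists>k \<rho>. exec E W (count_com \<kappa>) (init_regs n Count, \<mu>) 5 k (\<rho>, \<mu>) \<and> k \<le> B \<and> \<rho> 0 = emb n (adj F) div \<kappa>"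
proof -
  obtain M H \<theta> rem s3 m0 where \<mu>: "\<mu> = mem_of N M" and R: "Rep M (adj F) H {x. nb (adj F) x \<noteq> {}} {} (\<theta> - 1) rem s3"
    and s3: "fst s3 = card F" and G: "good n (adj F) H \<theta> rem (card F) m0"
    using I unfolding Inv_def by blast
  note L = Rep_lrep[OF R] and GD = G[unfolded good_def] and GB = good_bounds[OF G]
  let ?A = "adj F" and ?U = "{x. nb (adj F) x \<noteq> {}}"
  have t1: "\<theta> \<ge> 1" using GD by blast
  have dA: "degsum n ?A = 2 * card F" using GD by blast
  have low20: "low_degree_le n ?A H (20 * \<theta>)" using GD by (auto simp: low_degree_le_def intro: order_trans)
  have cU: "card ?U \<le> 2 * card F"
  proof -
    have "card ?U = (\<Sum>x\<in>?U. 1)" by simp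
    also have "\<dots> \<le> (\<Sum>x\<in>?U. card (nb ?A x))"
      by (rule sum_mono) (use L(9) in \<open>auto simp: Suc_le_eq card_gt_0_iff\<close>)
    also have "\<dots> \<le> (\<Sum>x<n. card (nb ?A x))"
      by (rule sum_mono2) (use L(6) in auto)
    finally show ?thesis using dA by (simp add: degsum_def)
  qed
  have cH: "card H \<le> 1000 * \<theta> ^ q" using GB(1,5) by linarith
  have th: "\<theta> ^ p \<le> 32 * max 1 (card F)" by (rule theta_le[OF G]) simp
  have fit: "fits B (card F) \<theta>" by (rule B[OF t1 th])
  let ?Z = "keys (fam_of ?A H ?U {}) ?A H"
  have Z: "finite ?Z" "card ?Z \<le> B"
    using fitsD[OF fit L(9) _ L(5) cH low20 L(6) _ empty_subsetI] dA cU by auto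
  have sM: "supp M \<subseteq> ?Z" using R rep_supp unfolding Rep_def by blast
  have k: "mem_space \<mu> \<le> B" using sp_le[OF sM Z] by (simp add: sp_def \<mu>)
  have "mem_of N M 0 = M (0, 0, 0, 0)"
    using mem_of_adr[of "(0, 0, 0, 0)" N M] by (simp add: box_def)
  then have m0: "\<mu> 0 = emb n ?A" using R by (simp add: \<mu> Rep_def rep_def)
  let ?s = "(init_regs n Count, \<mu>)"
  have "\<kappa> mod W = \<kappa>" "emb n ?A mod W = emb n ?A" using \<kappa> W_ge(5) emb_less by simp_all
  moreover have "emb n ?A div \<kappa> mod W = emb n ?A div \<kappa>"
    using emb_less[of ?A] div_le_dividend[of "emb n ?A" \<kappa>] by (meson le_less_trans mod_less)
  ultimately have e: "eval E W ?s (Bin Divide (Mem (Const 0)) (Const \<kappa>)) = emb n ?A div \<kappa>" using m0 by simp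
  have c5: "1 + expr_cost (Bin Divide (Mem (Const 0)) (Const \<kappa>)) = 5" by simp
  have "exec E W (count_com \<kappa>) ?s 5 (mem_space \<mu>) ((init_regs n Count)(0 := emb n ?A div \<kappa>), \<mu>)"
    using exec.Assign[of E W 0 "Bin Divide (Mem (Const 0)) (Const \<kappa>)" ?s] unfolding count_com_def e c5 by simp
  then show ?thesis using k by (metis fun_upd_same)
qed

end

lemma card_edge_set_le:
  assumes "edge_set n F" shows "card F \<le> n ^ 2"
proof -
  have "F \<subseteq> (\<lambda>(x, y). {x, y}) ` ({..<n} \<times> {..<n})"
  proof
    fix e assume "e \<in> F"
    then obtain x y where "e = {x, y}" "e \<subseteq> {..<n}"
      using assms by (auto simp: edge_set_def card_2_iff)
    then show "e \<in> (\<lambda>(x, y). {x, y}) ` ({..<n} \<times> {..<n})" by auto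
  qed
  then have "card F \<le> card ({..<n} \<times> {..<n})" by (meson card_image_le card_mono finite_SigmaI finite_imageI finite_lessThan le_trans)
  then show ?thesis by (simp add: power2_eq_square)
qed

text \<open>The constants match \<open>fits\<close>: tables are needed up to light degree
  \<open>D = 20 * \<theta>\<close>, where \<open>20 ^ p * 32 \<le> 256000\<close>, and
  \<open>2 * m + 2 \<le> 4 * m\<close> for \<open>m \<ge> 1\<close>. The space function has to
  dominate the number of edges, because the neighbourhoods themselves are stored.\<close>

locale counted_pattern = pattern p Kit nC nT tab emb
  for p Kit nC nT tab emb +
  fixes \<kappa> :: nat and P :: "'p graph" and Sp :: "nat \<Rightarrow> nat \<Rightarrow> real"
  assumes \<kappa>: "\<kappa> > 0" "\<kappa> < 4 ^ 12"
    and emb_count: "edge_set n F \<Longrightarrow> emb n (adj F) = \<kappa> * subgraph_count ({..<n}, F) P"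
    and tab_space: "\<exists>Cs. \<forall>n m A H D. n \<ge> 2 \<longrightarrow> m \<ge> 1 \<longrightarrow> graph n A \<longrightarrow> degsum n A \<le> 4 * m \<longrightarrow> H \<subseteq> {..<n} \<longrightarrow>
      low_degree_le n A H D \<longrightarrow> D \<ge> 1 \<longrightarrow> D ^ p \<le> 256000 * m \<longrightarrow> card H \<le> 1000 * D ^ (p - 1) \<longrightarrow> m \<le> n ^ 2 \<longrightarrow>
      real (card {k. tab n A H k \<noteq> 0}) \<le> Cs * Sp n m"
    and Sp_ge: "n \<ge> 2 \<Longrightarrow> m \<ge> 1 \<Longrightarrow> m \<le> n ^ 2 \<Longrightarrow> real m \<le> Sp n m"
    and Sp_nonneg: "Sp n m \<ge> 0"
begin

lemma fits_space:
  assumes ds: "ds n W p Kit nC nT tab emb" and Cs: "Cs \<ge> 0"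
    and sp: "\<forall>n m A H D. n \<ge> 2 \<longrightarrow> m \<ge> 1 \<longrightarrow> graph n A \<longrightarrow> degsum n A \<le> 4 * m \<longrightarrow> H \<subseteq> {..<n} \<longrightarrow>
      low_degree_le n A H D \<longrightarrow> D \<ge> 1 \<longrightarrow> D ^ p \<le> 256000 * m \<longrightarrow> card H \<le> 1000 * D ^ (p - 1) \<longrightarrow> m \<le> n ^ 2 \<longrightarrow>
      real (card {k. tab n A H k \<noteq> 0}) \<le> Cs * Sp n m"
    and \<theta>: "\<theta> \<ge> 1" "\<theta> ^ p \<le> 32 * max 1 m" and m: "m \<le> n ^ 2"
  shows "ds.fits n p tab (nat \<lfloor>2 * (100000 + Cs) * Sp n (max 1 m)\<rfloor>) m \<theta>"
proof -
  interpret ds E n W p Kit nC nT tab emb by (rule ds)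
  define mm where "mm = max 1 m"
  have mm: "mm \<ge> 1" "m \<le> mm" "\<theta> ^ p \<le> 32 * mm" using \<theta> by (auto simp: mm_def)
  have mn: "mm \<le> n ^ 2" using m n2 by (auto simp: mm_def Suc_le_eq)
  show ?thesis
    unfolding fits_def mm_def[symmetric]
  proof (intro allI impI)
    fix A H U S
    assume a: "graph n A" "degsum n A \<le> 2 * m + 2" "H \<subseteq> {..<n}" "card H \<le> 1000 * \<theta> ^ q" "low_degree_le n A H (20 * \<theta>)"
      "U \<subseteq> {..<n}" "card U \<le> 2 * m + 4" "S \<subseteq> {..<n}" "card S \<le> 2 * m + 2"
    have tq: "\<theta> ^ q \<le> \<theta> ^ p" using \<theta>(1) by (simp add: power_p)
    have D: "(20 * \<theta>) ^ p \<le> 256000 * mm"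
    proof -
      have "(20 * \<theta>) ^ p = 20 ^ p * \<theta> ^ p" by (rule power_mult_distrib)
      also have "\<dots> \<le> 8000 * (32 * mm)" using mm(3) p23 by (intro mult_mono) auto
      finally show ?thesis by simp
    qed
    have "\<theta> ^ q \<le> (20 * \<theta>) ^ q" by (rule power_mono) auto
    then have h: "card H \<le> 1000 * (20 * \<theta>) ^ (p - 1)" using a(4) unfolding q_def by linarith
    have "real (card {k. tab n A H k \<noteq> 0}) \<le> Cs * Sp n mm"
      using sp[rule_format, OF n2 mm(1) a(1) _ a(3,5) _ D h mn] a(2) mm \<theta>(1) by simp
    \<comment> \<open>Degrees, heavy set, \<open>U\<close> and \<open>S\<close> contribute at most
      4, 32000, 6 and 4 times \<open>mm\<close>, in total 32014 times, with three cells per element;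
      four single cells are added.\<close>
    moreover have "card (keys (fam_of A H U S) A H) \<le> 100000 * mm + card {k. tab n A H k \<noteq> 0}"
    proof -
      have "card (keys (fam_of A H U S) A H) \<le> 4 + 3 * (degsum n A + card H + card U + card S) + card {k. tab n A H k \<noteq> 0}"
        by (rule card_keys) (use a in auto)
      moreover have "degsum n A \<le> 4 * mm" "card U \<le> 6 * mm" "card S \<le> 4 * mm" using a mm by linarith+
      moreover have "card H \<le> 32000 * mm" using a(4) tq mm(3) by linarith
      ultimately have "card (keys (fam_of A H U S) A H) \<le> 4 + 3 * (degsum n A + card H + card U + card S) + card {k. tab n A H k \<noteq> 0}"
        "degsum n A + card H + card U + card S \<le> 32014 * mm" by linarith+
      moreover from this(2) have "3 * (degsum n A + card H + card U + card S) \<le> 96042 * mm" by simp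
      ultimately show ?thesis using mm(1) by linarith
    qed
    moreover have "real mm \<le> Sp n mm" by (rule Sp_ge[OF n2 mm(1) mn])
    ultimately have "real (card (keys (fam_of A H U S) A H)) \<le> 100000 * Sp n mm + Cs * Sp n mm" by linarith
    then have "real (2 * card (keys (fam_of A H U S) A H)) \<le> 2 * (100000 + Cs) * Sp n mm" by (simp add: algebra_simps)
    then show "2 * card (keys (fam_of A H U S) A H) \<le> nat \<lfloor>2 * (100000 + Cs) * Sp n mm\<rfloor>" by (rule le_nat_floor)
  qed
qed

text \<open>The hypothesis is raised to the power \<open>q / p\<close>; as this exponent is at most
  1, the constant 32 does not grow.\<close>

lemma theta_time:
  assumes "\<theta> ^ p \<le> 32 * m" "m \<ge> 1"
  shows "real (\<theta> ^ q) \<le> 32 * (real m powr (real q / real p))"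
proof (cases "\<theta> = 0")
  case True
  then show ?thesis using q12 by auto
next
  case False
  have p0: "real p > 0" using p23 by auto
  have r: "0 \<le> real q / real p" "real q / real p \<le> 1" using p23 by (auto simp: q_def)
  have "real (\<theta> ^ q) = real \<theta> powr real q" using False by (simp add: powr_realpow)
  also have "\<dots> = (real \<theta> powr real p) powr (real q / real p)" using p0 by (simp add: powr_powr)
  also have "real \<theta> powr real p = real (\<theta> ^ p)" using False by (simp add: powr_realpow)
  also have "real (\<theta> ^ p) powr (real q / real p) \<le> real (32 * m) powr (real q / real p)"
    using assms(1) r by (intro powr_mono2) (simp_all only: of_nat_le_iff of_nat_0_le_iff)
  also have "\<dots> = 32 powr (real q / real p) * real m powr (real q / real p)" by (simp add: powr_mult)
  also have "\<dots> \<le> 32 powr 1 * real m powr (real q / real p)"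
    using r by (intro mult_right_mono powr_mono) auto
  finally show ?thesis by simp
qed

text \<open>The potential starts at 0 and is never negative, so summing the amortized bounds along a
  run bounds the true cost. Queries and counts keep the potential.\<close>

theorem maintainable_pattern:
  assumes T: "\<And>m. m \<ge> 1 \<Longrightarrow> T m = real m powr (real q / real p)"
  shows "maintainable P T Sp T"
proof -
  obtain Cs0 where sp0: "\<forall>n m A H D. n \<ge> 2 \<longrightarrow> m \<ge> 1 \<longrightarrow> graph n A \<longrightarrow> degsum n A \<le> 4 * m \<longrightarrow> H \<subseteq> {..<n} \<longrightarrow>
      low_degree_le n A H D \<longrightarrow> D \<ge> 1 \<longrightarrow> D ^ p \<le> 256000 * m \<longrightarrow> card H \<le> 1000 * D ^ (p - 1) \<longrightarrow> m \<le> n ^ 2 \<longrightarrow>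
      real (card {k. tab n A H k \<noteq> 0}) \<le> Cs0 * Sp n m" using tab_space by blast
  define Cs where "Cs = max Cs0 0"
  have Cs: "Cs \<ge> 0" by (simp add: Cs_def)
  have le: "Cs0 * Sp n m \<le> Cs * Sp n m" for n m
    unfolding Cs_def using Sp_nonneg by (intro mult_right_mono) auto
  have sp: "\<forall>n m A H D. n \<ge> 2 \<longrightarrow> m \<ge> 1 \<longrightarrow> graph n A \<longrightarrow> degsum n A \<le> 4 * m \<longrightarrow> H \<subseteq> {..<n} \<longrightarrow>
      low_degree_le n A H D \<longrightarrow> D \<ge> 1 \<longrightarrow> D ^ p \<le> 256000 * m \<longrightarrow> card H \<le> 1000 * D ^ (p - 1) \<longrightarrow> m \<le> n ^ 2 \<longrightarrow>
      real (card {k. tab n A H k \<noteq> 0}) \<le> Cs * Sp n m"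
    using sp0 order_trans[OF _ le] by blast
  define Cb where "Cb = 2 * (100000 + Cs)"
  define cq where "cq = 2800 * prim_cost + 1000"
  define C where "C = 32 * real update_cost + 32 * real cq + Cb + 5"
  have Cb0: "Cb \<ge> 0" using Cs by (simp add: Cb_def)
  have CC: "32 * real update_cost \<le> C" "32 * real cq \<le> C" "Cb \<le> C" "5 \<le> C" "0 \<le> C" using Cb0 by (auto simp: C_def)
  have main: "\<exists>es. run (dyn_structure \<kappa>) n ((n + 2) ^ 12) {} (\<lambda>_. 0) xs es \<and> amortized_update_time es C T \<and>
            (\<forall>x\<in>set es. correct_answer n P x \<and> query_time C T x \<and> real (space_of x) \<le> C * Sp n (edges_at x))"
    if legal: "legal_seq n {} xs" for n xs
  proof (cases "n \<ge> 2")
    case n2: True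
    define W where "W = (n + 2) ^ 12"
    have dsE: "ds n W p Kit nC nT tab emb" by unfold_locales (use n2 in \<open>auto simp: W_def\<close>)
    define Iv where "Iv = ds.Inv n W p Kit nC nT tab emb"
    define B where "B F = nat \<lfloor>Cb * Sp n (max 1 (card F))\<rfloor>" for F :: "nat set set"
    have Bc: "real (B F) \<le> C * Sp n (max 1 (card F))" for F
    proof -
      have "real (B F) \<le> Cb * Sp n (max 1 (card F))"
        unfolding B_def using Cb0 Sp_nonneg by (intro of_nat_floor) auto
      also have "\<dots> \<le> C * Sp n (max 1 (card F))" using CC Sp_nonneg by (intro mult_right_mono) auto
      finally show ?thesis .
    qed
    have fit: "ds.fits n p tab (B F) (card F) \<theta>" if "edge_set n F" "\<theta> \<ge> 1" "\<theta> ^ p \<le> 32 * max 1 (card F)" for F \<theta>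
      unfolding B_def Cb_def by (rule fits_space[OF dsE Cs sp that(2,3) card_edge_set_le[OF that(1)]])
    have T1: "T (max 1 m) \<ge> 0" for m using T[of "max 1 m"] by simp
    have time: "real (c * \<theta> ^ q) \<le> 32 * real c * T (max 1 m)" if "\<theta> ^ p \<le> 32 * max 1 m" for c \<theta> m
    proof -
      have "real (\<theta> ^ q) \<le> 32 * T (max 1 m)" using theta_time[OF that] T[of "max 1 m"] by simp
      then have "real c * real (\<theta> ^ q) \<le> real c * (32 * T (max 1 m))" by (intro mult_left_mono) auto
      then show ?thesis by (simp add: algebra_simps)
    qed
    \<comment> \<open>Generalised to an arbitrary starting state, whose potential appears as credit
      on the right; this is the form in which induction over the operations goes through.\<close>
    have "\<exists>es. run (dyn_structure \<kappa>) n W F \<mu> xs es \<and>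
        (\<Sum>x \<leftarrow> filter (is_update \<circ> op_of) es. real (cost_of x)) \<le> C * (\<Sum>x \<leftarrow> filter (is_update \<circ> op_of) es. T (edges_at x)) + real \<Phi> \<and>
        (\<forall>x\<in>set es. correct_answer n P x \<and> query_time C T x \<and> real (space_of x) \<le> C * Sp n (edges_at x))"
      if "Iv F \<mu> \<Phi>" "edge_set n F" "legal_seq n F xs" for F \<mu> \<Phi>
      using that
    proof (induction xs arbitrary: F \<mu> \<Phi>)
      case Nil
      show ?case by (intro exI[of _ "[]"]) (auto intro: run.Nil)
    next
      case (Cons x xs)
      let ?F = "apply_op x F"
      interpret D: ds ?F n W p Kit nC nT tab emb by (rule dsE)
      have inv: "D.Inv F \<mu> \<Phi>" using Cons.prems(1) by (simp add: Iv_def)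
      have l: "legal_op n F x" "legal_seq n ?F xs" using Cons.prems(3) by auto
      have fin: "finite F" by (rule finite_edge_set[OF Cons.prems(2)])
      show ?case
      proof (cases "is_update x")
        case True
        have es': "edge_set n ?F"
        proof (cases x)
          case (Insert u v)
          then show ?thesis using l Cons.prems(2) by (auto simp: edge_set_def)
        qed (use Cons.prems(2) in \<open>auto simp: edge_set_def\<close>)
        obtain t k \<rho> \<mu>' \<Phi>' \<theta> where ex: "exec ?F W (prog (dyn_structure \<kappa>) x) (init_regs n x, \<mu>) t k (\<rho>, \<mu>')" "k \<le> B ?F"
          and inv': "D.Inv ?F \<mu>' \<Phi>'" and c: "t + \<Phi>' \<le> update_cost * \<theta> ^ q + \<Phi>" and th: "\<theta> ^ p \<le> 32 * max 1 (card ?F)"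
          using D.update_step[OF inv Cons.prems(2) l(1) True fit[OF es']] by blast
        obtain es where es: "run (dyn_structure \<kappa>) n W ?F \<mu>' xs es"
          "(\<Sum>x \<leftarrow> filter (is_update \<circ> op_of) es. real (cost_of x)) \<le> C * (\<Sum>x \<leftarrow> filter (is_update \<circ> op_of) es. T (edges_at x)) + real \<Phi>'"
          "\<forall>x\<in>set es. correct_answer n P x \<and> query_time C T x \<and> real (space_of x) \<le> C * Sp n (edges_at x)"
          using Cons.IH[OF _ es' l(2)] inv' unfolding Iv_def by blast
        let ?e = "Event x ?F t k (\<rho> 0)"
        have r: "run (dyn_structure \<kappa>) n W F \<mu> (x # xs) (?e # es)" by (rule run.Cons[OF refl ex(1) es(1)])
        have ea: "edges_at ?e = max 1 (card ?F)" by (simp add: edges_at_def)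
        have "real t + real \<Phi>' \<le> real (update_cost * \<theta> ^ q) + real \<Phi>" using c by (metis of_nat_add of_nat_le_iff)
        also have "real (update_cost * \<theta> ^ q) \<le> 32 * real update_cost * T (max 1 (card ?F))" by (rule time[OF th])
        also have "\<dots> \<le> C * T (max 1 (card ?F))" using CC T1 by (intro mult_right_mono) auto
        finally have cost: "real t + real \<Phi>' \<le> C * T (edges_at ?e) + real \<Phi>" unfolding ea by simp
        have sum: "(\<Sum>x \<leftarrow> filter (is_update \<circ> op_of) (?e # es). real (cost_of x)) \<le> C * (\<Sum>x \<leftarrow> filter (is_update \<circ> op_of) (?e # es). T (edges_at x)) + real \<Phi>"
          using cost es(2) True by (simp add: algebra_simps)
        have new: "correct_answer n P ?e \<and> query_time C T ?e \<and> real (space_of ?e) \<le> C * Sp n (edges_at ?e)"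
        proof -
          have "real k \<le> C * Sp n (max 1 (card ?F))" using ex(2) Bc[of ?F] by linarith
          then show ?thesis using True unfolding ea by (cases x) auto
        qed
        have "\<forall>x\<in>set (?e # es). correct_answer n P x \<and> query_time C T x \<and> real (space_of x) \<le> C * Sp n (edges_at x)"
          using new es(3) by auto
        then show ?thesis using r sum by blast
      next
        case False
        then have F': "?F = F" by (cases x) auto
        have "\<exists>t k \<rho> \<mu>'. exec F W (prog (dyn_structure \<kappa>) x) (init_regs n x, \<mu>) t k (\<rho>, \<mu>') \<and> Iv F \<mu>' \<Phi> \<and>
          (correct_answer n P (Event x F t k (\<rho> 0)) \<and> query_time C T (Event x F t k (\<rho> 0)) \<and> k \<le> B F)"
        proof (cases x)
          case (Query u v)
          have uv: "{u, v} \<in> F" using l Query by simp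
          obtain t k \<rho> \<mu>' \<theta> where ex: "exec F W (query_com \<kappa>) (init_regs n (Query u v), \<mu>) t k (\<rho>, \<mu>')" "k \<le> B F"
            and inv': "D.Inv F \<mu>' \<Phi>" and c: "t \<le> cq * \<theta> ^ q" and th: "\<theta> ^ p \<le> 32 * max 1 (card F)"
            and ans: "\<rho> 0 = (emb n (adj F) - emb n (adj (F - {{u, v}}))) div \<kappa>"
            using D.query_step[OF inv Cons.prems(2) uv \<kappa> fit[OF Cons.prems(2)]] unfolding F' cq_def by blast
          have es': "edge_set n (F - {{u, v}})" using Cons.prems(2) by (auto simp: edge_set_def)
          have "emb n (adj F) - emb n (adj (F - {{u, v}})) = \<kappa> * subgraph_count_edge ({..<n}, F) P {u, v}"
            unfolding emb_count[OF Cons.prems(2)] emb_count[OF es']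
            using subgraph_count_split[OF _ fin, of "{..<n}" P "{u, v}"] by (simp add: algebra_simps)
          then have a: "\<rho> 0 = subgraph_count_edge ({..<n}, F) P {u, v}" using ans \<kappa> by simp
          have "real t \<le> real (cq * \<theta> ^ q)" using c by (simp only: of_nat_le_iff)
          also have "\<dots> \<le> 32 * real cq * T (max 1 (card F))" by (rule time[OF th])
          also have "\<dots> \<le> C * T (max 1 (card F))" using CC T1 by (intro mult_right_mono) auto
          finally have "real t \<le> C * T (max 1 (card F))" .
          then show ?thesis using ex inv' a by (intro exI[of _ t] exI[of _ k] exI[of _ \<rho>] exI[of _ \<mu>'])
              (simp add: Query dyn_structure_def Iv_def edges_at_def)
        next
          case Count
          obtain k \<rho> where ex: "exec F W (count_com \<kappa>) (init_regs n Count, \<mu>) 5 k (\<rho>, \<mu>)" "k \<le> B F" "\<rho> 0 = emb n (adj F) div \<kappa>"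
            using D.count_step[OF inv \<kappa> fit[OF Cons.prems(2)]] unfolding F' by blast
          have "\<rho> 0 = subgraph_count ({..<n}, F) P" using ex(3) \<kappa> unfolding emb_count[OF Cons.prems(2)] by simp
          then show ?thesis using ex inv CC by (intro exI[of _ 5] exI[of _ k] exI[of _ \<rho>] exI[of _ \<mu>])
              (simp add: Count dyn_structure_def Iv_def)
        qed (use False in auto)
        then obtain t k \<rho> \<mu>' where ex: "exec F W (prog (dyn_structure \<kappa>) x) (init_regs n x, \<mu>) t k (\<rho>, \<mu>')" and inv': "Iv F \<mu>' \<Phi>"
          and ok: "correct_answer n P (Event x F t k (\<rho> 0))" "query_time C T (Event x F t k (\<rho> 0))" "k \<le> B F" by blast
        obtain es where es: "run (dyn_structure \<kappa>) n W F \<mu>' xs es"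
          "(\<Sum>x \<leftarrow> filter (is_update \<circ> op_of) es. real (cost_of x)) \<le> C * (\<Sum>x \<leftarrow> filter (is_update \<circ> op_of) es. T (edges_at x)) + real \<Phi>"
          "\<forall>x\<in>set es. correct_answer n P x \<and> query_time C T x \<and> real (space_of x) \<le> C * Sp n (edges_at x)"
          using Cons.IH[OF inv' Cons.prems(2)] l(2) unfolding F' by blast
        let ?e = "Event x F t k (\<rho> 0)"
        have r: "run (dyn_structure \<kappa>) n W F \<mu> (x # xs) (?e # es)"
          by (rule run.Cons[OF F'[symmetric]]) (use ex es(1) in auto)
        have "real (space_of ?e) \<le> C * Sp n (edges_at ?e)" using ok(3) Bc[of F] by (simp add: edges_at_def)
        then have new: "correct_answer n P ?e \<and> query_time C T ?e \<and> real (space_of ?e) \<le> C * Sp n (edges_at ?e)" using ok by simp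
        have sum: "(\<Sum>x \<leftarrow> filter (is_update \<circ> op_of) (?e # es). real (cost_of x)) \<le> C * (\<Sum>x \<leftarrow> filter (is_update \<circ> op_of) (?e # es). T (edges_at x)) + real \<Phi>"
          using es(2) False by simp
        have "\<forall>x\<in>set (?e # es). correct_answer n P x \<and> query_time C T x \<and> real (space_of x) \<le> C * Sp n (edges_at x)"
          using new es(3) by auto
        then show ?thesis using r sum by blast
      qed
    qed
    moreover have "Iv {} (\<lambda>_. 0) 0" unfolding Iv_def by (rule ds.Inv_empty[OF dsE])
    moreover have "edge_set n {}" by (simp add: edge_set_def)
    ultimately obtain es where "run (dyn_structure \<kappa>) n W {} (\<lambda>_. 0) xs es \<and>
        (\<Sum>x \<leftarrow> filter (is_update \<circ> op_of) es. real (cost_of x)) \<le> C * (\<Sum>x \<leftarrow> filter (is_update \<circ> op_of) es. T (edges_at x)) + real 0 \<and>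
        (\<forall>x\<in>set es. correct_answer n P x \<and> query_time C T x \<and> real (space_of x) \<le> C * Sp n (edges_at x))"
      using legal by blast
    then show ?thesis unfolding amortized_update_time_def W_def by auto
  next
    \<comment> \<open>With fewer than two vertices no edge ever exists: only \<open>Count\<close> is
      legal, and the memory stays zero.\<close>
    case False
    let ?W = "(n + 2) ^ 12"
    have cnt: "subgraph_count ({..<n}, {}) P = 0"
      using emb_count[of n "{}"] emb_empty \<kappa> by (simp add: edge_set_def adj_empty)
    have "\<exists>es. run (dyn_structure \<kappa>) n ?W {} (\<lambda>_. 0) xs es \<and>
        (\<forall>x\<in>set es. op_of x = Count \<and> correct_answer n P x \<and> query_time C T x \<and> real (space_of x) \<le> C * Sp n (edges_at x))"
      using legal
    proof (induction xs)
      case Nil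
      show ?case by (intro exI[of _ "[]"]) (auto intro: run.Nil)
    next
      case (Cons x xs)
      have x: "x = Count" using Cons.prems False by (cases x) auto
      obtain es where es: "run (dyn_structure \<kappa>) n ?W {} (\<lambda>_. 0) xs es"
        "\<forall>x\<in>set es. op_of x = Count \<and> correct_answer n P x \<and> query_time C T x \<and> real (space_of x) \<le> C * Sp n (edges_at x)"
        using Cons x by auto
      let ?s = "(init_regs n Count, \<lambda>_::nat. 0::nat)"
      have e: "eval {} ?W ?s (Bin Divide (Mem (Const 0)) (Const \<kappa>)) = 0" by simp
      have c5: "1 + expr_cost (Bin Divide (Mem (Const 0)) (Const \<kappa>)) = 5" by simp
      have ex: "exec {} ?W (prog (dyn_structure \<kappa>) x) (init_regs n x, \<lambda>_. 0) 5 (mem_space (\<lambda>_. 0)) ((init_regs n Count)(0 := 0), \<lambda>_. 0)"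
        using exec.Assign[of "{}" ?W 0 "Bin Divide (Mem (Const 0)) (Const \<kappa>)" ?s] unfolding e c5
        by (simp add: x dyn_structure_def count_com_def)
      let ?e = "Event x {} 5 (mem_space (\<lambda>_. 0)) (((init_regs n Count)(0 := 0)) 0)"
      have r: "run (dyn_structure \<kappa>) n ?W {} (\<lambda>_. 0) (x # xs) (?e # es)"
        by (rule run.Cons[OF _ ex es(1)]) (simp add: x)
      have "real (space_of ?e) = 0" by (simp add: mem_space_def)
      moreover have "0 \<le> C * Sp n (edges_at ?e)" using CC Sp_nonneg by simp
      ultimately have "op_of ?e = Count \<and> correct_answer n P ?e \<and> query_time C T ?e \<and> real (space_of ?e) \<le> C * Sp n (edges_at ?e)"
        using cnt CC by (simp add: x)
      then have "\<forall>x\<in>set (?e # es). op_of x = Count \<and> correct_answer n P x \<and> query_time C T x \<and> real (space_of x) \<le> C * Sp n (edges_at x)"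
        using es(2) by auto
      then show ?case using r by blast
    qed
    then obtain es where es: "run (dyn_structure \<kappa>) n ?W {} (\<lambda>_. 0) xs es"
        "\<forall>x\<in>set es. op_of x = Count \<and> correct_answer n P x \<and> query_time C T x \<and> real (space_of x) \<le> C * Sp n (edges_at x)" by blast
    have "filter (is_update \<circ> op_of) es = []" using es(2) by (auto simp: filter_empty_conv)
    then show ?thesis using es unfolding amortized_update_time_def by auto
  qed
  show ?thesis
    unfolding maintainable_def
    by (rule exI[of _ "dyn_structure \<kappa>"], rule exI[of _ 12], rule exI[of _ C]) (use main in auto)
qed

end

section \<open>Evaluating loops on a represented graph\<close>

definition ADJ :: "nexp \<Rightarrow> nexp \<Rightarrow> nexp" where "ADJ x y = R 3 x y (K 0)"
text \<open>Register 0 holds \<open>n\<close>, which is at the same time the index of the heavy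
  set.\<close>

definition HEAVY :: "nexp \<Rightarrow> nexp" where "HEAVY x = R 3 (V 0) x (K 0)"
definition LOW :: "nexp \<Rightarrow> nexp" where "LOW x = Op Equal (HEAVY x) (K 0)"
definition DEG :: "nexp \<Rightarrow> nexp" where "DEG x = R 1 x (K 0) (K 0)"
definition NEQ :: "nexp \<Rightarrow> nexp \<Rightarrow> nexp" where "NEQ x y = Op Equal (Op Equal x y) (K 0)"

lemma base_facts:
  assumes "base n W M A H"
  shows "2 \<le> n" "n + 3 < W" "graph n A" "H \<subseteq> {..<n}" "j < n \<Longrightarrow> lrep M j (nb A j)" "lrep M n H" "finite H"
    "1 < W" "W \<noteq> Suc 0"
  using assms finite_subset[of H "{..<n}"] by (auto simp: base_def)

lemma lrep_pos_le: "lrep M j S \<Longrightarrow> S \<subseteq> {..<n} \<Longrightarrow> M (3, j, x, 0) \<le> n"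
proof -
  assume l: "lrep M j S" "S \<subseteq> {..<n}"
  have "card S \<le> n" using card_mono[of "{..<n}" S] l(2) by simp
  moreover have "M (3, j, x, 0) \<le> card S"
  proof (cases "x \<in> S")
    case True
    then show ?thesis using l(1) by (simp add: lrep_def)
  next
    case False
    then show ?thesis using lrep_mem(1)[OF l(1), of x] by simp
  qed
  ultimately show ?thesis by simp
qed

context
  fixes n W :: nat and M :: "key \<Rightarrow> nat" and A :: "nat \<Rightarrow> nat \<Rightarrow> bool" and H :: "nat set"
  assumes b: "base n W M A H"
begin

lemma ev_V: "\<rho> r < n \<Longrightarrow> nev n W \<rho> M (V r) = \<rho> r"
  using base_facts(2)[OF b] by simp

lemma ev_ADJ: "\<rho> r < n \<Longrightarrow> \<rho> s < n \<Longrightarrow> nev n W \<rho> M (ADJ (V r) (V s)) = 0 \<longleftrightarrow> \<not> A (\<rho> r) (\<rho> s)"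
proof -
  assume a: "\<rho> r < n" "\<rho> s < n"
  have l: "lrep M (\<rho> r) (nb A (\<rho> r))" by (rule base_facts(5)[OF b a(1)])
  have "M (3, \<rho> r, \<rho> s, 0) mod W = M (3, \<rho> r, \<rho> s, 0)"
    using lrep_pos_le[OF l nb_subset[OF base_facts(3)[OF b]]] base_facts(2)[OF b] by (meson le_less_trans mod_less trans_less_add1 add_lessD1)
  then show ?thesis using a base_facts(2)[OF b] lrep_mem(1)[OF l, of "\<rho> s"] by (simp add: ADJ_def nb_def)
qed

lemma ev_HEAVY: "\<rho> 0 = n \<Longrightarrow> \<rho> r < n \<Longrightarrow> nev n W \<rho> M (HEAVY (V r)) = 0 \<longleftrightarrow> \<rho> r \<notin> H"
proof -
  assume a: "\<rho> 0 = n" "\<rho> r < n"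
  note l = base_facts(6)[OF b]
  have "M (3, n, \<rho> r, 0) mod W = M (3, n, \<rho> r, 0)"
    using lrep_pos_le[OF l base_facts(4)[OF b]] base_facts(2)[OF b] by (meson le_less_trans mod_less trans_less_add1 add_lessD1)
  then show ?thesis using a base_facts(2)[OF b] lrep_mem(1)[OF l, of "\<rho> r"] by (simp add: HEAVY_def)
qed

lemma ev_LOW: "\<rho> 0 = n \<Longrightarrow> \<rho> r < n \<Longrightarrow> nev n W \<rho> M (LOW (V r)) = 0 \<longleftrightarrow> \<rho> r \<in> H"
  using ev_HEAVY[of \<rho> r] base_facts(8,9)[OF b] by (simp add: LOW_def)

lemma ev_NEQ: "\<rho> r < n \<Longrightarrow> \<rho> s < n \<Longrightarrow> nev n W \<rho> M (NEQ (V r) (V s)) = 0 \<longleftrightarrow> \<rho> r = \<rho> s"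
  using base_facts(2,8,9)[OF b] by (simp add: NEQ_def)

lemma card_nb_less: "card (nb A x) \<le> n"
  using card_mono[OF _ nb_subset[OF base_facts(3)[OF b], of x]] by simp

lemma ev_DEG: "\<rho> r < n \<Longrightarrow> nev n W \<rho> M (DEG (V r)) = card (nb A (\<rho> r))"
  using base_facts(2)[OF b] lrep_card[OF base_facts(5)[OF b]] card_nb_less[of "\<rho> r"] by (simp add: DEG_def)

text \<open>The list enumerates the neighbourhood bijectively. A sum over all \<open>y < n\<close>
  weighted by an indicator is the common form in which loops and tables are compared.\<close>

lemma sum_Each:
  fixes f :: "nat \<Rightarrow> 'b::comm_semiring_1"
  assumes "\<rho> r < n"
  shows "(\<Sum>i < M (1, nev n W \<rho> M (V r) mod (n + 3), 0, 0). f (M (2, nev n W \<rho> M (V r) mod (n + 3), i mod (n + 3), 0))) =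
    (\<Sum>y<n. of_bool (A (\<rho> r) y) * f y)"
proof -
  have l: "lrep M (\<rho> r) (nb A (\<rho> r))" by (rule base_facts(5)[OF b assms])
  have r: "nev n W \<rho> M (V r) mod (n + 3) = \<rho> r" using assms base_facts(2)[OF b] by simp
  have "(\<Sum>i < card (nb A (\<rho> r)). f (M (2, \<rho> r, i mod (n + 3), 0))) = (\<Sum>i < card (nb A (\<rho> r)). f (M (2, \<rho> r, i, 0)))"
    by (rule sum.cong) (use card_nb_less[of "\<rho> r"] in auto)
  also have "\<dots> = (\<Sum>y\<in>nb A (\<rho> r). f y)" by (rule lrep_sum[OF l])
  also have "\<dots> = (\<Sum>y\<in>{y\<in>{..<n}. A (\<rho> r) y}. f y)"
    by (rule sum.cong) (use nb_subset[OF base_facts(3)[OF b], of "\<rho> r"] in \<open>auto simp: nb_def\<close>)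
  also have "\<dots> = (\<Sum>y<n. if A (\<rho> r) y then f y else 0)" by (rule sum.inter_filter) simp
  also have "\<dots> = (\<Sum>y<n. of_bool (A (\<rho> r) y) * f y)" by (rule sum.cong) auto
  finally show ?thesis unfolding r lrep_card(1)[OF l] .
qed

lemma sum_Each_H:
  fixes f :: "nat \<Rightarrow> 'b::comm_semiring_1"
  assumes "\<rho> 0 = n"
  shows "(\<Sum>i < M (1, nev n W \<rho> M (V 0) mod (n + 3), 0, 0). f (M (2, nev n W \<rho> M (V 0) mod (n + 3), i mod (n + 3), 0))) =
    (\<Sum>y<n. of_bool (y \<in> H) * f y)"
proof -
  note l = base_facts(6)[OF b]
  have cH: "card H \<le> n" using card_mono[OF _ base_facts(4)[OF b]] by simp
  have r: "nev n W \<rho> M (V 0) mod (n + 3) = n" using assms base_facts(2)[OF b] by simp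
  have "(\<Sum>i < card H. f (M (2, n, i mod (n + 3), 0))) = (\<Sum>i < card H. f (M (2, n, i, 0)))"
    by (rule sum.cong) (use cH in auto)
  also have "\<dots> = (\<Sum>y\<in>H. f y)" by (rule lrep_sum[OF l])
  also have "\<dots> = (\<Sum>y\<in>{y\<in>{..<n}. y \<in> H}. f y)"
    by (rule sum.cong) (use base_facts(4)[OF b] in auto)
  also have "\<dots> = (\<Sum>y<n. if y \<in> H then f y else 0)" by (rule sum.inter_filter) simp
  also have "\<dots> = (\<Sum>y<n. of_bool (y \<in> H) * f y)" by (rule sum.cong) auto
  finally show ?thesis unfolding r lrep_card(1)[OF l] .
qed

lemma den_Each: "\<rho> r < n \<Longrightarrow> den n W sg M \<rho> d (Each (V r) p) k =
    (\<Sum>y<n. of_bool (A (\<rho> r) y) * den n W sg M (\<rho>(11 + 2 * d := y)) (d + 1) p k)"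
  unfolding den.simps by (rule sum_Each)

lemma den_Each_H: "\<rho> 0 = n \<Longrightarrow> den n W sg M \<rho> d (Each (V 0) p) k =
    (\<Sum>y<n. of_bool (y \<in> H) * den n W sg M (\<rho>(11 + 2 * d := y)) (d + 1) p k)"
  unfolding den.simps by (rule sum_Each_H)

lemma iters_Each: "\<rho> r < n \<Longrightarrow> iters n W M \<rho> d (Each (V r) p) =
    1 + (\<Sum>y<n. of_bool (A (\<rho> r) y) * (1 + iters n W M (\<rho>(11 + 2 * d := y)) (d + 1) p))"
  unfolding iters.simps by (rule arg_cong[where f = "(+) 1"], erule sum_Each)

lemma iters_Each_H: "\<rho> 0 = n \<Longrightarrow> iters n W M \<rho> d (Each (V 0) p) =
    1 + (\<Sum>y<n. of_bool (y \<in> H) * (1 + iters n W M (\<rho>(11 + 2 * d := y)) (d + 1) p))"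
  unfolding iters.simps by (rule arg_cong[where f = "(+) 1"], erule sum_Each_H)

end

section \<open>A syntactic bound on the number of iterations\<close>

definition counted_reg :: "nat \<Rightarrow> nat \<Rightarrow> bool" where
  "counted_reg d r \<longleftrightarrow> r \<in> {1, 2} \<or> (odd r \<and> 11 \<le> r \<and> r < 11 + 2 * d)"

definition low_reg :: "nat \<Rightarrow> nexp \<Rightarrow> nat set" where
  "low_reg d e = {r. counted_reg d r \<and> e = LOW (V r)}"

text \<open>Every loop has to run over the heavy set or over the neighbourhood of a vertex that has
  passed the test \<open>LOW\<close>. \<open>G\<close> collects the registers known to hold light
  vertices; a register that becomes a new loop variable loses this status.\<close>

fun bounded_nest :: "nat \<Rightarrow> nat set \<Rightarrow> nest \<Rightarrow> bool" where
  "bounded_nest d G (Guard e p) \<longleftrightarrow> bounded_nest d (G \<union> low_reg d e) p"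
| "bounded_nest d G (Both p q) \<longleftrightarrow> bounded_nest d G p \<and> bounded_nest d G q"
| "bounded_nest d G (Each (V r) p) \<longleftrightarrow> (r = 0 \<or> r \<in> G) \<and> bounded_nest (d + 1) (G - {11 + 2 * d}) p"
| "bounded_nest d G (Each _ p) \<longleftrightarrow> False"
| "bounded_nest d G _ \<longleftrightarrow> True"

fun nest_bound :: "nat \<Rightarrow> nat \<Rightarrow> nest \<Rightarrow> nat" where
  "nest_bound D h (Guard e p) = 1 + nest_bound D h p"
| "nest_bound D h (Both p q) = nest_bound D h p + nest_bound D h q"
| "nest_bound D h (Each j p) = 1 + (if j = V 0 then h else D) * (1 + nest_bound D h p)"
| "nest_bound D h _ = 1"

lemma iters_bound:
  assumes b: "base n W M A H" and D: "low_degree_le n A H D"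
  shows "bounded_nest d G p \<Longrightarrow> (\<And>r. r \<in> G \<Longrightarrow> \<rho> r < n \<and> \<rho> r \<notin> H) \<Longrightarrow> (\<And>r. counted_reg d r \<Longrightarrow> \<rho> r < n) \<Longrightarrow> \<rho> 0 = n \<Longrightarrow>
    iters n W M \<rho> d p \<le> nest_bound D (card H) p"
proof (induction p arbitrary: d G \<rho>)
  case (Guard e p)
  show ?case
  proof (cases "nev n W \<rho> M e = 0")
    case False
    have "iters n W M \<rho> d p \<le> nest_bound D (card H) p"
    proof (rule Guard.IH)
      show "bounded_nest d (G \<union> low_reg d e) p" using Guard.prems by simp
      fix r assume "r \<in> G \<union> low_reg d e"
      then show "\<rho> r < n \<and> \<rho> r \<notin> H"
      proof
        assume "r \<in> low_reg d e"
        then have "counted_reg d r" "e = LOW (V r)" by (auto simp: low_reg_def)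
        then show ?thesis using False ev_LOW[OF b, of \<rho> r] Guard.prems by auto
      qed (use Guard.prems in auto)
    qed (use Guard.prems in auto)
    then show ?thesis using False by simp
  qed simp
next
  case (Both p q)
  have "iters n W M \<rho> d p \<le> nest_bound D (card H) p" "iters n W M \<rho> d q \<le> nest_bound D (card H) q"
    using Both.IH(1)[of d G \<rho>] Both.IH(2)[of d G \<rho>] Both.prems by auto
  then show ?case by simp
next
  case (Each j p)
  then obtain r where j: "j = V r" and r: "r = 0 \<or> r \<in> G" and bp: "bounded_nest (d + 1) (G - {11 + 2 * d}) p"
    by (cases j) auto
  have IH: "iters n W M (\<rho>(11 + 2 * d := y)) (d + 1) p \<le> nest_bound D (card H) p" if "y < n" for y
  proof (rule Each.IH[OF bp])
    fix r' assume c: "counted_reg (d + 1) r'"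
    show "(\<rho>(11 + 2 * d := y)) r' < n"
    proof (cases "r' = 11 + 2 * d")
      case False
      then have "counted_reg d r'" using c by (auto simp: counted_reg_def) presburger
      then show ?thesis using Each.prems False by simp
    qed (use that in simp)
  qed (use Each.prems in auto)
  have le: "(\<Sum>y<n. of_bool (P y) * (1 + iters n W M (\<rho>(11 + 2 * d := y)) (d + 1) p)) \<le> card {y. y < n \<and> P y} * (1 + nest_bound D (card H) p)" for P
  proof -
    have "(\<Sum>y<n. of_bool (P y) * (1 + iters n W M (\<rho>(11 + 2 * d := y)) (d + 1) p)) \<le> (\<Sum>y<n. if P y then 1 + nest_bound D (card H) p else 0)"
      by (rule sum_mono) (use IH in auto)
    also have "\<dots> = (\<Sum>y\<in>{y\<in>{..<n}. P y}. 1 + nest_bound D (card H) p)" by (rule sum.inter_filter[symmetric]) simp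
    also have "\<dots> = card {y. y < n \<and> P y} * (1 + nest_bound D (card H) p)" by simp
    finally show ?thesis .
  qed
  show ?case
  proof (cases "r = 0")
    case True
    have "{y. y < n \<and> y \<in> H} = H" using base_facts(4)[OF b] by auto
    then show ?thesis using le[of "\<lambda>y. y \<in> H"] iters_Each_H[OF b, of \<rho> d p] Each.prems(4) j True by simp
  next
    case False
    then have rG: "r \<in> G" "\<rho> r < n" "\<rho> r \<notin> H" using r Each.prems by auto
    have "{y. y < n \<and> A (\<rho> r) y} = nb A (\<rho> r)" using base_facts(3)[OF b] by (auto simp: nb_def graph_def)
    moreover have "card (nb A (\<rho> r)) \<le> D" using D rG by (simp add: low_degree_le_def)
    ultimately have "card {y. y < n \<and> A (\<rho> r) y} * (1 + nest_bound D (card H) p) \<le> D * (1 + nest_bound D (card H) p)" by (simp only: mult_le_mono1)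
    then have "(\<Sum>y<n. of_bool (A (\<rho> r) y) * (1 + iters n W M (\<rho>(11 + 2 * d := y)) (d + 1) p)) \<le> D * (1 + nest_bound D (card H) p)"
      using le[of "A (\<rho> r)"] by (rule order_trans[rotated])
    then show ?thesis unfolding j using iters_Each[OF b, of \<rho> r d p] rG(2) False by simp
  qed
qed auto

section \<open>Tables of light configurations\<close>

lemma sum_if_const: "(\<Sum>x\<in>S. if P then f x else 0) = (if P then sum f S else 0)"
  by simp

text \<open>Applied to every variable in turn, it reduces identities about a new edge
  \<open>uv\<close> to finitely many cases without quantifiers.\<close>

lemma three_cases:
  assumes "x \<noteq> u \<Longrightarrow> x \<noteq> v \<Longrightarrow> Q" "x = u \<Longrightarrow> Q" "x = v \<Longrightarrow> Q"
  shows Q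
  using assms by blast

lemma sum_of_bool_eq: "(\<Sum>w<(n::nat). of_bool (w = c \<and> P w) :: int) = of_bool (c < n \<and> P c)"
proof -
  have "(\<Sum>w<n. of_bool (w = c \<and> P w) :: int) = (\<Sum>w<n. if w = c then of_bool (P c) else 0)"
    by (rule sum.cong) auto
  then show ?thesis by simp
qed

lemma sum_of_bool_eq2: "(\<Sum>w<(n::nat). \<Sum>x<m. of_bool (w = c \<and> P w x) :: int) = (\<Sum>x<m. of_bool (c < n \<and> P c x))"
  by (subst sum.swap) (simp only: sum_of_bool_eq)

text \<open>
  Table \<open>Ti\<close> is stored under tag \<open>i\<close>. Its inner vertices are light, except for \<open>T7\<close>, where instead the end
  vertices are heavy.
\<close>

definition T5 :: "nat \<Rightarrow> (nat \<Rightarrow> nat \<Rightarrow> bool) \<Rightarrow> nat set \<Rightarrow> nat \<Rightarrow> nat \<Rightarrow> int" where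
  "T5 n A H a b = (\<Sum>w<n. of_bool (w \<notin> H \<and> A w a \<and> A w b \<and> a \<noteq> b))"

definition T6 :: "nat \<Rightarrow> (nat \<Rightarrow> nat \<Rightarrow> bool) \<Rightarrow> nat set \<Rightarrow> nat \<Rightarrow> int" where
  "T6 n A H a = (\<Sum>w<n. \<Sum>y<n. of_bool (w \<notin> H \<and> A a w \<and> A w y \<and> y \<noteq> a))"

text \<open>If the heavy vertices are the ends instead of the middle, a new edge changes entries
  only along a loop over \<open>H\<close>, however large the neighbourhoods are.\<close>

definition T7 :: "nat \<Rightarrow> (nat \<Rightarrow> nat \<Rightarrow> bool) \<Rightarrow> nat set \<Rightarrow> nat \<Rightarrow> nat \<Rightarrow> int" where
  "T7 n A H a b = (\<Sum>w<n. of_bool (a \<in> H \<and> b \<in> H \<and> a \<noteq> b \<and> A w a \<and> A w b))"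

definition T8 :: "nat \<Rightarrow> (nat \<Rightarrow> nat \<Rightarrow> bool) \<Rightarrow> nat set \<Rightarrow> nat \<Rightarrow> nat \<Rightarrow> int" where
  "T8 n A H a b = (\<Sum>w<n. \<Sum>x<n. of_bool (w \<notin> H \<and> x \<notin> H \<and> A a w \<and> A w x \<and> A x b \<and> a \<noteq> x \<and> b \<noteq> w))"

text \<open>Claws with a light centre and two prescribed leaves; they account for paws whose pendant
  edge hangs at a light common neighbour.\<close>

definition T9 :: "nat \<Rightarrow> (nat \<Rightarrow> nat \<Rightarrow> bool) \<Rightarrow> nat set \<Rightarrow> nat \<Rightarrow> nat \<Rightarrow> int" where
  "T9 n A H a b = (\<Sum>w<n. \<Sum>z<n. of_bool (w \<notin> H \<and> A w a \<and> A w b \<and> A w z \<and> a \<noteq> b \<and> z \<noteq> a \<and> z \<noteq> b))"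

definition T10 :: "nat \<Rightarrow> (nat \<Rightarrow> nat \<Rightarrow> bool) \<Rightarrow> nat set \<Rightarrow> nat \<Rightarrow> nat \<Rightarrow> nat \<Rightarrow> int" where
  "T10 n A H a b c = (\<Sum>w<n. of_bool (w \<notin> H \<and> A w a \<and> A w b \<and> A w c \<and> a \<noteq> b \<and> a \<noteq> c \<and> b \<noteq> c))"

text \<open>Triangles \<open>a\<close>, \<open>w\<close>, \<open>x\<close> together with an edge
  from \<open>w\<close> to \<open>b\<close>: a diamond in which the edge from \<open>a\<close> to
  \<open>b\<close> is still missing.\<close>

definition T11 :: "nat \<Rightarrow> (nat \<Rightarrow> nat \<Rightarrow> bool) \<Rightarrow> nat set \<Rightarrow> nat \<Rightarrow> nat \<Rightarrow> int" where
  "T11 n A H a b = (\<Sum>w<n. \<Sum>x<n. of_bool (w \<notin> H \<and> x \<notin> H \<and> A w a \<and> A w b \<and> A w x \<and> A x a \<and> a \<noteq> b \<and> x \<noteq> b))"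

text \<open>\<open>Zi\<close> collects the configurations that table \<open>Ti\<close> gains from
  one orientation \<open>p q\<close> of the new edge; both orientations together give the full
  change. Inequalities that follow from \<open>\<not> A p q\<close> are left out.\<close>

definition Z5 :: "(nat \<Rightarrow> nat \<Rightarrow> bool) \<Rightarrow> nat set \<Rightarrow> nat \<Rightarrow> nat \<Rightarrow> nat \<Rightarrow> nat \<Rightarrow> int" where
  "Z5 A H p q a b = of_bool (q \<notin> H \<and> a = p \<and> A q b) + of_bool (q \<notin> H \<and> b = p \<and> A q a)"

definition Z6 :: "nat \<Rightarrow> (nat \<Rightarrow> nat \<Rightarrow> bool) \<Rightarrow> nat set \<Rightarrow> nat \<Rightarrow> nat \<Rightarrow> nat \<Rightarrow> int" where
  "Z6 n A H p q a = (\<Sum>x<n. of_bool (a = p \<and> q \<notin> H \<and> A q x)) + of_bool (q \<notin> H \<and> A q a)"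

definition Z7 :: "(nat \<Rightarrow> nat \<Rightarrow> bool) \<Rightarrow> nat set \<Rightarrow> nat \<Rightarrow> nat \<Rightarrow> nat \<Rightarrow> nat \<Rightarrow> int" where
  "Z7 A H p q a b = of_bool (a = p \<and> p \<in> H \<and> b \<in> H \<and> A q b) + of_bool (b = p \<and> p \<in> H \<and> a \<in> H \<and> A q a)"

definition Z8 :: "nat \<Rightarrow> (nat \<Rightarrow> nat \<Rightarrow> bool) \<Rightarrow> nat set \<Rightarrow> nat \<Rightarrow> nat \<Rightarrow> nat \<Rightarrow> nat \<Rightarrow> int" where
  "Z8 n A H p q a b = of_bool (p \<notin> H \<and> q \<notin> H \<and> A p a \<and> A q b)
     + (\<Sum>x<n. of_bool (a = p \<and> q \<notin> H \<and> A q x \<and> x \<notin> H \<and> A x b \<and> b \<noteq> q))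
     + (\<Sum>x<n. of_bool (b = p \<and> q \<notin> H \<and> A q x \<and> x \<notin> H \<and> A x a \<and> a \<noteq> q))"

definition Z9 :: "nat \<Rightarrow> (nat \<Rightarrow> nat \<Rightarrow> bool) \<Rightarrow> nat set \<Rightarrow> nat \<Rightarrow> nat \<Rightarrow> nat \<Rightarrow> nat \<Rightarrow> int" where
  "Z9 n A H p q a b = of_bool (q \<notin> H \<and> A q a \<and> A q b \<and> a \<noteq> b)
     + (\<Sum>z<n. of_bool (a = p \<and> q \<notin> H \<and> A q b \<and> A q z \<and> z \<noteq> b))
     + (\<Sum>z<n. of_bool (b = p \<and> q \<notin> H \<and> A q a \<and> A q z \<and> z \<noteq> a))"

definition Z10 :: "(nat \<Rightarrow> nat \<Rightarrow> bool) \<Rightarrow> nat set \<Rightarrow> nat \<Rightarrow> nat \<Rightarrow> nat \<Rightarrow> nat \<Rightarrow> nat \<Rightarrow> int" where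
  "Z10 A H p q a b c = of_bool (q \<notin> H \<and> a = p \<and> A q b \<and> A q c \<and> b \<noteq> c) + of_bool (q \<notin> H \<and> b = p \<and> A q a \<and> A q c \<and> a \<noteq> c)
     + of_bool (q \<notin> H \<and> c = p \<and> A q a \<and> A q b \<and> a \<noteq> b)"

text \<open>In the four summands the new edge takes the place of \<open>a w\<close>,
  \<open>b w\<close>, \<open>w x\<close> and \<open>a x\<close>, in this order.\<close>

definition Z11 :: "nat \<Rightarrow> (nat \<Rightarrow> nat \<Rightarrow> bool) \<Rightarrow> nat set \<Rightarrow> nat \<Rightarrow> nat \<Rightarrow> nat \<Rightarrow> nat \<Rightarrow> int" where
  "Z11 n A H p q a b = (\<Sum>x<n. of_bool (a = p \<and> q \<notin> H \<and> A q x \<and> x \<notin> H \<and> A p x \<and> A q b \<and> b \<noteq> x))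
     + (\<Sum>x<n. of_bool (b = p \<and> q \<notin> H \<and> A q x \<and> x \<notin> H \<and> A q a \<and> A x a))
     + of_bool (q \<notin> H \<and> p \<notin> H \<and> A q a \<and> A p a \<and> A q b \<and> b \<noteq> a)
     + (\<Sum>x<n. of_bool (a = p \<and> q \<notin> H \<and> A q x \<and> x \<notin> H \<and> A p x \<and> A x b \<and> b \<noteq> p \<and> b \<noteq> q))"

section \<open>Nests that realise the changes of the tables\<close>

definition up5 :: "nat \<Rightarrow> nat \<Rightarrow> nest" where
  "up5 p q = Guard (LOW (V q)) (Each (V q) (Both (Add 3 5 (V p) (V 11) (K 0) (K 1)) (Add 3 5 (V 11) (V p) (K 0) (K 1))))"

definition up6 :: "nat \<Rightarrow> nat \<Rightarrow> nest" where
  "up6 p q = Guard (LOW (V q)) (Each (V q) (Both (Add 3 6 (V p) (K 0) (K 0) (K 1)) (Add 3 6 (V 11) (K 0) (K 0) (K 1))))"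

definition up7 :: "nat \<Rightarrow> nat \<Rightarrow> nest" where
  "up7 p q = Guard (HEAVY (V p)) (Each (V 0) (Guard (ADJ (V q) (V 11))
     (Both (Add 3 7 (V p) (V 11) (K 0) (K 1)) (Add 3 7 (V 11) (V p) (K 0) (K 1)))))"

definition up8 :: "nat \<Rightarrow> nat \<Rightarrow> nest" where
  "up8 p q = Both (Guard (LOW (V p)) (Guard (LOW (V q)) (Each (V p) (Each (V q) (Add 3 8 (V 11) (V 13) (K 0) (K 1))))))
     (Guard (LOW (V q)) (Each (V q) (Guard (LOW (V 11)) (Each (V 11) (Guard (NEQ (V 13) (V q))
       (Both (Add 3 8 (V p) (V 13) (K 0) (K 1)) (Add 3 8 (V 13) (V p) (K 0) (K 1))))))))"

text \<open>One double loop over the neighbours of \<open>q\<close> serves all summands of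
  \<open>Z9\<close>, with \<open>p\<close> in the place of \<open>z\<close>, \<open>a\<close> and
  \<open>b\<close>.\<close>

definition up9 :: "nat \<Rightarrow> nat \<Rightarrow> nest" where
  "up9 p q = Guard (LOW (V q)) (Each (V q) (Each (V q) (Guard (NEQ (V 13) (V 11))
     (Both (Add 3 9 (V 11) (V 13) (K 0) (K 1)) (Both (Add 3 9 (V p) (V 11) (K 0) (K 1)) (Add 3 9 (V 11) (V p) (K 0) (K 1)))))))"

definition up10 :: "nat \<Rightarrow> nat \<Rightarrow> nest" where
  "up10 p q = Guard (LOW (V q)) (Each (V q) (Each (V q) (Guard (NEQ (V 13) (V 11))
     (Both (Add 3 10 (V p) (V 11) (V 13) (K 1)) (Both (Add 3 10 (V 11) (V p) (V 13) (K 1)) (Add 3 10 (V 11) (V 13) (V p) (K 1)))))))"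

definition up11 :: "nat \<Rightarrow> nat \<Rightarrow> nest" where
  "up11 p q = Guard (LOW (V q)) (Each (V q) (Both
      (Guard (LOW (V 11)) (Guard (ADJ (V p) (V 11)) (Each (V q) (Guard (NEQ (V 13) (V 11)) (Add 3 11 (V p) (V 13) (K 0) (K 1))))))
      (Both (Guard (LOW (V 11)) (Each (V q) (Guard (ADJ (V 11) (V 13)) (Add 3 11 (V 13) (V p) (K 0) (K 1)))))
      (Both (Guard (LOW (V p)) (Guard (ADJ (V p) (V 11)) (Each (V q) (Guard (NEQ (V 13) (V 11)) (Add 3 11 (V 11) (V 13) (K 0) (K 1))))))
            (Guard (LOW (V 11)) (Guard (ADJ (V p) (V 11)) (Each (V 11) (Guard (NEQ (V 13) (V p)) (Guard (NEQ (V 13) (V q)) (Add 3 11 (V p) (V 13) (K 0) (K 1)))))))))))"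

text \<open>An identity between indicators, decided by comparing every variable with
  \<open>u\<close> and \<open>v\<close>. The new terms contain an equation for a summation variable,
  so their sums collapse. The same scheme proves the statements for the other tables.\<close>

lemma T5_add:
  assumes "addable n A u v"
  shows "T5 n (add_edge A u v) H a b = T5 n A H a b + Z5 A H u v a b + Z5 A H v u a b"
proof -
  have uv: "u < n" "v < n" "u \<noteq> v" "\<not> A u v" "\<not> A v u" and g: "graph n A" using assms by (auto simp: addable_def graph_def)
  have irr: "\<not> A x x" and sym: "A x y \<longleftrightarrow> A y x" for x y using g by (auto simp: graph_def)
  have "of_bool (w \<notin> H \<and> add_edge A u v w a \<and> add_edge A u v w b \<and> a \<noteq> b) =
    (of_bool (w \<notin> H \<and> A w a \<and> A w b \<and> a \<noteq> b) + of_bool (w = v \<and> (v \<notin> H \<and> a = u \<and> A v b)) + of_bool (w = v \<and> (v \<notin> H \<and> b = u \<and> A v a))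
     + of_bool (w = u \<and> (u \<notin> H \<and> a = v \<and> A u b)) + of_bool (w = u \<and> (u \<notin> H \<and> b = v \<and> A u a)) :: int)" for w
    by (rule three_cases[of w u v]; rule three_cases[of a u v]; rule three_cases[of b u v]; simp add: add_edge_def uv irr uv(3)[symmetric])
  then show ?thesis unfolding T5_def Z5_def
    by (simp only: sum.distrib sum_of_bool_eq) (use uv in simp)
qed

lemma T6_add:
  assumes "addable n A u v"
  shows "T6 n (add_edge A u v) H a = T6 n A H a + Z6 n A H u v a + Z6 n A H v u a"
proof -
  have uv: "u < n" "v < n" "u \<noteq> v" "\<not> A u v" "\<not> A v u" and g: "graph n A" using assms by (auto simp: addable_def graph_def)
  have irr: "\<not> A x x" and sym: "A x y \<longleftrightarrow> A y x" for x y using g by (auto simp: graph_def)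
  define E where "E p q w y = (of_bool (w = q \<and> (a = p \<and> q \<notin> H \<and> A q y)) + of_bool (w = q \<and> (y = p \<and> q \<notin> H \<and> A q a)) :: int)" for p q w y
  have pt: "of_bool (w \<notin> H \<and> add_edge A u v a w \<and> add_edge A u v w y \<and> y \<noteq> a) =
    (of_bool (w \<notin> H \<and> A a w \<and> A w y \<and> y \<noteq> a) + E u v w y + E v u w y :: int)" for w y
    unfolding sym[of a w] add_edge_def E_def by (rule three_cases[of w u v]; rule three_cases[of y u v]; rule three_cases[of a u v]; auto simp: uv irr uv(3)[symmetric])
  have Z: "(\<Sum>w<n. \<Sum>x<n. E p q w x) = Z6 n A H p q a" if "p < n" "q < n" for p q
    unfolding E_def Z6_def by (simp only: sum.distrib sum_of_bool_eq2) (use that in \<open>simp add: sum_of_bool_eq\<close>)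
  show ?thesis unfolding T6_def pt sum.distrib Z[OF uv(1,2)] Z[OF uv(2,1)] ..
qed

lemma T7_add:
  assumes "addable n A u v"
  shows "T7 n (add_edge A u v) H a b = T7 n A H a b + Z7 A H u v a b + Z7 A H v u a b"
proof -
  have uv: "u < n" "v < n" "u \<noteq> v" "\<not> A u v" "\<not> A v u" and g: "graph n A" using assms by (auto simp: addable_def graph_def)
  have irr: "\<not> A x x" and sym: "A x y \<longleftrightarrow> A y x" for x y using g by (auto simp: graph_def)
  have "of_bool (a \<in> H \<and> b \<in> H \<and> a \<noteq> b \<and> add_edge A u v w a \<and> add_edge A u v w b) =
    (of_bool (a \<in> H \<and> b \<in> H \<and> a \<noteq> b \<and> A w a \<and> A w b) + of_bool (w = v \<and> (a = u \<and> u \<in> H \<and> b \<in> H \<and> A v b)) + of_bool (w = v \<and> (b = u \<and> u \<in> H \<and> a \<in> H \<and> A v a))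
     + of_bool (w = u \<and> (a = v \<and> v \<in> H \<and> b \<in> H \<and> A u b)) + of_bool (w = u \<and> (b = v \<and> v \<in> H \<and> a \<in> H \<and> A u a)) :: int)" for w
    by (rule three_cases[of w u v]; rule three_cases[of a u v]; rule three_cases[of b u v]; simp add: add_edge_def uv irr uv(3)[symmetric])
  then show ?thesis unfolding T7_def Z7_def
    by (simp only: sum.distrib sum_of_bool_eq) (use uv in simp)
qed

lemma T8_add:
  assumes "addable n A u v"
  shows "T8 n (add_edge A u v) H a b = T8 n A H a b + Z8 n A H u v a b + Z8 n A H v u a b"
proof -
  have uv: "u < n" "v < n" "u \<noteq> v" "\<not> A u v" "\<not> A v u" and g: "graph n A" using assms by (auto simp: addable_def graph_def)
  have irr: "\<not> A x x" and sym: "A x y \<longleftrightarrow> A y x" for x y using g by (auto simp: graph_def)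
  define E where "E p q w x = (of_bool (w = p \<and> (x = q \<and> p \<notin> H \<and> q \<notin> H \<and> A p a \<and> A q b))
     + of_bool (w = q \<and> (a = p \<and> q \<notin> H \<and> A q x \<and> x \<notin> H \<and> A x b \<and> b \<noteq> q))
     + of_bool (x = q \<and> (b = p \<and> q \<notin> H \<and> A q w \<and> w \<notin> H \<and> A w a \<and> a \<noteq> q)) :: int)" for p q w x
  have pt: "of_bool (w \<notin> H \<and> x \<notin> H \<and> add_edge A u v a w \<and> add_edge A u v w x \<and> add_edge A u v x b \<and> a \<noteq> x \<and> b \<noteq> w) =
    (of_bool (w \<notin> H \<and> x \<notin> H \<and> A a w \<and> A w x \<and> A x b \<and> a \<noteq> x \<and> b \<noteq> w) + E u v w x + E v u w x :: int)" for w x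
    unfolding sym[of a w] add_edge_def E_def by (insert sym[of w x]; rule three_cases[of w u v]; rule three_cases[of x u v]; rule three_cases[of a u v]; rule three_cases[of b u v]; auto simp: uv irr uv(3)[symmetric])
  have Z: "(\<Sum>w<n. \<Sum>x<n. E p q w x) = Z8 n A H p q a b" if "p < n" "q < n" for p q
    unfolding E_def Z8_def by (simp only: sum.distrib sum_of_bool_eq2 sum_of_bool_eq) (use that in \<open>simp add: sum_of_bool_eq\<close>)
  show ?thesis unfolding T8_def pt sum.distrib Z[OF uv(1,2)] Z[OF uv(2,1)] ..
qed

lemma T9_add:
  assumes "addable n A u v"
  shows "T9 n (add_edge A u v) H a b = T9 n A H a b + Z9 n A H u v a b + Z9 n A H v u a b"
proof -
  have uv: "u < n" "v < n" "u \<noteq> v" "\<not> A u v" "\<not> A v u" and g: "graph n A" using assms by (auto simp: addable_def graph_def)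
  have irr: "\<not> A x x" and sym: "A x y \<longleftrightarrow> A y x" for x y using g by (auto simp: graph_def)
  define E where "E p q w z = (of_bool (w = q \<and> (z = p \<and> q \<notin> H \<and> A q a \<and> A q b \<and> a \<noteq> b))
     + of_bool (w = q \<and> (a = p \<and> q \<notin> H \<and> A q b \<and> A q z \<and> z \<noteq> b))
     + of_bool (w = q \<and> (b = p \<and> q \<notin> H \<and> A q a \<and> A q z \<and> z \<noteq> a)) :: int)" for p q w z
  have pt: "of_bool (w \<notin> H \<and> add_edge A u v w a \<and> add_edge A u v w b \<and> add_edge A u v w z \<and> a \<noteq> b \<and> z \<noteq> a \<and> z \<noteq> b) =
    (of_bool (w \<notin> H \<and> A w a \<and> A w b \<and> A w z \<and> a \<noteq> b \<and> z \<noteq> a \<and> z \<noteq> b) + E u v w z + E v u w z :: int)" for w z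
    unfolding add_edge_def E_def by (rule three_cases[of w u v]; rule three_cases[of z u v]; rule three_cases[of a u v]; rule three_cases[of b u v]; auto simp: uv irr uv(3)[symmetric])
  have Z: "(\<Sum>w<n. \<Sum>x<n. E p q w x) = Z9 n A H p q a b" if "p < n" "q < n" for p q
    unfolding E_def Z9_def by (simp only: sum.distrib sum_of_bool_eq2 sum_of_bool_eq) (use that in \<open>simp add: sum_of_bool_eq\<close>)
  show ?thesis unfolding T9_def pt sum.distrib Z[OF uv(1,2)] Z[OF uv(2,1)] ..
qed

lemma T10_add:
  assumes "addable n A u v"
  shows "T10 n (add_edge A u v) H a b c = T10 n A H a b c + Z10 A H u v a b c + Z10 A H v u a b c"
proof -
  have uv: "u < n" "v < n" "u \<noteq> v" "\<not> A u v" "\<not> A v u" and g: "graph n A" using assms by (auto simp: addable_def graph_def)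
  have irr: "\<not> A x x" and sym: "A x y \<longleftrightarrow> A y x" for x y using g by (auto simp: graph_def)
  define E where "E p q w = (of_bool (w = q \<and> (q \<notin> H \<and> a = p \<and> A q b \<and> A q c \<and> b \<noteq> c)) + of_bool (w = q \<and> (q \<notin> H \<and> b = p \<and> A q a \<and> A q c \<and> a \<noteq> c))
     + of_bool (w = q \<and> (q \<notin> H \<and> c = p \<and> A q a \<and> A q b \<and> a \<noteq> b)) :: int)" for p q w
  have pt: "of_bool (w \<notin> H \<and> add_edge A u v w a \<and> add_edge A u v w b \<and> add_edge A u v w c \<and> a \<noteq> b \<and> a \<noteq> c \<and> b \<noteq> c) =
    (of_bool (w \<notin> H \<and> A w a \<and> A w b \<and> A w c \<and> a \<noteq> b \<and> a \<noteq> c \<and> b \<noteq> c) + E u v w + E v u w :: int)" for w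
    unfolding add_edge_def E_def by (rule three_cases[of w u v]; rule three_cases[of a u v]; rule three_cases[of b u v]; rule three_cases[of c u v]; auto simp: uv irr uv(3)[symmetric])
  have Z: "(\<Sum>w<n. E p q w) = Z10 A H p q a b c" if "p < n" "q < n" for p q
    unfolding E_def Z10_def by (simp only: sum.distrib sum_of_bool_eq) (use that in simp)
  show ?thesis unfolding T10_def pt sum.distrib Z[OF uv(1,2)] Z[OF uv(2,1)] ..
qed

lemma T11_add:
  assumes "addable n A u v"
  shows "T11 n (add_edge A u v) H a b = T11 n A H a b + Z11 n A H u v a b + Z11 n A H v u a b"
proof -
  have uv: "u < n" "v < n" "u \<noteq> v" "\<not> A u v" "\<not> A v u" and g: "graph n A" using assms by (auto simp: addable_def graph_def)
  have irr: "\<not> A x x" and sym: "A x y \<longleftrightarrow> A y x" for x y using g by (auto simp: graph_def)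
  define E where "E p q w x = (of_bool (w = q \<and> (a = p \<and> q \<notin> H \<and> A q x \<and> x \<notin> H \<and> A p x \<and> A q b \<and> b \<noteq> x))
     + of_bool (w = q \<and> (b = p \<and> q \<notin> H \<and> A q x \<and> x \<notin> H \<and> A q a \<and> A x a))
     + of_bool (w = q \<and> (x = p \<and> q \<notin> H \<and> p \<notin> H \<and> A q a \<and> A p a \<and> A q b \<and> b \<noteq> a))
     + of_bool (x = q \<and> (a = p \<and> q \<notin> H \<and> A q w \<and> w \<notin> H \<and> A p w \<and> A w b \<and> b \<noteq> p \<and> b \<noteq> q)) :: int)" for p q w x
  have pt: "of_bool (w \<notin> H \<and> x \<notin> H \<and> add_edge A u v w a \<and> add_edge A u v w b \<and> add_edge A u v w x \<and> add_edge A u v x a \<and> a \<noteq> b \<and> x \<noteq> b) =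
    (of_bool (w \<notin> H \<and> x \<notin> H \<and> A w a \<and> A w b \<and> A w x \<and> A x a \<and> a \<noteq> b \<and> x \<noteq> b) + E u v w x + E v u w x :: int)" for w x
    unfolding add_edge_def E_def by (insert sym[of w x] sym[of a x] sym[of a w]; rule three_cases[of w u v]; rule three_cases[of x u v]; rule three_cases[of a u v]; rule three_cases[of b u v]; auto simp: uv irr uv(3)[symmetric])
  have Z: "(\<Sum>w<n. \<Sum>x<n. E p q w x) = Z11 n A H p q a b" if "p < n" "q < n" for p q
    unfolding E_def Z11_def by (simp only: sum.distrib sum_of_bool_eq2 sum_of_bool_eq) (use that in \<open>simp add: sum_of_bool_eq\<close>)
  show ?thesis unfolding T11_def pt sum.distrib Z[OF uv(1,2)] Z[OF uv(2,1)] ..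
qed

lemma of_bool_mult: "of_bool P * (of_bool Q :: int) = of_bool (P \<and> Q)"
  by simp

lemma sum_of_bool_last: "(\<Sum>y<(n::nat). of_bool (P y \<and> a = y) :: int) = of_bool (P a \<and> a < n)"
proof -
  have "(\<Sum>y<n. of_bool (P y \<and> a = y) :: int) = (\<Sum>y<n. if y = a then of_bool (P a) else 0)"
    by (rule sum.cong) auto
  then show ?thesis by simp
qed

lemma sum_of_bool_collapse:
  "(\<Sum>y<(n::nat). of_bool (a = y \<and> P y) :: int) = of_bool (a < n \<and> P a)"
  "(\<Sum>y<n. of_bool (Q \<and> a = y \<and> P y) :: int) = of_bool (a < n \<and> Q \<and> P a)"
  "(\<Sum>y<n. of_bool (Q \<and> Q' \<and> a = y \<and> P y) :: int) = of_bool (a < n \<and> Q \<and> Q' \<and> P a)"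
  using sum_of_bool_last[of P a n] sum_of_bool_last[of "\<lambda>y. Q \<and> P y" a n] sum_of_bool_last[of "\<lambda>y. Q \<and> Q' \<and> P y" a n]
  by (simp_all only: conj_ac)

lemma sum_of_bool_collapse2:
  "(\<Sum>y<(n::nat). \<Sum>z<m. of_bool (a = y \<and> P y z) :: int) = (\<Sum>z<m. of_bool (a < n \<and> P a z))"
  "(\<Sum>y<(n::nat). \<Sum>z<m. of_bool (Q \<and> a = y \<and> P y z) :: int) = (\<Sum>z<m. of_bool (a < n \<and> Q \<and> P a z))"
  by (subst sum.swap, simp only: sum_of_bool_collapse)+

context
  fixes n W :: nat and M :: "key \<Rightarrow> nat" and A :: "nat \<Rightarrow> nat \<Rightarrow> bool" and H :: "nat set" and \<rho> :: "nat \<Rightarrow> nat" and p q :: nat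
    and sg :: "nat \<Rightarrow> int"
  assumes b: "base n W M A H" and \<rho>: "\<rho> 0 = n" "\<rho> p < n" "\<rho> q < n" "p < 10" "q < 10" and sg: "sg 3 = 1"
begin

text \<open>The indicator is put behind the inner value. Equations between a cell index and a loop
  variable then come to the front, where \<open>sum_of_bool_collapse\<close> finds them.\<close>

lemma den_right:
  "den n W sg M \<rho>' d (Guard e s) k = den n W sg M \<rho>' d s k * of_bool (nev n W \<rho>' M e \<noteq> 0)"
  "\<rho>' r < n \<Longrightarrow> den n W sg M \<rho>' 0 (Each (V r) s) k = (\<Sum>y<n. den n W sg M (\<rho>'(11 := y)) 1 s k * of_bool (A (\<rho>' r) y))"
  "\<rho>' r < n \<Longrightarrow> den n W sg M \<rho>' 1 (Each (V r) s) k = (\<Sum>y<n. den n W sg M (\<rho>'(13 := y)) 2 s k * of_bool (A (\<rho>' r) y))"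
  "\<rho>' 0 = n \<Longrightarrow> den n W sg M \<rho>' 0 (Each (V 0) s) k = (\<Sum>y<n. den n W sg M (\<rho>'(11 := y)) 1 s k * of_bool (y \<in> H))"
  using den_Each[OF b, of \<rho>' r sg 0 s k] den_Each[OF b, of \<rho>' r sg 1 s k] den_Each_H[OF b, of \<rho>' sg 0 s k]
  by (simp_all add: mult.commute numeral_2_eq_2)

lemma Add_at: "nev n W \<rho>' M x < n \<Longrightarrow> nev n W \<rho>' M y < n \<Longrightarrow> nev n W \<rho>' M z < n \<Longrightarrow> r < 16 \<Longrightarrow>
    den n W sg M \<rho>' d (Add 3 r x y z (K 1)) (t, a, b', c) =
    of_bool (a = nev n W \<rho>' M x \<and> b' = nev n W \<rho>' M y \<and> c = nev n W \<rho>' M z \<and> t = r)"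
  using base_facts(8)[OF b] sg by auto

lemma ev_facts: "nev n W \<rho>' M (K 0) = 0" "0 < n" "p \<noteq> 11" "p \<noteq> 13" "q \<noteq> 11" "q \<noteq> 13"
  using base_facts(1)[OF b] \<rho> by simp_all

lemma lessThan_memD: "y \<in> {..<n} \<Longrightarrow> y < n"
  by simp

lemma outside: "\<not> x < n \<Longrightarrow> A y x = False" "\<not> x < n \<Longrightarrow> (x = \<rho> p) = False" "\<not> x < n \<Longrightarrow> (x = \<rho> q) = False" "\<not> x < n \<Longrightarrow> (x = 0) = False"
  using graph_less[OF base_facts(3)[OF b]] \<rho> ev_facts by auto

lemmas dsimps = den_right den.simps(4) Add_at ev_facts ev_V[OF b] ev_LOW[OF b] ev_HEAVY[OF b]
  ev_ADJ[OF b] ev_NEQ[OF b] \<rho> sum.distrib distrib_right of_bool_mult conj_assoc sum_of_bool_collapse sum_of_bool_collapse2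
  fun_upd_apply if_True if_False simp_thms rel_simps arith_simps lessThan_memD sum_distrib_right

lemma den_up5: "den n W sg M \<rho> 0 (up5 p q) (t, a, b', c) =
    (if t = 5 \<and> a < n \<and> b' < n \<and> c = 0 then Z5 A H (\<rho> p) (\<rho> q) a b' else 0)"
proof (cases "t = 5 \<and> a < n \<and> b' < n \<and> c = 0")
  case True
  then show ?thesis unfolding up5_def Z5_def
    by (simp only: dsimps cong: sum.cong) (simp only: conj_ac add_ac)
next
  case False
  then have "t \<noteq> 5 \<or> \<not> a < n \<or> \<not> b' < n \<or> \<not> c = 0" by blast
  then show ?thesis unfolding up5_def
    by (elim disjE) (simp_all only: dsimps cong: sum.cong, simp_all add: outside)
qed

lemma den_up6: "den n W sg M \<rho> 0 (up6 p q) (t, a, b', c) =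
    (if t = 6 \<and> a < n \<and> b' = 0 \<and> c = 0 then Z6 n A H (\<rho> p) (\<rho> q) a else 0)"
proof (cases "t = 6 \<and> a < n \<and> b' = 0 \<and> c = 0")
  case True
  then show ?thesis unfolding up6_def Z6_def
    by (simp only: dsimps cong: sum.cong) (simp only: conj_ac add_ac)
next
  case False
  then have "t \<noteq> 6 \<or> \<not> a < n \<or> \<not> b' = 0 \<or> \<not> c = 0" by blast
  then show ?thesis unfolding up6_def
    by (elim disjE) (simp_all only: dsimps cong: sum.cong, simp_all add: outside)
qed

lemma den_up7: "den n W sg M \<rho> 0 (up7 p q) (t, a, b', c) =
    (if t = 7 \<and> a < n \<and> b' < n \<and> c = 0 then Z7 A H (\<rho> p) (\<rho> q) a b' else 0)"
proof (cases "t = 7 \<and> a < n \<and> b' < n \<and> c = 0")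
  case True
  then show ?thesis unfolding up7_def Z7_def
    by (simp only: dsimps cong: sum.cong) (simp only: conj_ac add_ac)
next
  case False
  then have "t \<noteq> 7 \<or> \<not> a < n \<or> \<not> b' < n \<or> \<not> c = 0" by blast
  then show ?thesis unfolding up7_def
    by (elim disjE) (simp_all only: dsimps cong: sum.cong, simp_all add: outside)
qed

lemma den_up8: "den n W sg M \<rho> 0 (up8 p q) (t, a, b', c) =
    (if t = 8 \<and> a < n \<and> b' < n \<and> c = 0 then Z8 n A H (\<rho> p) (\<rho> q) a b' else 0)"
proof (cases "t = 8 \<and> a < n \<and> b' < n \<and> c = 0")
  case True
  then show ?thesis unfolding up8_def Z8_def
    by (simp only: dsimps cong: sum.cong) (simp only: conj_ac add_ac)
next
  case False
  then have "t \<noteq> 8 \<or> \<not> a < n \<or> \<not> b' < n \<or> \<not> c = 0" by blast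
  then show ?thesis unfolding up8_def
    by (elim disjE) (simp_all only: dsimps cong: sum.cong, simp_all add: outside)
qed

lemma den_up9: "den n W sg M \<rho> 0 (up9 p q) (t, a, b', c) =
    (if t = 9 \<and> a < n \<and> b' < n \<and> c = 0 then Z9 n A H (\<rho> p) (\<rho> q) a b' else 0)"
proof (cases "t = 9 \<and> a < n \<and> b' < n \<and> c = 0")
  case True
  then show ?thesis unfolding up9_def Z9_def
    by (simp only: dsimps cong: sum.cong) (simp only: conj_ac add_ac eq_commute[of b' a])
next
  case False
  then have "t \<noteq> 9 \<or> \<not> a < n \<or> \<not> b' < n \<or> \<not> c = 0" by blast
  then show ?thesis unfolding up9_def
    by (elim disjE) (simp_all only: dsimps cong: sum.cong, simp_all add: outside)
qed

lemma den_up10: "den n W sg M \<rho> 0 (up10 p q) (t, a, b', c) =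
    (if t = 10 \<and> a < n \<and> b' < n \<and> c < n then Z10 A H (\<rho> p) (\<rho> q) a b' c else 0)"
proof (cases "t = 10 \<and> a < n \<and> b' < n \<and> c < n")
  case True
  then show ?thesis unfolding up10_def Z10_def
    by (simp only: dsimps cong: sum.cong) (simp only: conj_ac add_ac eq_commute[of b' a] eq_commute[of c a] eq_commute[of c b'])
next
  case False
  then have "t \<noteq> 10 \<or> \<not> a < n \<or> \<not> b' < n \<or> \<not> c < n" by blast
  then show ?thesis unfolding up10_def
    by (elim disjE) (simp_all only: dsimps cong: sum.cong, simp_all add: outside)
qed

lemma den_up11: "den n W sg M \<rho> 0 (up11 p q) (t, a, b', c) =
    (if t = 11 \<and> a < n \<and> b' < n \<and> c = 0 then Z11 n A H (\<rho> p) (\<rho> q) a b' else 0)"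
proof (cases "t = 11 \<and> a < n \<and> b' < n \<and> c = 0")
  case True
  then show ?thesis unfolding up11_def Z11_def
    by (simp only: dsimps cong: sum.cong) (simp only: conj_ac add_ac)
next
  case False
  then have "t \<noteq> 11 \<or> \<not> a < n \<or> \<not> b' < n \<or> \<not> c = 0" by blast
  then show ?thesis unfolding up11_def
    by (elim disjE) (simp_all only: dsimps cong: sum.cong, simp_all add: outside)
qed

end

text \<open>The tables with tags in \<open>S\<close> as one function on keys. Surplus coordinates
  are pinned to 0, so that each entry occupies a single cell.\<close>

definition tabs :: "nat set \<Rightarrow> nat \<Rightarrow> (nat \<Rightarrow> nat \<Rightarrow> bool) \<Rightarrow> nat set \<Rightarrow> key \<Rightarrow> int" where
  "tabs S n A H = (\<lambda>(t, a, b, c). if t \<in> S \<and> a < n \<and> b < n \<and> c < n then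
     (if t = 5 \<and> c = 0 then T5 n A H a b else
      if t = 6 \<and> b = 0 \<and> c = 0 then T6 n A H a else
      if t = 7 \<and> c = 0 then T7 n A H a b else
      if t = 8 \<and> c = 0 then T8 n A H a b else
      if t = 9 \<and> c = 0 then T9 n A H a b else
      if t = 10 then T10 n A H a b c else
      if t = 11 \<and> c = 0 then T11 n A H a b else 0) else 0)"

lemmas T_defs = T5_def T6_def T7_def T8_def T9_def T10_def T11_def

lemma tabs_nonneg: "tabs S n A H k \<ge> 0"
  by (cases k) (auto simp: tabs_def T_defs intro!: sum_nonneg)

lemma tabs_box: "S \<subseteq> {5..<16} \<Longrightarrow> tabs S n A H k \<noteq> 0 \<Longrightarrow> k \<in> {5..<16} \<times> {..<n} \<times> {..<n} \<times> {..<n}"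
  by (cases k) (auto simp: tabs_def split: if_splits)

lemma tabs_mono:
  assumes "\<And>x y. A x y \<Longrightarrow> A' x y"
  shows "tabs S n A H k \<le> tabs S n A' H k"
proof -
  have "T5 n A H a b \<le> T5 n A' H a b" "T6 n A H a \<le> T6 n A' H a" "T7 n A H a b \<le> T7 n A' H a b"
    "T8 n A H a b \<le> T8 n A' H a b" "T9 n A H a b \<le> T9 n A' H a b" "T10 n A H a b c \<le> T10 n A' H a b c"
    "T11 n A H a b \<le> T11 n A' H a b" for a b c
    unfolding T_defs by (intro sum_mono, simp only: of_bool_less_eq_iff, use assms in blast)+
  then show ?thesis by (cases k) (simp add: tabs_def)
qed

lemma tabs_empty: "tabs S n (\<lambda>_ _. False) H k = 0"
  by (cases k) (simp add: tabs_def T_defs)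

text \<open>No counted configuration passes through an isolated vertex, and an entry of
  \<open>T7\<close> with an isolated end is 0 on either side.\<close>

lemma tabs_isolated:
  assumes "graph n A" "nb A w = {}"
  shows "tabs S n A (insert w H) k = tabs S n A (H - {w}) k"
proof -
  have w: "\<not> A w x" "\<not> A x w" for x using assms by (auto simp: nb_def graph_def)
  have "T5 n A (insert w H) a b = T5 n A (H - {w}) a b" "T6 n A (insert w H) a = T6 n A (H - {w}) a"
    "T7 n A (insert w H) a b = T7 n A (H - {w}) a b" "T8 n A (insert w H) a b = T8 n A (H - {w}) a b"
    "T9 n A (insert w H) a b = T9 n A (H - {w}) a b" "T10 n A (insert w H) a b c = T10 n A (H - {w}) a b c"
    "T11 n A (insert w H) a b = T11 n A (H - {w}) a b" for a b c
    unfolding T_defs by (intro sum.cong refl arg_cong[where f = of_bool]; auto simp: w)+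
  then show ?thesis by (cases k) (simp add: tabs_def)
qed

lemma tabs_insert: "t \<notin> S \<Longrightarrow> tabs (insert t S) n A H k = tabs {t} n A H k + tabs S n A H k"
proof -
  assume t: "t \<notin> S"
  obtain t' a b c where k: "k = (t', a, b, c)" by (cases k)
  show ?thesis
  proof (cases "t' = t")
    case True
    then show ?thesis unfolding k tabs_def prod.case using t by (simp only: insertI1 simp_thms if_False add_0_right insert_iff empty_iff)
  next
    case False
    then show ?thesis unfolding k tabs_def prod.case by (simp only: simp_thms if_False add_0 insert_iff empty_iff)
  qed
qed

definition table_nest :: "nat \<Rightarrow> nest" where
  "table_nest t = (let up = (if t = 5 then up5 else if t = 6 then up6 else if t = 7 then up7 else if t = 8 then up8
     else if t = 9 then up9 else if t = 10 then up10 else up11) in Both (up 1 2) (up 2 1))"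

lemma den_table_nest:
  assumes b: "base n W M A H" and ad: "addable n A u v" and \<rho>: "\<rho> 0 = n" "\<rho> 1 = u" "\<rho> 2 = v" and sg: "sg 3 = 1"
    and t: "t \<in> {5, 6, 7, 8, 9, 10, 11}"
  shows "den n W sg M \<rho> 0 (table_nest t) k = tabs {t} n (add_edge A u v) H k - tabs {t} n A H k"
proof -
  obtain t' a b' c where k: "k = (t', a, b', c)" by (cases k)
  have uv: "u < n" "v < n" "0 < n" using ad base_facts(1)[OF b] by (auto simp: addable_def)
  have \<rho>': "\<rho> (Suc 0) = u" using \<rho> by simp
  note ds = den_up5 den_up6 den_up7 den_up8 den_up9 den_up10 den_up11
  note as = T5_add[OF ad] T6_add[OF ad] T7_add[OF ad] T8_add[OF ad] T9_add[OF ad] T10_add[OF ad] T11_add[OF ad]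
  show ?thesis using t uv unfolding k table_nest_def Let_def tabs_def
    by (elim insertE emptyE) (simp_all add: ds[OF b] \<rho> \<rho>' sg as)
qed

section \<open>Arithmetic modulo the word size\<close>

definition cg :: "nat \<Rightarrow> int \<Rightarrow> int \<Rightarrow> bool" where
  "cg W x y \<longleftrightarrow> x mod int W = y mod int W"

lemma cg_refl: "cg W x x"
  by (simp add: cg_def)

lemma cg_add: "cg W x x' \<Longrightarrow> cg W y y' \<Longrightarrow> cg W (x + y) (x' + y')"
  unfolding cg_def by (rule mod_add_cong)

lemma cg_diff: "cg W x x' \<Longrightarrow> cg W y y' \<Longrightarrow> cg W (x - y) (x' - y')"
  unfolding cg_def by (rule mod_diff_cong)

lemma cg_mult: "cg W x x' \<Longrightarrow> cg W y y' \<Longrightarrow> cg W (x * y) (x' * y')"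
  unfolding cg_def by (rule mod_mult_cong)

lemma cg_mod: "cg W x y \<Longrightarrow> cg W (x mod int W) y"
  by (simp add: cg_def)

lemma int_nat_mod: "W > 0 \<Longrightarrow> int (nat (x mod int W) mod W) = x mod int W"
  by (simp add: zmod_int)

lemma cg_sum: "(\<And>i. i \<in> S \<Longrightarrow> cg W (f i) (g i)) \<Longrightarrow> cg W (sum f S) (sum g S)"
  by (induction S rule: infinite_finite_induct) (auto intro: cg_add cg_refl)

section \<open>Counting nests\<close>

definition ct :: "nat \<Rightarrow> nexp \<Rightarrow> nest" where "ct r e = Add r 0 (K 0) (K 0) (K 0) e"
definition dbl :: "nest \<Rightarrow> nest" where "dbl p = Both p p"

locale count_state =
  fixes n W :: nat and M :: "key \<Rightarrow> nat" and A :: "nat \<Rightarrow> nat \<Rightarrow> bool" and H :: "nat set" and u v :: nat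
    and S :: "nat set" and sg :: "nat \<Rightarrow> int" and \<rho> :: "nat \<Rightarrow> nat"
  assumes b: "base n W M A H" and ad: "addable n A u v" and \<rho>: "\<rho> 0 = n" "\<rho> 1 = u" "\<rho> 2 = v"
    and sg: "sg 3 = 1" "sg 4 = -1" and tab: "\<And>k. 5 \<le> fst k \<Longrightarrow> M k = nat (tabs S n A H k mod int W)"
begin

lemma uv: "u < n" "v < n" "u \<noteq> v" "v \<noteq> u" "\<not> A u v" "\<not> A v u" "0 < n" and irr: "\<not> A x x" and sym: "A x y \<longleftrightarrow> A y x"
  and less: "A x y \<Longrightarrow> x < n \<and> y < n"
  using ad base_facts(1)[OF b] by (auto simp: addable_def graph_def)

lemma \<rho>1: "\<rho> (Suc 0) = u" using \<rho> by simp

text \<open>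
  In \<open>evs\<close> and \<open>cn\<close> the value is fixed only modulo the word size; this is harmless because the number of embeddings is
  smaller than \<open>W\<close>.
\<close>

definition evs :: "(nat \<Rightarrow> nat) \<Rightarrow> nexp \<Rightarrow> int \<Rightarrow> bool" where
  "evs \<rho>' e x \<longleftrightarrow> cg W (int (nev n W \<rho>' M e)) x"

definition cn :: "(nat \<Rightarrow> nat) \<Rightarrow> nat \<Rightarrow> nest \<Rightarrow> int \<Rightarrow> bool" where
  "cn \<rho>' d p x \<longleftrightarrow> cg W (den n W sg M \<rho>' d p (0, 0, 0, 0)) x"

lemma evs_K: "x = int k \<Longrightarrow> evs \<rho>' (K k) x"
  by (simp add: evs_def cg_def zmod_int)

lemma evs_DEG: "\<rho>' r = x \<Longrightarrow> x < n \<Longrightarrow> evs \<rho>' (DEG (V r)) (\<Sum>y<n. of_bool (A x y))"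
proof -
  assume "\<rho>' r = x" "x < n"
  moreover have "nb A x = {y \<in> {..<n}. A x y}" using base_facts(3)[OF b] by (auto simp: nb_def graph_def)
  moreover have "(\<Sum>y<n. of_bool (A x y) :: int) = int (card {y \<in> {..<n}. A x y})"
    by (simp add: of_bool_def sum.inter_filter[symmetric])
  ultimately show ?thesis using ev_DEG[OF b, of \<rho>' r] by (simp add: evs_def cg_def)
qed

lemma evs_R:
  "\<rho>' r = x \<Longrightarrow> \<rho>' s = y \<Longrightarrow> x < n \<Longrightarrow> y < n \<Longrightarrow> 5 \<in> S \<Longrightarrow> evs \<rho>' (R 5 (V r) (V s) (K 0)) (T5 n A H x y)"
  "\<rho>' r = x \<Longrightarrow> x < n \<Longrightarrow> 6 \<in> S \<Longrightarrow> evs \<rho>' (R 6 (V r) (K 0) (K 0)) (T6 n A H x)"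
  "\<rho>' r = x \<Longrightarrow> \<rho>' s = y \<Longrightarrow> x < n \<Longrightarrow> y < n \<Longrightarrow> 7 \<in> S \<Longrightarrow> evs \<rho>' (R 7 (V r) (V s) (K 0)) (T7 n A H x y)"
  "\<rho>' r = x \<Longrightarrow> \<rho>' s = y \<Longrightarrow> x < n \<Longrightarrow> y < n \<Longrightarrow> 8 \<in> S \<Longrightarrow> evs \<rho>' (R 8 (V r) (V s) (K 0)) (T8 n A H x y)"
  "\<rho>' r = x \<Longrightarrow> \<rho>' s = y \<Longrightarrow> x < n \<Longrightarrow> y < n \<Longrightarrow> 9 \<in> S \<Longrightarrow> evs \<rho>' (R 9 (V r) (V s) (K 0)) (T9 n A H x y)"
  "\<rho>' r = x \<Longrightarrow> \<rho>' s = y \<Longrightarrow> \<rho>' q = z \<Longrightarrow> x < n \<Longrightarrow> y < n \<Longrightarrow> z < n \<Longrightarrow> 10 \<in> S \<Longrightarrow> evs \<rho>' (R 10 (V r) (V s) (V q)) (T10 n A H x y z)"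
  "\<rho>' r = x \<Longrightarrow> \<rho>' s = y \<Longrightarrow> x < n \<Longrightarrow> y < n \<Longrightarrow> 11 \<in> S \<Longrightarrow> evs \<rho>' (R 11 (V r) (V s) (K 0)) (T11 n A H x y)"
  using base_facts(2)[OF b] uv(7) int_nat_mod[of W] by (simp_all add: tab evs_def cg_def tabs_def)

lemma evs_Times: "evs \<rho>' e x \<Longrightarrow> evs \<rho>' f y \<Longrightarrow> evs \<rho>' (Op Times e f) (x * y)"
  unfolding evs_def using cg_mod[OF cg_mult] by (simp add: zmod_int)

lemma evs_Plus: "evs \<rho>' e x \<Longrightarrow> evs \<rho>' f y \<Longrightarrow> evs \<rho>' (Op Plus e f) (x + y)"
  unfolding evs_def using cg_mod[OF cg_add] by (simp add: zmod_int)

lemma cn_ct3: "evs \<rho>' e x \<Longrightarrow> cn \<rho>' d (ct 3 e) x"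
  by (simp add: evs_def cn_def ct_def sg)

lemma cn_ct4: "evs \<rho>' e x \<Longrightarrow> cn \<rho>' d (ct 4 e) (- x)"
  using cg_diff[OF cg_refl[of W 0]] by (simp add: evs_def cn_def ct_def sg)

lemma cn_Both: "cn \<rho>' d p x \<Longrightarrow> cn \<rho>' d q y \<Longrightarrow> cn \<rho>' d (Both p q) (x + y)"
  by (simp add: cn_def cg_add)

lemma cn_dbl: "cn \<rho>' d p x \<Longrightarrow> cn \<rho>' d (dbl p) (2 * x)"
  using cn_Both[of \<rho>' d p x p x] by (simp add: dbl_def)

lemma cn_Guard: "(nev n W \<rho>' M e = 0 \<longleftrightarrow> \<not> P) \<Longrightarrow> (P \<Longrightarrow> cn \<rho>' d p x) \<Longrightarrow> cn \<rho>' d (Guard e p) (of_bool P * x)"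
  by (auto simp: cn_def cg_refl)

lemma cn_ADJ: "\<rho>' r = x \<Longrightarrow> \<rho>' s = y \<Longrightarrow> x < n \<Longrightarrow> y < n \<Longrightarrow> cn \<rho>' d p z \<Longrightarrow> cn \<rho>' d (Guard (ADJ (V r) (V s)) p) (of_bool (A x y) * z)"
  by (rule cn_Guard) (simp_all add: ev_ADJ[OF b])

lemma cn_HEAVY: "\<rho>' 0 = n \<Longrightarrow> \<rho>' r = x \<Longrightarrow> x < n \<Longrightarrow> cn \<rho>' d p z \<Longrightarrow> cn \<rho>' d (Guard (HEAVY (V r)) p) (of_bool (x \<in> H) * z)"
  by (rule cn_Guard) (simp_all add: ev_HEAVY[OF b])

lemma cn_LOW: "\<rho>' 0 = n \<Longrightarrow> \<rho>' r = x \<Longrightarrow> x < n \<Longrightarrow> cn \<rho>' d p z \<Longrightarrow> cn \<rho>' d (Guard (LOW (V r)) p) (of_bool (x \<notin> H) * z)"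
  by (rule cn_Guard) (simp_all add: ev_LOW[OF b])

lemma cn_NEQ: "\<rho>' r = x \<Longrightarrow> \<rho>' s = y \<Longrightarrow> x < n \<Longrightarrow> y < n \<Longrightarrow> cn \<rho>' d p z \<Longrightarrow> cn \<rho>' d (Guard (NEQ (V r) (V s)) p) (of_bool (x \<noteq> y) * z)"
  by (rule cn_Guard) (simp_all add: ev_NEQ[OF b])

text \<open>The premise \<open>r \<noteq> 0\<close> keeps this rule away from loops over the heavy
  set, which have register 0 as index.\<close>

lemma cn_Each: "r \<noteq> 0 \<Longrightarrow> \<rho>' r = x \<Longrightarrow> x < n \<Longrightarrow> (\<And>y. y < n \<Longrightarrow> cn (\<rho>'(11 + 2 * d := y)) (d + 1) p (f y)) \<Longrightarrow>
    cn \<rho>' d (Each (V r) p) (\<Sum>y<n. of_bool (A x y) * f y)"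
  unfolding cn_def by (subst den_Each[OF b]) (auto intro!: cg_sum cg_mult cg_refl)

lemma cn_Each_H: "\<rho>' 0 = n \<Longrightarrow> (\<And>y. y < n \<Longrightarrow> cn (\<rho>'(11 + 2 * d := y)) (d + 1) p (f y)) \<Longrightarrow>
    cn \<rho>' d (Each (V 0) p) (\<Sum>y<n. of_bool (y \<in> H) * f y)"
  unfolding cn_def by (subst den_Each_H[OF b]) (auto intro!: cg_sum cg_mult cg_refl)

text \<open>Used as introduction rules, these facts follow the syntax of a nest and verify the
  formula that it computes.\<close>

lemmas cn_intros = cn_ct3 cn_ct4 cn_Both cn_dbl cn_ADJ cn_HEAVY cn_LOW cn_NEQ cn_Each_H cn_Each
  evs_R evs_DEG evs_Times evs_Plus evs_K

end

section \<open>Embeddings and copies\<close>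

type_synonym quad = "nat \<times> nat \<times> nat \<times> nat"

fun sel :: "quad \<Rightarrow> nat \<Rightarrow> nat" where
  "sel (a, b, c, d) i = (if i = 0 then a else if i = 1 then b else if i = 2 then c else d)"

definition image_graph :: "('a \<Rightarrow> 'b) \<Rightarrow> 'a graph \<Rightarrow> 'b graph" where
  "image_graph f G = (f ` fst G, (\<lambda>e. f ` e) ` snd G)"

text \<open>Quadruples stand for maps on \<open>{..<4}\<close>: unlike functions they carry no
  values outside this set, so their number is meaningful.\<close>

definition embeddings :: "nat \<Rightarrow> nat set set \<Rightarrow> nat graph \<Rightarrow> quad set" where
  "embeddings n F P = {t. inj_on (sel t) {..<4} \<and> sel t ` {..<4} \<subseteq> {..<n} \<and> (\<lambda>e. sel t ` e) ` snd P \<subseteq> F}"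

lemma four: "{..<4::nat} = {0, 1, 2, 3}"
  by auto

lemma isomorphic_iff: "isomorphic G P \<longleftrightarrow> (\<exists>f. inj_on f (fst G) \<and> image_graph f G = P)"
  by (cases P) (auto simp: isomorphic_def image_graph_def bij_betw_def)

lemma image_graph_comp: "image_graph f (image_graph g G) = image_graph (f \<circ> g) G"
  by (simp add: image_graph_def image_image image_comp)

lemma image_graph_cong: "simple_graph G \<Longrightarrow> (\<And>x. x \<in> fst G \<Longrightarrow> f x = g x) \<Longrightarrow> image_graph f G = image_graph g G"
proof -
  assume G: "simple_graph G" and fg: "\<And>x. x \<in> fst G \<Longrightarrow> f x = g x"
  have "f ` e = g ` e" if "e \<in> snd G" for e using G that fg by (intro image_cong) (auto simp: simple_graph_def)
  then show ?thesis using fg by (simp add: image_graph_def cong: image_cong)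
qed

lemma image_graph_id: "image_graph id G = G"
  by (simp add: image_graph_def)

lemma simple_image_graph: "simple_graph G \<Longrightarrow> inj_on f (fst G) \<Longrightarrow> simple_graph (image_graph f G)"
  unfolding simple_graph_def image_graph_def by (auto simp: card_image inj_on_subset)

lemma isomorphic_inverse:
  assumes G: "simple_graph G" and f: "inj_on f (fst G)" "image_graph f G = P"
  shows "inj_on (inv_into (fst G) f) (fst P)" "image_graph (inv_into (fst G) f) P = G"
proof -
  have fP: "fst P = f ` fst G" using f(2) by (auto simp: image_graph_def)
  show "inj_on (inv_into (fst G) f) (fst P)" unfolding fP by (rule inj_on_inv_into) simp
  have "image_graph (inv_into (fst G) f) P = image_graph (inv_into (fst G) f \<circ> f) G"
    using f(2) by (simp add: image_graph_comp[symmetric])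
  also have "\<dots> = image_graph id G" by (rule image_graph_cong[OF G]) (simp add: f(1))
  finally show "image_graph (inv_into (fst G) f) P = G" by (simp add: image_graph_id)
qed

lemma isomorphic_sym: "simple_graph G \<Longrightarrow> isomorphic G P \<Longrightarrow> isomorphic P G"
  unfolding isomorphic_iff using isomorphic_inverse by blast

lemma isomorphic_trans: "isomorphic G P \<Longrightarrow> isomorphic P Q \<Longrightarrow> isomorphic G Q"
  unfolding isomorphic_iff
proof (elim exE conjE)
  fix f g assume f: "inj_on f (fst G)" "image_graph f G = P" and g: "inj_on g (fst P)" "image_graph g P = Q"
  have "fst P = f ` fst G" using f(2) by (auto simp: image_graph_def)
  then have "inj_on (g \<circ> f) (fst G)" using f(1) g(1) by (simp add: comp_inj_on)
  moreover have "image_graph (g \<circ> f) G = Q" using f g by (simp add: image_graph_comp[symmetric])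
  ultimately show "\<exists>f. inj_on f (fst G) \<and> image_graph f G = Q" by blast
qed

text \<open>Lets the four concrete graphs on natural numbers stand for patterns over any vertex
  type.\<close>

lemma subgraph_count_isomorphic:
  assumes "simple_graph P" "isomorphic P Q"
  shows "subgraph_count G P = subgraph_count G Q"
proof -
  have "isomorphic H P \<longleftrightarrow> isomorphic H Q" if "simple_graph H" for H
    using assms isomorphic_sym isomorphic_trans that by metis
  then show ?thesis unfolding subgraph_count_def subgraph_def by (metis (mono_tags, lifting))
qed

lemma image_graph_inject:
  assumes "inj_on f X" "simple_graph G" "simple_graph G'" "fst G \<subseteq> X" "fst G' \<subseteq> X" "image_graph f G = image_graph f G'"
  shows "G = G'"
proof -
  have e: "snd G \<subseteq> Pow X" "snd G' \<subseteq> Pow X" using assms(2-5) unfolding simple_graph_def by blast+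
  have "fst G = fst G'" using assms(6) inj_on_image_eq_iff[OF assms(1,4,5)] by (simp add: image_graph_def)
  moreover have "snd G = snd G'" using assms(6) inj_on_image_eq_iff[OF inj_on_image_Pow[OF assms(1)] e] by (simp add: image_graph_def)
  ultimately show ?thesis by (simp add: prod_eq_iff)
qed

lemma subgraph_image_iff:
  assumes "simple_graph P" "fst P = {..<4}" "inj_on (sel t) {..<4}"
  shows "subgraph (image_graph (sel t) P) ({..<n}, F) \<longleftrightarrow> t \<in> embeddings n F P"
  unfolding subgraph_def embeddings_def using assms simple_image_graph[of P "sel t"] by (auto simp: image_graph_def)

definition quad_comp :: "quad \<Rightarrow> quad \<Rightarrow> quad" where
  "quad_comp t s = (sel t (sel s 0), sel t (sel s 1), sel t (sel s 2), sel t (sel s 3))"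

lemma sel_quad_comp: "i < 4 \<Longrightarrow> sel (quad_comp t s) i = sel t (sel s i)"
proof -
  assume "i < 4"
  then have "i = 0 \<or> i = 1 \<or> i = 2 \<or> i = 3" by auto
  then show ?thesis by (auto simp: quad_comp_def)
qed

lemma quad_eqI: "(\<And>i. i < 4 \<Longrightarrow> sel s i = sel t i) \<Longrightarrow> s = t"
proof -
  assume a: "\<And>i. i < 4 \<Longrightarrow> sel s i = sel t i"
  show "s = t" using a[of 0] a[of 1] a[of 2] a[of 3] by (cases s; cases t) simp
qed

lemma finite_embeddings: "finite (embeddings n F P)"
proof (rule finite_subset)
  show "embeddings n F P \<subseteq> {..<n} \<times> {..<n} \<times> {..<n} \<times> {..<n}"
    by (auto simp: embeddings_def four)
qed simp

text \<open>Injective self-maps of finite sets are onto, for vertices and for edges alike. Hence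
  \<open>embeddings 4 (snd P) P\<close> is the automorphism group of \<open>P\<close>.\<close>

lemma image_self:
  assumes P: "simple_graph P" "fst P = {..<4}" and s: "s \<in> embeddings 4 (snd P) P"
  shows "image_graph (sel s) P = P"
proof -
  have inj: "inj_on (sel s) {..<4}" and sub: "sel s ` {..<4} \<subseteq> {..<4}" "(\<lambda>e. sel s ` e) ` snd P \<subseteq> snd P"
    using s by (auto simp: embeddings_def)
  have fin: "finite (snd P)" by (rule finite_subset[of _ "Pow {..<4}"]) (use P in \<open>auto simp: simple_graph_def\<close>)
  have "sel s ` {..<4} = {..<4}" by (rule endo_inj_surj[OF _ sub(1) inj]) simp
  moreover have "inj_on (\<lambda>e. sel s ` e) (snd P)"
    by (rule inj_on_subset[OF inj_on_image_Pow[OF inj]]) (use P in \<open>auto simp: simple_graph_def\<close>)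
  then have "(\<lambda>e. sel s ` e) ` snd P = snd P" by (rule endo_inj_surj[OF fin sub(2)])
  ultimately show ?thesis using P(2) by (simp add: image_graph_def prod_eq_iff)
qed

text \<open>Automorphisms act by precomposition, freely because \<open>t\<close> is injective, and
  two embeddings have the same image exactly when they differ by an automorphism.\<close>

lemma card_fibre:
  assumes P: "simple_graph P" "fst P = {..<4}" and t: "t \<in> embeddings n F P"
  shows "card {s \<in> embeddings n F P. image_graph (sel s) P = image_graph (sel t) P} = card (embeddings 4 (snd P) P)"
proof -
  let ?I = "{s \<in> embeddings n F P. image_graph (sel s) P = image_graph (sel t) P}"
  have inj: "inj_on (sel t) {..<4}" using t by (simp add: embeddings_def)
  have img: "image_graph (sel (quad_comp t s)) P = image_graph (sel t) (image_graph (sel s) P)" for s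
    unfolding image_graph_comp by (rule image_graph_cong[OF P(1)]) (use P(2) in \<open>auto simp: sel_quad_comp\<close>)
  have "bij_betw (quad_comp t) (embeddings 4 (snd P) P) ?I"
    unfolding bij_betw_def
  proof (intro conjI subset_antisym subsetI)
    show "inj_on (quad_comp t) (embeddings 4 (snd P) P)"
    proof (intro inj_onI quad_eqI)
      fix s s' i assume s: "s \<in> embeddings 4 (snd P) P" "s' \<in> embeddings 4 (snd P) P" "quad_comp t s = quad_comp t s'" and i: "(i::nat) < 4"
      have "sel t (sel s i) = sel t (sel s' i)" using s(3) sel_quad_comp[OF i] by metis
      moreover have "sel s i \<in> {..<4}" "sel s' i \<in> {..<4}" using s(1,2) i by (auto simp: embeddings_def)
      ultimately show "sel s i = sel s' i" using inj by (auto dest: inj_onD)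
    qed
  next
    fix x assume "x \<in> quad_comp t ` embeddings 4 (snd P) P"
    then obtain s where s: "s \<in> embeddings 4 (snd P) P" "x = quad_comp t s" by auto
    have eq: "image_graph (sel x) P = image_graph (sel t) P" using img[of s] image_self[OF P s(1)] s(2) by simp
    have si: "inj_on (sel s) {..<4}" "sel s ` {..<4} \<subseteq> {..<4}" using s by (auto simp: embeddings_def)
    have "inj_on (sel t \<circ> sel s) {..<4}" by (rule comp_inj_on[OF si(1) inj_on_subset[OF inj si(2)]])
    then have "inj_on (sel x) {..<4}" by (rule inj_on_cong[THEN iffD1, rotated]) (simp add: s(2) sel_quad_comp)
    then have "x \<in> embeddings n F P" using subgraph_image_iff[OF P] eq t inj by metis
    then show "x \<in> ?I" using eq by simp
  next
    fix x assume x: "x \<in> ?I"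
    then have "sel x ` {..<4} = sel t ` {..<4}" using P(2) by (simp add: image_graph_def)
    \<comment> \<open>Both maps have the same vertex set as image, so \<open>x\<close> is
      \<open>t\<close> after a map \<open>s\<close> of positions; \<open>s\<close> turns out to be
      an automorphism.\<close>
    then have "\<forall>i\<in>{..<4}. \<exists>j\<in>{..<4}. sel x i = sel t j" by blast
    then obtain h where h: "\<And>i. i < 4 \<Longrightarrow> h i < 4 \<and> sel x i = sel t (h i)" by (metis lessThan_iff)
    define s where "s = (h 0, h 1, h 2, h 3)"
    have s: "sel s i = h i" if "i < 4" for i
    proof -
      have "i = 0 \<or> i = 1 \<or> i = 2 \<or> i = 3" using that by auto
      then show ?thesis by (auto simp: s_def)
    qed
    have xs: "x = quad_comp t s" by (rule quad_eqI) (simp add: sel_quad_comp s h)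
    have xi: "inj_on (sel x) {..<4}" using x by (simp add: embeddings_def)
    have si: "inj_on (sel s) {..<4}" "sel s ` {..<4} \<subseteq> {..<4}"
      using xi h by (auto simp: inj_on_def s)
    have "image_graph (sel s) P = P"
    proof (rule image_graph_inject[OF inj])
      show "image_graph (sel t) (image_graph (sel s) P) = image_graph (sel t) P" using x img xs by simp
      show "simple_graph (image_graph (sel s) P)" by (rule simple_image_graph[OF P(1)]) (use si P(2) in simp)
    qed (use P si in \<open>auto simp: image_graph_def\<close>)
    then have "s \<in> embeddings 4 (snd P) P" using si by (cases P) (auto simp: embeddings_def image_graph_def)
    then show "x \<in> quad_comp t ` embeddings 4 (snd P) P" using xs by blast
  qed
  then show ?thesis using bij_betw_same_card by fastforce
qed

text \<open>Embeddings are grouped by their image: the images are the copies, and by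
  \<open>card_fibre\<close> all groups have the order of the automorphism group.\<close>

lemma card_embeddings:
  assumes P: "simple_graph P" "fst P = {..<4}"
  shows "card (embeddings n F P) = card (embeddings 4 (snd P) P) * subgraph_count ({..<n}, F) P"
proof -
  let ?E = "embeddings n F P" and ?g = "\<lambda>t. image_graph (sel t) P"
  have im: "?g ` ?E = {H. subgraph H ({..<n}, F) \<and> isomorphic H P}"
  proof (intro subset_antisym subsetI)
    fix H assume "H \<in> ?g ` ?E"
    then obtain t where t: "t \<in> ?E" "H = ?g t" by auto
    have inj: "inj_on (sel t) {..<4}" using t by (simp add: embeddings_def)
    then have "isomorphic P H" using t(2) P(2) by (auto simp: isomorphic_iff)
    then have "isomorphic H P" by (rule isomorphic_sym[OF P(1)])
    then show "H \<in> {H. subgraph H ({..<n}, F) \<and> isomorphic H P}" using subgraph_image_iff[OF P inj] t by auto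
  next
    fix H assume "H \<in> {H. subgraph H ({..<n}, F) \<and> isomorphic H P}"
    then have H: "subgraph H ({..<n}, F)" "isomorphic P H" using isomorphic_sym[of H P] by (auto simp: subgraph_def)
    then obtain f where f: "inj_on f {..<4}" "image_graph f P = H" using P(2) by (auto simp: isomorphic_iff)
    define t where "t = (f 0, f 1, f 2, f 3)"
    have ft: "f i = sel t i" if "i < 4" for i
    proof -
      have "i = 0 \<or> i = 1 \<or> i = 2 \<or> i = 3" using that by auto
      then show ?thesis by (auto simp: t_def)
    qed
    have g: "?g t = H" using image_graph_cong[OF P(1), of "sel t" f] f(2) P(2) ft by simp
    have "inj_on (sel t) {..<4}" using f(1) ft by (simp add: inj_on_def)
    then have "t \<in> ?E" using subgraph_image_iff[OF P] g H by metis
    then show "H \<in> ?g ` ?E" using g by blast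
  qed
  have "card ?E = (\<Sum>H\<in>?g ` ?E. card {t \<in> ?E. ?g t = H})"
    using sum.image_gen[OF finite_embeddings, of "\<lambda>_. 1::nat" n F P ?g] by simp
  also have "\<dots> = (\<Sum>H\<in>?g ` ?E. card (embeddings 4 (snd P) P))"
    by (rule sum.cong) (use card_fibre[OF P] in auto)
  finally show ?thesis unfolding im by (simp add: subgraph_count_def)
qed

section \<open>Embeddings as sums over quadruples\<close>

definition sum4 :: "nat \<Rightarrow> (nat \<Rightarrow> nat \<Rightarrow> nat \<Rightarrow> nat \<Rightarrow> bool) \<Rightarrow> nat" where
  "sum4 n Q = (\<Sum>a<n. \<Sum>b<n. \<Sum>c<n. \<Sum>d<n. of_bool (Q a b c d))"

lemma sum4_card: "sum4 n Q = card {(a, b, c, d). a < n \<and> b < n \<and> c < n \<and> d < n \<and> Q a b c d}"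
proof -
  have "sum4 n Q = (\<Sum>(a, b, c, d)\<in>{..<n} \<times> {..<n} \<times> {..<n} \<times> {..<n}. of_bool (Q a b c d))"
    by (simp add: sum4_def sum.cartesian_product[symmetric] case_prod_unfold sum.cartesian_product')
  also have "\<dots> = (\<Sum>x\<in>{x \<in> {..<n} \<times> {..<n} \<times> {..<n} \<times> {..<n}. case x of (a, b, c, d) \<Rightarrow> Q a b c d}. 1)"
    by (subst sum.inter_filter) (auto intro!: sum.cong)
  finally show ?thesis by (auto intro!: arg_cong[where f = card])
qed

lemma sum4_le: "sum4 n Q \<le> n ^ 4"
proof -
  have "sum4 n Q \<le> card ({..<n} \<times> {..<n} \<times> {..<n} \<times> {..<n})" unfolding sum4_card by (rule card_mono) auto
  then show ?thesis by (simp add: card_cartesian_product power4_eq_xxxx mult.assoc)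
qed

definition path_at :: "(nat \<Rightarrow> nat \<Rightarrow> bool) \<Rightarrow> nat \<Rightarrow> nat \<Rightarrow> nat \<Rightarrow> nat \<Rightarrow> bool" where
  "path_at A a b c d \<longleftrightarrow> A a b \<and> A b c \<and> A c d \<and> a \<noteq> c \<and> a \<noteq> d \<and> b \<noteq> d"
definition cycle_at :: "(nat \<Rightarrow> nat \<Rightarrow> bool) \<Rightarrow> nat \<Rightarrow> nat \<Rightarrow> nat \<Rightarrow> nat \<Rightarrow> bool" where
  "cycle_at A a b c d \<longleftrightarrow> A a b \<and> A b c \<and> A c d \<and> A a d \<and> a \<noteq> c \<and> b \<noteq> d"
definition paw_at :: "(nat \<Rightarrow> nat \<Rightarrow> bool) \<Rightarrow> nat \<Rightarrow> nat \<Rightarrow> nat \<Rightarrow> nat \<Rightarrow> bool" where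
  "paw_at A a b c d \<longleftrightarrow> A a b \<and> A b c \<and> A a c \<and> A c d \<and> d \<noteq> a \<and> d \<noteq> b"
definition diamond_at :: "(nat \<Rightarrow> nat \<Rightarrow> bool) \<Rightarrow> nat \<Rightarrow> nat \<Rightarrow> nat \<Rightarrow> nat \<Rightarrow> bool" where
  "diamond_at A a b c d \<longleftrightarrow> A a b \<and> A b c \<and> A c d \<and> A a d \<and> A a c \<and> b \<noteq> d"

lemma embeddings_eq:
  assumes F: "edge_set n F"
  shows "embeddings n F path3 = {(a, b, c, d). a < n \<and> b < n \<and> c < n \<and> d < n \<and> path_at (adj F) a b c d}" (is ?path)
    "embeddings n F cycle4 = {(a, b, c, d). a < n \<and> b < n \<and> c < n \<and> d < n \<and> cycle_at (adj F) a b c d}" (is ?cycle)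
    "embeddings n F paw = {(a, b, c, d). a < n \<and> b < n \<and> c < n \<and> d < n \<and> paw_at (adj F) a b c d}" (is ?paw)
    "embeddings n F diamond = {(a, b, c, d). a < n \<and> b < n \<and> c < n \<and> d < n \<and> diamond_at (adj F) a b c d}" (is ?diamond)
proof -
  have "{x} \<notin> F" for x using F by (auto simp: edge_set_def)
  note defs = this embeddings_def path3_def cycle4_def paw_def diamond_def path_at_def cycle_at_def paw_at_def diamond_at_def adj_def four
  show ?path ?cycle ?paw ?diamond by (auto simp: defs)
qed

text \<open>The groups are generated by reversal for the path, dihedral for the cycle, the exchange
  of the two triangle vertices of degree 2 for the paw, and the Klein four-group for the
  diamond.\<close>

lemma automorphisms:
  "sum4 4 (path_at (adj (snd path3))) = 2" "sum4 4 (cycle_at (adj (snd cycle4))) = 8"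
  "sum4 4 (paw_at (adj (snd paw))) = 2" "sum4 4 (diamond_at (adj (snd diamond))) = 4"
  unfolding sum4_def four
  by (simp_all add: path_at_def cycle_at_def paw_at_def diamond_at_def adj_def path3_def cycle4_def paw_def diamond_def doubleton_eq_iff)

lemma patterns:
  "simple_graph path3" "fst path3 = {..<4}" "edge_set 4 (snd path3)"
  "simple_graph cycle4" "fst cycle4 = {..<4}" "edge_set 4 (snd cycle4)"
  "simple_graph paw" "fst paw = {..<4}" "edge_set 4 (snd paw)"
  "simple_graph diamond" "fst diamond = {..<4}" "edge_set 4 (snd diamond)"
  by (auto simp: simple_graph_def edge_set_def path3_def cycle4_def paw_def diamond_def card_insert_if)

lemma sum4_counts:
  assumes F: "edge_set n F" and P: "simple_graph P"
  shows "isomorphic P path3 \<Longrightarrow> sum4 n (path_at (adj F)) = 2 * subgraph_count ({..<n}, F) P"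
    "isomorphic P cycle4 \<Longrightarrow> sum4 n (cycle_at (adj F)) = 8 * subgraph_count ({..<n}, F) P"
    "isomorphic P paw \<Longrightarrow> sum4 n (paw_at (adj F)) = 2 * subgraph_count ({..<n}, F) P"
    "isomorphic P diamond \<Longrightarrow> sum4 n (diamond_at (adj F)) = 4 * subgraph_count ({..<n}, F) P"
  using card_embeddings[OF patterns(1,2), of n F] card_embeddings[OF patterns(4,5), of n F]
    card_embeddings[OF patterns(7,8), of n F] card_embeddings[OF patterns(10,11), of n F]
    subgraph_count_isomorphic[OF P, of path3 "({..<n}, F)"] subgraph_count_isomorphic[OF P, of cycle4 "({..<n}, F)"]
    subgraph_count_isomorphic[OF P, of paw "({..<n}, F)"] subgraph_count_isomorphic[OF P, of diamond "({..<n}, F)"]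
  unfolding embeddings_eq[OF F] embeddings_eq[OF patterns(3)] embeddings_eq[OF patterns(6)]
    embeddings_eq[OF patterns(9)] embeddings_eq[OF patterns(12)] sum4_card[symmetric] automorphisms
  by simp_all

section \<open>Embeddings using a new edge\<close>

lemma sum4_int: "int (sum4 n Q) = (\<Sum>a<n. \<Sum>b<n. \<Sum>c<n. \<Sum>d<n. of_bool (Q a b c d))"
  by (simp add: sum4_def)

lemma of_bool_conj3: "(of_bool (P \<and> Q \<and> Q') :: int) = (if P then if Q then of_bool Q' else 0 else 0)"
  by simp

lemma sum4_fix:
  fixes n x y :: nat and R :: "nat \<Rightarrow> nat \<Rightarrow> bool"
  assumes "x < n" "y < n"
  shows "(\<Sum>a<n. \<Sum>b<n. \<Sum>c<n. \<Sum>d<n. of_bool (a = x \<and> b = y \<and> R c d) :: int) = (\<Sum>c<n. \<Sum>d<n. of_bool (R c d))"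
    "(\<Sum>a<n. \<Sum>b<n. \<Sum>c<n. \<Sum>d<n. of_bool (a = x \<and> c = y \<and> R b d) :: int) = (\<Sum>b<n. \<Sum>d<n. of_bool (R b d))"
    "(\<Sum>a<n. \<Sum>b<n. \<Sum>c<n. \<Sum>d<n. of_bool (a = x \<and> d = y \<and> R b c) :: int) = (\<Sum>b<n. \<Sum>c<n. of_bool (R b c))"
    "(\<Sum>a<n. \<Sum>b<n. \<Sum>c<n. \<Sum>d<n. of_bool (b = x \<and> c = y \<and> R a d) :: int) = (\<Sum>a<n. \<Sum>d<n. of_bool (R a d))"
    "(\<Sum>a<n. \<Sum>b<n. \<Sum>c<n. \<Sum>d<n. of_bool (c = x \<and> d = y \<and> R a b) :: int) = (\<Sum>a<n. \<Sum>b<n. of_bool (R a b))"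
  unfolding of_bool_conj3 using assms by (simp_all add: sum_if_const)

text \<open>Walks suffice instead of paths: if \<open>p\<close> and \<open>q\<close> are distinct
  and not adjacent, a walk of length 3 between them repeats no vertex, and for \<open>p = q\<close>
  it is a triangle with a direction.\<close>

definition walk3 :: "nat \<Rightarrow> (nat \<Rightarrow> nat \<Rightarrow> bool) \<Rightarrow> nat \<Rightarrow> nat \<Rightarrow> int" where
  "walk3 n A p q = (\<Sum>w<n. \<Sum>x<n. of_bool (A p w \<and> A w x \<and> A x q))"

definition tail2 :: "nat \<Rightarrow> (nat \<Rightarrow> nat \<Rightarrow> bool) \<Rightarrow> nat \<Rightarrow> nat \<Rightarrow> int" where
  "tail2 n A p q = (\<Sum>c<n. \<Sum>d<n. of_bool (A q c \<and> A c d \<and> d \<noteq> p \<and> d \<noteq> q))"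

definition forks :: "nat \<Rightarrow> (nat \<Rightarrow> nat \<Rightarrow> bool) \<Rightarrow> nat \<Rightarrow> nat \<Rightarrow> int" where
  "forks n A p q = (\<Sum>a<n. \<Sum>d<n. of_bool (A p a \<and> A q d \<and> a \<noteq> d))"

definition roof :: "nat \<Rightarrow> (nat \<Rightarrow> nat \<Rightarrow> bool) \<Rightarrow> nat \<Rightarrow> nat \<Rightarrow> int" where
  "roof n A p q = (\<Sum>c<n. \<Sum>d<n. of_bool (A p c \<and> A q c \<and> A c d \<and> d \<noteq> p \<and> d \<noteq> q))"

definition eave :: "nat \<Rightarrow> (nat \<Rightarrow> nat \<Rightarrow> bool) \<Rightarrow> nat \<Rightarrow> nat \<Rightarrow> int" where
  "eave n A p q = (\<Sum>a<n. \<Sum>d<n. of_bool (A p a \<and> A q a \<and> A q d \<and> d \<noteq> a))"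

definition codeg2 :: "nat \<Rightarrow> (nat \<Rightarrow> nat \<Rightarrow> bool) \<Rightarrow> nat \<Rightarrow> nat \<Rightarrow> int" where
  "codeg2 n A p q = (\<Sum>b<n. \<Sum>d<n. of_bool (A p b \<and> A q b \<and> A p d \<and> A q d \<and> b \<noteq> d))"

definition fan :: "nat \<Rightarrow> (nat \<Rightarrow> nat \<Rightarrow> bool) \<Rightarrow> nat \<Rightarrow> nat \<Rightarrow> int" where
  "fan n A p q = (\<Sum>c<n. \<Sum>d<n. of_bool (A p c \<and> A q c \<and> A c d \<and> A p d))"

context
  fixes n :: nat and A :: "nat \<Rightarrow> nat \<Rightarrow> bool" and u v :: nat
  assumes ad: "addable n A u v"
begin

lemma new_edge: "u < n" "v < n" "u \<noteq> v" "v \<noteq> u" "\<not> A u v" "\<not> A v u" and new_irr: "\<not> A x x" and new_sym: "A x y \<longleftrightarrow> A y x"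
  using ad by (auto simp: addable_def graph_def)

text \<open>The new edge may be any of the four sides in either direction; the rest of the cycle is
  a walk of length 3 between its ends.\<close>

lemma cycle_new:
  "int (sum4 n (cycle_at (add_edge A u v))) - int (sum4 n (cycle_at A)) = 8 * walk3 n A u v"
proof -
  define E where "E p q a b c d = (of_bool (a = p \<and> b = q \<and> A q c \<and> A c d \<and> A d p) + of_bool (b = p \<and> c = q \<and> A p a \<and> A a d \<and> A d q)
    + of_bool (c = p \<and> d = q \<and> A q a \<and> A a b \<and> A b p) + of_bool (a = q \<and> d = p \<and> A q b \<and> A b c \<and> A c p) :: int)" for p q a b c d
  have pt: "of_bool (cycle_at (add_edge A u v) a b c d) = (of_bool (cycle_at A a b c d) + E u v a b c d + E v u a b c d :: int)" for a b c d
    unfolding cycle_at_def add_edge_def E_def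
    by (insert new_sym[of a b] new_sym[of b c] new_sym[of c d] new_sym[of a d]; rule three_cases[of a u v]; rule three_cases[of b u v]; rule three_cases[of c u v]; rule three_cases[of d u v]; auto simp: new_edge new_irr)
  have sw: "walk3 n A p q = walk3 n A q p" for p q
    unfolding walk3_def by (subst sum.swap) (intro sum.cong refl arg_cong[where f = of_bool], use new_sym in blast)
  have S: "(\<Sum>a<n. \<Sum>b<n. \<Sum>c<n. \<Sum>d<n. E p q a b c d) = 4 * walk3 n A p q" if "p < n" "q < n" for p q
    unfolding E_def sum.distrib sum4_fix[OF that] sum4_fix[OF that(2,1)] using sw[of q p] by (simp add: walk3_def)
  show ?thesis unfolding sum4_int pt sum.distrib S[OF new_edge(1,2)] S[OF new_edge(2,1)] using sw[of v u] by simp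
qed

text \<open>The new edge is an end edge, continued from either endpoint (\<open>tail2\<close>), or
  the middle edge (\<open>forks\<close>); the factor 2 comes from reversal.\<close>

lemma path_new:
  "int (sum4 n (path_at (add_edge A u v))) - int (sum4 n (path_at A)) = 2 * (tail2 n A u v + tail2 n A v u + forks n A u v)"
proof -
  define E where "E p q a b c d = (of_bool (a = p \<and> b = q \<and> A q c \<and> A c d \<and> d \<noteq> p \<and> d \<noteq> q) + of_bool (c = q \<and> d = p \<and> A q b \<and> A b a \<and> a \<noteq> p \<and> a \<noteq> q)
    + of_bool (b = p \<and> c = q \<and> A p a \<and> A q d \<and> a \<noteq> d) :: int)" for p q a b c d
  have pt: "of_bool (path_at (add_edge A u v) a b c d) = (of_bool (path_at A a b c d) + E u v a b c d + E v u a b c d :: int)" for a b c d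
    unfolding path_at_def add_edge_def E_def
    by (insert new_sym[of a b] new_sym[of b c] new_sym[of c d]; rule three_cases[of a u v]; rule three_cases[of b u v]; rule three_cases[of c u v]; rule three_cases[of d u v]; auto simp: new_edge new_irr)
  have sw: "forks n A v u = forks n A u v"
    unfolding forks_def by (subst sum.swap) (intro sum.cong refl arg_cong[where f = of_bool], blast)
  have S: "(\<Sum>a<n. \<Sum>b<n. \<Sum>c<n. \<Sum>d<n. E p q a b c d) = 2 * tail2 n A p q + forks n A p q" if "p < n" "q < n" for p q
  proof -
    have "(\<Sum>a<n. \<Sum>b<n. of_bool (A q b \<and> A b a \<and> a \<noteq> p \<and> a \<noteq> q) :: int) = tail2 n A p q"
      unfolding tail2_def by (rule sum.swap)
    then show ?thesis unfolding E_def sum.distrib sum4_fix[OF that] sum4_fix[OF that(2,1)] by (simp add: tail2_def forks_def)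
  qed
  show ?thesis unfolding sum4_int pt sum.distrib S[OF new_edge(1,2)] S[OF new_edge(2,1)] sw by simp
qed

text \<open>Three roles of the new edge: the pendant edge (closed walks at the triangle vertex), the
  triangle side opposite to the pendant vertex's neighbour (\<open>roof\<close>), or a triangle side
  at that neighbour (\<open>eave\<close>). Closed walks already count each triangle twice.\<close>

lemma paw_new:
  "int (sum4 n (paw_at (add_edge A u v))) - int (sum4 n (paw_at A)) =
    walk3 n A u u + walk3 n A v v + 2 * (roof n A u v + eave n A u v + eave n A v u)"
proof -
  define E where "E p q a b c d = (of_bool (c = p \<and> d = q \<and> A p a \<and> A a b \<and> A b p) + of_bool (a = p \<and> b = q \<and> A p c \<and> A q c \<and> A c d \<and> d \<noteq> p \<and> d \<noteq> q)
    + of_bool (b = p \<and> c = q \<and> A p a \<and> A q a \<and> A q d \<and> d \<noteq> a) + of_bool (a = p \<and> c = q \<and> A p b \<and> A q b \<and> A q d \<and> d \<noteq> b) :: int)" for p q a b c d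
  have pt: "of_bool (paw_at (add_edge A u v) a b c d) = (of_bool (paw_at A a b c d) + E u v a b c d + E v u a b c d :: int)" for a b c d
    unfolding paw_at_def add_edge_def E_def
    by (insert new_sym[of a b] new_sym[of b c] new_sym[of a c] new_sym[of c d]; rule three_cases[of a u v]; rule three_cases[of b u v]; rule three_cases[of c u v]; rule three_cases[of d u v]; auto simp: new_edge new_irr)
  have sw: "roof n A v u = roof n A u v"
    unfolding roof_def by (intro sum.cong refl arg_cong[where f = of_bool]) blast
  have S: "(\<Sum>a<n. \<Sum>b<n. \<Sum>c<n. \<Sum>d<n. E p q a b c d) = walk3 n A p p + roof n A p q + 2 * eave n A p q" if "p < n" "q < n" for p q
    unfolding E_def sum.distrib sum4_fix[OF that] by (simp add: walk3_def roof_def eave_def)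
  show ?thesis unfolding sum4_int pt sum.distrib S[OF new_edge(1,2)] S[OF new_edge(2,1)] sw by simp
qed

text \<open>The new edge is the chord (\<open>codeg2\<close>) or a rim edge; in
  \<open>fan n A p q\<close> the vertex \<open>p\<close> is the end of the chord and
  \<open>q\<close> is not. Either orientation admits four rim positions.\<close>

lemma diamond_new:
  "int (sum4 n (diamond_at (add_edge A u v))) - int (sum4 n (diamond_at A)) =
    2 * codeg2 n A u v + 4 * (fan n A u v + fan n A v u)"
proof -
  define E where "E p q a b c d = (of_bool (a = p \<and> c = q \<and> A p b \<and> A q b \<and> A p d \<and> A q d \<and> b \<noteq> d)
    + of_bool (a = p \<and> b = q \<and> A p c \<and> A q c \<and> A c d \<and> A p d) + of_bool (b = q \<and> c = p \<and> A p a \<and> A q a \<and> A a d \<and> A p d)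
    + of_bool (c = p \<and> d = q \<and> A p a \<and> A q a \<and> A a b \<and> A p b) + of_bool (a = p \<and> d = q \<and> A p c \<and> A q c \<and> A c b \<and> A p b) :: int)" for p q a b c d
  have pt: "of_bool (diamond_at (add_edge A u v) a b c d) = (of_bool (diamond_at A a b c d) + E u v a b c d + E v u a b c d :: int)" for a b c d
    unfolding diamond_at_def add_edge_def E_def
    by (insert new_sym[of a b] new_sym[of b c] new_sym[of a c] new_sym[of c d] new_sym[of a d]; rule three_cases[of a u v]; rule three_cases[of b u v]; rule three_cases[of c u v]; rule three_cases[of d u v]; auto simp: new_edge new_irr)
  have sw: "codeg2 n A v u = codeg2 n A u v"
    unfolding codeg2_def by (intro sum.cong refl arg_cong[where f = of_bool]) blast
  have S: "(\<Sum>a<n. \<Sum>b<n. \<Sum>c<n. \<Sum>d<n. E p q a b c d) = codeg2 n A p q + 4 * fan n A p q" if "p < n" "q < n" for p q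
  proof -
    have "(\<Sum>b<n. \<Sum>c<n. of_bool (A p c \<and> A q c \<and> A c b \<and> A p b) :: int) = fan n A p q"
      unfolding fan_def by (rule sum.swap)
    then show ?thesis unfolding E_def sum.distrib sum4_fix[OF that] sum4_fix[OF that(2,1)] by (simp add: codeg2_def fan_def)
  qed
  show ?thesis unfolding sum4_int pt sum.distrib S[OF new_edge(1,2)] S[OF new_edge(2,1)] sw by simp
qed

end

section \<open>Counting from the tables\<close>

text \<open>Let \<open>q\<close> be heavy and \<open>p\<close>, \<open>w\<close>, \<open>x\<close>,
  \<open>q\<close> a walk. A heavy \<open>w\<close> is found by the loop, with \<open>x\<close>
  counted in table 7; for light \<open>w\<close> and heavy \<open>x\<close> the loop finds
  \<open>x\<close>, with \<open>w\<close> counted in table 5; two light inner vertices are counted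
  in table 8.\<close>

definition walk3_heavy :: "nat \<Rightarrow> nat \<Rightarrow> nest" where
  "walk3_heavy p q = Guard (HEAVY (V q)) (Both (Each (V 0) (Guard (ADJ (V p) (V 11)) (ct 3 (R 7 (V 11) (V q) (K 0)))))
     (Both (Each (V 0) (Guard (ADJ (V 11) (V q)) (ct 3 (R 5 (V p) (V 11) (K 0))))) (ct 3 (R 8 (V p) (V q) (K 0)))))"

text \<open>A heavy \<open>p\<close> is treated by reversing the walk. If both ends are light, the
  double loop over their neighbourhoods is cheap.\<close>

definition walk3_nest :: "nat \<Rightarrow> nat \<Rightarrow> nest" where
  "walk3_nest p q = Both (walk3_heavy p q) (Guard (LOW (V q)) (Both (walk3_heavy q p)
     (Guard (LOW (V p)) (Each (V p) (Each (V q) (Guard (ADJ (V 11) (V 13)) (ct 3 (K 1))))))))"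

definition tail_nest :: "nat \<Rightarrow> nest" where
  "tail_nest p = Both (ct 3 (R 6 (V p) (K 0) (K 0))) (Each (V 0) (Guard (ADJ (V p) (V 11)) (Both (ct 3 (DEG (V 11))) (ct 4 (K 1)))))"

definition common_nest :: nest where
  "common_nest = Both (ct 4 (R 5 (V 1) (V 2) (K 0))) (Each (V 0) (Guard (ADJ (V 1) (V 11)) (Guard (ADJ (V 2) (V 11)) (ct 4 (K 1)))))"

text \<open>A common neighbour of degree \<open>k\<close> lies in \<open>k - 2\<close> roofs, and
  the endpoints of degrees \<open>i\<close> and \<open>j\<close> add \<open>i - 1\<close> and
  \<open>j - 1\<close> eaves, in total \<open>i + j + k - 4\<close>. Light common neighbours enter
  through tables 9 and 5, heavy ones through the loop.\<close>

definition house_nest :: nest where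
  "house_nest = Both (ct 3 (R 9 (V 1) (V 2) (K 0))) (Both (ct 3 (Op Times (R 5 (V 1) (V 2) (K 0)) (Op Plus (DEG (V 1)) (DEG (V 2)))))
     (Both (ct 4 (Op Times (R 5 (V 1) (V 2) (K 0)) (K 2)))
     (Each (V 0) (Guard (ADJ (V 1) (V 11)) (Guard (ADJ (V 2) (V 11))
       (Both (ct 3 (Op Plus (Op Plus (DEG (V 1)) (DEG (V 2))) (DEG (V 11)))) (ct 4 (K 4))))))))"

definition codeg_low :: "nat \<Rightarrow> nat \<Rightarrow> nest" where
  "codeg_low p q = Each (V p) (Each (V p) (Guard (ADJ (V q) (V 11)) (Guard (ADJ (V q) (V 13)) (Guard (NEQ (V 11) (V 13)) (ct 3 (K 1))))))"

text \<open>If one end is light, its neighbourhood is searched twice. For two heavy ends, table 7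
  holds the number \<open>k\<close> of common neighbours, and \<open>k * k - k\<close> ordered pairs
  remain.\<close>

definition codeg_nest :: nest where
  "codeg_nest = Both (Guard (LOW (V 1)) (codeg_low 1 2)) (Guard (HEAVY (V 1)) (Both (Guard (LOW (V 2)) (codeg_low 2 1))
     (Guard (HEAVY (V 2)) (Both (ct 3 (Op Times (R 7 (V 1) (V 2) (K 0)) (R 7 (V 1) (V 2) (K 0)))) (ct 4 (R 7 (V 1) (V 2) (K 0)))))))"

text \<open>For heavy \<open>p\<close> with chord from \<open>p\<close> to \<open>c\<close> and
  fourth vertex \<open>d\<close>: a heavy \<open>c\<close> is found by the first loop and
  \<open>d\<close> counted in table 7; for light \<open>c\<close> and heavy \<open>d\<close> the
  second loop finds \<open>d\<close> and table 10 counts \<open>c\<close>; if both are light, table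
  11 counts them.\<close>

definition fan_nest :: "nat \<Rightarrow> nat \<Rightarrow> nest" where
  "fan_nest p q = Both (Guard (LOW (V p)) (Each (V p) (Each (V p) (Guard (ADJ (V q) (V 11)) (Guard (ADJ (V 11) (V 13)) (ct 3 (K 1)))))))
     (Guard (HEAVY (V p)) (Both (Each (V 0) (Guard (ADJ (V p) (V 11)) (Guard (ADJ (V q) (V 11)) (ct 3 (R 7 (V p) (V 11) (K 0))))))
       (Both (Each (V 0) (Guard (ADJ (V p) (V 11)) (ct 3 (R 10 (V p) (V q) (V 11))))) (ct 3 (R 11 (V p) (V q) (K 0))))))"

text \<open>The product of the degrees exceeds \<open>forks\<close>, and each tail exceeds its
  \<open>tail2\<close>, by the number of common neighbours of \<open>u\<close> and \<open>v\<close>;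
  so this number is subtracted three times.\<close>

definition path_nest :: nest where
  "path_nest = dbl (Both (ct 3 (Op Times (DEG (V 1)) (DEG (V 2)))) (Both (tail_nest 1) (Both (tail_nest 2)
     (Both common_nest (Both common_nest common_nest)))))"

definition cycle_nest :: nest where
  "cycle_nest = dbl (dbl (dbl (walk3_nest 1 2)))"

definition paw_nest :: nest where
  "paw_nest = Both (walk3_nest 1 1) (Both (walk3_nest 2 2) (dbl house_nest))"

definition diamond_nest :: nest where
  "diamond_nest = Both (dbl codeg_nest) (dbl (dbl (Both (fan_nest 1 2) (fan_nest 2 1))))"

section \<open>Correctness of the counting nests\<close>

context count_state
begin

lemma cn_cong: "cn \<rho>' d p x \<Longrightarrow> x = y \<Longrightarrow> cn \<rho>' d p y"
  by simp

text \<open>The inequalities built into tables 5, 7 and 8 hold of themselves along such a walk,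
  because \<open>x\<close> and \<open>y\<close> are not adjacent. Hence the three terms partition
  the walks by the sides of the inner vertices.\<close>

lemma walk3_split:
  assumes "\<not> A x y" "y \<in> H"
  shows "(\<Sum>w<n. of_bool (w \<in> H) * (of_bool (A x w) * T7 n A H w y)) +
    ((\<Sum>w<n. of_bool (w \<in> H) * (of_bool (A w y) * T5 n A H x w)) + T8 n A H x y) = walk3 n A x y"
proof -
  have a: "\<not> A y x" using assms sym by blast
  have 1: "(\<Sum>w<n. of_bool (w \<in> H) * (of_bool (A x w) * T7 n A H w y)) = (\<Sum>w<n. \<Sum>z<n. of_bool (w \<in> H \<and> A x w \<and> A w z \<and> A z y))"
    unfolding T7_def sum_distrib_left of_bool_mult
    by (intro sum.cong refl arg_cong[where f = of_bool]) (use assms sym in blast)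
  have 2: "(\<Sum>w<n. of_bool (w \<in> H) * (of_bool (A w y) * T5 n A H x w)) = (\<Sum>w<n. \<Sum>z<n. of_bool (w \<notin> H \<and> z \<in> H \<and> A x w \<and> A w z \<and> A z y))"
    unfolding T5_def sum_distrib_left of_bool_mult
    by (subst sum.swap) (intro sum.cong refl arg_cong[where f = of_bool], use assms a sym in blast)
  have 3: "T8 n A H x y = (\<Sum>w<n. \<Sum>z<n. of_bool (w \<notin> H \<and> z \<notin> H \<and> A x w \<and> A w z \<and> A z y))"
    unfolding T8_def by (intro sum.cong refl arg_cong[where f = of_bool]) (use assms a sym in blast)
  show ?thesis unfolding 1 2 3 walk3_def sum.distrib[symmetric] by (intro sum.cong refl) simp
qed

lemma walk3_swap: "walk3 n A y x = walk3 n A x y"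
  unfolding walk3_def by (subst sum.swap) (intro sum.cong refl arg_cong[where f = of_bool], use sym in blast)

lemma walk3_low: "(\<Sum>w<n. of_bool (A x w) * (\<Sum>z<n. of_bool (A y z) * (of_bool (A w z) * 1))) = walk3 n A x y"
  unfolding walk3_def sum_distrib_left mult_1_right of_bool_mult
  by (intro sum.cong refl arg_cong[where f = of_bool]) (use sym in blast)

lemma cn_walk3:
  assumes S: "{5, 7, 8} \<subseteq> S" and r: "\<rho> p = x" "\<rho> q = y" "x < n" "y < n" "p \<in> {1, 2}" "q \<in> {1, 2}" and xy: "\<not> A x y"
  shows "cn \<rho> 0 (walk3_nest p q) (walk3 n A x y)"
proof -
  let ?h = "\<lambda>x y. of_bool (y \<in> H) * ((\<Sum>w<n. of_bool (w \<in> H) * (of_bool (A x w) * T7 n A H w y)) +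
    ((\<Sum>w<n. of_bool (w \<in> H) * (of_bool (A w y) * T5 n A H x w)) + T8 n A H x y))"
  have yx: "\<not> A y x" using xy sym by blast
  have "cn \<rho> 0 (walk3_nest p q) (?h x y + of_bool (y \<notin> H) * (?h y x + of_bool (x \<notin> H) *
      (\<Sum>w<n. of_bool (A x w) * (\<Sum>z<n. of_bool (A y z) * (of_bool (A w z) * 1)))))"
    unfolding walk3_nest_def walk3_heavy_def
    by (intro cn_intros; use S r \<rho> in auto)
  then show ?thesis
    by (rule cn_cong) (use walk3_split[OF xy] walk3_split[OF yx] walk3_swap[of y x] walk3_low[of x y] in auto)
qed

abbreviation dg :: "nat \<Rightarrow> int" where "dg x \<equiv> (\<Sum>y<n. of_bool (A x y))"

lemma deg_less_one: "A c x \<Longrightarrow> (\<Sum>d<n. of_bool (A c d \<and> d \<noteq> x)) = dg c - 1"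
proof -
  assume a: "A c x"
  have "(\<Sum>d<n. of_bool (A c d \<and> d \<noteq> x) :: int) = (\<Sum>d<n. of_bool (A c d) - of_bool (d = x \<and> True))"
    by (rule sum.cong) (use a in auto)
  then show ?thesis unfolding sum_subtractf sum_of_bool_eq using less[OF a] by simp
qed

lemma deg_less_two: "A c u \<Longrightarrow> A c v \<Longrightarrow> (\<Sum>d<n. of_bool (A c d \<and> d \<noteq> u \<and> d \<noteq> v)) = dg c - 2"
proof -
  assume a: "A c u" "A c v"
  have "(\<Sum>d<n. of_bool (A c d \<and> d \<noteq> u \<and> d \<noteq> v) :: int) = (\<Sum>d<n. of_bool (A c d) - of_bool (d = u \<and> True) - of_bool (d = v \<and> True))"
    by (rule sum.cong) (use a uv in auto)
  then show ?thesis unfolding sum_subtractf sum_of_bool_eq using uv by simp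
qed

lemma tail_split: "T6 n A H x + (\<Sum>y<n. of_bool (y \<in> H) * (of_bool (A x y) * (dg y + -1))) = (\<Sum>c<n. \<Sum>d<n. of_bool (A x c \<and> A c d \<and> d \<noteq> x))"
proof -
  have "of_bool (y \<in> H) * (of_bool (A x y) * (dg y + -1)) = (\<Sum>d<n. of_bool (y \<in> H \<and> A x y \<and> A y d \<and> d \<noteq> x) :: int)" for y
    using deg_less_one[of y x] sym[of x y] by (cases "y \<in> H \<and> A x y") auto
  then show ?thesis unfolding T6_def by (simp only: sum.distrib[symmetric]) (intro sum.cong refl, simp)
qed

lemma common_split: "- T5 n A H u v + (\<Sum>y<n. of_bool (y \<in> H) * (of_bool (A u y) * (of_bool (A v y) * - 1))) = - (\<Sum>c<n. of_bool (A u c \<and> A v c))"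
  unfolding T5_def sum_negf[symmetric] sum.distrib[symmetric]
  by (intro sum.cong refl) (use sym uv in auto)

lemma tail2_eq:
  assumes "{p, q} = {u, v}"
  shows "tail2 n A p q = (\<Sum>c<n. \<Sum>d<n. of_bool (A q c \<and> A c d \<and> d \<noteq> q)) - (\<Sum>c<n. of_bool (A u c \<and> A v c))"
proof -
  have pq: "p \<noteq> q" "p < n" "A u c \<and> A v c \<longleftrightarrow> A q c \<and> A c p" for c using assms uv sym by (auto simp: doubleton_eq_iff)
  have "(of_bool (A q c \<and> A c d \<and> d \<noteq> p \<and> d \<noteq> q) :: int) = of_bool (A q c \<and> A c d \<and> d \<noteq> q) - of_bool (d = p \<and> A q c \<and> A c p)" for c d
    using pq(1) by auto
  then show ?thesis unfolding tail2_def by (simp only: sum_subtractf sum_of_bool_eq) (simp add: pq)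
qed

lemma forks_eq: "forks n A u v = dg u * dg v - (\<Sum>c<n. of_bool (A u c \<and> A v c))"
proof -
  have "(of_bool (A u a \<and> A v d \<and> a \<noteq> d) :: int) = of_bool (A u a) * of_bool (A v d) - of_bool (d = a \<and> A u a \<and> A v a)" for a d
    by auto
  then have "forks n A u v = (\<Sum>a<n. \<Sum>d<n. of_bool (A u a) * of_bool (A v d)) - (\<Sum>a<n. of_bool (a < n \<and> A u a \<and> A v a))"
    unfolding forks_def by (simp only: sum_subtractf sum_of_bool_eq)
  moreover have "(\<Sum>a<n. of_bool (a < n \<and> A u a \<and> A v a) :: int) = (\<Sum>c<n. of_bool (A u c \<and> A v c))" by (rule sum.cong) auto
  ultimately show ?thesis by (simp only: sum_product)
qed

lemma cn_path:
  assumes "S = {5, 6}"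
  shows "cn \<rho> 0 path_nest (int (sum4 n (path_at (add_edge A u v))) - int (sum4 n (path_at A)))"
proof -
  let ?h = "\<lambda>x. T6 n A H x + (\<Sum>y<n. of_bool (y \<in> H) * (of_bool (A x y) * (dg y + -1)))"
  let ?t = "- T5 n A H u v + (\<Sum>y<n. of_bool (y \<in> H) * (of_bool (A u y) * (of_bool (A v y) * - 1)))"
  have "cn \<rho> 0 path_nest (2 * (dg u * dg v + (?h u + (?h v + (?t + (?t + ?t))))))"
    unfolding path_nest_def tail_nest_def common_nest_def
    by (intro cn_intros; use assms \<rho> \<rho>1 uv in auto)
  then show ?thesis unfolding tail_split common_split path_new[OF ad]
    by (rule cn_cong) (simp add: tail2_eq[of u v] tail2_eq[of v u] insert_commute forks_eq)
qed

lemma cn_cycle: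
  assumes "S = {5, 7, 8}"
  shows "cn \<rho> 0 cycle_nest (int (sum4 n (cycle_at (add_edge A u v))) - int (sum4 n (cycle_at A)))"
proof -
  have "cn \<rho> 0 cycle_nest (2 * (2 * (2 * walk3 n A u v)))"
    unfolding cycle_nest_def by (intro cn_dbl cn_walk3) (use assms \<rho> uv in auto)
  then show ?thesis unfolding cycle_new[OF ad] by simp
qed

lemma house_split:
  "T9 n A H u v + (T5 n A H u v * (dg u + dg v) + (- (T5 n A H u v * 2) +
     (\<Sum>y<n. of_bool (y \<in> H) * (of_bool (A u y) * (of_bool (A v y) * ((dg u + dg v + dg y) + - 4)))))) =
   roof n A u v + eave n A u v + eave n A v u"
proof -
  have r: "roof n A u v = (\<Sum>c<n. of_bool (A u c \<and> A v c) * (dg c - 2))"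
    unfolding roof_def
  proof (intro sum.cong refl)
    fix c show "(\<Sum>d<n. of_bool (A u c \<and> A v c \<and> A c d \<and> d \<noteq> u \<and> d \<noteq> v)) = of_bool (A u c \<and> A v c) * (dg c - 2)"
      using deg_less_two[of c] sym by (cases "A u c \<and> A v c") auto
  qed
  have e: "eave n A p q = (\<Sum>c<n. of_bool (A u c \<and> A v c) * (dg q - 1))" if "{p, q} = {u, v}" for p q
    unfolding eave_def
  proof (intro sum.cong refl)
    fix c
    have "A u c \<and> A v c \<longleftrightarrow> A p c \<and> A q c" using that by (auto simp: doubleton_eq_iff)
    then show "(\<Sum>d<n. of_bool (A p c \<and> A q c \<and> A q d \<and> d \<noteq> c)) = of_bool (A u c \<and> A v c) * (dg q - 1)"
      using deg_less_one[of q c] by (cases "A p c \<and> A q c") auto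
  qed
  have t: "T5 n A H u v * k = (\<Sum>c<n. of_bool (c \<notin> H \<and> A u c \<and> A v c) * k)" for k
    unfolding T5_def sum_distrib_right by (intro sum.cong refl) (use sym uv in auto)
  have t9: "T9 n A H u v = (\<Sum>c<n. of_bool (c \<notin> H \<and> A u c \<and> A v c) * (dg c - 2))"
    unfolding T9_def
  proof (intro sum.cong refl)
    fix c show "(\<Sum>z<n. of_bool (c \<notin> H \<and> A c u \<and> A c v \<and> A c z \<and> u \<noteq> v \<and> z \<noteq> u \<and> z \<noteq> v)) = of_bool (c \<notin> H \<and> A u c \<and> A v c) * (dg c - 2)"
      using deg_less_two[of c] sym uv by (cases "c \<notin> H \<and> A u c \<and> A v c") auto
  qed
  \<comment> \<open>Hides the inner sums, so that only the sums over the common neighbour are merged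
    and compared term by term.\<close>
  define D where "D x = dg x" for x
  show ?thesis unfolding t9 t r e[OF refl] e[OF insert_commute] D_def[symmetric] sum_negf[symmetric] sum.distrib[symmetric]
    by (intro sum.cong refl) auto
qed

lemma cn_paw:
  assumes "S = {5, 7, 8, 9}"
  shows "cn \<rho> 0 paw_nest (int (sum4 n (paw_at (add_edge A u v))) - int (sum4 n (paw_at A)))"
proof -
  have "cn \<rho> 0 house_nest (T9 n A H u v + (T5 n A H u v * (dg u + dg v) + (- (T5 n A H u v * 2) +
     (\<Sum>y<n. of_bool (y \<in> H) * (of_bool (A u y) * (of_bool (A v y) * ((dg u + dg v + dg y) + - 4)))))))"
    unfolding house_nest_def by (intro cn_intros; use assms \<rho> \<rho>1 uv in auto)
  then have "cn \<rho> 0 house_nest (roof n A u v + eave n A u v + eave n A v u)" unfolding house_split .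
  then have "cn \<rho> 0 paw_nest (walk3 n A u u + (walk3 n A v v + 2 * (roof n A u v + eave n A u v + eave n A v u)))"
    unfolding paw_nest_def by (intro cn_Both cn_dbl cn_walk3) (use assms \<rho> uv irr in auto)
  then show ?thesis unfolding paw_new[OF ad] by (simp add: add.assoc)
qed

lemma codeg_low_eq:
  assumes "{p, q} = {u, v}"
  shows "(\<Sum>w<n. of_bool (A p w) * (\<Sum>z<n. of_bool (A p z) * (of_bool (A q w) * (of_bool (A q z) * (of_bool (w \<noteq> z) * 1))))) = codeg2 n A u v"
  unfolding codeg2_def sum_distrib_left mult_1_right of_bool_mult
  by (intro sum.cong refl arg_cong[where f = of_bool]) (use assms in \<open>auto simp: doubleton_eq_iff\<close>)

lemma codeg_heavy: "u \<in> H \<Longrightarrow> v \<in> H \<Longrightarrow> T7 n A H u v * T7 n A H u v + - T7 n A H u v = codeg2 n A u v"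
proof -
  assume H: "u \<in> H" "v \<in> H"
  have t: "T7 n A H u v = (\<Sum>b<n. of_bool (A u b \<and> A v b))"
    unfolding T7_def by (intro sum.cong refl) (use H uv sym in auto)
  have "(of_bool (A u b \<and> A v b \<and> A u d \<and> A v d \<and> b \<noteq> d) :: int) =
      of_bool (A u b \<and> A v b) * of_bool (A u d \<and> A v d) - of_bool (d = b \<and> A u b \<and> A v b)" for b d
    by auto
  then have "codeg2 n A u v = (\<Sum>b<n. \<Sum>d<n. of_bool (A u b \<and> A v b) * of_bool (A u d \<and> A v d)) - (\<Sum>b<n. of_bool (b < n \<and> A u b \<and> A v b))"
    unfolding codeg2_def by (simp only: sum_subtractf sum_of_bool_eq)
  moreover have "(\<Sum>b<n. of_bool (b < n \<and> A u b \<and> A v b) :: int) = (\<Sum>b<n. of_bool (A u b \<and> A v b))" by (rule sum.cong) auto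
  ultimately show ?thesis unfolding t sum_product by simp
qed

lemma fan_low: "(\<Sum>w<n. of_bool (A x w) * (\<Sum>z<n. of_bool (A x z) * (of_bool (A y w) * (of_bool (A w z) * 1)))) = fan n A x y"
  unfolding fan_def sum_distrib_left mult_1_right of_bool_mult
  by (intro sum.cong refl arg_cong[where f = of_bool]) blast

text \<open>The same partition by the sides of \<open>w\<close> and \<open>z\<close> as in
  \<open>walk3_split\<close>. The inequalities in the tables follow from irreflexivity,
  \<open>x \<noteq> y\<close> and the missing edge.\<close>

lemma fan_split:
  assumes "\<not> A x y" "x \<noteq> y" "x \<in> H"
  shows "(\<Sum>w<n. of_bool (w \<in> H) * (of_bool (A x w) * (of_bool (A y w) * T7 n A H x w))) +
    ((\<Sum>w<n. of_bool (w \<in> H) * (of_bool (A x w) * T10 n A H x y w)) + T11 n A H x y) = fan n A x y"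
proof -
  have a: "\<not> A y x" using assms sym by blast
  have 1: "(\<Sum>w<n. of_bool (w \<in> H) * (of_bool (A x w) * (of_bool (A y w) * T7 n A H x w))) = (\<Sum>w<n. \<Sum>z<n. of_bool (w \<in> H \<and> A x w \<and> A y w \<and> A w z \<and> A x z))"
    unfolding T7_def sum_distrib_left of_bool_mult
    by (intro sum.cong refl arg_cong[where f = of_bool]) (use assms sym irr in metis)
  have 2: "(\<Sum>w<n. of_bool (w \<in> H) * (of_bool (A x w) * T10 n A H x y w)) = (\<Sum>w<n. \<Sum>z<n. of_bool (w \<notin> H \<and> z \<in> H \<and> A x w \<and> A y w \<and> A w z \<and> A x z))"
    unfolding T10_def sum_distrib_left of_bool_mult
    by (subst sum.swap) (intro sum.cong refl arg_cong[where f = of_bool], use assms a sym irr in metis)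
  have 3: "T11 n A H x y = (\<Sum>w<n. \<Sum>z<n. of_bool (w \<notin> H \<and> z \<notin> H \<and> A x w \<and> A y w \<and> A w z \<and> A x z))"
    unfolding T11_def by (intro sum.cong refl arg_cong[where f = of_bool]) (use assms a sym in metis)
  show ?thesis unfolding 1 2 3 fan_def sum.distrib[symmetric] by (intro sum.cong refl) simp
qed

lemma cn_fan:
  assumes S: "{7, 10, 11} \<subseteq> S" and r: "\<rho> p = x" "\<rho> q = y" "x < n" "y < n" "p \<in> {1, 2}" "q \<in> {1, 2}" and xy: "\<not> A x y" "x \<noteq> y"
  shows "cn \<rho> 0 (fan_nest p q) (fan n A x y)"
proof -
  have "cn \<rho> 0 (fan_nest p q) (of_bool (x \<notin> H) * (\<Sum>w<n. of_bool (A x w) * (\<Sum>z<n. of_bool (A x z) * (of_bool (A y w) * (of_bool (A w z) * 1)))) +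
     of_bool (x \<in> H) * ((\<Sum>w<n. of_bool (w \<in> H) * (of_bool (A x w) * (of_bool (A y w) * T7 n A H x w))) +
    ((\<Sum>w<n. of_bool (w \<in> H) * (of_bool (A x w) * T10 n A H x y w)) + T11 n A H x y)))"
    unfolding fan_nest_def by (intro cn_intros; use S r \<rho> in auto)
  then show ?thesis
    by (rule cn_cong) (use fan_split[OF xy] fan_low[of x y] in auto)
qed

lemma cn_diamond:
  assumes "S = {7, 10, 11}"
  shows "cn \<rho> 0 diamond_nest (int (sum4 n (diamond_at (add_edge A u v))) - int (sum4 n (diamond_at A)))"
proof -
  let ?l = "\<lambda>p q. \<Sum>w<n. of_bool (A p w) * (\<Sum>z<n. of_bool (A p z) * (of_bool (A q w) * (of_bool (A q z) * (of_bool (w \<noteq> z) * 1))))"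
  have "cn \<rho> 0 codeg_nest (of_bool (u \<notin> H) * ?l u v + of_bool (u \<in> H) * (of_bool (v \<notin> H) * ?l v u +
      of_bool (v \<in> H) * (T7 n A H u v * T7 n A H u v + - T7 n A H u v)))"
    unfolding codeg_nest_def codeg_low_def by (intro cn_intros; use assms \<rho> \<rho>1 uv in auto)
  then have c: "cn \<rho> 0 codeg_nest (codeg2 n A u v)"
    by (rule cn_cong) (use codeg_low_eq[of u v] codeg_low_eq[of v u] codeg_heavy in \<open>auto simp: insert_commute\<close>)
  have "cn \<rho> 0 diamond_nest (2 * codeg2 n A u v + 2 * (2 * (fan n A u v + fan n A v u)))"
    unfolding diamond_nest_def by (intro cn_Both cn_dbl cn_fan c) (use assms \<rho> uv in auto)
  then show ?thesis unfolding diamond_new[OF ad] by simp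
qed

end

section \<open>Space\<close>

lemma card_neighbour_pairs:
  assumes L: "L \<subseteq> {..<n}" "\<And>w. w \<in> L \<Longrightarrow> card (nb A w) \<le> B" and g: "graph n A"
  shows "card (\<Union>w\<in>L. nb A w \<times> nb A w) \<le> B * degsum n A"
proof -
  have fin: "finite L" using L(1) finite_subset by blast
  have "card (\<Union>w\<in>L. nb A w \<times> nb A w) \<le> (\<Sum>w\<in>L. card (nb A w \<times> nb A w))" by (rule card_UN_le[OF fin])
  also have "\<dots> \<le> (\<Sum>w\<in>L. B * card (nb A w))" by (rule sum_mono) (simp add: card_cartesian_product L(2))
  also have "\<dots> \<le> (\<Sum>w<n. B * card (nb A w))" by (rule sum_mono2) (use L(1) in auto)
  finally show ?thesis by (simp add: degsum_def sum_distrib_left)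
qed

lemma card_neighbour_triples:
  assumes L: "L \<subseteq> {..<n}" "\<And>w. w \<in> L \<Longrightarrow> card (nb A w) \<le> B" and g: "graph n A"
  shows "card (\<Union>w\<in>L. nb A w \<times> nb A w \<times> nb A w) \<le> B * B * degsum n A" "card (\<Union>w\<in>L. nb A w \<times> nb A w \<times> nb A w) \<le> n * B ^ 3"
proof -
  have fin: "finite L" using L(1) finite_subset by blast
  have c: "card (\<Union>w\<in>L. nb A w \<times> nb A w \<times> nb A w) \<le> (\<Sum>w\<in>L. card (nb A w \<times> nb A w \<times> nb A w))" by (rule card_UN_le[OF fin])
  also have "\<dots> \<le> (\<Sum>w\<in>L. B * B * card (nb A w))"
    by (rule sum_mono) (simp add: card_cartesian_product L(2) mult_le_mono mult.assoc[symmetric])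
  also have "\<dots> \<le> (\<Sum>w<n. B * B * card (nb A w))" by (rule sum_mono2) (use L(1) in auto)
  finally show "card (\<Union>w\<in>L. nb A w \<times> nb A w \<times> nb A w) \<le> B * B * degsum n A" by (simp add: degsum_def sum_distrib_left)
  note c
  also have "(\<Sum>w\<in>L. card (nb A w \<times> nb A w \<times> nb A w)) \<le> (\<Sum>w\<in>L. B ^ 3)"
    by (rule sum_mono) (simp add: card_cartesian_product L(2) mult_le_mono power3_eq_cube mult.assoc)
  also have "\<dots> \<le> n * B ^ 3" using card_mono[OF _ L(1)] by (simp add: mult_le_mono1)
  finally show "card (\<Union>w\<in>L. nb A w \<times> nb A w \<times> nb A w) \<le> n * B ^ 3" .
qed

lemma finite_neighbours: "graph n A \<Longrightarrow> L \<subseteq> {..<n} \<Longrightarrow> finite (\<Union>w\<in>L. nb A w \<times> nb A w)"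
  "graph n A \<Longrightarrow> L \<subseteq> {..<n} \<Longrightarrow> finite (\<Union>w\<in>L. nb A w \<times> nb A w \<times> nb A w)"
  "graph n A \<Longrightarrow> finite (nb A w)"
  using finite_subset[OF nb_subset, of n A] finite_subset[of L "{..<n}"] by auto

lemma sum_nonzeroD: "(\<Sum>w<n. f w) \<noteq> 0 \<Longrightarrow> \<exists>w<n. f w \<noteq> (0::int)"
  by (metis lessThan_iff sum.neutral)

lemma tables_nonzero:
  "T5 n A H a b \<noteq> 0 \<Longrightarrow> \<exists>w<n. w \<notin> H \<and> A w a \<and> A w b"
  "T6 n A H a \<noteq> 0 \<Longrightarrow> \<exists>w<n. A a w"
  "T7 n A H a b \<noteq> 0 \<Longrightarrow> a \<in> H \<and> b \<in> H \<and> (\<exists>w<n. A w a \<and> A w b)"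
  "T10 n A H a b c \<noteq> 0 \<Longrightarrow> \<exists>w<n. w \<notin> H \<and> A w a \<and> A w b \<and> A w c"
  "T11 n A H a b \<noteq> 0 \<Longrightarrow> \<exists>w<n. w \<notin> H \<and> A w a \<and> A w b"
  unfolding T_defs by (auto dest!: sum_nonzeroD)

lemma pair_tables_space:
  assumes "S \<subseteq> {5, 6, 7, 8, 9}"
  shows "card {k. tabs S n A H k \<noteq> 0} \<le> 5 * n ^ 2"
proof -
  have "{k. tabs S n A H k \<noteq> 0} \<subseteq> {5..<10} \<times> {..<n} \<times> {..<n} \<times> {0}"
    using assms by (auto simp: tabs_def split: if_splits)
  then have "card {k. tabs S n A H k \<noteq> 0} \<le> card ({5..<10::nat} \<times> {..<n} \<times> {..<n} \<times> {0::nat})" by (rule card_mono[rotated]) simp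
  then show ?thesis by (simp add: card_cartesian_product power2_eq_square)
qed

text \<open>A non-zero entry of \<open>T5\<close> is a pair of neighbours of some light vertex, and
  the squares of the light degrees sum to at most \<open>D * degsum n A\<close>. Entries of
  \<open>T6\<close> sit at non-isolated vertices.\<close>

lemma path_tables_space:
  assumes g: "graph n A" and ds: "degsum n A \<le> 4 * m" and lo: "low_degree_le n A H D" and D: "D \<ge> 1"
  shows "card {k. tabs {5, 6} n A H k \<noteq> 0} \<le> 8 * (m * D)"
proof -
  let ?L = "{..<n} - H"
  let ?X = "\<Union>w\<in>?L. nb A w \<times> nb A w" and ?Y = "\<Union>w\<in>{..<n}. nb A w"
  have "{k. tabs {5, 6} n A H k \<noteq> 0} \<subseteq> (\<lambda>(a, b). (5, a, b, 0)) ` ?X \<union> (\<lambda>a. (6, a, 0, 0)) ` ?Y"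
  proof
    fix k assume "k \<in> {k. tabs {5, 6} n A H k \<noteq> 0}"
    moreover obtain t a b c where k: "k = (t, a, b, c)" by (cases k)
    ultimately consider "t = 5" "c = 0" "T5 n A H a b \<noteq> 0" | "t = 6" "b = 0" "c = 0" "T6 n A H a \<noteq> 0"
      by (auto simp: tabs_def split: if_splits)
    then show "k \<in> (\<lambda>(a, b). (5, a, b, 0)) ` ?X \<union> (\<lambda>a. (6, a, 0, 0)) ` ?Y"
    proof cases
      case 1
      then have "(a, b) \<in> ?X" using tables_nonzero(1)[of n A H a b] by (auto simp: nb_def)
      then show ?thesis unfolding k 1 by (auto intro: rev_image_eqI)
    next
      case 2
      then have "a \<in> ?Y" using tables_nonzero(2)[of n A H a] graph_sym[OF g] by (auto simp: nb_def)
      then show ?thesis unfolding k 2 by auto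
    qed
  qed
  then have "card {k. tabs {5, 6} n A H k \<noteq> 0} \<le> card ((\<lambda>(a, b). (5::nat, a, b, 0::nat)) ` ?X \<union> (\<lambda>a. (6, a, 0, 0)) ` ?Y)"
    by (rule card_mono[rotated]) (use finite_neighbours[OF g] in auto)
  also have "\<dots> \<le> card ?X + card ?Y"
    by (rule order_trans[OF card_Un_le]) (intro add_mono card_image_le finite_neighbours[OF g]; use finite_neighbours[OF g] in auto)
  also have "card ?X \<le> D * degsum n A" by (rule card_neighbour_pairs) (use lo g in \<open>auto simp: low_degree_le_def\<close>)
  also have "card ?Y \<le> degsum n A" unfolding degsum_def by (rule card_UN_le) simp
  also have "D * degsum n A + degsum n A \<le> D * (4 * m) + D * (4 * m)"
    by (rule add_mono[OF mult_le_mono2[OF ds]]) (use mult_le_mono[OF D ds] in simp)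
  finally show ?thesis by (simp add: mult_ac)
qed

text \<open>Each table has two bounds. \<open>T7\<close> consists of pairs of neighbours of a
  vertex, and also of pairs of heavy vertices, where \<open>D ^ 4 = D ^ 3 * D\<close> is of order
  \<open>m * D\<close>. \<open>T10\<close> consists of triples of neighbours of a light vertex, at
  most \<open>n * D ^ 3\<close> with \<open>D ^ 3\<close> of order \<open>m\<close>, and also at
  most \<open>D * D * degsum n A\<close>. For \<open>T11\<close> pairs of neighbours of light
  vertices suffice.\<close>

lemma diamond_tables_space:
  assumes g: "graph n A" and ds: "degsum n A \<le> 4 * m" and H: "H \<subseteq> {..<n}" and lo: "low_degree_le n A H D" and D: "D \<ge> 1"
    and D3: "D ^ 3 \<le> 256000 * m" and cH: "card H \<le> 1000 * D ^ 2"
  shows "card {k. tabs {7, 10, 11} n A H k \<noteq> 0} \<le> 256008 * (n * m)"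
    "card {k. tabs {7, 10, 11} n A H k \<noteq> 0} \<le> 256000000008 * (m * D ^ 2)"
proof -
  let ?L = "{..<n} - H"
  let ?X = "(\<Union>w\<in>{..<n}. nb A w \<times> nb A w) \<inter> H \<times> H" and ?Y = "\<Union>w\<in>?L. nb A w \<times> nb A w \<times> nb A w" and ?Z = "\<Union>w\<in>?L. nb A w \<times> nb A w"
  let ?f = "\<lambda>(a, b). (7::nat, a, b, 0::nat)" and ?g = "\<lambda>(a, b, c). (10::nat, a, b, c)" and ?h = "\<lambda>(a, b). (11::nat, a, b, 0::nat)"
  have fin: "finite ?X" "finite ?Y" "finite ?Z" using finite_neighbours[OF g] by auto
  have "{k. tabs {7, 10, 11} n A H k \<noteq> 0} \<subseteq> ?f ` ?X \<union> (?g ` ?Y \<union> ?h ` ?Z)"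
  proof
    fix k assume "k \<in> {k. tabs {7, 10, 11} n A H k \<noteq> 0}"
    moreover obtain t a b c where k: "k = (t, a, b, c)" by (cases k)
    ultimately consider "t = 7" "c = 0" "T7 n A H a b \<noteq> 0" | "t = 10" "T10 n A H a b c \<noteq> 0" | "t = 11" "c = 0" "T11 n A H a b \<noteq> 0"
      by (auto simp: tabs_def split: if_splits)
    then show "k \<in> ?f ` ?X \<union> (?g ` ?Y \<union> ?h ` ?Z)"
    proof cases
      case 1
      then have "(a, b) \<in> ?X" using tables_nonzero(3)[of n A H a b] by (auto simp: nb_def)
      then show ?thesis unfolding k 1 by (auto intro: rev_image_eqI)
    next
      case 2
      then have "(a, b, c) \<in> ?Y" using tables_nonzero(4)[of n A H a b c] by (auto simp: nb_def)
      then show ?thesis unfolding k 2 by (auto intro: rev_image_eqI)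
    next
      case 3
      then have "(a, b) \<in> ?Z" using tables_nonzero(5)[of n A H a b] by (auto simp: nb_def)
      then show ?thesis unfolding k 3 by (auto intro: rev_image_eqI)
    qed
  qed
  then have "card {k. tabs {7, 10, 11} n A H k \<noteq> 0} \<le> card (?f ` ?X \<union> (?g ` ?Y \<union> ?h ` ?Z))"
    by (rule card_mono[rotated]) (use fin in blast)
  also have "\<dots> \<le> card (?f ` ?X) + (card (?g ` ?Y) + card (?h ` ?Z))"
    by (rule order_trans[OF card_Un_le add_left_mono[OF card_Un_le]])
  also have "\<dots> \<le> card ?X + (card ?Y + card ?Z)" by (intro add_mono card_image_le fin)
  finally have le: "card {k. tabs {7, 10, 11} n A H k \<noteq> 0} \<le> card ?X + (card ?Y + card ?Z)" .
  have low: "card (nb A w) \<le> D" if "w \<in> ?L" for w using lo that by (simp add: low_degree_le_def)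
  have all: "card (nb A w) \<le> n" for w using card_mono[OF _ nb_subset[OF g, of w]] by simp
  have DD: "D \<le> D ^ 2" "1 \<le> D ^ 2" using D by (simp_all add: power2_eq_square)
  have X1: "card ?X \<le> n * (4 * m)"
  proof -
    have "card ?X \<le> card (\<Union>w\<in>{..<n}. nb A w \<times> nb A w)" by (rule card_mono[OF finite_neighbours(1)[OF g]]) auto
    also have "\<dots> \<le> n * degsum n A" by (rule card_neighbour_pairs) (use all g in auto)
    also have "\<dots> \<le> n * (4 * m)" by (rule mult_le_mono2[OF ds])
    finally show ?thesis .
  qed
  have fH: "finite H" using H finite_subset by blast
  have X2: "card ?X \<le> 256000000000 * (m * D ^ 2)"
  proof -
    have "card ?X \<le> card (H \<times> H)" by (rule card_mono) (use fH in auto)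
    also have "\<dots> \<le> (1000 * D ^ 2) * (1000 * D ^ 2)" unfolding card_cartesian_product by (intro mult_le_mono cH)
    also have "\<dots> = 1000000 * (D ^ 3 * D)" by (simp add: power2_eq_square power3_eq_cube)
    also have "\<dots> \<le> 1000000 * (256000 * m * D ^ 2)" by (intro mult_le_mono order_refl D3 DD)
    finally show ?thesis by simp
  qed
  have Z0: "card ?Z \<le> D * degsum n A" by (rule card_neighbour_pairs) (use low g in auto)
  have Z1: "card ?Z \<le> n * degsum n A" by (rule card_neighbour_pairs) (use all g in auto)
  have Z2: "card ?Z \<le> n * (4 * m)" by (rule order_trans[OF Z1 mult_le_mono2[OF ds]])
  have Z3: "card ?Z \<le> 4 * (m * D ^ 2)" using order_trans[OF Z0 mult_le_mono[OF DD(1) ds]] by (simp add: mult.commute mult.left_commute)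
  have Y0: "card ?Y \<le> D * D * degsum n A" "card ?Y \<le> n * D ^ 3"
    by (rule card_neighbour_triples; use low g in auto)+
  have Y1: "card ?Y \<le> 4 * (m * D ^ 2)" using order_trans[OF Y0(1) mult_le_mono2[OF ds]] by (simp add: power2_eq_square mult_ac)
  have Y2: "card ?Y \<le> n * (256000 * m)" by (rule order_trans[OF Y0(2) mult_le_mono2[OF D3]])
  show "card {k. tabs {7, 10, 11} n A H k \<noteq> 0} \<le> 256008 * (n * m)" using le X1 Y2 Z2 by simp
  show "card {k. tabs {7, 10, 11} n A H k \<noteq> 0} \<le> 256000000008 * (m * D ^ 2)" using le X2 Y1 Z3 by linarith
qed

lemma threshold_power:
  fixes D m p e :: nat
  assumes "D ^ p \<le> c * m" "p > 0" "D \<ge> 1"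
  shows "real D ^ e \<le> real c powr (real e / real p) * real m powr (real e / real p)"
proof -
  have "real D ^ e = (real D ^ p) powr (real e / real p)"
    using assms by (simp add: powr_realpow[symmetric] powr_powr)
  also have "\<dots> \<le> (real c * real m) powr (real e / real p)"
    by (rule powr_mono2) (use assms(1) in \<open>simp_all flip: of_nat_power of_nat_mult add: of_nat_le_iff\<close>)
  finally show ?thesis by (simp add: powr_mult)
qed

section \<open>The four patterns\<close>

lemma tabs_split:
  "tabs {5, 6} n A H k = tabs {5} n A H k + tabs {6} n A H k"
  "tabs {5, 7, 8} n A H k = tabs {5} n A H k + (tabs {7} n A H k + tabs {8} n A H k)"
  "tabs {5, 7, 8, 9} n A H k = tabs {5} n A H k + (tabs {7} n A H k + (tabs {8} n A H k + tabs {9} n A H k))"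
  "tabs {7, 10, 11} n A H k = tabs {7} n A H k + (tabs {10} n A H k + tabs {11} n A H k)"
  using tabs_insert[of 5 "{6}"] tabs_insert[of 5 "{7, 8}"] tabs_insert[of 7 "{8}"] tabs_insert[of 5 "{7, 8, 9}"]
    tabs_insert[of 7 "{8, 9}"] tabs_insert[of 8 "{9}"] tabs_insert[of 7 "{10, 11}"] tabs_insert[of 10 "{11}"] by simp_all

text \<open>Reduces the assumptions of \<open>pattern\<close> to syntactic checks of the nests and
  two identities. The constant 2000 only has to exceed the coefficients of \<open>nest_bound\<close>
  for all nests concerned.\<close>

lemma pattern_tabs:
  assumes p: "p = 2 \<or> p = 3" and S: "S \<subseteq> {5..<16}"
    and okC: "nest_ok 0 {1..<16} {0} nC" "scalar_nest nC" and okT: "nest_ok 0 {1, 2, 3} {5..<16} nT" "positive_nest nT"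
    and Q: "\<And>a b c d. \<not> Q (\<lambda>_ _. False) a b c d"
    and T: "\<And>n W M A H u v \<rho> sg k. base n W M A H \<Longrightarrow> addable n A u v \<Longrightarrow> \<rho> 0 = n \<Longrightarrow> \<rho> 1 = u \<Longrightarrow> \<rho> 2 = v \<Longrightarrow> sg 3 = 1 \<Longrightarrow>
      den n W sg M \<rho> 0 nT k = tabs S n (add_edge A u v) H k - tabs S n A H k"
    and C: "\<And>n W M A H u v sg \<rho>. count_state n W M A H u v S sg \<rho> \<Longrightarrow>
      count_state.cn n W M sg \<rho> 0 nC (int (sum4 n (Q (add_edge A u v))) - int (sum4 n (Q A)))"
    and bn: "bounded_nest 0 {} nC" "bounded_nest 0 {} nT"
    and nb: "\<And>D h. D \<ge> 1 \<Longrightarrow> nest_bound D h nC \<le> 2000 * (D ^ (p - 1) + h)" "\<And>D h. D \<ge> 1 \<Longrightarrow> nest_bound D h nT \<le> 2000 * (D ^ (p - 1) + h)"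
  shows "pattern p 2000 nC nT (tabs S) (\<lambda>n A. sum4 n (Q A))"
proof
  show "sum4 n (Q A) \<le> 8 * n ^ 4" for n A using sum4_le[of n "Q A"] by simp
  show "sum4 n (Q (\<lambda>_ _. False)) = 0" for n by (simp add: sum4_def Q)
  show "den n W sg M \<rho> 0 nC (0, 0, 0, 0) mod int W = (int (sum4 n (Q (add_edge A u v))) - int (sum4 n (Q A))) mod int W"
    if "base n W M A H" "addable n A u v" "\<rho> 0 = n" "\<rho> 1 = u" "\<rho> 2 = v" "sg 3 = 1" "sg 4 = -1"
      "\<And>k. 5 \<le> fst k \<Longrightarrow> M k = nat (tabs S n A H k mod int W)" for n W M A H u v \<rho> sg
  proof -
    have c: "count_state n W M A H u v S sg \<rho>" using that by unfold_locales
    show ?thesis using C[OF c] unfolding count_state.cn_def[OF c] cg_def .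
  qed
  show "iters n W M \<rho> 0 nC \<le> 2000 * (D ^ (p - 1) + card H) \<and> iters n W M \<rho> 0 nT \<le> 2000 * (D ^ (p - 1) + card H)"
    if "base n W M A H" "addable n A u v" "\<rho> 0 = n" "\<rho> 1 = u" "\<rho> 2 = v" "D \<ge> 1" "low_degree_le n A H D" for n W M A H u v \<rho> D
  proof -
    have r: "\<rho> r < n" if "counted_reg 0 r" for r using that \<open>\<rho> 1 = u\<close> \<open>\<rho> 2 = v\<close> \<open>addable n A u v\<close>
      by (auto simp: counted_reg_def addable_def)
    show ?thesis
      using iters_bound[where \<rho> = \<rho>, OF that(1,7) bn(1)] iters_bound[where \<rho> = \<rho>, OF that(1,7) bn(2)]
        nb(1)[OF that(6), of "card H"] nb(2)[OF that(6), of "card H"] r that(3) by (auto intro: order_trans)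
  qed
  show "tabs S n A H k \<noteq> 0 \<Longrightarrow> k \<in> {5..<16} \<times> {..<n} \<times> {..<n} \<times> {..<n}" for n A H k by (rule tabs_box[OF S])
qed (use p okC okT T tabs_nonneg tabs_mono tabs_empty tabs_isolated in auto)

lemmas nest_defs = path_nest_def cycle_nest_def paw_nest_def diamond_nest_def walk3_nest_def walk3_heavy_def tail_nest_def
  common_nest_def house_nest_def codeg_nest_def codeg_low_def fan_nest_def table_nest_def up5_def up6_def up7_def up8_def up9_def up10_def up11_def
  dbl_def ct_def

lemmas exp_defs = ADJ_def HEAVY_def LOW_def DEG_def NEQ_def exp_ok_def visible_def

lemma path_pattern: "pattern 2 2000 path_nest (Both (table_nest 5) (table_nest 6)) (tabs {5, 6}) (\<lambda>n A. sum4 n (path_at A))"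
proof (rule pattern_tabs)
  show "nest_ok 0 {1..<16} {0} path_nest" "scalar_nest path_nest"
    "nest_ok 0 {1, 2, 3} {5..<16} (Both (table_nest 5) (table_nest 6))" "positive_nest (Both (table_nest 5) (table_nest 6))"
    by (simp_all add: nest_defs exp_defs)
  show "bounded_nest 0 {} path_nest" "bounded_nest 0 {} (Both (table_nest 5) (table_nest 6))"
    by (simp_all add: nest_defs low_reg_def counted_reg_def)
  show "nest_bound D h path_nest \<le> 2000 * (D ^ (2 - 1) + h)" "nest_bound D h (Both (table_nest 5) (table_nest 6)) \<le> 2000 * (D ^ (2 - 1) + h)" if "D \<ge> 1" for D h
    using that by (simp_all add: nest_defs)
  show "den n W sg M \<rho> 0 (Both (table_nest 5) (table_nest 6)) k = tabs {5, 6} n (add_edge A u v) H k - tabs {5, 6} n A H k"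
    if "base n W M A H" "addable n A u v" "\<rho> 0 = n" "\<rho> 1 = u" "\<rho> 2 = v" "sg 3 = 1" for n W M A H u v \<rho> sg k
    using den_table_nest[where \<rho> = \<rho> and sg = sg, OF that] by (simp add: tabs_split)
qed (auto simp: path_at_def count_state.cn_path)

lemma cycle_pattern: "pattern 3 2000 cycle_nest (Both (table_nest 5) (Both (table_nest 7) (table_nest 8))) (tabs {5, 7, 8}) (\<lambda>n A. sum4 n (cycle_at A))"
proof (rule pattern_tabs)
  let ?T = "Both (table_nest 5) (Both (table_nest 7) (table_nest 8))"
  show "nest_ok 0 {1..<16} {0} cycle_nest" "scalar_nest cycle_nest" "nest_ok 0 {1, 2, 3} {5..<16} ?T" "positive_nest ?T"
    by (simp_all add: nest_defs exp_defs)
  show "bounded_nest 0 {} cycle_nest" "bounded_nest 0 {} ?T"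
    by (simp_all add: nest_defs low_reg_def counted_reg_def)
  show "nest_bound D h cycle_nest \<le> 2000 * (D ^ (3 - 1) + h)" "nest_bound D h ?T \<le> 2000 * (D ^ (3 - 1) + h)" if D: "D \<ge> 1" for D h
  proof -
    \<comment> \<open>This turns the claim into a comparison of polynomials in \<open>j\<close> and
      \<open>h\<close> with natural coefficients, which normalisation decides.\<close>
    obtain j where "D = Suc j" using D by (cases D) auto
    then show "nest_bound D h cycle_nest \<le> 2000 * (D ^ (3 - 1) + h)" "nest_bound D h ?T \<le> 2000 * (D ^ (3 - 1) + h)"
      by (simp_all add: nest_defs power2_eq_square algebra_simps)
  qed
  show "den n W sg M \<rho> 0 ?T k = tabs {5, 7, 8} n (add_edge A u v) H k - tabs {5, 7, 8} n A H k"
    if "base n W M A H" "addable n A u v" "\<rho> 0 = n" "\<rho> 1 = u" "\<rho> 2 = v" "sg 3 = 1" for n W M A H u v \<rho> sg k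
    using den_table_nest[where \<rho> = \<rho> and sg = sg, OF that] by (simp add: tabs_split)
qed (auto simp: cycle_at_def count_state.cn_cycle)

lemma paw_pattern: "pattern 3 2000 paw_nest (Both (table_nest 5) (Both (table_nest 7) (Both (table_nest 8) (table_nest 9)))) (tabs {5, 7, 8, 9}) (\<lambda>n A. sum4 n (paw_at A))"
proof (rule pattern_tabs)
  let ?T = "Both (table_nest 5) (Both (table_nest 7) (Both (table_nest 8) (table_nest 9)))"
  show "nest_ok 0 {1..<16} {0} paw_nest" "scalar_nest paw_nest" "nest_ok 0 {1, 2, 3} {5..<16} ?T" "positive_nest ?T"
    by (simp_all add: nest_defs exp_defs)
  show "bounded_nest 0 {} paw_nest" "bounded_nest 0 {} ?T"
    by (simp_all add: nest_defs low_reg_def counted_reg_def)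
  show "nest_bound D h paw_nest \<le> 2000 * (D ^ (3 - 1) + h)" "nest_bound D h ?T \<le> 2000 * (D ^ (3 - 1) + h)" if D: "D \<ge> 1" for D h
  proof -
    obtain j where "D = Suc j" using D by (cases D) auto
    then show "nest_bound D h paw_nest \<le> 2000 * (D ^ (3 - 1) + h)" "nest_bound D h ?T \<le> 2000 * (D ^ (3 - 1) + h)"
      by (simp_all add: nest_defs power2_eq_square algebra_simps)
  qed
  show "den n W sg M \<rho> 0 ?T k = tabs {5, 7, 8, 9} n (add_edge A u v) H k - tabs {5, 7, 8, 9} n A H k"
    if "base n W M A H" "addable n A u v" "\<rho> 0 = n" "\<rho> 1 = u" "\<rho> 2 = v" "sg 3 = 1" for n W M A H u v \<rho> sg k
    using den_table_nest[where \<rho> = \<rho> and sg = sg, OF that] by (simp add: tabs_split)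
qed (auto simp: paw_at_def count_state.cn_paw)

lemma diamond_pattern: "pattern 3 2000 diamond_nest (Both (table_nest 7) (Both (table_nest 10) (table_nest 11))) (tabs {7, 10, 11}) (\<lambda>n A. sum4 n (diamond_at A))"
proof (rule pattern_tabs)
  let ?T = "Both (table_nest 7) (Both (table_nest 10) (table_nest 11))"
  show "nest_ok 0 {1..<16} {0} diamond_nest" "scalar_nest diamond_nest" "nest_ok 0 {1, 2, 3} {5..<16} ?T" "positive_nest ?T"
    by (simp_all add: nest_defs exp_defs)
  show "bounded_nest 0 {} diamond_nest" "bounded_nest 0 {} ?T"
    by (simp_all add: nest_defs low_reg_def counted_reg_def)
  show "nest_bound D h diamond_nest \<le> 2000 * (D ^ (3 - 1) + h)" "nest_bound D h ?T \<le> 2000 * (D ^ (3 - 1) + h)" if D: "D \<ge> 1" for D h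
  proof -
    obtain j where "D = Suc j" using D by (cases D) auto
    then show "nest_bound D h diamond_nest \<le> 2000 * (D ^ (3 - 1) + h)" "nest_bound D h ?T \<le> 2000 * (D ^ (3 - 1) + h)"
      by (simp_all add: nest_defs power2_eq_square algebra_simps)
  qed
  show "den n W sg M \<rho> 0 ?T k = tabs {7, 10, 11} n (add_edge A u v) H k - tabs {7, 10, 11} n A H k"
    if "base n W M A H" "addable n A u v" "\<rho> 0 = n" "\<rho> 1 = u" "\<rho> 2 = v" "sg 3 = 1" for n W M A H u v \<rho> sg k
    using den_table_nest[where \<rho> = \<rho> and sg = sg, OF that] by (simp add: tabs_split)
qed (auto simp: diamond_at_def count_state.cn_diamond)

lemma le_powr: "m \<ge> 1 \<Longrightarrow> a \<ge> 1 \<Longrightarrow> real m \<le> real m powr a"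
  using powr_mono[of 1 a "real m"] by simp

lemma maintainable_path:
  assumes P: "simple_graph P" "isomorphic P path3"
  shows "maintainable P (\<lambda>m. sqrt (real m)) (\<lambda>n m. min (real m powr (3 / 2)) (real n ^ 2)) (\<lambda>m. sqrt (real m))"
proof -
  interpret counted_pattern 2 2000 path_nest "Both (table_nest 5) (table_nest 6)" "tabs {5, 6}" "\<lambda>n A. sum4 n (path_at A)" 2 P
    "\<lambda>n m. min (real m powr (3 / 2)) (real n ^ 2)"
  proof (intro counted_pattern.intro path_pattern counted_pattern_axioms.intro)
    \<comment> \<open>The first summand serves the bound in \<open>m\<close>, where \<open>D\<close>
      is of order \<open>sqrt m\<close>; the 5 serves the bound in \<open>n\<close> from
      \<open>pair_tables_space\<close>.\<close>
    let ?C = "8 * real 256000 powr (real 1 / real 2) + 5"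
    show "\<exists>Cs. \<forall>n m A H D. n \<ge> 2 \<longrightarrow> m \<ge> 1 \<longrightarrow> graph n A \<longrightarrow> degsum n A \<le> 4 * m \<longrightarrow> H \<subseteq> {..<n} \<longrightarrow>
      low_degree_le n A H D \<longrightarrow> D \<ge> 1 \<longrightarrow> D ^ 2 \<le> 256000 * m \<longrightarrow> card H \<le> 1000 * D ^ (2 - 1) \<longrightarrow> m \<le> n ^ 2 \<longrightarrow>
      real (card {k. tabs {5, 6} n A H k \<noteq> 0}) \<le> Cs * min (real m powr (3 / 2)) (real n ^ 2)"
    proof (intro exI[of _ ?C] allI impI)
      fix n m A H D
      assume g: "graph n A" "degsum n A \<le> 4 * m" "low_degree_le n A H D" "D \<ge> 1" "D ^ 2 \<le> 256000 * m" "m \<ge> 1"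
      let ?c = "real (card {k. tabs {5, 6} n A H k \<noteq> 0})"
      have "?c \<le> real (8 * (m * D))" using path_tables_space[OF g(1-4)] by (simp only: of_nat_le_iff)
      also have "\<dots> \<le> 8 * (real m * (real 256000 powr (real 1 / real 2) * real m powr (real 1 / real 2)))"
        using threshold_power[OF g(5) _ g(4), of 1] by (simp add: mult_left_mono)
      also have "\<dots> = (8 * real 256000 powr (real 1 / real 2)) * (real m powr 1 * real m powr (1 / 2))" using g(6) by simp
      also have "\<dots> = (8 * real 256000 powr (real 1 / real 2)) * real m powr (3 / 2)" by (simp only: powr_add[symmetric]) simp
      also have "\<dots> \<le> ?C * real m powr (3 / 2)" by (intro mult_right_mono) auto
      finally have 1: "?c \<le> ?C * real m powr (3 / 2)" .
      have "?c \<le> real (5 * n ^ 2)" using pair_tables_space[of "{5, 6}" n A H] by (simp only: of_nat_le_iff) simp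
      also have "\<dots> \<le> ?C * real n ^ 2" by (simp add: mult_right_mono)
      finally show "?c \<le> ?C * min (real m powr (3 / 2)) (real n ^ 2)" using 1 by (simp add: min_def)
    qed
    show "real m \<le> min (real m powr (3 / 2)) (real n ^ 2)" if "m \<ge> 1" "m \<le> n ^ 2" for n m
      using le_powr[OF that(1), of "3 / 2"] that(2) by (simp flip: of_nat_power)
  qed (use sum4_counts(1)[OF _ P(1)] P(2) in auto)
  show ?thesis by (rule maintainable_pattern) (simp add: q_def powr_half_sqrt)
qed

text \<open>For the paw and the cycle every table has at most two vertex indices, so its size is at
  most \<open>n ^ 2\<close> whatever the threshold is.\<close>

lemma maintainable_pairs:
  assumes pat: "pattern 3 Kit nC nT (tabs S) (\<lambda>n A. sum4 n (Q A))" and S: "S \<subseteq> {5, 6, 7, 8, 9}" and \<kappa>: "\<kappa> > 0" "\<kappa> < 4 ^ 12"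
    and cnt: "\<And>n F. edge_set n F \<Longrightarrow> sum4 n (Q (adj F)) = \<kappa> * subgraph_count ({..<n}, F) P"
  shows "maintainable P (\<lambda>m. real m powr (2 / 3)) (\<lambda>n m. real n ^ 2) (\<lambda>m. real m powr (2 / 3))"
proof -
  interpret counted_pattern 3 Kit nC nT "tabs S" "\<lambda>n A. sum4 n (Q A)" \<kappa> P "\<lambda>n m. real n ^ 2"
  proof (intro counted_pattern.intro pat counted_pattern_axioms.intro \<kappa>)
    show "\<exists>Cs. \<forall>n m A H D. n \<ge> 2 \<longrightarrow> m \<ge> 1 \<longrightarrow> graph n A \<longrightarrow> degsum n A \<le> 4 * m \<longrightarrow> H \<subseteq> {..<n} \<longrightarrow>
      low_degree_le n A H D \<longrightarrow> D \<ge> 1 \<longrightarrow> D ^ 3 \<le> 256000 * m \<longrightarrow> card H \<le> 1000 * D ^ (3 - 1) \<longrightarrow> m \<le> n ^ 2 \<longrightarrow>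
      real (card {k. tabs S n A H k \<noteq> 0}) \<le> Cs * real n ^ 2"
    proof (intro exI[of _ 5] allI impI)
      fix n A H
      have "real (card {k. tabs S n A H k \<noteq> 0}) \<le> real (5 * n ^ 2)" using pair_tables_space[OF S, of n A H] by (simp only: of_nat_le_iff)
      then show "real (card {k. tabs S n A H k \<noteq> 0}) \<le> 5 * real n ^ 2" by simp
    qed
  qed (use cnt in \<open>auto simp flip: of_nat_power\<close>)
  show ?thesis by (rule maintainable_pattern) (simp add: q_def)
qed

lemma maintainable_diamond:
  assumes P: "simple_graph P" "isomorphic P diamond"
  shows "maintainable P (\<lambda>m. real m powr (2 / 3)) (\<lambda>n m. min (real n * real m) (real m powr (5 / 3))) (\<lambda>m. real m powr (2 / 3))"
proof -
  interpret counted_pattern 3 2000 diamond_nest "Both (table_nest 7) (Both (table_nest 10) (table_nest 11))" "tabs {7, 10, 11}" "\<lambda>n A. sum4 n (diamond_at A)" 4 P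
    "\<lambda>n m. min (real n * real m) (real m powr (5 / 3))"
  proof (intro counted_pattern.intro diamond_pattern counted_pattern_axioms.intro)
    \<comment> \<open>The sum of the constants for the two bounds of
      \<open>diamond_tables_space\<close>, the first one multiplied by the factor that converts
      \<open>D ^ 2\<close> into \<open>m powr (2 / 3)\<close>.\<close>
    let ?C = "256000000008 * real 256000 powr (real 2 / real 3) + 256008"
    show "\<exists>Cs. \<forall>n m A H D. n \<ge> 2 \<longrightarrow> m \<ge> 1 \<longrightarrow> graph n A \<longrightarrow> degsum n A \<le> 4 * m \<longrightarrow> H \<subseteq> {..<n} \<longrightarrow>
      low_degree_le n A H D \<longrightarrow> D \<ge> 1 \<longrightarrow> D ^ 3 \<le> 256000 * m \<longrightarrow> card H \<le> 1000 * D ^ (3 - 1) \<longrightarrow> m \<le> n ^ 2 \<longrightarrow>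
      real (card {k. tabs {7, 10, 11} n A H k \<noteq> 0}) \<le> Cs * min (real n * real m) (real m powr (5 / 3))"
    proof (intro exI[of _ ?C] allI impI)
      fix n m A H D
      assume g: "graph n A" "degsum n A \<le> 4 * m" "H \<subseteq> {..<n}" "low_degree_le n A H D" "D \<ge> 1" "D ^ 3 \<le> 256000 * m"
        and h: "card H \<le> 1000 * D ^ (3 - 1)" and m: "m \<ge> 1"
      let ?c = "real (card {k. tabs {7, 10, 11} n A H k \<noteq> 0})"
      have sp: "card {k. tabs {7, 10, 11} n A H k \<noteq> 0} \<le> 256008 * (n * m)"
        "card {k. tabs {7, 10, 11} n A H k \<noteq> 0} \<le> 256000000008 * (m * D ^ 2)"
        using diamond_tables_space[OF g] h by simp_all
      have "?c \<le> real (256000000008 * (m * D ^ 2))" using sp(2) by (simp only: of_nat_le_iff)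
      also have "\<dots> \<le> 256000000008 * (real m * (real 256000 powr (real 2 / real 3) * real m powr (real 2 / real 3)))"
        using threshold_power[OF g(6) _ g(5), of 2] by (simp add: mult_left_mono)
      also have "\<dots> = (256000000008 * real 256000 powr (real 2 / real 3)) * (real m powr 1 * real m powr (2 / 3))" using m by simp
      also have "\<dots> = (256000000008 * real 256000 powr (real 2 / real 3)) * real m powr (5 / 3)" by (simp only: powr_add[symmetric]) simp
      also have "\<dots> \<le> ?C * real m powr (5 / 3)" by (intro mult_right_mono) auto
      finally have 1: "?c \<le> ?C * real m powr (5 / 3)" .
      have "?c \<le> real (256008 * (n * m))" using sp(1) by (simp only: of_nat_le_iff)
      also have "\<dots> = 256008 * (real n * real m)" by simp
      also have "\<dots> \<le> ?C * (real n * real m)" by (intro mult_right_mono) auto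
      finally show "?c \<le> ?C * min (real n * real m) (real m powr (5 / 3))" using 1 by (simp add: min_def)
    qed
    show "real m \<le> min (real n * real m) (real m powr (5 / 3))" if "n \<ge> 2" "m \<ge> 1" for n m
      using le_powr[OF that(2), of "5 / 3"] mult_right_mono[of 1 "real n" "real m"] that by simp
  qed (use sum4_counts(4)[OF _ P(1)] P(2) in auto)
  show ?thesis by (rule maintainable_pattern) (simp add: q_def)
qed

theorem theorem3p3:
  fixes P :: "'p graph"
  assumes "simple_graph P" and "card (fst P) = 4" and "connected_graph P"
  shows "(isomorphic P path3 \<longrightarrow>
            maintainable P
              (\<lambda>m. sqrt (real m))
              (\<lambda>n m. min (real m powr (3 / 2)) (real n ^ 2))
              (\<lambda>m. sqrt (real m))) \<and>
         (isomorphic P paw \<or> isomorphic P cycle4 \<longrightarrow>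
            maintainable P
              (\<lambda>m. real m powr (2 / 3))
              (\<lambda>n m. real n ^ 2)
              (\<lambda>m. real m powr (2 / 3))) \<and>
         (isomorphic P diamond \<longrightarrow>
            maintainable P
              (\<lambda>m. real m powr (2 / 3))
              (\<lambda>n m. min (real n * real m) (real m powr (5 / 3)))
              (\<lambda>m. real m powr (2 / 3)))"
  using maintainable_path[OF assms(1)] maintainable_diamond[OF assms(1)]
    maintainable_pairs[OF paw_pattern _ _ _ sum4_counts(3)[OF _ assms(1)]]
    maintainable_pairs[OF cycle_pattern _ _ _ sum4_counts(2)[OF _ assms(1)]] by auto

end
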